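(* Let $\Bbbk, Q_0, S, G, M$ be as in the context, and let $Q_G$ be a quiver whose vertices are the pairs $(i,U)$ with $i\in[G\backslash Q_0]$ and $U\in\mathrm{irr}(G_i)$ and such that, for all vertices $(i,U)$ and $(j,V)$, the arrows $(i,U)\to(j,V)$ form a $\Bbbk$-basis of $\mathrm{Hom}_{\Bbbk G_i}(U,M(i,j;V))$. Then: (1) Assigning $f_\gamma$ to every path $\gamma$ in $Q_G$ yields an isomorphism of $\Bbbk$-algebras $$\Bbbk Q_G\xrightarrow{\ \sim\ }\mathcal{I}ntw^{\mathrm{op}}.$$ (2) For all $f\in\mathcal{I}ntw$ lying in a component $\mathrm{Hom}_{\Bbbk G_{i_0}}(U_0,M(i_0,\ldots,i_n;U_n))$ (where $n\geqslant 0$, $i_0,\ldots,i_n\in[G\backslash Q_0]$, $U_0\in\mathrm{irr}(G_{i_0})$, $U_n\in\mathrm{irr}(G_{i_n})$), $$f=\sum_\gamma (f|\varphi_\gamma)\,f_\gamma,$$ where $\gamma$ runs through all paths of $Q_G$ of the shape $(i_0,U_0)\to(i_1,\bullet)\to\cdots\to(i_{n-1},\bullet)\to(i_n,U_n)$ (the $\bullet$'s being arbitrary).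
   Context: **Setting.** $\Bbbk$ is an algebraically closed field; $\mathrm{mod}(\Lambda)$ is the category of finite dimensional left modules over a $\Bbbk$-algebra $\Lambda$. $Q_0$ is a finite set and $S=\Bbbk Q_0$ is the semisimple algebra with primitive orthogonal idempotents $e_i$, $i\in Q_0$. $G$ is a finite group with order not divisible by $\mathrm{char}(\Bbbk)$, acting on $Q_0$. $M$ is a finite dimensional $S$-bimodule, viewed as a collection of vector spaces ${}_iM_j=e_iMe_j$ ($i,j\in Q_0$), endowed with a linear action of $G$ written $m\mapsto{}^gm$ such that ${}^g({}_iM_j)={}_{g\cdot i}M_{g\cdot j}$. $G_i$ is the stabiliser of $i$; $[G\backslash Q_0]$, $[G/G_i]$, $\mathrm{irr}(G_i)$ are fixed complete sets of representatives of the $G$-orbits of $Q_0$, of the cosets $gG_i$, and of the isomorphism classes of irreducible $\Bbbk$-representations of $G_i$, respectively. **The modules $M(\underline i;V)$.** Let $\underline i=i_0,\ldots,i_n$ ($n\geqslant0$) be a sequence in $Q_0$ and $V\in\mathrm{mod}(\Bbbk G_{i_n})$. For $\underline y=y_1,\ldots,y_n$ with $y_t\in[G/G_{i_t}]$ let $$M_{\underline y}(\underline i;V)={}_{i_0}M_{y_1\cdot i_1}\otimes_\Bbbk{}_{y_1\cdot i_1}M_{y_1y_2\cdot i_2}\otimes_\Bbbk\cdots\otimes_\Bbbk{}_{y_1\cdots y_{n-1}\cdot i_{n-1}}M_{y_1\cdots y_n\cdot i_n}\otimes_\Bbbk y_1\cdots y_nV,$$ where $y_1\cdots y_nV$ stands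 for $y_1\cdots y_n\otimes_\Bbbk V\subset\Bbbk G\otimes_\Bbbk V$. Put $M(\underline i;V)=\bigoplus_{\underline y}M_{\underline y}(\underline i;V)$. It is a $\Bbbk G_{i_0}$-module: for $g\in G_{i_0}$ and $\underline y$, there are a unique sequence $\underline y'$ ($y'_t\in[G/G_{i_t}]$) and a unique $h\in G_{i_n}$ with $gy_1\cdots y_tG_{i_t}=y'_1\cdots y'_tG_{i_t}$ for all $t$ and $gy_1\cdots y_n=y'_1\cdots y'_nh$; then ${}^g(m_1\otimes\cdots\otimes m_n\otimes y_1\cdots y_nv)={}^gm_1\otimes\cdots\otimes{}^gm_n\otimes y'_1\cdots y'_n\,{}^hv$. If $n=0$, $M(\underline i;V)=V$. **Notation for intertwiners.** For $f\in\mathrm{Hom}_{\Bbbk G_{i_0}}(U,M(\underline i;V))$ and $u\in U$, the component of $f(u)$ in $M_{\underline y}(\underline i;V)$ is written symbolically (sum sign omitted) $f_{\underline y}(u)=f_{\underline y}^{(1)}(u)\otimes\cdots\otimes f_{\underline y}^{(n)}(u)\otimes y_1\cdots y_nf_{\underline y}^{(0)}(u)$, with $f^{(t)}_{\underline y}(u)\in{}_{y_1\cdots y_{t-1}\cdot i_{t-1}}M_{y_1\cdots y_t\cdot i_t}$ and $f^{(0)}_{\underline y}(u)\in V$. **Operation $\circledast$.** Let $\underline i''=i_0,\ldots,i_{m+n}$, $\underline i=i_0,\ldots,i_m$, $\underline i'=i_m,\ldots,i_{m+n}$. For $f\in\mathrm{Hom}_{\Bbbk G_{i_0}}(U,M(\underline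 i;V))$ and $f'\in\mathrm{Hom}_{\Bbbk G_{i_m}}(V,M(\underline i';W))$, $f'\circledast f:U\to M(\underline i'';W)$ is the morphism whose component at $\underline y''=y_1,\ldots,y_{m+n}$ is, with $\underline y=y_1,\ldots,y_m$ and $\underline y'=y_{m+1},\ldots,y_{m+n}$, $$u\mapsto f^{(1)}_{\underline y}(u)\otimes\cdots\otimes f^{(m)}_{\underline y}(u)\otimes{}^{y_1\cdots y_m}\big(f'^{(1)}_{\underline y'}(f^{(0)}_{\underline y}(u))\big)\otimes\cdots\otimes{}^{y_1\cdots y_m}\big(f'^{(n)}_{\underline y'}(f^{(0)}_{\underline y}(u))\big)\otimes y_1\cdots y_{m+n}f'^{(0)}_{\underline y'}(f^{(0)}_{\underline y}(u)).$$ The same formula is used when $m=0$ or $n=0$ (it is then composition of $f$ and $f'$ in the obvious sense). **Algebra of intertwiners.** $\mathcal{I}ntw=\bigoplus_{n,\underline i,U,V}\mathrm{Hom}_{\Bbbk G_{i_0}}(U,M(\underline i;V))$, where $n\geqslant0$, $\underline i=i_0,\ldots,i_n$ runs through sequences in $[G\backslash Q_0]$, $U\in\mathrm{irr}(G_{i_0})$, $V\in\mathrm{irr}(G_{i_n})$; its product is $\circledast$ (zero on non-composable components). **Path algebra and $f_\gamma$.** In $\Bbbk Q_G$, the product $\gamma\gamma'$ is "first $\gamma$, then $\gamma'$". For a path $\gamma:(i_0,U_0)\xrightarrow{f_1}(i_1,U_1)\to\cdots\xrightarrow{f_n}(i_n,U_n)$ in $Q_G$, $f_\gamma=f_n\circledast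 f_{n-1}\circledast\cdots\circledast f_1\in\mathrm{Hom}_{\Bbbk G_{i_0}}(U_0,M(i_0,\ldots,i_n;U_n))$; for the trivial path at $(i,U)$, $f_\gamma=\mathrm{Id}_U$. **Dual intertwiners and pairing.** $M^*=\mathrm{Hom}_\Bbbk(M,\Bbbk)$ is an $S$-bimodule with ${}_iM^*_j=({}_jM_i)^*$ and $G$-action ${}^g\varphi=\varphi({}^{g^{-1}}\bullet)$, so that ${}^g({}_iM^*_j)={}_{g\cdot i}M^*_{g\cdot j}$. Replacing $M$ by $M^*$ in the definition of the modules $M(\underline i;V)$ gives, for every sequence $\underline j=j_0,\ldots,j_n$ in $Q_0$ and every $W\in\mathrm{mod}(\Bbbk G_{j_n})$, the $\Bbbk G_{j_0}$-module $M^*(\underline j;W)=\bigoplus_{\underline y}M^*_{\underline y}(\underline j;W)$, where $\underline y=y_1,\ldots,y_n$ with $y_t\in[G/G_{j_t}]$ and $M^*_{\underline y}(\underline j;W)={}_{j_0}M^*_{y_1\cdot j_1}\otimes_\Bbbk\cdots\otimes_\Bbbk{}_{y_1\cdots y_{n-1}\cdot j_{n-1}}M^*_{y_1\cdots y_n\cdot j_n}\otimes_\Bbbk y_1\cdots y_nW$ (and $M^*(\underline j;W)=W$ if $n=0$), the action of $G_{j_0}$ being defined by the same formula as for $M$; likewise, the operation $\circledast$ is defined on composable morphisms $U\to M^*(j_0,\ldots,j_m;V)$ and $V\to M^*(j_m,\ldots,j_{m+n};W)$ by the same formula as for $M$, with values in the morphisms $U\to M^*(j_0,\ldots,j_{m+n};W)$.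 Put $\underline i^o=i_n,\ldots,i_0$. For $\varphi\in\mathrm{Hom}_{\Bbbk G_{i_n}}(V,M^*(\underline i^o;U))$, $v\in V$ and $\underline x=x_{n-1},\ldots,x_0$ ($x_t\in[G/G_{i_t}]$), the component of $\varphi(v)$ in $M^*_{\underline x}(\underline i^o;U)$ is written $\varphi^{\underline x}_{(n)}(v)\otimes\cdots\otimes\varphi^{\underline x}_{(1)}(v)\otimes x_{n-1}\cdots x_0\varphi^{\underline x}_{(0)}(v)$, with $\varphi^{\underline x}_{(t)}(v)\in{}_{x_{n-1}\cdots x_t\cdot i_t}M^*_{x_{n-1}\cdots x_{t-1}\cdot i_{t-1}}$ and $\varphi^{\underline x}_{(0)}(v)\in U$. For $U$ simple, there is a non-degenerate pairing $(-|-):\mathrm{Hom}_{\Bbbk G_{i_0}}(U,M(\underline i;V))\otimes_\Bbbk\mathrm{Hom}_{\Bbbk G_{i_n}}(V,M^*(\underline i^o;U))\to\Bbbk$ determined by: for all $u\in U$, $$(f|\varphi)\,u=\sum_{\underline y}\Big(\prod_{t=1}^n\varphi^{\underline x}_{(t)}(f^{(0)}_{\underline y}(u))\big({}^{(y_1\cdots y_n)^{-1}}f^{(t)}_{\underline y}(u)\big)\Big)\;{}^{h_0^{-1}}\big(\varphi^{\underline x}_{(0)}(f^{(0)}_{\underline y}(u))\big),$$ where, for each $\underline y$, $\underline x$ and $h_0$ are the unique elements with $x_t\in[G/G_{i_t}]$, $h_0\in G_{i_0}$, $(y_t\cdots y_n)^{-1}\in x_{n-1}x_{n-2}\cdots x_{t-1}G_{i_{t-1}}$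 for $1\leqslant t\leqslant n$, and $(y_1\cdots y_n)^{-1}=x_{n-1}\cdots x_0h_0$. **$\varphi_\gamma$.** For an arrow $f:(i,U)\to(j,V)$ of $Q_G$, $f^\vee\in\mathrm{Hom}_{\Bbbk G_j}(V,M^*(j,i;U))$ is the element of the $(-|-)$-dual basis: $(f'|f^\vee)=1$ if $f'=f$ and $0$ for every other arrow $f':(i,U)\to(j,V)$. For a path $\gamma:(i_0,U_0)\xrightarrow{f_1}(i_1,U_1)\to\cdots\xrightarrow{f_n}(i_n,U_n)$ in $Q_G$, $\varphi_\gamma=f_1^\vee\circledast f_2^\vee\circledast\cdots\circledast f_n^\vee\in\mathrm{Hom}_{\Bbbk G_{i_n}}(U_n,M^*(i_n,\ldots,i_0;U_0))$, and $\varphi_\gamma=\mathrm{Id}_U$ for the trivial path at $(i,U)$. *)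

theory Defs
  imports
    "HOL-Library.Function_Algebras"
    "HOL-Algebra.Group_Action"
    "HOL-Algebra.QuotRing"
    "HOL-Algebra.Algebraic_Closure_Type"
    "Graph_Theory.Arc_Walk"
begin

hide_const (open) Multiset.mult

section \<open>Linear algebra\<close>

text \<open>
  A vector space over the field \<open>'k\<close> is a subspace of a type of class \<^class>\<open>ab_group_add\<close>
  with a scalar multiplication satisfying \<^locale>\<open>vector_space\<close>. On function types, addition is
  pointwise (theory \<^theory>\<open>HOL-Library.Function_Algebras\<close>), and so is scalar multiplication:
\<close>

definition pw :: "('k \<Rightarrow> 'b \<Rightarrow> 'b) \<Rightarrow> 'k \<Rightarrow> ('x \<Rightarrow> 'b) \<Rightarrow> 'x \<Rightarrow> 'b" where
  "pw s c f = (\<lambda>x. s c (f x))"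

definition single :: "'x \<Rightarrow> 'b \<Rightarrow> 'x \<Rightarrow> 'b::zero" where
  "single a b = (\<lambda>x. if x = a then b else 0)"

definition linear_on ::
  "('k \<Rightarrow> 'a::ab_group_add \<Rightarrow> 'a) \<Rightarrow> ('k \<Rightarrow> 'b::ab_group_add \<Rightarrow> 'b) \<Rightarrow> 'a set \<Rightarrow> ('a \<Rightarrow> 'b) \<Rightarrow> bool" where
  "linear_on s1 s2 A f \<longleftrightarrow>
     (\<forall>x\<in>A. \<forall>y\<in>A. f (x + y) = f x + f y) \<and> (\<forall>c. \<forall>x\<in>A. f (s1 c x) = s2 c (f x))"

definition fin_dim :: "('k::field \<Rightarrow> 'a::ab_group_add \<Rightarrow> 'a) \<Rightarrow> 'a set \<Rightarrow> bool" where
  "fin_dim s A \<longleftrightarrow> (\<exists>B. finite B \<and> Modules.module.span s B = A)"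

definition is_basis :: "('k::field \<Rightarrow> 'a::ab_group_add \<Rightarrow> 'a) \<Rightarrow> 'a set \<Rightarrow> 'a set \<Rightarrow> bool" where
  "is_basis s A B \<longleftrightarrow> \<not> Modules.module.dependent s B \<and> Modules.module.span s B = A"

subsection \<open>Tensor products\<close>

text \<open>
  For subspaces \<open>C\<^sub>1, \<dots>, C\<^sub>n\<close> of \<open>'m\<close> (the list \<open>Cs\<close>) and a subspace \<open>V\<close> of \<open>'v\<close>, the space
  \<open>C\<^sub>1 \<otimes> \<cdots> \<otimes> C\<^sub>n \<otimes> V\<close> is realised inside the dual of the space of multilinear forms on
  \<open>C\<^sub>1 \<times> \<cdots> \<times> C\<^sub>n \<times> V\<close>: the pure tensor \<open>m\<^sub>1 \<otimes> \<cdots> \<otimes> m\<^sub>n \<otimes> v\<close> is the evaluation at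
  \<open>(m\<^sub>1, \<dots>, m\<^sub>n, v)\<close>, and the tensor product is the span of the pure tensors. Its universal
  property is proved below (\<open>tlift_linear\<close>, \<open>tlift_tpure\<close>, \<open>tensor_map_unique\<close>).
\<close>

type_synonym ('m, 'v, 'k) tens = "('m list \<Rightarrow> 'v \<Rightarrow> 'k) \<Rightarrow> 'k"

definition multilinear ::
  "('k \<Rightarrow> 'm::ab_group_add \<Rightarrow> 'm) \<Rightarrow> ('k \<Rightarrow> 'v::ab_group_add \<Rightarrow> 'v) \<Rightarrow> ('k \<Rightarrow> 'w::ab_group_add \<Rightarrow> 'w)
    \<Rightarrow> 'm set list \<Rightarrow> 'v set \<Rightarrow> ('m list \<Rightarrow> 'v \<Rightarrow> 'w) \<Rightarrow> bool" where
  "multilinear sm sv sw Cs V F \<longleftrightarrow>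
     (\<forall>ms\<in>listset Cs. linear_on sv sw V (F ms)) \<and>
     (\<forall>ms\<in>listset Cs. \<forall>v\<in>V. \<forall>t<length Cs. linear_on sm sw (Cs ! t) (\<lambda>m. F (ms[t := m]) v))"

definition tpure ::
  "('k::field \<Rightarrow> 'm::ab_group_add \<Rightarrow> 'm) \<Rightarrow> ('k \<Rightarrow> 'v::ab_group_add \<Rightarrow> 'v)
    \<Rightarrow> 'm set list \<Rightarrow> 'v set \<Rightarrow> 'm list \<Rightarrow> 'v \<Rightarrow> ('m, 'v, 'k) tens" where
  "tpure sm sv Cs V ms v = (\<lambda>\<beta>. if multilinear sm sv (*) Cs V \<beta> then \<beta> ms v else 0)"

definition tensor ::
  "('k::field \<Rightarrow> 'm::ab_group_add \<Rightarrow> 'm) \<Rightarrow> ('k \<Rightarrow> 'v::ab_group_add \<Rightarrow> 'v)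
    \<Rightarrow> 'm set list \<Rightarrow> 'v set \<Rightarrow> ('m, 'v, 'k) tens set" where
  "tensor sm sv Cs V =
     Modules.module.span (pw (*)) {tpure sm sv Cs V ms v | ms v. ms \<in> listset Cs \<and> v \<in> V}"

text \<open>
  \<open>tlift sm sv Cs V F t\<close> writes \<open>t\<close> as a sum of pure tensors and returns the sum of the values of
  \<open>F\<close>; for multilinear \<open>F\<close> it does not depend on the chosen expression (\<open>tlift_eq\<close>). It renders
  the symbolic notation \<open>t = t\<^bsup>(1)\<^esup> \<otimes> \<cdots> \<otimes> t\<^bsup>(n)\<^esup> \<otimes> t\<^bsup>(0)\<^esup>\<close> with omitted summation sign:
  \<open>tlift sm sv Cs V F t\<close> is \<open>F [t\<^bsup>(1)\<^esup>, \<dots>, t\<^bsup>(n)\<^esup>] t\<^bsup>(0)\<^esup>\<close>.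
\<close>

definition tlift ::
  "('k::field \<Rightarrow> 'm::ab_group_add \<Rightarrow> 'm) \<Rightarrow> ('k \<Rightarrow> 'v::ab_group_add \<Rightarrow> 'v)
    \<Rightarrow> 'm set list \<Rightarrow> 'v set \<Rightarrow> ('m list \<Rightarrow> 'v \<Rightarrow> 'w::ab_group_add) \<Rightarrow> ('m, 'v, 'k) tens \<Rightarrow> 'w" where
  "tlift sm sv Cs V F t =
     (let ps = (SOME ps. set ps \<subseteq> listset Cs \<times> V \<and> t = (\<Sum>(ms, v)\<leftarrow>ps. tpure sm sv Cs V ms v))
      in (\<Sum>(ms, v)\<leftarrow>ps. F ms v))"

lemma vector_space_pw_mult: "vector_space (pw (*) :: 'k::field \<Rightarrow> ('x \<Rightarrow> 'k) \<Rightarrow> 'x \<Rightarrow> 'k)"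
  by standard (auto simp: pw_def fun_eq_iff algebra_simps)

lemma tpure_multilinear:
  assumes "ms \<in> listset Cs" "v \<in> V"
  shows "multilinear sm sv (pw (*)) Cs V (tpure sm sv Cs V)"
  unfolding multilinear_def linear_on_def tpure_def pw_def fun_eq_iff
  by (auto simp: multilinear_def linear_on_def)

lemma tlift_eq:
  fixes sm :: "'k::field \<Rightarrow> 'm::ab_group_add \<Rightarrow> 'm" and sv :: "'k \<Rightarrow> 'v::ab_group_add \<Rightarrow> 'v"
    and sw :: "'k \<Rightarrow> 'w::ab_group_add \<Rightarrow> 'w"
  assumes sw: "vector_space sw" and F: "multilinear sm sv sw Cs V F"
    and ps: "set ps \<subseteq> listset Cs \<times> V" and t: "t = (\<Sum>(ms, v)\<leftarrow>ps. tpure sm sv Cs V ms v)"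
  shows "tlift sm sv Cs V F t = (\<Sum>(ms, v)\<leftarrow>ps. F ms v)"
proof -
  interpret W: vector_space sw by fact
  interpret K: vector_space "(*) :: 'k \<Rightarrow> 'k \<Rightarrow> 'k"
    by standard (auto simp: algebra_simps)
  interpret WK: vector_space_pair sw "(*) :: 'k \<Rightarrow> 'k \<Rightarrow> 'k" ..
  define qs where "qs = (SOME ps. set ps \<subseteq> listset Cs \<times> V \<and> t = (\<Sum>(ms, v)\<leftarrow>ps. tpure sm sv Cs V ms v))"
  have qs: "set qs \<subseteq> listset Cs \<times> V \<and> t = (\<Sum>(ms, v)\<leftarrow>qs. tpure sm sv Cs V ms v)"
    unfolding qs_def by (rule someI[of _ ps]) (use ps t in auto)
  have apply_sum: "(\<Sum>(ms, v)\<leftarrow>rs. tpure sm sv Cs V ms v) \<beta> = (\<Sum>(ms, v)\<leftarrow>rs. \<beta> ms v)"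
    if "multilinear sm sv (*) Cs V \<beta>" for rs and \<beta> :: "'m list \<Rightarrow> 'v \<Rightarrow> 'k"
    using that by (induction rs) (auto simp: tpure_def)
  have eq: "l (\<Sum>(ms, v)\<leftarrow>qs. F ms v) = l (\<Sum>(ms, v)\<leftarrow>ps. F ms v)"
    if l: "Vector_Spaces.linear sw (*) l" for l
  proof -
    interpret l: Vector_Spaces.linear sw "(*)" l by fact
    have "multilinear sm sv (*) Cs V (\<lambda>ms v. l (F ms v))"
      using F by (auto simp: multilinear_def linear_on_def l.add l.scale)
    from apply_sum[OF this] qs t
    have "(\<Sum>(ms, v)\<leftarrow>qs. l (F ms v)) = (\<Sum>(ms, v)\<leftarrow>ps. l (F ms v))" by metis
    moreover have "l (\<Sum>(ms, v)\<leftarrow>rs. F ms v) = (\<Sum>(ms, v)\<leftarrow>rs. l (F ms v))" for rs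
      by (induction rs) (auto simp: l.add l.zero)
    ultimately show ?thesis by simp
  qed
  define d where "d = (\<Sum>(ms, v)\<leftarrow>qs. F ms v) - (\<Sum>(ms, v)\<leftarrow>ps. F ms v)"
  have "d = 0"
  proof (rule ccontr)
    assume "d \<noteq> 0"
    then have "W.independent {d}" by simp
    then obtain l where l: "Vector_Spaces.linear sw (*) l" "l d = 1"
      using WK.linear_independent_extend[of "{d}" "\<lambda>_. 1"] by auto
    interpret l: Vector_Spaces.linear sw "(*)" l by fact
    show False using eq[OF l(1)] l(2) by (simp add: d_def l.diff)
  qed
  then show ?thesis by (simp add: tlift_def flip: qs_def) (simp add: d_def)
qed

lemma tensor_decomp:
  fixes sm :: "'k::field \<Rightarrow> 'm::ab_group_add \<Rightarrow> 'm" and sv :: "'k \<Rightarrow> 'v::ab_group_add \<Rightarrow> 'v"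
  assumes V: "vector_space sv" "Modules.module.subspace sv V" and t: "t \<in> tensor sm sv Cs V"
  shows "\<exists>ps. set ps \<subseteq> listset Cs \<times> V \<and> t = (\<Sum>(ms, v)\<leftarrow>ps. tpure sm sv Cs V ms v)"
proof -
  interpret V: vector_space sv by fact
  interpret T: vector_space "pw (*) :: 'k \<Rightarrow> ('m, 'v, 'k) tens \<Rightarrow> _"
    by (rule vector_space_pw_mult)
  show ?thesis using t unfolding tensor_def
  proof (induction rule: T.span_induct_alt)
    case base
    show ?case by (intro exI[of _ "[]"]) auto
  next
    case (step c x y)
    then obtain ms v ps where *: "x = tpure sm sv Cs V ms v" "ms \<in> listset Cs" "v \<in> V"
      "set ps \<subseteq> listset Cs \<times> V" "y = (\<Sum>(ms, v)\<leftarrow>ps. tpure sm sv Cs V ms v)" by blast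
    have "pw (*) c x = tpure sm sv Cs V ms (sv c v)"
      using tpure_multilinear[OF *(2,3), of sm sv] *(1-3) by (auto simp: multilinear_def linear_on_def)
    moreover have "sv c v \<in> V" using V(2) *(3) by (rule V.subspace_scale)
    ultimately show ?case using * by (intro exI[of _ "(ms, sv c v) # ps"]) auto
  qed
qed

lemma tlift_tpure:
  assumes "vector_space sw" "multilinear sm sv sw Cs V F" "ms \<in> listset Cs" "v \<in> V"
  shows "tlift sm sv Cs V F (tpure sm sv Cs V ms v) = F ms v"
  using tlift_eq[OF assms(1,2), of "[(ms, v)]"] assms(3,4) by simp

lemma tlift_linear:
  fixes sm :: "'k::field \<Rightarrow> 'm::ab_group_add \<Rightarrow> 'm" and sv :: "'k \<Rightarrow> 'v::ab_group_add \<Rightarrow> 'v"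
  assumes sw: "vector_space sw" and F: "multilinear sm sv sw Cs V F"
    and V: "vector_space sv" "Modules.module.subspace sv V"
  shows "linear_on (pw (*)) sw (tensor sm sv Cs V) (tlift sm sv Cs V F)"
proof -
  interpret V: vector_space sv by fact
  interpret W: vector_space sw by fact
  show ?thesis unfolding linear_on_def
  proof safe
    fix x y assume x: "x \<in> tensor sm sv Cs V" and y: "y \<in> tensor sm sv Cs V"
    from tensor_decomp[OF V x] obtain ps where
      ps: "set ps \<subseteq> listset Cs \<times> V" "x = (\<Sum>(ms, v)\<leftarrow>ps. tpure sm sv Cs V ms v)" by blast
    from tensor_decomp[OF V y] obtain qs where
      qs: "set qs \<subseteq> listset Cs \<times> V" "y = (\<Sum>(ms, v)\<leftarrow>qs. tpure sm sv Cs V ms v)" by blast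
    show "tlift sm sv Cs V F (x + y) = tlift sm sv Cs V F x + tlift sm sv Cs V F y"
      using tlift_eq[OF sw F ps] tlift_eq[OF sw F qs] tlift_eq[OF sw F, of "ps @ qs" "x + y"] ps qs
      by simp
  next
    fix c x assume x: "x \<in> tensor sm sv Cs V"
    from tensor_decomp[OF V x] obtain ps where
      ps: "set ps \<subseteq> listset Cs \<times> V" "x = (\<Sum>(ms, v)\<leftarrow>ps. tpure sm sv Cs V ms v)" by blast
    let ?qs = "map (\<lambda>(ms, v). (ms, sv c v)) ps"
    have qs: "set ?qs \<subseteq> listset Cs \<times> V" using ps(1) V.subspace_scale[OF V(2)] by auto
    have "pw (*) c (\<Sum>(ms, v)\<leftarrow>rs. tpure sm sv Cs V ms v) =
        (\<Sum>(ms, v)\<leftarrow>map (\<lambda>(ms, v). (ms, sv c v)) rs. tpure sm sv Cs V ms v)"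
      if "set rs \<subseteq> listset Cs \<times> V" for rs
      using that
    proof (induction rs)
      case Nil
      then show ?case by (simp add: pw_def fun_eq_iff)
    next
      case (Cons p rs)
      obtain ms v where p: "p = (ms, v)" by force
      with Cons have *: "ms \<in> listset Cs" "v \<in> V" by auto
      have "pw (*) c (tpure sm sv Cs V ms v) = tpure sm sv Cs V ms (sv c v)"
        using tpure_multilinear[OF *, of sm sv] * by (auto simp: multilinear_def linear_on_def)
      moreover have "pw (*) c (x + y) = pw (*) c x + pw (*) c y" for x y :: "('m, 'v, 'k) tens"
        by (simp add: pw_def fun_eq_iff algebra_simps)
      ultimately show ?case using Cons.IH Cons.prems p
        by (simp only: list.map sum_list.Cons case_prod_conv list.set insert_subset simp_thms)
    qed
    moreover have "(\<Sum>(ms, v)\<leftarrow>map (\<lambda>(ms, v). (ms, sv c v)) rs. F ms v) = sw c (\<Sum>(ms, v)\<leftarrow>rs. F ms v)"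
      if "set rs \<subseteq> listset Cs \<times> V" for rs
      using that F by (induction rs) (auto simp: multilinear_def linear_on_def W.scale_right_distrib)
    ultimately show "tlift sm sv Cs V F (pw (*) c x) = sw c (tlift sm sv Cs V F x)"
      using tlift_eq[OF sw F ps] tlift_eq[OF sw F qs] ps by simp
  qed
qed

lemma tensor_map_unique:
  fixes sm :: "'k::field \<Rightarrow> 'm::ab_group_add \<Rightarrow> 'm" and sv :: "'k \<Rightarrow> 'v::ab_group_add \<Rightarrow> 'v"
  assumes V: "vector_space sv" "Modules.module.subspace sv V" "V \<noteq> {}"
    and L: "linear_on (pw (*)) sw (tensor sm sv Cs V) L" "linear_on (pw (*)) sw (tensor sm sv Cs V) L'"
    and eq: "\<And>ms v. ms \<in> listset Cs \<Longrightarrow> v \<in> V \<Longrightarrow> L (tpure sm sv Cs V ms v) = L' (tpure sm sv Cs V ms v)"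
    and t: "t \<in> tensor sm sv Cs V"
  shows "L t = L' t"
proof -
  interpret T: vector_space "pw (*) :: 'k \<Rightarrow> ('m, 'v, 'k) tens \<Rightarrow> _"
    by (rule vector_space_pw_mult)
  have 0: "0 \<in> tensor sm sv Cs V" unfolding tensor_def by (rule T.span_zero)
  have L0: "L 0 = 0" "L' 0 = 0" using L 0 unfolding linear_on_def by (metis add_0 add_cancel_right_right)+
  from tensor_decomp[OF V(1,2) t] obtain ps where
    ps: "set ps \<subseteq> listset Cs \<times> V" "t = (\<Sum>(ms, v)\<leftarrow>ps. tpure sm sv Cs V ms v)" by blast
  have "(\<Sum>(ms, v)\<leftarrow>rs. tpure sm sv Cs V ms v) \<in> tensor sm sv Cs V \<and>
      L (\<Sum>(ms, v)\<leftarrow>rs. tpure sm sv Cs V ms v) = L' (\<Sum>(ms, v)\<leftarrow>rs. tpure sm sv Cs V ms v)"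
    if "set rs \<subseteq> listset Cs \<times> V" for rs
    using that
  proof (induction rs)
    case Nil
    then show ?case using 0 L0 by (simp only: list.map sum_list.Nil simp_thms)
  next
    case (Cons p rs)
    obtain ms v where p: "p = (ms, v)" by force
    with Cons have *: "ms \<in> listset Cs" "v \<in> V" by auto
    let ?r = "\<Sum>(ms, v)\<leftarrow>rs. tpure sm sv Cs V ms v"
    have x: "tpure sm sv Cs V ms v \<in> tensor sm sv Cs V"
      unfolding tensor_def using * by (intro T.span_base) auto
    have r: "?r \<in> tensor sm sv Cs V" "L ?r = L' ?r" using Cons by auto
    have "tpure sm sv Cs V ms v + ?r \<in> tensor sm sv Cs V"
      using x r(1) unfolding tensor_def by (rule T.span_add)
    moreover have "L (tpure sm sv Cs V ms v + ?r) = L' (tpure sm sv Cs V ms v + ?r)"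
      using L x r eq[OF *] unfolding linear_on_def by metis
    ultimately show ?case using p by (simp only: list.map sum_list.Cons case_prod_conv simp_thms)
  qed
  with ps show ?thesis by blast
qed

section \<open>Group actions, representations and bimodules\<close>

text \<open>
  \<open>pts\<close> is \<open>Q\<^sub>0\<close>, \<open>orb_reps\<close> is \<open>[G\<setminus>Q\<^sub>0]\<close>, and \<open>cos_reps i\<close> is \<open>[G/G\<^sub>i]\<close>.
\<close>

record ('g, 'i) gset =
  grp :: "'g monoid"
  pts :: "'i set"
  pact :: "'g \<Rightarrow> 'i \<Rightarrow> 'i"
  orb_reps :: "'i set"
  cos_reps :: "'i \<Rightarrow> 'g set"

abbreviation stab :: "('g, 'i) gset \<Rightarrow> 'i \<Rightarrow> 'g set" where
  "stab C i \<equiv> stabilizer (grp C) (pact C) i"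

definition is_gset :: "('g, 'i) gset \<Rightarrow> bool" where
  "is_gset C \<longleftrightarrow>
     group_action (grp C) (pts C) (pact C) \<and> finite (carrier (grp C)) \<and> finite (pts C) \<and>
     orb_reps C \<subseteq> pts C \<and>
     (\<forall>\<O>\<in>orbits (grp C) (pts C) (pact C). \<exists>!i. i \<in> orb_reps C \<and> i \<in> \<O>) \<and>
     (\<forall>i\<in>pts C. cos_reps C i \<subseteq> carrier (grp C) \<and>
        (\<forall>g\<in>carrier (grp C). \<exists>!y. y \<in> cos_reps C i \<and> y \<in> g <#\<^bsub>grp C\<^esub> stab C i))"

definition gprod :: "('g, 'i) gset \<Rightarrow> 'g list \<Rightarrow> 'g" where
  "gprod C ys = foldr (\<lambda>y z. y \<otimes>\<^bsub>grp C\<^esub> z) ys \<one>\<^bsub>grp C\<^esub>"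

text \<open>
  A representation is a subspace of \<open>'v\<close> with its scalar multiplication and group action. The
  module operations are meaningful on the subspace only.
\<close>

record ('g, 'k, 'v) rep =
  space :: "'v set"
  scal :: "'k \<Rightarrow> 'v \<Rightarrow> 'v"
  gact :: "'g \<Rightarrow> 'v \<Rightarrow> 'v"

definition is_rep :: "'g monoid \<Rightarrow> 'g set \<Rightarrow> ('g, 'k::field, 'v::ab_group_add) rep \<Rightarrow> bool" where
  "is_rep G H V \<longleftrightarrow>
     vector_space (scal V) \<and> Modules.module.subspace (scal V) (space V) \<and> fin_dim (scal V) (space V) \<and>
     (\<forall>h\<in>H. gact V h ` space V \<subseteq> space V \<and> linear_on (scal V) (scal V) (space V) (gact V h)) \<and>
     (\<forall>v\<in>space V. gact V \<one>\<^bsub>G\<^esub> v = v) \<and>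
     (\<forall>g\<in>H. \<forall>h\<in>H. \<forall>v\<in>space V. gact V (g \<otimes>\<^bsub>G\<^esub> h) v = gact V g (gact V h v))"

definition irreducible_rep :: "'g monoid \<Rightarrow> 'g set \<Rightarrow> ('g, 'k::field, 'v::ab_group_add) rep \<Rightarrow> bool" where
  "irreducible_rep G H V \<longleftrightarrow>
     is_rep G H V \<and> space V \<noteq> {0} \<and>
     (\<forall>W\<subseteq>space V. Modules.module.subspace (scal V) W \<and> (\<forall>h\<in>H. gact V h ` W \<subseteq> W) \<longrightarrow>
        W = {0} \<or> W = space V)"

definition rep_isomorphic ::
  "'g set \<Rightarrow> ('g, 'k, 'v::ab_group_add) rep \<Rightarrow> ('g, 'k, 'w::ab_group_add) rep \<Rightarrow> bool" where
  "rep_isomorphic H V W \<longleftrightarrow>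
     (\<exists>f. bij_betw f (space V) (space W) \<and> linear_on (scal V) (scal W) (space V) f \<and>
          (\<forall>h\<in>H. \<forall>v\<in>space V. f (gact V h v) = gact W h (f v)))"

text \<open>
  Completeness is tested against the representations on finite-dimensional subspaces of
  \<open>nat \<Rightarrow> 'k\<close>. As these include all representations on \<open>'k\<^sup>n\<close> for all \<open>n\<close>, every finite-dimensional
  representation, over whatever type, is isomorphic to one of them.
\<close>

definition irr_reps ::
  "'g monoid \<Rightarrow> 'g set \<Rightarrow> ('g, 'k::field, 'v::ab_group_add) rep set \<Rightarrow> bool" where
  "irr_reps G H R \<longleftrightarrow>
     (\<forall>U\<in>R. irreducible_rep G H U) \<and>
     (\<forall>U\<in>R. \<forall>V\<in>R. rep_isomorphic H U V \<longrightarrow> U = V) \<and>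
     (\<forall>V :: ('g, 'k, nat \<Rightarrow> 'k) rep. scal V = pw (*) \<and> irreducible_rep G H V \<longrightarrow>
        (\<exists>U\<in>R. rep_isomorphic H U V))"

text \<open>
  Bimodules over \<open>S = \<Bbbk>Q\<^sub>0\<close>. Elements of \<open>S\<close> are functions \<open>'i \<Rightarrow> 'k\<close> with pointwise operations,
  acting through their restriction to \<open>Q\<^sub>0\<close>; the bimodule is the subspace \<open>bcar\<close> of \<open>'m\<close>.
\<close>

record ('g, 'i, 'k, 'm) bimod =
  bcar :: "'m set"
  bscale :: "'k \<Rightarrow> 'm \<Rightarrow> 'm"
  lmul :: "('i \<Rightarrow> 'k) \<Rightarrow> 'm \<Rightarrow> 'm"
  rmul :: "'m \<Rightarrow> ('i \<Rightarrow> 'k) \<Rightarrow> 'm"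
  bact :: "'g \<Rightarrow> 'm \<Rightarrow> 'm"

definition bcomp :: "('g, 'i, 'k::field, 'm) bimod \<Rightarrow> 'i \<Rightarrow> 'i \<Rightarrow> 'm set" where
  "bcomp N i j = (\<lambda>m. lmul N (single i 1) (rmul N m (single j 1))) ` bcar N"

definition is_bimod ::
  "'i set \<Rightarrow> ('g, 'i, 'k::field, 'm::ab_group_add) bimod \<Rightarrow> bool" where
  "is_bimod Q0 N \<longleftrightarrow>
     vector_space (bscale N) \<and> Modules.module.subspace (bscale N) (bcar N) \<and>
     fin_dim (bscale N) (bcar N) \<and>
     (\<forall>s. \<forall>m\<in>bcar N. lmul N s m \<in> bcar N \<and> rmul N m s \<in> bcar N) \<and>
     (\<forall>s. \<forall>m\<in>bcar N. \<forall>m'\<in>bcar N. lmul N s (m + m') = lmul N s m + lmul N s m' \<and>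
                                rmul N (m + m') s = rmul N m s + rmul N m' s) \<and>
     (\<forall>s s'. \<forall>m\<in>bcar N. lmul N (s + s') m = lmul N s m + lmul N s' m \<and>
                      rmul N m (s + s') = rmul N m s + rmul N m s') \<and>
     (\<forall>s s'. \<forall>m\<in>bcar N. lmul N (s * s') m = lmul N s (lmul N s' m) \<and>
                      rmul N m (s * s') = rmul N (rmul N m s) s') \<and>
     (\<forall>s s'. \<forall>m\<in>bcar N. rmul N (lmul N s m) s' = lmul N s (rmul N m s')) \<and>
     (\<forall>c. \<forall>m\<in>bcar N. lmul N (\<lambda>_. c) m = bscale N c m \<and> rmul N m (\<lambda>_. c) = bscale N c m) \<and>
     (\<forall>s s'. \<forall>m\<in>bcar N. (\<forall>i\<in>Q0. s i = s' i) \<longrightarrow> lmul N s m = lmul N s' m \<and> rmul N m s = rmul N m s')"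

definition is_gbimod ::
  "('g, 'i) gset \<Rightarrow> ('g, 'i, 'k::field, 'm::ab_group_add) bimod \<Rightarrow> bool" where
  "is_gbimod C N \<longleftrightarrow>
     is_bimod (pts C) N \<and>
     (\<forall>g\<in>carrier (grp C). bact N g ` bcar N \<subseteq> bcar N \<and>
        linear_on (bscale N) (bscale N) (bcar N) (bact N g)) \<and>
     (\<forall>m\<in>bcar N. bact N \<one>\<^bsub>grp C\<^esub> m = m) \<and>
     (\<forall>g\<in>carrier (grp C). \<forall>h\<in>carrier (grp C). \<forall>m\<in>bcar N.
        bact N (g \<otimes>\<^bsub>grp C\<^esub> h) m = bact N g (bact N h m)) \<and>
     (\<forall>g\<in>carrier (grp C). \<forall>i\<in>pts C. \<forall>j\<in>pts C.
        bact N g ` bcomp N i j = bcomp N (pact C g i) (pact C g j))"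

text \<open>
  \<open>M\<^sup>*\<close> with \<open>(s\<phi>s')(m) = \<phi>(s'ms)\<close>, so that \<open>e\<^sub>i M\<^sup>* e\<^sub>j\<close> consists of the functionals
  \<open>m \<mapsto> \<phi>(e\<^sub>j m e\<^sub>i)\<close>, that is, of the functionals on \<open>e\<^sub>j M e\<^sub>i\<close> extended by zero to the other
  components. Functionals are set to zero outside \<open>bcar\<close>.
\<close>

definition dual ::
  "('g, 'i) gset \<Rightarrow> ('g, 'i, 'k::field, 'm::ab_group_add) bimod \<Rightarrow> ('g, 'i, 'k, 'm \<Rightarrow> 'k) bimod" where
  "dual C N = \<lparr>
     bcar = {\<phi>. linear_on (bscale N) (*) (bcar N) \<phi> \<and> (\<forall>m. m \<notin> bcar N \<longrightarrow> \<phi> m = 0)},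
     bscale = pw (*),
     lmul = (\<lambda>s \<phi> m. if m \<in> bcar N then \<phi> (rmul N m s) else 0),
     rmul = (\<lambda>\<phi> s m. if m \<in> bcar N then \<phi> (lmul N s m) else 0),
     bact = (\<lambda>g \<phi> m. if m \<in> bcar N then \<phi> (bact N (inv\<^bsub>grp C\<^esub> g) m) else 0)\<rparr>"

section \<open>The modules \<open>M(i\<^sub>0,\<dots>,i\<^sub>n;V)\<close> and their intertwiners\<close>

text \<open>
  A sequence \<open>i\<^sub>0, \<dots>, i\<^sub>n\<close> is a non-empty list \<open>is\<close>, and \<open>y\<^sub>1, \<dots>, y\<^sub>n\<close> is a list \<open>ys\<close> with
  \<open>ys ! t = y\<^bsub>t+1\<^esub>\<close>. The list \<open>comps C N is ys\<close> has the entries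
  \<open>\<^bsub>y\<^sub>1\<cdots>y\<^sub>t\<cdot>i\<^sub>t\<^esub>M\<^bsub>y\<^sub>1\<cdots>y\<^bsub>t+1\<^esub>\<cdot>i\<^bsub>t+1\<^esub>\<^esub>\<close>, \<open>0 \<le> t < n\<close>.
\<close>

definition yseqs :: "('g, 'i) gset \<Rightarrow> 'i list \<Rightarrow> 'g list set" where
  "yseqs C is = {ys. Suc (length ys) = length is \<and> (\<forall>t<length ys. ys ! t \<in> cos_reps C (is ! Suc t))}"

definition comps ::
  "('g, 'i) gset \<Rightarrow> ('g, 'i, 'k::field, 'm) bimod \<Rightarrow> 'i list \<Rightarrow> 'g list \<Rightarrow> 'm set list" where
  "comps C N is ys =
     map (\<lambda>t. bcomp N (pact C (gprod C (take t ys)) (is ! t))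
                     (pact C (gprod C (take (Suc t) ys)) (is ! Suc t))) [0..<length ys]"

abbreviation pure_M ::
  "('g, 'i) gset \<Rightarrow> ('g, 'i, 'k::field, 'm::ab_group_add) bimod \<Rightarrow> 'i list \<Rightarrow> ('g, 'k, 'v::ab_group_add) rep
    \<Rightarrow> 'g list \<Rightarrow> 'm list \<Rightarrow> 'v \<Rightarrow> ('m, 'v, 'k) tens" where
  "pure_M C N is V ys \<equiv> tpure (bscale N) (scal V) (comps C N is ys) (space V)"

abbreviation lift_M ::
  "('g, 'i) gset \<Rightarrow> ('g, 'i, 'k::field, 'm::ab_group_add) bimod \<Rightarrow> 'i list \<Rightarrow> ('g, 'k, 'v::ab_group_add) rep
    \<Rightarrow> 'g list \<Rightarrow> ('m list \<Rightarrow> 'v \<Rightarrow> 'w::ab_group_add) \<Rightarrow> ('m, 'v, 'k) tens \<Rightarrow> 'w" where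
  "lift_M C N is V ys \<equiv> tlift (bscale N) (scal V) (comps C N is ys) (space V)"

text \<open>
  An element of \<open>M(i\<^sub>0,\<dots>,i\<^sub>n;V) = \<Oplus>\<^sub>y M\<^sub>y(i\<^sub>0,\<dots>,i\<^sub>n;V)\<close> is the family of its components. The last
  tensor factor \<open>y\<^sub>1\<cdots>y\<^sub>n \<otimes> V\<close> of \<open>M\<^sub>y\<close> is represented by \<open>V\<close>, the label \<open>y\<^sub>1\<cdots>y\<^sub>n\<close> being
  determined by the index \<open>y\<close>. For \<open>n = 0\<close> the only index is the empty list, and the component
  there lies in the tensor product of the single factor \<open>V\<close>, which is \<open>V\<close> via
  \<open>v \<mapsto> tpure \<dots> [] \<dots> [] v\<close>.
\<close>

definition Mspace ::
  "('g, 'i) gset \<Rightarrow> ('g, 'i, 'k::field, 'm::ab_group_add) bimod \<Rightarrow> 'i list \<Rightarrow> ('g, 'k, 'v::ab_group_add) rep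
    \<Rightarrow> ('g list \<Rightarrow> ('m, 'v, 'k) tens) set" where
  "Mspace C N is V =
     {x. (\<forall>ys\<in>yseqs C is. x ys \<in> tensor (bscale N) (scal V) (comps C N is ys) (space V)) \<and>
         (\<forall>ys. ys \<notin> yseqs C is \<longrightarrow> x ys = 0)}"

definition transport :: "('g, 'i) gset \<Rightarrow> 'i list \<Rightarrow> 'g \<Rightarrow> 'g list \<Rightarrow> 'g list \<times> 'g" where
  "transport C is g ys = (THE (ys', h).
     ys' \<in> yseqs C is \<and> h \<in> stab C (last is) \<and>
     (\<forall>t\<in>{1..length ys}. (g \<otimes>\<^bsub>grp C\<^esub> gprod C (take t ys)) <#\<^bsub>grp C\<^esub> stab C (is ! t) =
                         gprod C (take t ys') <#\<^bsub>grp C\<^esub> stab C (is ! t)) \<and>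
     g \<otimes>\<^bsub>grp C\<^esub> gprod C ys = gprod C ys' \<otimes>\<^bsub>grp C\<^esub> h)"

definition Maction ::
  "('g, 'i) gset \<Rightarrow> ('g, 'i, 'k::field, 'm::ab_group_add) bimod \<Rightarrow> 'i list \<Rightarrow> ('g, 'k, 'v::ab_group_add) rep
    \<Rightarrow> 'g \<Rightarrow> ('g list \<Rightarrow> ('m, 'v, 'k) tens) \<Rightarrow> 'g list \<Rightarrow> ('m, 'v, 'k) tens" where
  "Maction C N is V g x =
     (\<Sum>ys\<in>yseqs C is. case transport C is g ys of (ys', h) \<Rightarrow>
        single ys' (lift_M C N is V ys
          (\<lambda>ms v. pure_M C N is V ys' (map (bact N g) ms) (gact V h v)) (x ys)))"

text \<open>Linear maps defined on a subspace are set to zero outside of it, so that equality is as maps.\<close>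

type_synonym ('g, 'k, 'm, 'v) morph = "'v \<Rightarrow> 'g list \<Rightarrow> ('m, 'v, 'k) tens"

abbreviation hscale :: "'k::field \<Rightarrow> ('g, 'k, 'm, 'v) morph \<Rightarrow> ('g, 'k, 'm, 'v) morph" where
  "hscale \<equiv> pw (pw (pw (*)))"

definition Hom ::
  "('g, 'i) gset \<Rightarrow> ('g, 'i, 'k::field, 'm::ab_group_add) bimod \<Rightarrow> 'i list
    \<Rightarrow> ('g, 'k, 'v::ab_group_add) rep \<Rightarrow> ('g, 'k, 'v) rep \<Rightarrow> ('g, 'k, 'm, 'v) morph set" where
  "Hom C N is U V =
     {f. (\<forall>u. u \<notin> space U \<longrightarrow> f u = 0) \<and>
         f ` space U \<subseteq> Mspace C N is V \<and>
         linear_on (scal U) (pw (pw (*))) (space U) f \<and>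
         (\<forall>g\<in>stab C (hd is). \<forall>u\<in>space U. f (gact U g u) = Maction C N is V g (f u))}"

definition id_hom ::
  "('g, 'i, 'k::field, 'm::ab_group_add) bimod \<Rightarrow> ('g, 'k, 'v::ab_group_add) rep \<Rightarrow> ('g, 'k, 'm, 'v) morph" where
  "id_hom N U = (\<lambda>u. if u \<in> space U then single [] (tpure (bscale N) (scal U) [] (space U) [] u) else 0)"

text \<open>
  \<open>circ C N is V is' W f' f\<close> is \<open>f' \<circledast> f\<close> for \<open>f: U \<rightarrow> M(is;V)\<close> and \<open>f': V \<rightarrow> M(is';W)\<close>, where
  \<open>last is = hd is'\<close>.
\<close>

definition circ ::
  "('g, 'i) gset \<Rightarrow> ('g, 'i, 'k::field, 'm::ab_group_add) bimod
    \<Rightarrow> 'i list \<Rightarrow> ('g, 'k, 'v::ab_group_add) rep \<Rightarrow> 'i list \<Rightarrow> ('g, 'k, 'v) rep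
    \<Rightarrow> ('g, 'k, 'm, 'v) morph \<Rightarrow> ('g, 'k, 'm, 'v) morph \<Rightarrow> ('g, 'k, 'm, 'v) morph" where
  "circ C N is V is' W f' f = (\<lambda>u zs.
     if zs \<in> yseqs C (is @ tl is') then
       let ys = take (length is - 1) zs; ys' = drop (length is - 1) zs in
       lift_M C N is V ys (\<lambda>ms v.
         lift_M C N is' W ys' (\<lambda>ms' w.
           pure_M C N (is @ tl is') W zs (ms @ map (bact N (gprod C ys)) ms') w)
         (f' v ys')) (f u ys)
     else 0)"

section \<open>Algebras\<close>

definition k_algebra :: "('k::field, 'a) module \<Rightarrow> bool" where
  "k_algebra A \<longleftrightarrow>
     ring A \<and> Module.module (ring_of_type_algebra :: 'k ring) A \<and>
     (\<forall>c. \<forall>x\<in>carrier A. \<forall>y\<in>carrier A.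
        (c \<odot>\<^bsub>A\<^esub> x) \<otimes>\<^bsub>A\<^esub> y = c \<odot>\<^bsub>A\<^esub> (x \<otimes>\<^bsub>A\<^esub> y) \<and> x \<otimes>\<^bsub>A\<^esub> (c \<odot>\<^bsub>A\<^esub> y) = c \<odot>\<^bsub>A\<^esub> (x \<otimes>\<^bsub>A\<^esub> y))"

definition opposite :: "('k, 'a) module \<Rightarrow> ('k, 'a) module" where
  "opposite A = A\<lparr>mult := (\<lambda>x y. y \<otimes>\<^bsub>A\<^esub> x)\<rparr>"

definition algebra_iso :: "('k::field, 'a) module \<Rightarrow> ('k, 'b) module \<Rightarrow> ('a \<Rightarrow> 'b) \<Rightarrow> bool" where
  "algebra_iso A B h \<longleftrightarrow>
     k_algebra A \<and> k_algebra B \<and> h \<in> ring_iso A B \<and>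
     (\<forall>c. \<forall>x\<in>carrier A. h (c \<odot>\<^bsub>A\<^esub> x) = c \<odot>\<^bsub>B\<^esub> h x)"

text \<open>
  Elements of the direct sum \<open>Intw\<close> are finitely supported families indexed by the triples
  \<open>(i\<^sub>0\<cdots>i\<^sub>n, U, V)\<close>.
\<close>

type_synonym ('g, 'i, 'k, 'v) idx = "'i list \<times> ('g, 'k, 'v) rep \<times> ('g, 'k, 'v) rep"

definition Intw_index ::
  "('g, 'i) gset \<Rightarrow> ('i \<Rightarrow> ('g, 'k, 'v) rep set) \<Rightarrow> ('g, 'i, 'k, 'v) idx set" where
  "Intw_index C irr =
     {(is, U, V). is \<noteq> [] \<and> set is \<subseteq> orb_reps C \<and> U \<in> irr (hd is) \<and> V \<in> irr (last is)}"

definition Intw_mult ::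
  "('g, 'i) gset \<Rightarrow> ('g, 'i, 'k::field, 'm::ab_group_add) bimod
    \<Rightarrow> (('g, 'i, 'k, 'v::ab_group_add) idx \<Rightarrow> ('g, 'k, 'm, 'v) morph)
    \<Rightarrow> (('g, 'i, 'k, 'v) idx \<Rightarrow> ('g, 'k, 'm, 'v) morph)
    \<Rightarrow> ('g, 'i, 'k, 'v) idx \<Rightarrow> ('g, 'k, 'm, 'v) morph" where
  "Intw_mult C N F' F =
     (\<Sum>((is', V', W), (is, U, V)) \<in>
         {((is', V', W), (is, U, V)). F' (is', V', W) \<noteq> 0 \<and> F (is, U, V) \<noteq> 0 \<and>
            last is = hd is' \<and> V = V'}.
        single (is @ tl is', U, W) (circ C N is V is' W (F' (is', V', W)) (F (is, U, V))))"

definition Intw ::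
  "('g, 'i) gset \<Rightarrow> ('g, 'i, 'k::field, 'm::ab_group_add) bimod \<Rightarrow> ('i \<Rightarrow> ('g, 'k, 'v::ab_group_add) rep set)
    \<Rightarrow> ('k, ('g, 'i, 'k, 'v) idx \<Rightarrow> ('g, 'k, 'm, 'v) morph) module" where
  "Intw C N irr = \<lparr>
     carrier = {F. finite {a. F a \<noteq> 0} \<and> {a. F a \<noteq> 0} \<subseteq> Intw_index C irr \<and>
                   (\<forall>(is, U, V)\<in>Intw_index C irr. F (is, U, V) \<in> Hom C N is U V)},
     mult = Intw_mult C N,
     one = (\<Sum>(i, U)\<in>Sigma (orb_reps C) irr. single ([i], U, U) (id_hom N U)),
     zero = 0,
     add = (+),
     module.smult = pw hscale\<rparr>"

section \<open>Path algebra\<close>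

text \<open>A path is given by its starting vertex and its list of arrows.\<close>

definition paths :: "('x, 'a) pre_digraph \<Rightarrow> ('x \<times> 'a list) set" where
  "paths Q = {(x, p). \<exists>y. pre_digraph.awalk Q x p y}"

definition path_end :: "('x, 'a) pre_digraph \<Rightarrow> 'x \<Rightarrow> 'a list \<Rightarrow> 'x" where
  "path_end Q x p = last (pre_digraph.awalk_verts Q x p)"

definition path_algebra :: "('x, 'a) pre_digraph \<Rightarrow> ('k::field, ('x \<times> 'a list) \<Rightarrow> 'k) module" where
  "path_algebra Q = \<lparr>
     carrier = {a. finite {\<gamma>. a \<gamma> \<noteq> 0} \<and> {\<gamma>. a \<gamma> \<noteq> 0} \<subseteq> paths Q},
     mult = (\<lambda>a b. \<Sum>((x, p), (y, q)) \<in> {((x, p), (y, q)).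
               a (x, p) \<noteq> 0 \<and> b (y, q) \<noteq> 0 \<and> path_end Q x p = y}.
               single (x, p @ q) (a (x, p) * b (y, q))),
     one = (\<Sum>x\<in>verts Q. single (x, []) 1),
     zero = 0,
     add = (+),
     module.smult = pw (*)\<rparr>"

section \<open>The quiver \<open>Q\<^sub>G\<close>\<close>

type_synonym ('g, 'i, 'k, 'v) vertex = "'i \<times> ('g, 'k, 'v) rep"

abbreviation arrows :: "('x, 'a) pre_digraph \<Rightarrow> 'x \<Rightarrow> 'x \<Rightarrow> 'a set" where
  "arrows Q x y \<equiv> {a \<in> arcs Q. tail Q a = x \<and> head Q a = y}"

text \<open>
  \<open>lab\<close> sends an arrow to the intertwiner that it is. The arrows themselves are kept abstract because
  one function may occur in several of the spaces \<open>Hom(U, M(i,j;V))\<close>.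
\<close>

definition is_QG ::
  "('g, 'i) gset \<Rightarrow> ('g, 'i, 'k::field, 'm::ab_group_add) bimod \<Rightarrow> ('i \<Rightarrow> ('g, 'k, 'v::ab_group_add) rep set)
    \<Rightarrow> (('g, 'i, 'k, 'v) vertex, 'a) pre_digraph \<Rightarrow> ('a \<Rightarrow> ('g, 'k, 'm, 'v) morph) \<Rightarrow> bool" where
  "is_QG C N irr Q lab \<longleftrightarrow>
     wf_digraph Q \<and> verts Q = Sigma (orb_reps C) irr \<and>
     (\<forall>(i, U)\<in>verts Q. \<forall>(j, V)\<in>verts Q.
        inj_on lab (arrows Q (i, U) (j, V)) \<and>
        is_basis hscale (Hom C N [i, j] U V) (lab ` arrows Q (i, U) (j, V)))"

definition path_idx ::
  "(('g, 'i, 'k, 'v) vertex, 'a) pre_digraph \<Rightarrow> ('g, 'i, 'k, 'v) vertex \<times> 'a list \<Rightarrow> ('g, 'i, 'k, 'v) idx" where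
  "path_idx Q = (\<lambda>(x, p). (map fst (pre_digraph.awalk_verts Q x p), snd x, snd (path_end Q x p)))"

fun f_path ::
  "('g, 'i) gset \<Rightarrow> ('g, 'i, 'k::field, 'm::ab_group_add) bimod
    \<Rightarrow> (('g, 'i, 'k, 'v::ab_group_add) vertex, 'a) pre_digraph \<Rightarrow> ('a \<Rightarrow> ('g, 'k, 'm, 'v) morph)
    \<Rightarrow> ('g, 'i, 'k, 'v) vertex \<Rightarrow> 'a list \<Rightarrow> ('g, 'k, 'm, 'v) morph" where
  "f_path C N Q lab x [] = id_hom N (snd x)"
| "f_path C N Q lab x [a] = lab a"
| "f_path C N Q lab x (a # b # p) =
     circ C N [fst (tail Q a), fst (head Q a)] (snd (head Q a))
       (map fst (pre_digraph.awalk_verts Q (head Q a) (b # p))) (snd (path_end Q (head Q a) (b # p)))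
       (f_path C N Q lab (head Q a) (b # p)) (lab a)"

definition path_map ::
  "('g, 'i) gset \<Rightarrow> ('g, 'i, 'k::field, 'm::ab_group_add) bimod
    \<Rightarrow> (('g, 'i, 'k, 'v::ab_group_add) vertex, 'a) pre_digraph \<Rightarrow> ('a \<Rightarrow> ('g, 'k, 'm, 'v) morph)
    \<Rightarrow> (('g, 'i, 'k, 'v) vertex \<times> 'a list \<Rightarrow> 'k) \<Rightarrow> ('g, 'i, 'k, 'v) idx \<Rightarrow> ('g, 'k, 'm, 'v) morph" where
  "path_map C N Q lab a =
     (\<Sum>(x, p) | a (x, p) \<noteq> 0. pw hscale (a (x, p)) (single (path_idx Q (x, p)) (f_path C N Q lab x p)))"

section \<open>The pairing and the dual intertwiners\<close>

text \<open>
  \<open>x\<^bsub>n-1\<^esub>, \<dots>, x\<^sub>0\<close> is the list \<open>xs\<close>, an element of \<open>yseqs C (rev is)\<close>; thus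
  \<open>x\<^bsub>n-1\<^esub>\<cdots>x\<^bsub>t-1\<^esub> = gprod C (take (n - (t - 1)) xs)\<close>.
\<close>

definition dual_index :: "('g, 'i) gset \<Rightarrow> 'i list \<Rightarrow> 'g list \<Rightarrow> 'g list \<times> 'g" where
  "dual_index C is ys = (THE (xs, h).
     xs \<in> yseqs C (rev is) \<and> h \<in> stab C (hd is) \<and>
     (\<forall>t\<in>{1..length ys}. inv\<^bsub>grp C\<^esub> (gprod C (drop (t - 1) ys)) \<in>
        gprod C (take (length ys - (t - 1)) xs) <#\<^bsub>grp C\<^esub> stab C (is ! (t - 1))) \<and>
     inv\<^bsub>grp C\<^esub> (gprod C ys) = gprod C xs \<otimes>\<^bsub>grp C\<^esub> h)"

text \<open>
  In the component \<open>\<phi>\<^bsub>(n)\<^esub> \<otimes> \<cdots> \<otimes> \<phi>\<^bsub>(1)\<^esub> \<otimes> \<phi>\<^bsub>(0)\<^esub>\<close> the functionals come in decreasing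
  order, hence \<open>rev \<phi>s\<close>.
\<close>

definition pairing ::
  "('g, 'i) gset \<Rightarrow> ('g, 'i, 'k::field, 'm::ab_group_add) bimod \<Rightarrow> 'i list
    \<Rightarrow> ('g, 'k, 'v::ab_group_add) rep \<Rightarrow> ('g, 'k, 'v) rep
    \<Rightarrow> ('g, 'k, 'm, 'v) morph \<Rightarrow> ('g, 'k, 'm \<Rightarrow> 'k, 'v) morph \<Rightarrow> 'k" where
  "pairing C N is U V f \<phi> = (THE c. \<forall>u\<in>space U.
     scal U c u =
       (\<Sum>ys\<in>yseqs C is. case dual_index C is ys of (xs, h\<^sub>0) \<Rightarrow>
          lift_M C N is V ys (\<lambda>ms v.
            lift_M C (dual C N) (rev is) U xs (\<lambda>\<phi>s w.
              scal U (\<Prod>(\<psi>, m)\<leftarrow>zip (rev \<phi>s) ms. \<psi> (bact N (inv\<^bsub>grp C\<^esub> (gprod C ys)) m))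
                (gact U (inv\<^bsub>grp C\<^esub> h\<^sub>0) w))
            (\<phi> v xs))
          (f u ys)))"

definition dual_arrow ::
  "('g, 'i) gset \<Rightarrow> ('g, 'i, 'k::field, 'm::ab_group_add) bimod
    \<Rightarrow> (('g, 'i, 'k, 'v::ab_group_add) vertex, 'a) pre_digraph \<Rightarrow> ('a \<Rightarrow> ('g, 'k, 'm, 'v) morph)
    \<Rightarrow> 'a \<Rightarrow> ('g, 'k, 'm \<Rightarrow> 'k, 'v) morph" where
  "dual_arrow C N Q lab a =
     (let (i, U) = tail Q a; (j, V) = head Q a in
      THE \<phi>. \<phi> \<in> Hom C (dual C N) [j, i] V U \<and>
        (\<forall>b\<in>arrows Q (i, U) (j, V).
           pairing C N [i, j] U V (lab b) \<phi> = (if b = a then 1 else 0)))"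

fun phi_path ::
  "('g, 'i) gset \<Rightarrow> ('g, 'i, 'k::field, 'm::ab_group_add) bimod
    \<Rightarrow> (('g, 'i, 'k, 'v::ab_group_add) vertex, 'a) pre_digraph \<Rightarrow> ('a \<Rightarrow> ('g, 'k, 'm, 'v) morph)
    \<Rightarrow> ('g, 'i, 'k, 'v) vertex \<Rightarrow> 'a list \<Rightarrow> ('g, 'k, 'm \<Rightarrow> 'k, 'v) morph" where
  "phi_path C N Q lab x [] = id_hom (dual C N) (snd x)"
| "phi_path C N Q lab x [a] = dual_arrow C N Q lab a"
| "phi_path C N Q lab x (a # b # p) =
     circ C (dual C N)
       (rev (map fst (pre_digraph.awalk_verts Q (head Q a) (b # p)))) (snd (head Q a))
       [fst (head Q a), fst (tail Q a)] (snd (tail Q a))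
       (dual_arrow C N Q lab a) (phi_path C N Q lab (head Q a) (b # p))"

end

theory Submission imports Defs begin

text \<open>
An intertwiner \<open>f : U \<rightarrow> M(i\<^sub>0,\<dots>,i\<^sub>n;V)\<close> is determined by operators \<open>U \<rightarrow> V\<close> indexed by words
\<open>(g\<^sub>1,\<psi>\<^sub>1)\<cdots>(g\<^sub>n,\<psi>\<^sub>n)\<close> with \<open>g\<^sub>t \<in> G\<close> and \<open>\<psi>\<^sub>t \<in> M\<^sup>*\<close>: contract the component of \<open>f(u)\<close> in the cosets of
\<open>g\<^sub>1\<cdots>g\<^sub>t\<close> with the translated \<open>\<psi>\<^sub>t\<close>. Then \<open>\<circledast>\<close> is the composition of operators along concatenated words,
and \<open>(f|\<phi>)\<close> is a sum over words in dual bases, so that it can be evaluated one arrow at a time. By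
Schur's lemma \<open>(f\<^sub>\<gamma>|\<phi>\<^sub>\<delta>) = 1\<close> if \<open>\<gamma> = \<delta>\<close> and \<open>0\<close> otherwise, once the pairing on a single arrow is known to be
non-degenerate, which follows by averaging rank one operators. The \<open>f\<^sub>\<gamma>\<close> span: decomposing \<open>M(i\<^sub>1,\<dots>,i\<^sub>n;V)\<close>
into irreducible \<open>G\<^bsub>i\<^sub>1\<^esub>\<close>-modules writes \<open>f\<close> as a sum of products of an arrow and a shorter intertwiner.
\<close>

text \<open>The defining formulas are tied to coset representatives, and the rules that transport
  them compose badly. Letting the g_t of a word be arbitrary elements of G removes the
  representatives; they return only in the normal form of a word. The price is redundancy: a
  function on words comes from an element of M(i;V) only if it is linear in each functional and
  balanced over the stabilisers. The pairing is a scalar only by Schur's lemma, and an induction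
  over arrows meets two paths through different representations at the same point. It is therefore
  replaced by an operator \<open>T\<close> between possibly different representations. Its sum over
  [G/G_j] is not visibly equivariant; multiplied by |G_j| it becomes a sum over G, in which one may
  substitute, and |G_j| is invertible in the field. Rank one operators survive averaging because the
  trace of the average is |G_i| times the original trace. The ring axioms of the algebra of
  intertwiners are not verified: they are carried over from the path algebra along the
  bijection.\<close>

section \<open>Linear algebra on subspaces with explicit scalar multiplication\<close>

definition vsp :: "('k::field => 'a::ab_group_add => 'a) => 'a set => bool" where
 "vsp s A \<longleftrightarrow> vector_space s \<and> Modules.module.subspace s A"

lemma vsp_add: "vsp s A ==> x \<in> A ==> y \<in> A ==> x + y \<in> A"
 and vsp_diff: "vsp s A ==> x \<in> A ==> y \<in> A ==> x - y \<in> A"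
 and vsp_scale: "vsp s A ==> x \<in> A ==> s c x \<in> A"
 and vsp_0: "vsp s A ==> 0 \<in> A"
 and vsp_sum: "vsp s A ==> (\<And>i. i \<in> I ==> f i \<in> A) ==> sum f I \<in> A"
proof -
 assume "vsp s A"
 then interpret vector_space s by (simp add: vsp_def)
 have A: "subspace A" using \<open>vsp s A\<close> by (simp add: vsp_def)
 show "x \<in> A ==> y \<in> A ==> x + y \<in> A" "x \<in> A ==> s c x \<in> A" "0 \<in> A"
  "x \<in> A ==> y \<in> A ==> x - y \<in> A"
  "(\<And>i. i \<in> I ==> f i \<in> A) ==> sum f I \<in> A"
  using A by (auto intro: subspace_add subspace_scale subspace_0 subspace_sum subspace_diff)
qed

lemma vsp_vs: "vsp s A ==> vector_space s" by (simp add: vsp_def)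

lemma vspI:
 assumes "vector_space s" "0 \<in> A" "\<And>x y. x \<in> A ==> y \<in> A ==> x + y \<in> A" "\<And>c x. x \<in> A ==> s c x \<in> A"
 shows "vsp s A"
proof -
 interpret vector_space s by fact
 show ?thesis using assms by (auto simp: vsp_def subspace_def)
qed

text \<open>The rules of \<open>vector_space\<close> with the scalar multiplication as an explicit
  argument: one goal may contain those of U, of V, of the bimodule and of functions into
  them.\<close>

lemma vs_simps:
 assumes "vector_space s"
 shows "s c (x + y) = s c x + s c y" "s (c + d) x = s c x + s d x" "s c (s d x) = s (c * d) x"
  "s 1 x = x" "s 0 x = 0" "s c 0 = 0" "s c (x - y) = s c x - s c y" "s c (- x) = - s c x"
  "s c (sum f I) = (\<Sum>i\<in>I. s c (f i))" "s (sum g I) x = (\<Sum>i\<in>I. s (g i) x)"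
  "s c x = 0 \<longleftrightarrow> c = 0 \<or> x = 0"
proof -
 interpret vector_space s by fact
 show "s c (x + y) = s c x + s c y" "s (c + d) x = s c x + s d x" "s c (s d x) = s (c * d) x"
  "s 1 x = x" "s 0 x = 0" "s c 0 = 0" "s c (x - y) = s c x - s c y" "s c (- x) = - s c x"
  "s c (sum f I) = (\<Sum>i\<in>I. s c (f i))" "s (sum g I) x = (\<Sum>i\<in>I. s (g i) x)"
  "s c x = 0 \<longleftrightarrow> c = 0 \<or> x = 0" by (auto simp: scale_right_distrib scale_left_distrib scale_right_diff_distrib
    scale_sum_right scale_sum_left)
qed

lemmas vsp_simps = vs_simps[OF vsp_vs]

lemma vector_space_pw:
 assumes "vector_space s"
 shows "vector_space (pw s)" using vs_simps[OF assms] by unfold_locales (auto simp: pw_def fun_eq_iff)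

lemma vector_space_mult: "vector_space ((*) :: 'k::field => 'k => 'k)" by unfold_locales (auto simp: algebra_simps)

lemma vs_pw3:
 "vector_space (pw (*) :: 'k::field => _)" "vector_space (pw (pw (*)) :: 'k::field => _)"
 "vector_space (pw (pw (pw (*))) :: 'k::field => _)" by (intro vector_space_pw vector_space_mult)+

lemma sum_apply: "sum f I x = (\<Sum>i\<in>I. f i x)" by (induction I rule: infinite_finite_induct) auto

lemma single_apply: "single a b x = (if x = a then b else 0)" by (simp add: single_def)

lemma linear_onI:
 assumes "\<And>x y. x \<in> A ==> y \<in> A ==> f (x + y) = f x + f y" "\<And>c x. x \<in> A ==> f (s1 c x) = s2 c (f x)"
 shows "linear_on s1 s2 A f" using assms by (auto simp: linear_on_def)

lemma linear_on_add: "linear_on s1 s2 A f ==> x \<in> A ==> y \<in> A ==> f (x + y) = f x + f y"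
 and linear_on_scale: "linear_on s1 s2 A f ==> x \<in> A ==> f (s1 c x) = s2 c (f x)" by (auto simp: linear_on_def)

lemma linear_on_0: "linear_on s1 s2 A f ==> 0 \<in> A ==> f 0 = 0" using linear_on_add[of s1 s2 A f 0 0] by simp

lemma linear_on_diff:
 assumes "linear_on s1 s2 A f" "vsp s1 A" "x \<in> A" "y \<in> A"
 shows "f (x - y) = f x - f y" using linear_on_add[OF assms(1), of "x - y" y] vsp_diff[OF assms(2)] assms by simp

lemma linear_on_sum:
 assumes "linear_on s1 s2 A f" "vsp s1 A" "\<And>i. i \<in> I ==> x i \<in> A"
 shows "f (sum x I) = (\<Sum>i\<in>I. f (x i))" using assms(3)
proof (induction I rule: infinite_finite_induct)
 case (insert i I)
 then show ?case using linear_on_add[OF assms(1), of "x i" "sum x I"] vsp_sum[OF assms(2), of I x] by auto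
qed (use linear_on_0[OF assms(1) vsp_0[OF assms(2)]] in auto)

lemma linear_on_combination:
 assumes "linear_on s1 s2 A f" "vsp s1 A" "\<And>i. i \<in> I ==> x i \<in> A"
 shows "f (\<Sum>i\<in>I. s1 (c i) (x i)) = (\<Sum>i\<in>I. s2 (c i) (f (x i)))"
proof -
 have "f (\<Sum>i\<in>I. s1 (c i) (x i)) = (\<Sum>i\<in>I. f (s1 (c i) (x i)))"
  by (rule linear_on_sum[OF assms(1,2)]) (auto intro: vsp_scale[OF assms(2)] assms(3))
 also have "\<dots> = (\<Sum>i\<in>I. s2 (c i) (f (x i)))" by (intro sum.cong refl linear_on_scale[OF assms(1)] assms(3))
 finally show ?thesis .
qed

lemma linear_on_comp:
 assumes "linear_on s1 s2 A f" "linear_on s2 s3 B g" "f ` A \<subseteq> B"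
 shows "linear_on s1 s3 A (\<lambda>x. g (f x))" using assms by (auto simp: linear_on_def image_subset_iff)

lemma linear_on_subset: "linear_on s1 s2 A f ==> B \<subseteq> A ==> linear_on s1 s2 B f" unfolding linear_on_def by blast

lemma linear_imp_linear_on: "Vector_Spaces.linear s1 s2 f ==> linear_on s1 s2 A f"
 by (auto simp: linear_on_def Vector_Spaces.linear_iff)

lemma vsp_image:
 assumes f: "linear_on s1 s2 A f" and A: "vsp s1 A" and s2: "vector_space s2"
 shows "vsp s2 (f ` A)"
proof (rule vspI[OF s2])
 show "0 \<in> f ` A" using linear_on_0[OF f vsp_0[OF A]] vsp_0[OF A] by force
 show "x + y \<in> f ` A" if "x \<in> f ` A" "y \<in> f ` A" for x y
  using that linear_on_add[OF f] vsp_add[OF A] by (metis (no_types, lifting) imageE imageI)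
 show "s2 c x \<in> f ` A" if "x \<in> f ` A" for c x
  using that linear_on_scale[OF f] vsp_scale[OF A] by (metis (no_types, lifting) imageE imageI)
qed

lemma vsp_kernel:
 assumes f: "linear_on s1 s2 A f" and A: "vsp s1 A" and s2: "vector_space s2"
 shows "vsp s1 {x \<in> A. f x = 0}" using linear_on_0[OF f vsp_0[OF A]] linear_on_add[OF f] linear_on_scale[OF f]
 by (intro vspI vsp_vs[OF A])
   (auto intro: vsp_0[OF A] vsp_add[OF A] vsp_scale[OF A] simp: vs_simps[OF s2])

subsection \<open>Finite dimension\<close>

lemma fin_dim_basis:
 assumes "vector_space s" "fin_dim s A"
 obtains B where "finite B" "B \<subseteq> A" "is_basis s A B"
proof -
 interpret vector_space s by fact
 obtain B0 where B0: "finite B0" "span B0 = A" using assms by (auto simp: fin_dim_def)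
 obtain B where B: "B \<subseteq> B0" "independent B" "B0 \<subseteq> span B" using maximal_independent_subset[of B0] by blast
 have "span B = A" using B B0 by (metis span_mono span_span subset_antisym)
 moreover have "finite B" using B B0 finite_subset by auto
 ultimately show ?thesis using B that[of B] span_superset[of B] by (auto simp: is_basis_def)
qed

lemma fin_dim_subset:
 assumes "vsp s A" "A \<subseteq> Modules.module.span s B" "finite B"
 shows "fin_dim s A"
proof -
 interpret vector_space s using assms by (simp add: vsp_def)
 have A: "subspace A" using assms by (simp add: vsp_def)
 obtain B' where B': "B' \<subseteq> A" "independent B'" "A \<subseteq> span B'" using maximal_independent_subset[of A] by blast
 have "finite B'" using independent_span_bound[OF assms(3) B'(2)] B' assms by auto
 moreover have "span B' = A" using B' A by (simp add: span_minimal subset_antisym)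
 ultimately show ?thesis by (auto simp: fin_dim_def)
qed

lemma basis_finite:
 assumes "vector_space s" "fin_dim s A" "is_basis s A B"
 shows "finite B"
proof -
 interpret vector_space s by fact
 obtain B0 where B0: "finite B0" "span B0 = A" using assms by (auto simp: fin_dim_def)
 show ?thesis using independent_span_bound[OF B0(1), of B] assms B0 span_superset[of B] by (auto simp: is_basis_def)
qed

lemma fin_dim_subspace:
 assumes "vsp s A" "fin_dim s A'" "A \<subseteq> A'"
 shows "fin_dim s A" using assms fin_dim_subset[of s A] unfolding fin_dim_def by metis

lemma fin_dim_psubset_dim:
 assumes "vsp s A" "fin_dim s A'" "A \<subset> A'"
 shows "vector_space.dim s A < vector_space.dim s A'"
proof -
 interpret vector_space s using assms by (simp add: vsp_def)
 obtain B' where B': "finite B'" "B' \<subseteq> A'" "is_basis s A' B'" using fin_dim_basis[OF vector_space_axioms assms(2)] .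
 obtain B where B: "finite B" "B \<subseteq> A" "is_basis s A B"
  using fin_dim_basis[OF vector_space_axioms fin_dim_subspace[OF assms(1,2)]] assms(3) by blast
 obtain x where x: "x \<in> A'" "x \<notin> A" using assms(3) by blast
 have ins: "independent (insert x B)" using independent_insertI[of x B] B x by (auto simp: is_basis_def)
 have "insert x B \<subseteq> span B'" using B B' x assms(3) by (auto simp: is_basis_def)
 from independent_span_bound[OF B'(1) ins this] have "card (insert x B) \<le> card B'" by simp
 moreover have "x \<notin> B" using B x by blast
 ultimately have "card B < card B'" using B(1) by simp
 moreover have "card B = dim A" using B by (metis is_basis_def dim_span_eq_card_independent)
 moreover have "card B' = dim A'" using B' by (metis is_basis_def dim_span_eq_card_independent)
 ultimately show ?thesis by simp
qed

text \<open>The functional is linear on the whole type and not only on the span of B. Its values off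
  the span are arbitrary, but linearity then holds without membership conditions.\<close>

definition coord :: "('k::field => 'a::ab_group_add => 'a) => 'a set => 'a => 'a => 'k" where
 "coord s B b = (SOME l. Vector_Spaces.linear s (*) l \<and> (\<forall>b'\<in>B. l b' = (if b' = b then 1 else 0)))"

lemma
 assumes "vector_space s" "is_basis s A B"
 shows coord_linear: "Vector_Spaces.linear s (*) (coord s B b)"
  and coord_basis: "b' \<in> B ==> coord s B b b' = (if b' = b then 1 else 0)"
  and coord_expand: "finite B ==> x \<in> A ==> x = (\<Sum>b\<in>B. s (coord s B b x) b)"
proof -
 interpret vector_space s by fact
 interpret K: vector_space "(*) :: 'a => 'a => 'a" by (rule vector_space_mult)
 interpret vector_space_pair s "(*) :: 'a => 'a => 'a" ..
 have B: "independent B" "span B = A" using assms by (auto simp: is_basis_def)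
 have "\<exists>l. Vector_Spaces.linear s (*) l \<and> (\<forall>b'\<in>B. l b' = (if b' = b then 1 else 0))" for b
  using linear_independent_extend[OF B(1), of "\<lambda>b'. if b' = b then 1 else 0"] by blast
 from someI_ex[OF this]
 have *: "Vector_Spaces.linear s (*) (coord s B b)"
  "b' \<in> B ==> coord s B b b' = (if b' = b then 1 else 0)" for b b' by (auto simp: coord_def)
 show "Vector_Spaces.linear s (*) (coord s B b)"
  "b' \<in> B ==> coord s B b b' = (if b' = b then 1 else 0)" by (fact *)+
 show "x = (\<Sum>b\<in>B. s (coord s B b x) b)" if fin: "finite B" and x: "x \<in> A"
 proof -
  from x B(2) have "x \<in> span B" by simp
  then show ?thesis
  proof (induction rule: span_induct_alt)
   case base
   then show ?case using linear_on_0[OF linear_imp_linear_on[OF *(1), of UNIV]] by simp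
  next
   case (step c b y)
   have "coord s B b' (s c b + y) = c * (if b = b' then 1 else 0) + coord s B b' y" for b'
    using *(1)[of b'] *(2)[OF step(1), of b'] by (simp add: Vector_Spaces.linear_iff)
   then have "(\<Sum>b'\<in>B. s (coord s B b' (s c b + y)) b') =
     (\<Sum>b'\<in>B. (if b = b' then s c b else 0)) + (\<Sum>b'\<in>B. s (coord s B b' y) b')"
    by (simp add: scale_left_distrib flip: sum.distrib) (auto intro!: sum.cong)
   then show ?case using step fin by simp
  qed
 qed
qed

lemma in_span_sum:
 assumes "vector_space s" "\<And>i. i \<in> I ==> f i \<in> B"
 shows "(\<Sum>i\<in>I. s (c i) (f i)) \<in> Modules.module.span s B"
proof -
 interpret vector_space s by fact
 show ?thesis using assms(2) by (auto intro: span_sum span_scale span_base)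
qed

text \<open>The coordinate space on a finite index set. It carries the copy of a representation on
  \<open>nat => 'k\<close> in \<open>irr_complete\<close> and the regular representation in
  \<open>finite_irr_reps\<close>.\<close>

lemma finite_support_space:
 assumes I: "finite I"
 shows "vsp (pw (*)) {a :: 'x => 'k::field. \<forall>n. n \<notin> I \<longrightarrow> a n = 0}" (is "vsp _ ?S")
  and "fin_dim (pw (*)) {a :: 'x => 'k::field. \<forall>n. n \<notin> I \<longrightarrow> a n = 0}"
proof -
 show v: "vsp (pw (*)) ?S" by (rule vspI[OF vector_space_pw_mult]) (auto simp: pw_def)
 show "fin_dim (pw (*)) ?S"
 proof (rule fin_dim_subset[OF v _ finite_imageI[OF I, of "\<lambda>n. single n 1"]], rule subsetI)
  fix a :: "'x => 'k" assume a: "a \<in> ?S"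
  have "(\<Sum>n\<in>I. pw (*) (a n) (single n 1)) m = a m" for m
   using a I by (cases "m \<in> I") (auto simp: sum_apply pw_def single_def if_distrib cong: if_cong)
  then have "a = (\<Sum>n\<in>I. pw (*) (a n) (single n 1))" by (intro ext) simp
  also have "\<dots> \<in> Modules.module.span (pw (*)) ((\<lambda>n. single n 1) ` I)"
   by (rule in_span_sum[OF vector_space_pw_mult]) auto
  finally show "a \<in> Modules.module.span (pw (*)) ((\<lambda>n. single n 1) ` I)" .
 qed
qed

text \<open>The matrix units \<open>E\<close> for bases of A and B span L: its members vanish off A,
  so that they are determined by their matrices.\<close>

lemma fin_dim_linear_maps:
 assumes A: "vsp s1 A" "fin_dim s1 A" and B: "vsp s2 B" "fin_dim s2 B" and L: "vsp (pw s2) L"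
  and lin: "\<And>f. f \<in> L ==> linear_on s1 s2 A f" and img: "\<And>f x. f \<in> L ==> x \<in> A ==> f x \<in> B"
  and out: "\<And>f x. f \<in> L ==> x \<notin> A ==> f x = 0"
 shows "fin_dim (pw s2) L"
proof -
 note vs = vsp_simps[OF B(1)]
 obtain BA where BA: "finite BA" "BA \<subseteq> A" "is_basis s1 A BA" using fin_dim_basis[OF vsp_vs[OF A(1)] A(2)] .
 obtain BB where BB: "finite BB" "BB \<subseteq> B" "is_basis s2 B BB" using fin_dim_basis[OF vsp_vs[OF B(1)] B(2)] .
 define E where "E = (\<lambda>(a, b) x. if x \<in> A then s2 (coord s1 BA a x) b else 0)"
 show ?thesis
 proof (rule fin_dim_subset[OF L _ finite_imageI[of "BA \<times> BB" E]], rule subsetI)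
  fix f assume f: "f \<in> L"
  let ?c = "\<lambda>(a, b). coord s2 BB b (f a)"
  have "f = (\<Sum>t\<in>BA \<times> BB. pw s2 (?c t) (E t))"
  proof
   fix x
   have S: "(\<Sum>t\<in>BA \<times> BB. pw s2 (?c t) (E t)) x = (\<Sum>a\<in>BA. \<Sum>b\<in>BB. s2 (coord s2 BB b (f a)) (E (a, b) x))"
    by (simp add: sum_apply pw_def sum.cartesian_product split_def)
   show "f x = (\<Sum>t\<in>BA \<times> BB. pw s2 (?c t) (E t)) x"
   proof (cases "x \<in> A")
    case True
    have "f x = f (\<Sum>a\<in>BA. s1 (coord s1 BA a x) a)" using coord_expand[OF vsp_vs[OF A(1)] BA(3,1) True] by simp
    also have "\<dots> = (\<Sum>a\<in>BA. s2 (coord s1 BA a x) (f a))"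
     using BA(2) by (intro linear_on_combination[OF lin[OF f] A(1)]) auto
    also have "\<dots> = (\<Sum>a\<in>BA. s2 (coord s1 BA a x) (\<Sum>b\<in>BB. s2 (coord s2 BB b (f a)) b))"
     using BA(2) coord_expand[OF vsp_vs[OF B(1)] BB(3,1) img[OF f]] by (intro sum.cong refl) auto
    also have "\<dots> = (\<Sum>a\<in>BA. \<Sum>b\<in>BB. s2 (coord s2 BB b (f a)) (E (a, b) x))"
     using True by (simp add: E_def vs mult.commute)
    finally show ?thesis unfolding S .
   qed (simp only: S, simp add: E_def vs out[OF f])
  qed
  also have "\<dots> \<in> Modules.module.span (pw s2) (E ` (BA \<times> BB))"
   by (rule in_span_sum[OF vector_space_pw[OF vsp_vs[OF B(1)]]]) auto
  finally show "f \<in> Modules.module.span (pw s2) (E ` (BA \<times> BB))" .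
 qed (use BA BB in simp)
qed

subsection \<open>Dual bases for non-degenerate pairings\<close>

lemma functional_in_span:
 fixes l :: "'b => 'f::ab_group_add => 'k::field" and s :: "'k => 'f => 'f"
 assumes "finite S" and F: "vsp s F" and lS: "\<And>b. b \<in> S ==> linear_on s (*) F (l b)"
  and m: "linear_on s (*) F m" and ker: "\<And>x. x \<in> F ==> (\<And>b. b \<in> S ==> l b x = 0) ==> m x = 0"
 shows "\<exists>c. \<forall>x\<in>F. m x = (\<Sum>b\<in>S. c b * l b x)" using assms(1) lS m ker
proof (induction S arbitrary: m)
 case (insert t S)
 show ?case
 proof (cases "\<exists>x0\<in>F. (\<forall>b\<in>S. l b x0 = 0) \<and> l t x0 \<noteq> 0")
  case False
  have "\<exists>c. \<forall>x\<in>F. m x = (\<Sum>b\<in>S. c b * l b x)"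
  proof (rule insert.IH)
   show "m x = 0" if "x \<in> F" "\<And>b. b \<in> S ==> l b x = 0" for x using that False insert.prems(3)[of x] by blast
  qed (use insert.prems in auto)
  then obtain c where "\<forall>x\<in>F. m x = (\<Sum>b\<in>S. c b * l b x)" ..
  then have "\<forall>x\<in>F. m x = (\<Sum>b\<in>insert t S. (if b = t then 0 else c b) * l b x)"
   using insert(1,2) by (auto intro!: sum.cong)
  then show ?thesis by (intro exI)
 next
  case True
  then obtain x0 where x0: "x0 \<in> F" "\<forall>b\<in>S. l b x0 = 0" "l t x0 \<noteq> 0" by blast
  \<comment> \<open>Evaluation at \<open>x0\<close>, where the functionals of S vanish, forces the
    coefficient of \<open>l t\<close>; the difference then kills the common kernel of S.\<close>
  define a where "a = m x0 / l t x0"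
  have lt: "linear_on s (*) F (l t)" using insert by auto
  have "\<exists>c. \<forall>x\<in>F. m x - a * l t x = (\<Sum>b\<in>S. c b * l b x)"
  proof (rule insert.IH)
   show "linear_on s (*) F (\<lambda>x. m x - a * l t x)"
    using insert.prems(2) lt by (auto simp: linear_on_def algebra_simps)
   show "m x - a * l t x = 0" if x: "x \<in> F" "\<And>b. b \<in> S ==> l b x = 0" for x
   proof -
    define d where "d = l t x / l t x0"
    have y: "s d x0 \<in> F" using vsp_scale[OF F x0(1)] .
    have "m (x - s d x0) = 0"
    proof (rule insert.prems(3))
     show "x - s d x0 \<in> F" using vsp_diff[OF F x(1) y] .
     show "l b (x - s d x0) = 0" if "b \<in> insert t S" for b
      using that x x0 linear_on_diff[OF insert.prems(1)[OF that] F x(1) y]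
       linear_on_scale[OF insert.prems(1)[OF that] x0(1)] by (auto simp: d_def)
    qed
    then show ?thesis using linear_on_diff[OF insert.prems(2) F x(1) y]
      linear_on_scale[OF insert.prems(2) x0(1)] by (simp add: a_def d_def)
   qed
  qed (use insert in auto)
  then obtain c where c: "\<forall>x\<in>F. m x - a * l t x = (\<Sum>b\<in>S. c b * l b x)" ..
  have "\<forall>x\<in>F. m x = (\<Sum>b\<in>insert t S. (if b = t then a else c b) * l b x)"
  proof
   fix x assume "x \<in> F"
   with c have "m x = a * l t x + (\<Sum>b\<in>S. c b * l b x)" by (metis add.commute diff_add_cancel)
   also have "(\<Sum>b\<in>S. c b * l b x) = (\<Sum>b\<in>S. (if b = t then a else c b) * l b x)"
    using insert(2) by (auto intro!: sum.cong)
   finally show "m x = (\<Sum>b\<in>insert t S. (if b = t then a else c b) * l b x)" using insert(1,2) by simp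
  qed
  then show ?thesis by (intro exI)
 qed
qed auto

text \<open>If no element of F separated b from the other basis vectors,
  \<open>functional_in_span\<close> would make \<open>\<beta> b\<close> a combination of the other
  \<open>\<beta> b'\<close>, and non-degeneracy in E would turn this into a linear relation in B.
  Non-degeneracy in F gives uniqueness. A finite basis is assumed for E only.\<close>

lemma dual_basis_exists1:
 fixes sE :: "'k::field => 'e::ab_group_add => 'e" and sF :: "'k => 'f::ab_group_add => 'f"
 assumes sE: "vector_space sE" and B: "finite B" "is_basis sE E B" and F: "vsp sF F"
  and lE: "\<And>x. x \<in> F ==> linear_on sE (*) E (\<lambda>e. \<beta> e x)"
  and lF: "\<And>e. e \<in> E ==> linear_on sF (*) F (\<beta> e)"
  and nE: "\<And>e. e \<in> E ==> (\<And>x. x \<in> F ==> \<beta> e x = 0) ==> e = 0"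
  and nF: "\<And>x. x \<in> F ==> (\<And>e. e \<in> E ==> \<beta> e x = 0) ==> x = 0"
  and b: "b \<in> B"
 shows "\<exists>!x. x \<in> F \<and> (\<forall>b'\<in>B. \<beta> b' x = (if b' = b then 1 else 0))"
proof -
 interpret vector_space sE by fact
 have indep: "independent B" and E: "span B = E" using B by (auto simp: is_basis_def)
 have BE: "B \<subseteq> E" using E span_superset by blast
 have vE: "vsp sE E" using E sE by (auto simp: vsp_def)
 have "\<exists>x\<in>F. (\<forall>b'\<in>B - {b}. \<beta> b' x = 0) \<and> \<beta> b x \<noteq> 0"
 proof (rule ccontr)
  assume "\<not> ?thesis"
  then have "\<exists>c. \<forall>x\<in>F. \<beta> b x = (\<Sum>b'\<in>B - {b}. c b' * \<beta> b' x)" using B(1) F lF BE b by (intro functional_in_span) auto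
  then obtain c where c: "\<forall>x\<in>F. \<beta> b x = (\<Sum>b'\<in>B - {b}. c b' * \<beta> b' x)" ..
  define e where "e = b - (\<Sum>b'\<in>B - {b}. sE (c b') b')"
  have sumE: "(\<Sum>b'\<in>B - {b}. sE (c b') b') \<in> E" using BE by (intro vsp_sum[OF vE] vsp_scale[OF vE]) auto
  have "e = 0"
  proof (rule nE)
   show "e \<in> E" unfolding e_def using b BE sumE by (intro vsp_diff[OF vE]) auto
   show "\<beta> e x = 0" if "x \<in> F" for x
   proof -
    have "\<beta> e x = \<beta> b x - \<beta> (\<Sum>b'\<in>B - {b}. sE (c b') b') x"
     unfolding e_def using b BE sumE by (intro linear_on_diff[OF lE[OF that] vE]) auto
    also have "\<beta> (\<Sum>b'\<in>B - {b}. sE (c b') b') x = (\<Sum>b'\<in>B - {b}. c b' * \<beta> b' x)"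
     using BE by (intro linear_on_combination[OF lE[OF that] vE]) auto
    finally show ?thesis using c that by simp
   qed
  qed
  then have "b = (\<Sum>b'\<in>B - {b}. sE (c b') b')" by (simp add: e_def)
  also have "\<dots> \<in> span (B - {b})" by (intro span_sum span_scale span_base)
  finally show False using indep b dependent_def by blast
 qed
 then obtain x where x: "x \<in> F" "\<forall>b'\<in>B - {b}. \<beta> b' x = 0" "\<beta> b x \<noteq> 0" by blast
 define y where "y = sF (1 / \<beta> b x) x"
 have y: "y \<in> F" "\<forall>b'\<in>B. \<beta> b' y = (if b' = b then 1 else 0)"
  using x vsp_scale[OF F] linear_on_scale[OF lF x(1)] BE by (auto simp: y_def)
 show ?thesis
 proof (rule ex1I[of _ y])
  fix z assume z: "z \<in> F \<and> (\<forall>b'\<in>B. \<beta> b' z = (if b' = b then 1 else 0))"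
  have "z - y = 0"
  proof (rule nF)
   show zy: "z - y \<in> F" using z y vsp_diff[OF F] by blast
   fix e assume e: "e \<in> E"
   have "\<beta> b' (z - y) = 0" if "b' \<in> B" for b' using linear_on_diff[OF lF F, of b' z y] that z y BE by auto
   moreover have "e = (\<Sum>b'\<in>B. sE (coord sE B b' e) b')" using coord_expand[OF sE B(2,1) e] .
   ultimately show "\<beta> e (z - y) = 0"
    using linear_on_combination[OF lE[OF zy] vE, of B "\<lambda>b. b" "\<lambda>b. coord sE B b e"] BE by auto
  qed
  then show "z = y" by simp
 qed (use y in auto)
qed

subsection \<open>Multilinear maps on lists\<close>

lemma multilinear_Nil: "multilinear sm sv sw [] V F \<longleftrightarrow> linear_on sv sw V (F [])" by (auto simp: multilinear_def)

lemma Cons_in_listset: "m # ms \<in> listset (C # Cs) \<longleftrightarrow> m \<in> C \<and> ms \<in> listset Cs" by (auto simp: set_Cons_def)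

lemma listset_length: "ms \<in> listset Cs ==> length ms = length Cs"
 by (induction Cs arbitrary: ms) (auto simp: set_Cons_def)

lemma listset_append: "length ms = length Cs ==> ms @ ms' \<in> listset (Cs @ Cs') \<longleftrightarrow> ms \<in> listset Cs \<and> ms' \<in> listset Cs'"
 by (induction Cs arbitrary: ms) (auto simp: set_Cons_def length_Suc_conv)

lemma listset_append': "ms \<in> listset Cs ==> ms' \<in> listset Cs' ==> ms @ ms' \<in> listset (Cs @ Cs')"
 using listset_append listset_length by blast

lemma listset_update: "ms \<in> listset Cs ==> t < length Cs ==> m \<in> Cs ! t ==> ms[t := m] \<in> listset Cs"
 by (induction Cs arbitrary: ms t) (auto simp: set_Cons_def nth_Cons split: nat.splits)

lemma listset_map:
 "ms \<in> listset Cs ==> list_all2 (\<lambda>C C'. A ` C \<subseteq> C') Cs Cs' ==> map A ms \<in> listset Cs'"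
 by (induction Cs arbitrary: ms Cs') (auto simp: set_Cons_def list_all2_Cons1)

text \<open>A recursive form of multilinearity: induction on the list of factors replaces updates at
  a position t.\<close>

lemma multilinear_Cons:
 "multilinear sm sv sw (C # Cs) V F \<longleftrightarrow>
   (\<forall>m\<in>C. multilinear sm sv sw Cs V (\<lambda>ms. F (m # ms))) \<and>
   (\<forall>ms\<in>listset Cs. \<forall>v\<in>V. linear_on sm sw C (\<lambda>m. F (m # ms) v))" (is "?l \<longleftrightarrow> ?r1 \<and> ?r2")
proof safe
 assume l: ?l
 show "multilinear sm sv sw Cs V (\<lambda>ms. F (m # ms))" if m: "m \<in> C" for m unfolding multilinear_def
 proof safe
  show "linear_on sv sw V (F (m # ms))" if "ms \<in> listset Cs" for ms
   using l m that by (auto simp: multilinear_def Cons_in_listset simp del: listset.simps)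
  show "linear_on sm sw (Cs ! t) (\<lambda>n. F (m # ms[t := n]) v)" if "ms \<in> listset Cs" "v \<in> V" "t < length Cs" for ms v t
   using l[unfolded multilinear_def, THEN conjunct2, rule_format, of "m # ms" v "Suc t"] m that
   by (simp add: Cons_in_listset del: listset.simps)
 qed
 show "linear_on sm sw C (\<lambda>m. F (m # ms) v)" if ms: "ms \<in> listset Cs" "v \<in> V" for ms v
 proof (cases "C = {}")
  case True
  then show ?thesis by (auto simp: linear_on_def)
 next
  case False
  then obtain m where "m \<in> C" by auto
  then show ?thesis using l[unfolded multilinear_def, THEN conjunct2, rule_format, of "m # ms" v 0] ms
   by (simp add: Cons_in_listset del: listset.simps)
 qed
next
 assume r: ?r1 ?r2
 show ?l unfolding multilinear_def
 proof safe
  fix ms assume "ms \<in> listset (C # Cs)"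
  then obtain m ms' where ms: "ms = m # ms'" "m \<in> C" "ms' \<in> listset Cs" by (auto simp: set_Cons_def)
  show "linear_on sv sw V (F ms)" using r(1) ms by (auto simp: multilinear_def)
  fix v t assume "v \<in> V" "t < length (C # Cs)"
  then show "linear_on sm sw ((C # Cs) ! t) (\<lambda>m. F (ms[t := m]) v)"
   using r ms by (cases t) (auto simp: multilinear_def)
 qed
qed

lemma multilinear_compose_map:
 assumes "list_all2 (\<lambda>C C'. A ` C \<subseteq> C' \<and> linear_on sm sm' C A) Cs Cs'"
  and "B ` V \<subseteq> V'" "linear_on sv sv' V B" and "multilinear sm' sv' sw Cs' V' F"
 shows "multilinear sm sv sw Cs V (\<lambda>ms v. F (map A ms) (B v))" using assms(1,4)
proof (induction arbitrary: F rule: list_all2_induct)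
 case Nil
 then show ?case using assms(2,3) by (auto simp: multilinear_Nil linear_on_def image_subset_iff)
next
 case (Cons C Cs C' Cs')
 have "map A ms \<in> listset Cs'" if "ms \<in> listset Cs" for ms
  by (rule listset_map[OF that list_all2_mono[OF Cons(2)]]) auto
 moreover have "multilinear sm sv sw Cs V (\<lambda>ms v. F (map A (m # ms)) (B v))" if "m \<in> C" for m
  using Cons(3)[of "\<lambda>ms. F (A m # ms)"] Cons(1) Cons.prems that by (auto simp: multilinear_Cons image_subset_iff)
 ultimately show ?case using Cons(1) Cons.prems assms(2) unfolding multilinear_Cons
  by (auto simp: image_subset_iff linear_on_def)
qed

lemma multilinear_append:
 assumes "multilinear sm sv sw (Cs @ Cs') V F" "ms \<in> listset Cs"
 shows "multilinear sm sv sw Cs' V (\<lambda>ms'. F (ms @ ms'))" using assms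
proof (induction Cs arbitrary: ms F)
 case (Cons C Cs)
 from Cons.prems(2) obtain m ms' where ms: "ms = m # ms'" "m \<in> C" "ms' \<in> listset Cs" by (auto simp: set_Cons_def)
 have "multilinear sm sv sw (Cs @ Cs') V (\<lambda>ms. F (m # ms))" using Cons.prems(1) ms by (simp add: multilinear_Cons)
 from Cons.IH[OF this ms(3)] show ?case by (simp add: ms)
qed simp

text \<open>Only values on the product of the factors matter; that the factors are subspaces keeps
  the sums and multiples tested by linearity inside them.\<close>

lemma multilinear_cong:
 assumes "\<And>ms v. ms \<in> listset Cs ==> v \<in> V ==> F ms v = F' ms v"
  and "vsp sv V" "\<And>C. C \<in> set Cs ==> vsp sm C"
 shows "multilinear sm sv sw Cs V F \<longleftrightarrow> multilinear sm sv sw Cs V F'"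
proof -
 have "linear_on sv sw V (F ms) \<longleftrightarrow> linear_on sv sw V (F' ms)" if "ms \<in> listset Cs" for ms
  using assms(1)[OF that] vsp_add[OF assms(2)] vsp_scale[OF assms(2)] by (auto simp: linear_on_def)
 moreover have "linear_on sm sw (Cs ! t) (\<lambda>m. F (ms[t := m]) v) \<longleftrightarrow> linear_on sm sw (Cs ! t) (\<lambda>m. F' (ms[t := m]) v)"
  if "ms \<in> listset Cs" "v \<in> V" "t < length Cs" for ms v t
 proof -
  have C: "vsp sm (Cs ! t)" using assms(3) that by auto
  have "F (ms[t := m]) v = F' (ms[t := m]) v" if "m \<in> Cs ! t" for m
   by (rule assms(1)) (use \<open>ms \<in> _\<close> \<open>v \<in> _\<close> \<open>t < _\<close> that in \<open>auto intro: listset_update\<close>)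
  then show ?thesis using vsp_add[OF C] vsp_scale[OF C] by (auto simp: linear_on_def)
 qed
 ultimately show ?thesis unfolding multilinear_def by auto
qed

text \<open>The value of a tensor product of functionals at a pure tensor. Lists of different length
  are cut to the shorter one and the empty product is 1, so the recursion equations hold without
  length conditions.\<close>

definition evl :: "('m => 'k) list => 'm list => 'k::comm_monoid_mult" where
 "evl \<psi>s ms = prod_list (map2 (\<lambda>\<psi> m. \<psi> m) \<psi>s ms)"

lemma evl_simps [simp]: "evl [] ms = 1" "evl \<psi>s [] = 1" "evl (\<psi> # \<psi>s) (m # ms) = \<psi> m * evl \<psi>s ms"
 by (auto simp: evl_def)

lemma evl_append: "length \<psi>s = length ms ==> evl (\<psi>s @ \<psi>s') (ms @ ms') = evl \<psi>s ms * evl \<psi>s' ms'" by (simp add: evl_def)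

lemma evl_multilinear:
 assumes "list_all2 (\<lambda>\<psi> C. linear_on sm (*) C \<psi>) \<psi>s Cs" "vsp sv V"
 shows "multilinear sm sv sv Cs V (\<lambda>ms v. sv (c * evl \<psi>s ms) v)" using assms(1)
proof (induction arbitrary: c rule: list_all2_induct)
 case Nil
 then show ?case by (auto simp: multilinear_Nil linear_on_def vsp_simps[OF assms(2)] mult.commute)
next
 case (Cons \<psi> \<psi>s C Cs)
 have "multilinear sm sv sv Cs V (\<lambda>ms v. sv (c * (\<psi> m * evl \<psi>s ms)) v)" for m
  using Cons(3)[of "c * \<psi> m"] by (simp add: mult.assoc)
 moreover have "linear_on sm sv C (\<lambda>m. sv (c * (\<psi> m * evl \<psi>s ms)) v)" for ms v
  using linear_on_add[OF Cons(1)] linear_on_scale[OF Cons(1)]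
  by (intro linear_onI) (simp_all add: vsp_simps[OF assms(2)] distrib_left distrib_right mult.left_commute mult.assoc)
 ultimately show ?case by (simp add: multilinear_Cons)
qed

subsection \<open>Tensors\<close>

text \<open>The universal property of the tensor product with the factors fixed, in the forms used
  later: uniqueness, compatibility with linear maps, and linearity in the multilinear map.\<close>

locale tensor_space =
 fixes sm :: "'k::field => 'm::ab_group_add => 'm" and sv :: "'k => 'v::ab_group_add => 'v"
  and Cs :: "'m set list" and V :: "'v set"
 assumes V: "vsp sv V"
begin

lemma tensor_vsp: "vsp (pw (*)) (tensor sm sv Cs V)"
proof -
 interpret T: vector_space "pw (*) :: 'k => ('m, 'v, 'k) tens => _" by (rule vector_space_pw_mult)
 show ?thesis unfolding vsp_def tensor_def using T.subspace_span T.vector_space_axioms by blast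
qed

lemma tpure_in_tensor:
 "ms \<in> listset Cs ==> v \<in> V ==> tpure sm sv Cs V ms v \<in> tensor sm sv Cs V"
proof -
 assume "ms \<in> listset Cs" "v \<in> V"
 interpret T: vector_space "pw (*) :: 'k => ('m, 'v, 'k) tens => _" by (rule vector_space_pw_mult)
 show ?thesis unfolding tensor_def using \<open>ms \<in> _\<close> \<open>v \<in> V\<close> by (auto intro: T.span_base)
qed

lemma lift_linear:
 "vector_space sw ==> multilinear sm sv sw Cs V F ==>
  linear_on (pw (*)) sw (tensor sm sv Cs V) (tlift sm sv Cs V F)" using tlift_linear V by (auto simp: vsp_def)

lemma lift_pure:
 "vector_space sw ==> multilinear sm sv sw Cs V F ==> ms \<in> listset Cs ==> v \<in> V ==>
  tlift sm sv Cs V F (tpure sm sv Cs V ms v) = F ms v" by (rule tlift_tpure)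

lemma tensor_eqI:
 assumes "linear_on (pw (*)) sw (tensor sm sv Cs V) L" "linear_on (pw (*)) sw (tensor sm sv Cs V) L'"
  "\<And>ms v. ms \<in> listset Cs ==> v \<in> V ==> L (tpure sm sv Cs V ms v) = L' (tpure sm sv Cs V ms v)"
  "t \<in> tensor sm sv Cs V"
 shows "L t = L' t" using tensor_map_unique[OF _ _ _ assms] V vsp_0[OF V] by (auto simp: vsp_def)

lemma lift_unique:
 assumes "vector_space sw" "multilinear sm sv sw Cs V F" "linear_on (pw (*)) sw (tensor sm sv Cs V) L"
  "\<And>ms v. ms \<in> listset Cs ==> v \<in> V ==> L (tpure sm sv Cs V ms v) = F ms v" "t \<in> tensor sm sv Cs V"
 shows "L t = tlift sm sv Cs V F t" by (rule tensor_eqI[OF assms(3) lift_linear[OF assms(1,2)] _ assms(5)])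
   (use assms lift_pure[OF assms(1,2)] in auto)

lemma lift_cong:
 assumes "\<And>ms v. ms \<in> listset Cs ==> v \<in> V ==> F ms v = F' ms v"
  and "vector_space sw" "multilinear sm sv sw Cs V F" "multilinear sm sv sw Cs V F'" "t \<in> tensor sm sv Cs V"
 shows "tlift sm sv Cs V F t = tlift sm sv Cs V F' t"
 using assms by (intro lift_unique lift_linear) (auto simp: lift_pure)

lemma lift_in:
 assumes "vsp sw W" "multilinear sm sv sw Cs V F" "\<And>ms v. ms \<in> listset Cs ==> v \<in> V ==> F ms v \<in> W"
  "t \<in> tensor sm sv Cs V"
 shows "tlift sm sv Cs V F t \<in> W"
proof -
 obtain ps where ps: "set ps \<subseteq> listset Cs \<times> V" "t = (\<Sum>(ms, v)\<leftarrow>ps. tpure sm sv Cs V ms v)"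
  using tensor_decomp[OF _ _ assms(4)] V by (auto simp: vsp_def)
 have "(\<Sum>(ms, v)\<leftarrow>qs. F ms v) \<in> W" if "set qs \<subseteq> listset Cs \<times> V" for qs
  using that by (induction qs) (auto intro: vsp_add[OF assms(1)] vsp_0[OF assms(1)] assms(3))
 then show ?thesis using tlift_eq[OF _ assms(2) ps] ps assms(1) by (simp add: vsp_def)
qed

lemma multilinear_linear_comp:
 assumes "multilinear sm sv sw Cs V F" "\<And>ms v. ms \<in> listset Cs ==> v \<in> V ==> F ms v \<in> W"
  "linear_on sw sx W L"
 shows "multilinear sm sv sx Cs V (\<lambda>ms v. L (F ms v))" unfolding multilinear_def
proof safe
 fix ms assume ms: "ms \<in> listset Cs"
 show "linear_on sv sx V (\<lambda>v. L (F ms v))"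
  using assms ms by (intro linear_on_comp[of sv sw V "F ms" sx W]) (auto simp: multilinear_def)
 fix v t assume v: "v \<in> V" "t < length Cs"
 show "linear_on sm sx (Cs ! t) (\<lambda>m. L (F (ms[t := m]) v))" using assms ms v listset_update[OF ms v(2)]
  by (intro linear_on_comp[of sm sw "Cs ! t" "\<lambda>m. F (ms[t := m]) v" sx W]) (auto simp: multilinear_def)
qed

lemma linear_lift_comp:
 assumes "vsp sw W" "multilinear sm sv sw Cs V F" "\<And>ms v. ms \<in> listset Cs ==> v \<in> V ==> F ms v \<in> W"
  "linear_on sw sx W L" "vector_space sx" "t \<in> tensor sm sv Cs V"
 shows "L (tlift sm sv Cs V F t) = tlift sm sv Cs V (\<lambda>ms v. L (F ms v)) t"
proof (rule lift_unique[OF assms(5)])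
 show "multilinear sm sv sx Cs V (\<lambda>ms v. L (F ms v))" by (rule multilinear_linear_comp[OF assms(2,3,4)])
 show "linear_on (pw (*)) sx (tensor sm sv Cs V) (\<lambda>t. L (tlift sm sv Cs V F t))" using lift_in[OF assms(1,2,3)]
  by (intro linear_on_comp[OF lift_linear[OF vsp_vs[OF assms(1)] assms(2)] assms(4)]) auto
 show "L (tlift sm sv Cs V F (tpure sm sv Cs V ms v)) = L (F ms v)" if "ms \<in> listset Cs" "v \<in> V" for ms v
  using lift_pure[OF vsp_vs[OF assms(1)] assms(2) that] by simp
qed (rule assms(6))

lemma lift_add_fun:
 assumes "vector_space sw" "multilinear sm sv sw Cs V F" "multilinear sm sv sw Cs V F'"
  "multilinear sm sv sw Cs V F''"
  "\<And>ms v. ms \<in> listset Cs ==> v \<in> V ==> F'' ms v = F ms v + F' ms v" "t \<in> tensor sm sv Cs V"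
 shows "tlift sm sv Cs V F'' t = tlift sm sv Cs V F t + tlift sm sv Cs V F' t"
proof -
 note lin = lift_linear[OF assms(1,2)] lift_linear[OF assms(1,3)]
 have "linear_on (pw (*)) sw (tensor sm sv Cs V) (\<lambda>t. tlift sm sv Cs V F t + tlift sm sv Cs V F' t)"
  using lin by (auto simp: linear_on_def vs_simps[OF assms(1)])
 from lift_unique[OF assms(1,4) this _ assms(6)] show ?thesis using lift_pure assms(1-5) by (metis (no_types, lifting))
qed

lemma lift_scale_fun:
 assumes "vector_space sw" "multilinear sm sv sw Cs V F" "multilinear sm sv sw Cs V F''"
  "\<And>ms v. ms \<in> listset Cs ==> v \<in> V ==> F'' ms v = sw c (F ms v)" "t \<in> tensor sm sv Cs V"
 shows "tlift sm sv Cs V F'' t = sw c (tlift sm sv Cs V F t)"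
proof -
 note lin = lift_linear[OF assms(1,2)]
 have "linear_on (pw (*)) sw (tensor sm sv Cs V) (\<lambda>t. sw c (tlift sm sv Cs V F t))"
  using lin by (auto simp: linear_on_def vs_simps[OF assms(1)] mult.commute)
 from lift_unique[OF assms(1,3) this _ assms(5)] show ?thesis using lift_pure assms(1-4) by (metis (no_types, lifting))
qed

end

text \<open>For the nested lifts in \<open>circ\<close> and \<open>pairing\<close>: the value of a
  lift is independent of the chosen sum of pure tensors only for multilinear maps, so the inner lift
  must be shown to depend multilinearly on the outer arguments.\<close>

lemma multilinear_lift:
 fixes K :: "'m::ab_group_add list => 'n::ab_group_add list => 'w::ab_group_add => 'x::ab_group_add"
 assumes W: "vsp sw W" and sx: "vector_space sx" and Cs: "\<And>C. C \<in> set Cs ==> vsp sm C"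
  and K: "\<And>ms. ms \<in> listset Cs ==> multilinear sn sw sx Ds W (K ms)"
  and Kt: "\<And>ms t ds w. ms \<in> listset Cs ==> t < length Cs ==> ds \<in> listset Ds ==> w \<in> W ==>
   linear_on sm sx (Cs ! t) (\<lambda>m. K (ms[t := m]) ds w)"
  and g: "linear_on sv (pw (*)) V g" "g ` V \<subseteq> tensor sn sw Ds W"
 shows "multilinear sm sv sx Cs V (\<lambda>ms v. tlift sn sw Ds W (K ms) (g v))"
proof -
 interpret tensor_space sn sw Ds W by standard (rule W)
 show ?thesis unfolding multilinear_def
 proof safe
  fix ms assume ms: "ms \<in> listset Cs"
  show "linear_on sv sx V (\<lambda>v. tlift sn sw Ds W (K ms) (g v))"
   by (rule linear_on_comp[OF g(1) lift_linear[OF sx K[OF ms]] g(2)])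
  fix v t assume v: "v \<in> V" "t < length Cs"
  have gv: "g v \<in> tensor sn sw Ds W" using g v by auto
  have C: "vsp sm (Cs ! t)" using Cs v by auto
  have upd: "K (ms[t := m]) ds w = K (ms[t := m]) ds w \<and> multilinear sn sw sx Ds W (K (ms[t := m]))"
   if "m \<in> Cs ! t" for m ds w using K listset_update[OF ms v(2) that] by auto
  show "linear_on sm sx (Cs ! t) (\<lambda>m. tlift sn sw Ds W (K (ms[t := m])) (g v))"
  proof (rule linear_onI)
   fix x y assume "x \<in> Cs ! t" "y \<in> Cs ! t"
   then show "tlift sn sw Ds W (K (ms[t := x + y])) (g v) =
     tlift sn sw Ds W (K (ms[t := x])) (g v) + tlift sn sw Ds W (K (ms[t := y])) (g v)"
    using vsp_add[OF C] upd linear_on_add[OF Kt[OF ms v(2)]] by (intro lift_add_fun[OF sx _ _ _ _ gv]) auto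
  next
   fix c x assume "x \<in> Cs ! t"
   then show "tlift sn sw Ds W (K (ms[t := sm c x])) (g v) = sx c (tlift sn sw Ds W (K (ms[t := x])) (g v))"
    using vsp_scale[OF C] upd linear_on_scale[OF Kt[OF ms v(2)]] by (intro lift_scale_fun[OF sx _ _ _ gv]) auto
  qed
 qed
qed

section \<open>Transport of sequences of group elements through coset representatives\<close>

text \<open>\<open>tr C is k gs = (ys, h)\<close> is characterised by \<open>k g\<^sub>1\<cdots>g\<^sub>t \<in> y\<^sub>1\<cdots>y\<^sub>t G\<^bsub>i\<^sub>t\<^esub>\<close> for all \<open>t\<close> and
\<open>k g\<^sub>1\<cdots>g\<^sub>n = y\<^sub>1\<cdots>y\<^sub>n h\<close>; both \<open>transport\<close> and \<open>dual_index\<close> are instances.\<close>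

definition crep :: "('g, 'i) gset => 'i => 'g => 'g" where
 "crep C j g = (THE y. y \<in> cos_reps C j \<and> y \<in> g <#\<^bsub>grp C\<^esub> stab C j)"

fun tr :: "('g, 'i) gset => 'i list => 'g => 'g list => 'g list \<times> 'g" where
 "tr C (i # j # is) k (g # gs) =
   (let y = crep C j (k \<otimes>\<^bsub>grp C\<^esub> g);
     (ys, h) = tr C (j # is) (inv\<^bsub>grp C\<^esub> y \<otimes>\<^bsub>grp C\<^esub> (k \<otimes>\<^bsub>grp C\<^esub> g)) gs
   in (y # ys, h))"
| "tr C is k gs = ([], k)"

locale gset_action =
 fixes C :: "('g, 'i) gset"
 assumes gset: "is_gset C"
begin

abbreviation gmul :: "'g => 'g => 'g" (infixl "\<cdot>" 70) where "g \<cdot> h \<equiv> g \<otimes>\<^bsub>grp C\<^esub> h"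
abbreviation iv :: "'g => 'g" where "iv g \<equiv> inv\<^bsub>grp C\<^esub> g"
abbreviation e :: "'g" where "e \<equiv> \<one>\<^bsub>grp C\<^esub>"
abbreviation Gr :: "'g set" where "Gr \<equiv> carrier (grp C)"
abbreviation rep_at where "rep_at i \<equiv> is_rep (grp C) (stab C i)"

sublocale group_action "grp C" "pts C" "pact C" using gset by (simp add: is_gset_def)

sublocale group "grp C" using group_hom by (simp add: group_hom_def)

lemma finite_Gr: "finite Gr" and finite_pts: "finite (pts C)" and orb_reps_pts: "orb_reps C \<subseteq> pts C"
 using gset by (auto simp: is_gset_def)

lemma pact_mult: "g \<in> Gr ==> h \<in> Gr ==> i \<in> pts C ==> pact C (g \<cdot> h) i = pact C g (pact C h i)"
 by (rule composition_rule)

lemma pact_pts: "g \<in> Gr ==> i \<in> pts C ==> pact C g i \<in> pts C" using element_image by blast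

lemma pact_one: "i \<in> pts C ==> pact C e i = i" using id_eq_one by (metis restrict_apply')

lemma pact_inj: "g \<in> Gr ==> i \<in> pts C ==> j \<in> pts C ==> pact C g i = pact C g j \<longleftrightarrow> i = j"
 using inj_prop by (auto dest: inj_onD)

lemma stab_Gr: "h \<in> stab C i ==> h \<in> Gr" and stab_fix: "h \<in> stab C i ==> pact C h i = i" by (auto simp: stabilizer_def)

lemma stab_subgroup: "i \<in> pts C ==> subgroup (stab C i) (grp C)" by (rule stabilizer_subgroup)

lemma stab_mult: "i \<in> pts C ==> g \<in> stab C i ==> h \<in> stab C i ==> g \<cdot> h \<in> stab C i"
 and stab_inv: "i \<in> pts C ==> g \<in> stab C i ==> iv g \<in> stab C i"
 and stab_one: "i \<in> pts C ==> e \<in> stab C i"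
 using stab_subgroup subgroup.m_closed subgroup.m_inv_closed subgroup.one_closed by metis+

lemma finite_stab: "finite (stab C i)" using finite_Gr by (rule finite_subset[rotated]) (auto simp: stabilizer_def)

lemma mult_iv_cancel: "g \<in> Gr ==> h \<in> Gr ==> g \<cdot> (iv g \<cdot> h) = h" "g \<in> Gr ==> h \<in> Gr ==> iv g \<cdot> (g \<cdot> h) = h"
 "g \<in> Gr ==> h \<in> Gr ==> h \<cdot> g \<cdot> iv g = h" "g \<in> Gr ==> h \<in> Gr ==> h \<cdot> iv g \<cdot> g = h"
 by (auto simp: m_assoc[symmetric]) (auto simp: m_assoc)

lemma lcoset_iff: "g \<in> Gr ==> y \<in> Gr ==> j \<in> pts C ==> y \<in> g <#\<^bsub>grp C\<^esub> stab C j \<longleftrightarrow> iv g \<cdot> y \<in> stab C j"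
 unfolding l_coset_def by (auto simp: mult_iv_cancel stab_Gr intro: exI[of _ "iv g \<cdot> y"]) (metis mult_iv_cancel(1))

lemma lcoset_iff': "g \<in> Gr ==> y \<in> Gr ==> j \<in> pts C ==> y \<in> g <#\<^bsub>grp C\<^esub> stab C j \<longleftrightarrow> iv y \<cdot> g \<in> stab C j"
 using lcoset_iff stab_inv inv_mult_group by (metis inv_closed inv_inv)

lemma cos_reps_Gr: "j \<in> pts C ==> y \<in> cos_reps C j ==> y \<in> Gr" using gset by (auto simp: is_gset_def)

lemma finite_cos_reps: "j \<in> pts C ==> finite (cos_reps C j)"
 using finite_Gr cos_reps_Gr by (metis finite_subset subsetI)

lemma crep_ex1: "j \<in> pts C ==> g \<in> Gr ==> \<exists>!y. y \<in> cos_reps C j \<and> y \<in> g <#\<^bsub>grp C\<^esub> stab C j"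
 using gset by (auto simp: is_gset_def)

lemma crep:
 assumes "j \<in> pts C" "g \<in> Gr"
 shows "crep C j g \<in> cos_reps C j" "crep C j g \<in> Gr" "iv (crep C j g) \<cdot> g \<in> stab C j"
 using theI'[OF crep_ex1[OF assms]] cos_reps_Gr[OF assms(1)] lcoset_iff' assms by (auto simp flip: crep_def)

lemma crep_unique:
 assumes "j \<in> pts C" "g \<in> Gr" "y \<in> cos_reps C j" "iv y \<cdot> g \<in> stab C j"
 shows "crep C j g = y" using the1_equality[OF crep_ex1[OF assms(1,2)], of y] assms lcoset_iff' cos_reps_Gr
 by (auto simp flip: crep_def)

lemma crep_mult_stab:
 assumes "j \<in> pts C" "g \<in> Gr" "h \<in> stab C j"
 shows "crep C j (g \<cdot> h) = crep C j g"
 using crep[OF assms(1,2)] assms stab_mult[OF assms(1) crep(3)[OF assms(1,2)] assms(3)]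
 by (intro crep_unique) (auto simp: stab_Gr m_assoc)

lemma crep_cos_reps: "j \<in> pts C ==> y \<in> cos_reps C j ==> crep C j y = y"
 by (rule crep_unique) (auto simp: cos_reps_Gr stab_one)

lemma gprod_Nil [simp]: "gprod C [] = e" and gprod_Cons [simp]: "gprod C (g # gs) = g \<cdot> gprod C gs"
 by (auto simp: gprod_def)

lemma gprod_Gr [simp]: "set gs \<subseteq> Gr ==> gprod C gs \<in> Gr" by (induction gs) auto

lemma gprod_append: "set gs \<subseteq> Gr ==> set gs' \<subseteq> Gr ==> gprod C (gs @ gs') = gprod C gs \<cdot> gprod C gs'"
 by (induction gs) (auto simp: m_assoc)

lemma gprod_inv_rev: "set gs \<subseteq> Gr ==> gprod C (map iv (rev gs)) = iv (gprod C gs)"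
proof (induction gs)
 case (Cons g gs)
 then have "set (map iv (rev gs)) \<subseteq> Gr" by (auto simp del: in_set_conv_nth)
 then show ?case using Cons gprod_append[of "map iv (rev gs)" "[iv g]"] by (simp add: inv_mult_group)
qed simp

lemma yseqs_Nil [simp]: "ys \<in> yseqs C [i] \<longleftrightarrow> ys = []" by (auto simp: yseqs_def)

lemma yseqs_Cons: "ys \<in> yseqs C (i # j # is) \<longleftrightarrow> (\<exists>y ys'. ys = y # ys' \<and> y \<in> cos_reps C j \<and> ys' \<in> yseqs C (j # is))"
 by (cases ys) (auto simp: yseqs_def nth_Cons less_Suc_eq_0_disj)

lemma yseqs_Cons_simp [simp]: "y # ys \<in> yseqs C (i # j # is) \<longleftrightarrow> y \<in> cos_reps C j \<and> ys \<in> yseqs C (j # is)"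
 by (auto simp: yseqs_Cons)

lemma yseqs_length: "ys \<in> yseqs C is ==> length is = Suc (length ys)" by (simp add: yseqs_def)

lemma yseqs_Gr: "set is \<subseteq> pts C ==> ys \<in> yseqs C is ==> set ys \<subseteq> Gr"
proof
 fix y assume "set is \<subseteq> pts C" "ys \<in> yseqs C is" "y \<in> set ys"
 then obtain t where t: "t < length ys" "y = ys ! t" by (metis in_set_conv_nth)
 have "is ! Suc t \<in> set is" using \<open>ys \<in> _\<close> t by (intro nth_mem) (simp add: yseqs_def)
 then have "is ! Suc t \<in> pts C" using \<open>set is \<subseteq> _\<close> by blast
 moreover have "y \<in> cos_reps C (is ! Suc t)" using \<open>ys \<in> _\<close> t by (simp add: yseqs_def)
 ultimately show "y \<in> Gr" by (rule cos_reps_Gr)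
qed

lemma yseqs_Cons_image: "yseqs C (i # j # is) = (\<lambda>(y, ys). y # ys) ` (cos_reps C j \<times> yseqs C (j # is))"
 by (auto simp: yseqs_Cons)

lemma finite_yseqs: "set is \<subseteq> pts C ==> is \<noteq> [] ==> finite (yseqs C is)"
proof (induction "is" rule: induct_list012)
 case (2 i)
 have "yseqs C [i] = {[]}" by auto
 then show ?case by simp
next
 case (3 i j "is")
 then show ?case by (auto simp: yseqs_Cons_image finite_cos_reps)
qed auto

lemma yseqs_append:
 assumes "is \<noteq> []" "is' \<noteq> []" "last is = hd is'" "length ys = length is - 1"
 shows "ys @ ys' \<in> yseqs C (is @ tl is') \<longleftrightarrow> ys \<in> yseqs C is \<and> ys' \<in> yseqs C is'" using assms
proof (induction "is" arbitrary: ys rule: induct_list012)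
 case (2 i)
 then show ?case by (cases is') auto
next
 case (3 i j "is")
 then show ?case by (cases ys) auto
qed auto

text \<open>Sequences of arbitrary elements of G along the points; \<open>yseqs\<close> is the
  special case of coset representatives.\<close>

definition gseq :: "'i list => 'g list => bool" where
 "gseq is gs \<longleftrightarrow> set is \<subseteq> pts C \<and> length is = Suc (length gs) \<and> set gs \<subseteq> Gr"

lemma gseq_Nil [simp]: "gseq is [] \<longleftrightarrow> (\<exists>i\<in>pts C. is = [i])" by (auto simp: gseq_def length_Suc_conv)

lemma gseq_Cons: "gseq is (g # gs) \<longleftrightarrow> (\<exists>i j is'. is = i # j # is' \<and> i \<in> pts C \<and> g \<in> Gr \<and> gseq (j # is') gs)"
 by (auto simp: gseq_def length_Suc_conv)

lemma gseq_Cons_simp [simp]: "gseq (i # j # is) (g # gs) \<longleftrightarrow> i \<in> pts C \<and> g \<in> Gr \<and> gseq (j # is) gs"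
 by (auto simp: gseq_Cons)

lemma gseq_ne: "gseq is gs ==> is \<noteq> []" by (auto simp: gseq_def)

lemma yseqs_gseq: "set is \<subseteq> pts C ==> ys \<in> yseqs C is ==> gseq is ys"
 using yseqs_Gr yseqs_length by (auto simp: gseq_def)

text \<open>After the representative y is split off, the rest h in k g = y h fixes the next point
  and takes over the role of k.\<close>

lemma tr_induct [consumes 2, case_names Nil Cons]:
 assumes "gseq is gs" "k \<in> stab C (hd is)"
  and "\<And>i k. i \<in> pts C ==> k \<in> stab C i ==> P [i] k []"
  and "\<And>i j is k g gs y h. i \<in> pts C ==> j \<in> pts C ==> gseq (j # is) gs ==> k \<in> stab C i ==> k \<in> Gr ==> g \<in> Gr ==>
   y = crep C j (k \<cdot> g) ==> h = iv y \<cdot> (k \<cdot> g) ==> y \<in> cos_reps C j ==> y \<in> Gr ==> h \<in> stab C j ==> h \<in> Gr ==> k \<cdot> g = y \<cdot> h ==>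
   P (j # is) h gs ==> P (i # j # is) k (g # gs)"
 shows "P is k gs" using assms(1,2)
proof (induction gs arbitrary: "is" k)
 case Nil
 then show ?case using assms(3) by auto
next
 case (Cons g gs)
 then obtain i j is' where "is": "is = i # j # is'" "i \<in> pts C" "g \<in> Gr" "gseq (j # is') gs" by (auto simp: gseq_Cons)
 then have j: "j \<in> pts C" by (auto simp: gseq_def)
 have k: "k \<in> Gr" "k \<in> stab C i" using Cons.prems(2) "is"(1) stab_Gr[of k i] by simp_all
 have kg: "k \<cdot> g \<in> Gr" using k "is" by simp
 note c = crep[OF j kg]
 show ?case unfolding "is"(1) by (rule assms(4)[OF "is"(2) j "is"(4) k(2,1) "is"(3) refl refl])
    (use c stab_Gr[OF c(3)] kg Cons.IH[OF "is"(4)] in \<open>auto simp: mult_iv_cancel\<close>)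
qed

lemma tr_props:
 assumes "gseq is gs" "k \<in> stab C (hd is)" "tr C is k gs = (ys, h)"
 shows "ys \<in> yseqs C is" "h \<in> stab C (last is)" "k \<cdot> gprod C gs = gprod C ys \<cdot> h"
proof -
 have "ys \<in> yseqs C is \<and> h \<in> stab C (last is) \<and> k \<cdot> gprod C gs = gprod C ys \<cdot> h" using assms
 proof (induction arbitrary: ys h rule: tr_induct)
  case (Nil i k)
  then show ?case using stab_Gr[OF Nil(2)] by auto
 next
  case (Cons i j "is" k g gs y h')
  obtain ys' h'' where t: "tr C (j # is) h' gs = (ys', h'')" by force
  from Cons.prems have ys: "ys = y # ys'" "h = h''" using t Cons(7,8) by (auto simp: Let_def)
  note IH = Cons.IH[OF t]
  have "k \<cdot> (g \<cdot> gprod C gs) = y \<cdot> (h' \<cdot> gprod C gs)"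
   using Cons(13) Cons(3) Cons(5,6,10,12) by (simp add: gseq_def flip: m_assoc)
  also have "\<dots> = y \<cdot> gprod C ys' \<cdot> h''"
  proof -
   have "set (j # is) \<subseteq> pts C" using Cons(3) by (auto simp: gseq_def)
   then have "set ys' \<subseteq> Gr" using IH yseqs_Gr by blast
   then show ?thesis using IH Cons(10) stab_Gr[of h'' "last (j # is)"] by (simp add: m_assoc)
  qed
  finally show ?case using ys IH Cons(9) by simp
 qed
 then show "ys \<in> yseqs C is" "h \<in> stab C (last is)" "k \<cdot> gprod C gs = gprod C ys \<cdot> h" by auto
qed

lemma tr_yseqs: "set is \<subseteq> pts C ==> ys \<in> yseqs C is ==> tr C is e ys = (ys, e)"
proof (induction "is" arbitrary: ys rule: induct_list012)
 case 1
 then show ?case by (auto simp: yseqs_def)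
next
 case (3 i j "is")
 then show ?case by (auto simp: yseqs_Cons crep_cos_reps cos_reps_Gr Let_def)
qed auto

text \<open>The cocycle property of transport: going along k is the same as going along inverse(g) k
  and then moving the representatives so obtained by g, with the stabiliser parts multiplying
  accordingly. It is behind injectivity and surjectivity of transport and behind
  \<open>cw_Maction\<close>.\<close>

lemma tr_comp:
 assumes "gseq is gs" "k \<in> stab C (hd is)" "g \<in> stab C (hd is)"
  and "tr C is k gs = (ys', h)" "tr C is (iv g \<cdot> k) gs = (ys, h2)"
 shows "tr C is g ys = (ys', h \<cdot> iv h2)" using assms
proof (induction arbitrary: g ys ys' h h2 rule: tr_induct)
 case (Nil i k)
 have "k \<in> Gr" "g \<in> Gr" using Nil stab_Gr[of k i] stab_Gr[of g i] by simp_all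
 with Nil show ?case by (auto simp: inv_mult_group mult_iv_cancel)
next
 case (Cons i j "is" k g1 gs y' a' g ys ys' h h2)
 have g: "g \<in> Gr" "g \<in> stab C i" using Cons.prems(1) stab_Gr[of g i] by simp_all
 define z where "z = iv g \<cdot> k \<cdot> g1"
 have z: "z \<in> Gr" using Cons(5,6) g by (simp add: z_def)
 define y where "y = crep C j z"
 define a where "a = iv y \<cdot> z"
 note c = crep[OF Cons(2) z, folded y_def, folded a_def]
 have a: "a \<in> Gr" by (rule stab_Gr[OF c(3)])
 have z': "z = y \<cdot> a" using c(2) z by (simp add: a_def mult_iv_cancel)
 have gz: "g \<cdot> z = k \<cdot> g1" using g Cons(5,6) by (simp add: z_def mult_iv_cancel m_assoc)
 \<comment> \<open>The rests a' and a of the two transports differ by b. This is also the rest left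
   when y is moved by g, so b plays the role of g at the next position.\<close>
 define b where "b = a' \<cdot> iv a"
 have b: "b \<in> stab C j" unfolding b_def by (intro stab_mult stab_inv Cons(2,11) c(3))
 then have b': "b \<in> Gr" by (rule stab_Gr)
 have gy: "g \<cdot> y = y' \<cdot> b"
 proof -
  have "g \<cdot> y = g \<cdot> (z \<cdot> iv a)" using c(2) a by (simp add: z' mult_iv_cancel)
  also have "\<dots> = k \<cdot> g1 \<cdot> iv a" using g z a gz by (simp flip: m_assoc)
  also have "\<dots> = y' \<cdot> b" using Cons(10,12,13) a by (simp add: b_def m_assoc)
  finally show ?thesis .
 qed
 obtain ys1 h1 where t: "tr C (j # is) a' gs = (ys1, h1)" by force
 obtain ys2 h3 where t2: "tr C (j # is) a gs = (ys2, h3)" by force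
 have 1: "ys' = y' # ys1" "h = h1" using Cons.prems(2) Cons(7,8) t by (auto simp: Let_def)
 have 2: "ys = y # ys2" "h2 = h3" using Cons.prems(3) t2 by (auto simp: Let_def y_def a_def z_def)
 have ba: "iv b \<cdot> a' = a" using Cons(12) a by (simp add: b_def inv_mult_group m_assoc)
 have 3: "tr C (j # is) b ys2 = (ys1, h1 \<cdot> iv h3)" using Cons.IH[of b ys1 h1 ys2 h3] b t t2 ba by simp
 have 4: "crep C j (g \<cdot> y) = y'" using gy b Cons(2,9,10) by (simp add: crep_mult_stab crep_cos_reps)
 have 5: "iv y' \<cdot> (g \<cdot> y) = b" using gy b' Cons(10) by (simp add: mult_iv_cancel)
 show ?case using 1 2 3 4 5 by (simp add: Let_def)
qed

lemma tr_append:
 assumes "gseq is gs" "k \<in> stab C (hd is)" "is' \<noteq> []" "last is = hd is'" "tr C is k gs = (ys, h)"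
  "tr C is' h gs' = (ys', h')"
 shows "tr C (is @ tl is') k (gs @ gs') = (ys @ ys', h')" using assms
proof (induction arbitrary: ys h rule: tr_induct)
 case (Nil i k)
 then show ?case by (cases is') simp_all
next
 case (Cons i j "is" k g gs y h1)
 obtain ys1 h2 where t: "tr C (j # is) h1 gs = (ys1, h2)" by force
 have "ys = y # ys1" "h = h2" using Cons.prems(3) t Cons(7,8) by (auto simp: Let_def)
 then show ?case using Cons.IH[OF Cons.prems(1) _ t] Cons.prems Cons(7,8) by (simp add: Let_def)
qed

text \<open>Transport by \<open>iv g\<close> undoes transport by g, which is \<open>tr_comp\<close>
  with k = e.\<close>

lemma tr_inj:
 assumes "set is \<subseteq> pts C" "is \<noteq> []" "g \<in> stab C (hd is)" "ys1 \<in> yseqs C is" "ys2 \<in> yseqs C is"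
  "fst (tr C is g ys1) = fst (tr C is g ys2)"
 shows "ys1 = ys2"
proof -
 have i: "hd is \<in> pts C" using assms by auto
 have "fst (tr C is (iv g) (fst (tr C is g ys))) = ys" if "ys \<in> yseqs C is" for ys
 proof -
  obtain ys' h where t: "tr C is g ys = (ys', h)" by force
  show ?thesis
   using tr_comp[OF yseqs_gseq[OF assms(1) that] stab_one[OF i] stab_inv[OF i assms(3)] tr_yseqs[OF assms(1) that]]
    t stab_Gr[OF assms(3)] stab_Gr[OF stab_inv[OF i assms(3)]] by simp
 qed
 with assms show ?thesis by metis
qed

lemma lcoset_eq_iff:
 assumes "g \<in> Gr" "g' \<in> Gr" "j \<in> pts C"
 shows "g <#\<^bsub>grp C\<^esub> stab C j = g' <#\<^bsub>grp C\<^esub> stab C j \<longleftrightarrow> iv g' \<cdot> g \<in> stab C j"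
proof
 assume "g <#\<^bsub>grp C\<^esub> stab C j = g' <#\<^bsub>grp C\<^esub> stab C j"
 moreover have "g \<in> g <#\<^bsub>grp C\<^esub> stab C j" using assms by (simp add: lcoset_iff stab_one)
 ultimately show "iv g' \<cdot> g \<in> stab C j" using assms by (simp add: lcoset_iff)
next
 assume s: "iv g' \<cdot> g \<in> stab C j"
 have "x \<in> g <#\<^bsub>grp C\<^esub> stab C j \<longleftrightarrow> x \<in> g' <#\<^bsub>grp C\<^esub> stab C j" for x
 proof (cases "x \<in> Gr")
  case True
  have "iv g' \<cdot> x = (iv g' \<cdot> g) \<cdot> (iv g \<cdot> x)" "iv g \<cdot> x = iv (iv g' \<cdot> g) \<cdot> (iv g' \<cdot> x)"
   using assms True by (simp_all add: inv_mult_group m_assoc mult_iv_cancel)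
  then have "iv g \<cdot> x \<in> stab C j \<longleftrightarrow> iv g' \<cdot> x \<in> stab C j" using stab_mult[OF assms(3)] stab_inv[OF assms(3)] s by metis
  then show ?thesis using True assms by (simp add: lcoset_iff)
 next
  case False
  then show ?thesis using assms stab_Gr[of _ j] by (auto simp: l_coset_def)
 qed
 then show "g <#\<^bsub>grp C\<^esub> stab C j = g' <#\<^bsub>grp C\<^esub> stab C j" by blast
qed

lemma tr_cosets:
 assumes "gseq is gs" "k \<in> stab C (hd is)" "tr C is k gs = (ys, h)" "t \<in> {1..length gs}"
 shows "iv (gprod C (take t ys)) \<cdot> (k \<cdot> gprod C (take t gs)) \<in> stab C (is ! t)" using assms
proof (induction arbitrary: ys h t rule: tr_induct)
 case (Nil i k)
 then show ?case by auto
next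
 case (Cons i j "is" k g gs y h')
 obtain ys' h'' where t: "tr C (j # is) h' gs = (ys', h'')" by force
 from Cons.prems(1) have ys: "ys = y # ys'" "h = h''" using t Cons(7,8) by (auto simp: Let_def)
 obtain s where s: "t = Suc s" "s \<le> length gs" using Cons.prems(2) by (cases t) auto
 have "set (j # is) \<subseteq> pts C" "hd (j # is) = j" using Cons(3) by (auto simp: gseq_def)
 then have ys': "set ys' \<subseteq> Gr" using tr_props(1)[OF Cons(3) _ t] Cons(11) yseqs_Gr by metis
 have sub: "set (take s ys') \<subseteq> Gr" "set (take s gs) \<subseteq> Gr"
  using ys' Cons(3) set_take_subset[of s ys'] set_take_subset[of s gs] by (auto simp: gseq_def)
 let ?p = "gprod C (take s ys')" and ?q = "gprod C (take s gs)"
 have "iv (gprod C (take t ys)) \<cdot> (k \<cdot> gprod C (take t (g # gs))) = iv ?p \<cdot> (iv y \<cdot> (k \<cdot> g \<cdot> ?q))"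
  using Cons(5,6,10) sub by (simp add: ys s inv_mult_group m_assoc)
 also have "\<dots> = iv ?p \<cdot> (h' \<cdot> ?q)" using Cons(10,12,13) sub by (simp add: m_assoc mult_iv_cancel)
 finally have *: "iv (gprod C (take t ys)) \<cdot> (k \<cdot> gprod C (take t (g # gs))) = iv ?p \<cdot> (h' \<cdot> ?q)" .
 show ?case
 proof (cases "s = 0")
  case True
  then show ?thesis using * s Cons(11,12) by simp
 next
  case False
  then show ?thesis using * Cons.IH[OF t, of s] s by simp
 qed
qed

text \<open>The coset condition at t = 1 forces the first representative. Once it is cancelled, the
  remaining conditions are those of the tail with the rest \<open>h'\<close> in place of k.\<close>

lemma tr_unique:
 assumes "gseq is gs" "k \<in> stab C (hd is)" "ys \<in> yseqs C is"
  "\<And>t. t \<in> {1..length gs} ==> iv (gprod C (take t ys)) \<cdot> (k \<cdot> gprod C (take t gs)) \<in> stab C (is ! t)"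
  "h \<in> Gr" "k \<cdot> gprod C gs = gprod C ys \<cdot> h"
 shows "tr C is k gs = (ys, h)" using assms
proof (induction arbitrary: ys rule: tr_induct)
 case (Nil i k)
 then show ?case using stab_Gr[OF Nil(2)] by auto
next
 case (Cons i j "is" k g gs y h')
 from Cons.prems(1) obtain y1 ys' where ys: "ys = y1 # ys'" "y1 \<in> cos_reps C j" "ys' \<in> yseqs C (j # is)"
  by (auto simp: yseqs_Cons)
 have y1: "y1 \<in> Gr" by (rule cos_reps_Gr[OF Cons(2) ys(2)])
 have gs: "set gs \<subseteq> Gr" and "set (j # is) \<subseteq> pts C" using Cons(3) by (auto simp: gseq_def)
 then have ys': "set ys' \<subseteq> Gr" using ys yseqs_Gr by metis
 have "iv y1 \<cdot> (k \<cdot> g) \<in> stab C j" using Cons.prems(2)[of 1] y1 Cons(5,6) by (simp add: ys)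
 then have y: "y1 = y" using Cons(2,5,6,7) crep_unique[of j "k \<cdot> g" y1] ys by simp
 have *: "iv (gprod C (take (Suc s) ys)) \<cdot> (k \<cdot> gprod C (take (Suc s) (g # gs))) =
   iv (gprod C (take s ys')) \<cdot> (h' \<cdot> gprod C (take s gs))" for s
 proof -
  have sub: "set (take s ys') \<subseteq> Gr" "set (take s gs) \<subseteq> Gr"
   using ys' gs set_take_subset[of s ys'] set_take_subset[of s gs] by auto
  let ?p = "gprod C (take s ys')" and ?q = "gprod C (take s gs)"
  have "iv (gprod C (take (Suc s) ys)) \<cdot> (k \<cdot> gprod C (take (Suc s) (g # gs))) = iv ?p \<cdot> (iv y \<cdot> (k \<cdot> g \<cdot> ?q))"
   using Cons(5,6,10) sub y by (simp add: ys inv_mult_group m_assoc)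
  also have "\<dots> = iv ?p \<cdot> (h' \<cdot> ?q)" using Cons(10,12,13) sub by (simp add: m_assoc mult_iv_cancel)
  finally show ?thesis .
 qed
 have "tr C (j # is) h' gs = (ys', h)"
 proof (rule Cons.IH[OF ys(3) _ Cons.prems(3)])
  show "iv (gprod C (take t ys')) \<cdot> (h' \<cdot> gprod C (take t gs)) \<in> stab C ((j # is) ! t)" if "t \<in> {1..length gs}" for t
   using Cons.prems(2)[of "Suc t"] * that by simp
  have "y \<cdot> (h' \<cdot> gprod C gs) = k \<cdot> gprod C (g # gs)" using Cons(5,6,10,12,13) gs by (simp flip: m_assoc)
  also have "\<dots> = y \<cdot> (gprod C ys' \<cdot> h)" using Cons.prems(3,4) ys' Cons(10) by (simp add: ys y m_assoc)
  finally show "h' \<cdot> gprod C gs = gprod C ys' \<cdot> h" using Cons.prems(3) Cons(10,12) gs ys' by simp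
 qed
 then show ?case using Cons(7,8) y ys by (simp add: Let_def)
qed

text \<open>The recursively computed pair satisfies the conditions in the definite description by
  \<open>tr_props\<close> and \<open>tr_cosets\<close>, and is the only one by
  \<open>tr_unique\<close>.\<close>

lemma transport_tr:
 assumes "gseq is gs" "k \<in> stab C (hd is)"
 shows "transport C is k gs = tr C is k gs"
proof -
 obtain ys h where t: "tr C is k gs = (ys, h)" by force
 have "is": "set is \<subseteq> pts C" and gs: "set gs \<subseteq> Gr" and len: "length is = Suc (length gs)" and k: "k \<in> Gr"
  using assms(1) stab_Gr[OF assms(2)] by (auto simp: gseq_def)
 have take: "gprod C (take t xs) \<in> Gr" if "set xs \<subseteq> Gr" for t xs
  using that set_take_subset[of t xs] by (intro gprod_Gr) auto
 have iff: "((k \<cdot> gprod C (take t gs)) <#\<^bsub>grp C\<^esub> stab C (is ! t) =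
             gprod C (take t ys') <#\<^bsub>grp C\<^esub> stab C (is ! t)) \<longleftrightarrow>
   iv (gprod C (take t ys')) \<cdot> (k \<cdot> gprod C (take t gs)) \<in> stab C (is ! t)"
  if "t \<in> {1..length gs}" "ys' \<in> yseqs C is" for t ys'
  using that take[OF gs] take[OF yseqs_Gr[OF "is" that(2)]] len "is" k by (intro lcoset_eq_iff) auto
 show ?thesis unfolding transport_def t
 proof (rule the_equality, goal_cases)
  case 1
  then show ?case using tr_props[OF assms t] iff tr_cosets[OF assms t] by auto
 next
  case (2 p)
  obtain ys' h' where p: "p = (ys', h')" by force
  have "tr C is k gs = (ys', h')" using 2 iff stab_Gr[of h' "last is"] unfolding p by (intro tr_unique[OF assms]) auto
  then show ?case using t p by simp
 qed
qed

lemma gprod_take_inv_rev: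
 assumes "set ys \<subseteq> Gr" "s \<le> length ys"
 shows "gprod C (take s (map iv (rev ys))) = iv (gprod C (drop (length ys - s) ys))"
proof -
 have "take s (map iv (rev ys)) = map iv (rev (drop (length ys - s) ys))" by (simp add: take_map take_rev)
 then show ?thesis using gprod_inv_rev[of "drop (length ys - s) ys"] set_drop_subset[of _ ys] assms by fastforce
qed

text \<open>The elements inverse(y_t...y_n) are the partial products of the inverted and reversed
  sequence, so the dual index is a transport along the reversed points with k = e.\<close>

lemma dual_index_tr:
 assumes "gseq is ys"
 shows "dual_index C is ys = tr C (rev is) e (map iv (rev ys))"
proof -
 have "is": "set is \<subseteq> pts C" and ys: "set ys \<subseteq> Gr" and len: "length is = Suc (length ys)"
  using assms by (auto simp: gseq_def)
 have gs: "gseq (rev is) (map iv (rev ys))" using "is" ys len by (auto simp: gseq_def)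
 have "hd (rev is) \<in> pts C" using "is" len by (metis gseq_ne[OF gs] hd_in_set set_rev subset_iff)
 then have e: "e \<in> stab C (hd (rev is))" by (rule stab_one)
 have cond: "(\<forall>t\<in>{1..length ys}. iv (gprod C (drop (t - 1) ys)) \<in>
    gprod C (take (length ys - (t - 1)) xs) <#\<^bsub>grp C\<^esub> stab C (is ! (t - 1))) \<longleftrightarrow>
   (\<forall>t\<in>{1..length (map iv (rev ys))}. (e \<cdot> gprod C (take t (map iv (rev ys)))) <#\<^bsub>grp C\<^esub> stab C (rev is ! t) =
             gprod C (take t xs) <#\<^bsub>grp C\<^esub> stab C (rev is ! t))" (is "?l \<longleftrightarrow> ?r")
  if xs: "xs \<in> yseqs C (rev is)" for xs
 proof -
  have xsG: "set xs \<subseteq> Gr" using yseqs_Gr[OF _ xs] "is" by simp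
  have "?r \<longleftrightarrow> (\<forall>s\<in>{1..length ys}. iv (gprod C (drop (length ys - s) ys)) \<in> gprod C (take s xs) <#\<^bsub>grp C\<^esub> stab C (is ! (length ys - s)))"
   unfolding length_map length_rev
  proof (intro ball_cong refl)
   fix s assume s: "s \<in> {1..length ys}"
   have G: "gprod C (drop (length ys - s) ys) \<in> Gr" "gprod C (take s xs) \<in> Gr"
    using ys xsG set_drop_subset[of _ ys] set_take_subset[of _ xs] by (intro gprod_Gr; fastforce)+
   have nth: "rev is ! s = is ! (length ys - s)" using s len by (simp add: rev_nth)
   have p: "is ! (length ys - s) \<in> pts C" using s len "is" by auto
   show "(e \<cdot> gprod C (take s (map iv (rev ys)))) <#\<^bsub>grp C\<^esub> stab C (rev is ! s) =
             gprod C (take s xs) <#\<^bsub>grp C\<^esub> stab C (rev is ! s) \<longleftrightarrow>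
    iv (gprod C (drop (length ys - s) ys)) \<in> gprod C (take s xs) <#\<^bsub>grp C\<^esub> stab C (is ! (length ys - s))"
    using s G p by (simp add: gprod_take_inv_rev[OF ys] nth lcoset_eq_iff lcoset_iff)
  qed
  \<comment> \<open>The partial product of length s belongs to t = n - s + 1, so that t - 1 = n -
    s.\<close>
  also have "\<dots> \<longleftrightarrow> ?l"
  proof safe
   fix t assume a: "\<forall>s\<in>{1..length ys}. iv (gprod C (drop (length ys - s) ys)) \<in> gprod C (take s xs) <#\<^bsub>grp C\<^esub> stab C (is ! (length ys - s))"
    and t: "t \<in> {1..length ys}"
   from a[rule_format, of "length ys - (t - 1)"] t
   show "iv (gprod C (drop (t - 1) ys)) \<in> gprod C (take (length ys - (t - 1)) xs) <#\<^bsub>grp C\<^esub> stab C (is ! (t - 1))"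
    by (simp add: Suc_leI)
  next
   fix s assume a: ?l and s: "s \<in> {1..length ys}"
   have "length ys - s + 1 \<in> {1..length ys}" using s by auto
   from a[rule_format, OF this] s
   show "iv (gprod C (drop (length ys - s) ys)) \<in> gprod C (take s xs) <#\<^bsub>grp C\<^esub> stab C (is ! (length ys - s))"
    by simp
  qed
  finally show ?thesis by simp
 qed
 have "dual_index C is ys = transport C (rev is) e (map iv (rev ys))" unfolding dual_index_def transport_def
  by (rule arg_cong[where f=The], rule ext)
    (use cond gs ys in \<open>auto simp: last_rev gprod_inv_rev gseq_ne split: prod.splits\<close>)
 then show ?thesis using transport_tr[OF gs e] by simp
qed

end

section \<open>Components of a bimodule and of its dual\<close>

definition prj :: "('g, 'i, 'k::field, 'm) bimod => 'i => 'i => 'm => 'm" where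
 "prj N i j m = lmul N (single i 1) (rmul N m (single j 1))"

lemma single_mult: "single i (1::'k::field) * single j 1 = (if i = j then single i 1 else (\<lambda>_. 0))"
 by (auto simp: fun_eq_iff single_def)

lemma bimod_props:
 fixes N :: "('g, 'i, 'k::field, 'm::ab_group_add) bimod"
 assumes N: "is_bimod Q0 N" and Q0: "finite Q0"
 shows bimod_vsp: "vsp (bscale N) (bcar N)"
  and bimod_fin: "fin_dim (bscale N) (bcar N)"
  and bimod_prj_linear: "linear_on (bscale N) (bscale N) (bcar N) (prj N i j)"
  and bimod_prj_in: "m \<in> bcar N ==> prj N i j m \<in> bcar N"
  and bimod_prj_prj: "m \<in> bcar N ==> prj N i j (prj N a b m) = (if i = a \<and> j = b then prj N i j m else 0)"
  and bimod_prj_sum: "m \<in> bcar N ==> m = (\<Sum>a\<in>Q0. \<Sum>b\<in>Q0. prj N a b m)"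
proof -
 note n = N[unfolded is_bimod_def]
 show v: "vsp (bscale N) (bcar N)" using n by (auto simp: vsp_def)
 show "fin_dim (bscale N) (bcar N)" using n by auto
 have cl: "lmul N s m \<in> bcar N" "rmul N m s \<in> bcar N" if "m \<in> bcar N" for s m using n that by auto
 have ladd: "lmul N s (m + m') = lmul N s m + lmul N s m'" "rmul N (m + m') s = rmul N m s + rmul N m' s"
  if "m \<in> bcar N" "m' \<in> bcar N" for s m m' using n that by auto
 have sadd: "lmul N (s + s') m = lmul N s m + lmul N s' m" "rmul N m (s + s') = rmul N m s + rmul N m s'"
  if "m \<in> bcar N" for s s' m using n that by auto
 have sm: "lmul N (s * s') m = lmul N s (lmul N s' m)" "rmul N m (s * s') = rmul N (rmul N m s) s'"
  if "m \<in> bcar N" for s s' m using n that by auto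
 have comm: "rmul N (lmul N s m) s' = lmul N s (rmul N m s')" if "m \<in> bcar N" for s s' m using n that by auto
 have cc: "lmul N (\<lambda>_. c) m = bscale N c m" "rmul N m (\<lambda>_. c) = bscale N c m" if "m \<in> bcar N" for c m
  using n that by auto
 have ext: "lmul N s m = lmul N s' m" "rmul N m s = rmul N m s'" if "m \<in> bcar N" "\<forall>i\<in>Q0. s i = s' i" for s s' m
  using n that by auto
 \<comment> \<open>Homogeneity is not among the axioms. It follows because a scalar acts as a
   constant function and S is commutative.\<close>
 have lsc: "lmul N s (bscale N c m) = bscale N c (lmul N s m)" if m: "m \<in> bcar N" for s c m
 proof -
  have "lmul N s (lmul N (\<lambda>_. c) m) = lmul N (s * (\<lambda>_. c)) m" using sm m by simp
  also have "s * (\<lambda>_. c) = (\<lambda>_. c) * s" by (simp add: fun_eq_iff mult.commute)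
  also have "lmul N \<dots> m = lmul N (\<lambda>_. c) (lmul N s m)" using sm m by simp
  finally show ?thesis using cc m cl by simp
 qed
 have rsc: "rmul N (bscale N c m) s = bscale N c (rmul N m s)" if m: "m \<in> bcar N" for s c m
 proof -
  have "rmul N (rmul N m (\<lambda>_. c)) s = rmul N m ((\<lambda>_. c) * s)" using sm m by simp
  also have "(\<lambda>_. c) * s = s * (\<lambda>_. c)" by (simp add: fun_eq_iff mult.commute)
  also have "rmul N m \<dots> = rmul N (rmul N m s) (\<lambda>_. c)" using sm m by simp
  finally show ?thesis using cc m cl by simp
 qed
 show lin: "linear_on (bscale N) (bscale N) (bcar N) (prj N i j)" for i j
  by (rule linear_onI) (simp_all add: prj_def ladd cl lsc rsc)
 show prin: "prj N i j m \<in> bcar N" if "m \<in> bcar N" for i j m using that cl by (simp add: prj_def)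
 have 0: "lmul N (\<lambda>_. 0) m = 0" "rmul N m (\<lambda>_. 0) = 0" if "m \<in> bcar N" for m
  using cc[OF that, of 0] vsp_simps(5)[OF v] by auto
 have z: "lmul N s 0 = 0" "rmul N 0 s = 0" for s
  using lsc[of 0 s 0] rsc[of 0 0 s] vsp_0[OF v] vsp_simps(5)[OF v] by auto
 have "prj N i j (prj N a b m) = lmul N (single i 1 * single a 1) (rmul N m (single b 1 * single j 1))"
  if m: "m \<in> bcar N" for i j a b m using m cl by (simp add: prj_def comm sm)
 then show "prj N i j (prj N a b m) = (if i = a \<and> j = b then prj N i j m else 0)" if "m \<in> bcar N"
  using that cl 0 z by (auto simp: single_mult prj_def)
 have sum1: "(\<Sum>a\<in>A. lmul N (single a 1) m) = lmul N (\<lambda>x. if x \<in> A then 1 else 0) m"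
  "(\<Sum>a\<in>A. rmul N m (single a 1)) = rmul N m (\<lambda>x. if x \<in> A then 1 else 0)" if m: "m \<in> bcar N" "finite A" for A m
  using m(2)
 proof (induction A)
  case (insert a A)
  have e: "(\<lambda>x. if x \<in> insert a A then 1 else 0) = single a (1::'k) + (\<lambda>x. if x \<in> A then 1 else 0)"
   using insert(2) by (auto simp: fun_eq_iff single_def)
  case 1 then show ?case using insert sadd[OF m(1)] e by simp
  case 2 then show ?case using insert sadd[OF m(1)] e by simp
 qed (simp_all add: 0 m)
 \<comment> \<open>The constant function 1 acts as the identity and agrees on Q_0 with the sum of
   the idempotents; functions that agree on Q_0 act equally.\<close>
 have one: "lmul N (\<lambda>x. if x \<in> Q0 then 1 else 0) m = m" "rmul N m (\<lambda>x. if x \<in> Q0 then 1 else 0) = m" if "m \<in> bcar N" for m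
  using ext[OF that, of "\<lambda>x. if x \<in> Q0 then 1 else 0" "\<lambda>_. 1"] cc[OF that, of 1]
   vsp_simps(4)[OF v] by auto
 have llin: "lmul N s (sum f I) = (\<Sum>x\<in>I. lmul N s (f x))" if "\<And>x. x \<in> I ==> f x \<in> bcar N" for s f and I :: "'i set"
  by (rule linear_on_sum[of "bscale N" "bscale N" "bcar N"]) (auto intro!: linear_onI v that simp: ladd lsc)
 show "m = (\<Sum>a\<in>Q0. \<Sum>b\<in>Q0. prj N a b m)" if m: "m \<in> bcar N"
 proof -
  have "(\<Sum>a\<in>Q0. \<Sum>b\<in>Q0. prj N a b m) = (\<Sum>a\<in>Q0. lmul N (single a 1) (\<Sum>b\<in>Q0. rmul N m (single b 1)))"
   using m cl by (simp add: prj_def llin)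
  then show ?thesis using sum1[OF _ Q0] one m cl by simp
 qed
qed

locale gbimod = gset_action C for C :: "('g, 'i) gset" +
 fixes N :: "('g, 'i, 'k::field, 'm::ab_group_add) bimod"
 assumes gb: "is_gbimod C N"
begin

lemma bim: "is_bimod (pts C) N" using gb by (simp add: is_gbimod_def)

lemmas bcar_vsp = bimod_vsp[OF bim finite_pts]
 and bcar_fin = bimod_fin[OF bim finite_pts]
 and prj_linear = bimod_prj_linear[OF bim finite_pts]
 and prj_in = bimod_prj_in[OF bim finite_pts]
 and prj_prj = bimod_prj_prj[OF bim finite_pts]
 and prj_sum = bimod_prj_sum[OF bim finite_pts]

lemmas bsc = vsp_simps[OF bcar_vsp]

lemma bcomp_prj: "bcomp N i j = prj N i j ` bcar N" by (simp add: bcomp_def prj_def)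

lemma bcomp_iff: "m \<in> bcomp N i j \<longleftrightarrow> m \<in> bcar N \<and> prj N i j m = m"
 using prj_in prj_prj by (auto simp: bcomp_prj) (metis imageI)

lemma bcomp_bcar: "bcomp N i j \<subseteq> bcar N" by (auto simp: bcomp_iff)

lemma bcomp_vsp: "vsp (bscale N) (bcomp N i j)"
 unfolding bcomp_prj by (rule vsp_image[OF prj_linear bcar_vsp vsp_vs[OF bcar_vsp]])

lemma bcomp_fin: "fin_dim (bscale N) (bcomp N i j)" by (rule fin_dim_subspace[OF bcomp_vsp bcar_fin bcomp_bcar])

lemma bact_in: "g \<in> Gr ==> m \<in> bcar N ==> bact N g m \<in> bcar N"
 and bact_linear: "g \<in> Gr ==> linear_on (bscale N) (bscale N) (bcar N) (bact N g)"
 and bact_one: "m \<in> bcar N ==> bact N e m = m"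
 and bact_mult: "g \<in> Gr ==> h \<in> Gr ==> m \<in> bcar N ==> bact N (g \<cdot> h) m = bact N g (bact N h m)"
 and bact_image: "g \<in> Gr ==> i \<in> pts C ==> j \<in> pts C ==> bact N g ` bcomp N i j = bcomp N (pact C g i) (pact C g j)"
 using gb by (auto simp: is_gbimod_def)

lemma bact_bcomp: "g \<in> Gr ==> i \<in> pts C ==> j \<in> pts C ==> m \<in> bcomp N i j ==>
  bact N g m \<in> bcomp N (pact C g i) (pact C g j)" using bact_image by blast

lemma bact_inv: "g \<in> Gr ==> m \<in> bcar N ==> bact N g (bact N (iv g) m) = m"
 "g \<in> Gr ==> m \<in> bcar N ==> bact N (iv g) (bact N g m) = m" by (simp_all flip: bact_mult add: bact_one)

text \<open>The hypothesis on the action says only that g permutes the components. Applying g to the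
  decomposition of m into its components turns this into compatibility with the projections, since g
  is injective on the points.\<close>

lemma bact_prj:
 assumes g: "g \<in> Gr" and ij: "i \<in> pts C" "j \<in> pts C" and m: "m \<in> bcar N"
 shows "prj N (pact C g i) (pact C g j) (bact N g m) = bact N g (prj N i j m)"
proof -
 have "bact N g m = bact N g (\<Sum>a\<in>pts C. \<Sum>b\<in>pts C. prj N a b m)" using prj_sum[OF m] by simp
 also have "\<dots> = (\<Sum>a\<in>pts C. \<Sum>b\<in>pts C. bact N g (prj N a b m))"
  using prj_in[OF m] by (simp add: linear_on_sum[OF bact_linear[OF g] bcar_vsp] vsp_sum[OF bcar_vsp])
 also have "prj N (pact C g i) (pact C g j) \<dots> =
   (\<Sum>a\<in>pts C. \<Sum>b\<in>pts C. prj N (pact C g i) (pact C g j) (bact N g (prj N a b m)))"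
  using bact_in[OF g prj_in[OF m]] by (simp add: linear_on_sum[OF prj_linear bcar_vsp] vsp_sum[OF bcar_vsp])
 also have "\<dots> = (\<Sum>a\<in>pts C. \<Sum>b\<in>pts C. if a = i \<and> b = j then bact N g (prj N a b m) else 0)"
 proof (intro sum.cong refl)
  fix a b assume ab: "a \<in> pts C" "b \<in> pts C"
  have "bact N g (prj N a b m) \<in> bcomp N (pact C g a) (pact C g b)"
   using m by (intro bact_bcomp g ab) (auto simp: bcomp_prj)
  then have x: "bact N g (prj N a b m) = prj N (pact C g a) (pact C g b) (bact N g (prj N a b m))"
   "bact N g (prj N a b m) \<in> bcar N" by (auto simp: bcomp_iff)
  show "prj N (pact C g i) (pact C g j) (bact N g (prj N a b m)) = (if a = i \<and> b = j then bact N g (prj N a b m) else 0)"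
   using prj_prj[OF x(2), of "pact C g i" "pact C g j" "pact C g a" "pact C g b"] x(1) pact_inj[OF g] ab ij by auto
 qed
 also have "\<dots> = (\<Sum>a\<in>pts C. if a = i then bact N g (prj N i j m) else 0)"
  by (intro sum.cong refl) (use finite_pts ij in \<open>auto simp: if_distrib cong: if_cong\<close>)
 also have "\<dots> = bact N g (prj N i j m)" using finite_pts ij by simp
 finally show ?thesis .
qed

subsection \<open>The dual bimodule\<close>

lemma dual_sel:
 "bcar (dual C N) = {\<phi>. linear_on (bscale N) (*) (bcar N) \<phi> \<and> (\<forall>m. m \<notin> bcar N \<longrightarrow> \<phi> m = 0)}"
 "bscale (dual C N) = pw (*)"
 "lmul (dual C N) s \<phi> = (\<lambda>m. if m \<in> bcar N then \<phi> (rmul N m s) else 0)"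
 "rmul (dual C N) \<phi> s = (\<lambda>m. if m \<in> bcar N then \<phi> (lmul N s m) else 0)"
 "bact (dual C N) g \<phi> = (\<lambda>m. if m \<in> bcar N then \<phi> (bact N (iv g) m) else 0)" by (simp_all add: dual_def)

lemma dual_linear: "\<phi> \<in> bcar (dual C N) ==> linear_on (bscale N) (*) (bcar N) \<phi>"
 and dual_out: "\<phi> \<in> bcar (dual C N) ==> m \<notin> bcar N ==> \<phi> m = 0" by (auto simp: dual_sel)

lemma dualI: "linear_on (bscale N) (*) (bcar N) \<phi> ==> (\<lambda>m. if m \<in> bcar N then \<phi> m else 0) \<in> bcar (dual C N)"
 by (auto simp: dual_sel linear_on_def vsp_add[OF bcar_vsp] vsp_scale[OF bcar_vsp])

lemma dual_prj:
 assumes "\<phi> \<in> bcar (dual C N)"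
 shows "prj (dual C N) i j \<phi> = (\<lambda>m. if m \<in> bcar N then \<phi> (prj N j i m) else 0)"
proof -
 have "rmul N m (single i 1) \<in> bcar N" "lmul N (single j 1) (rmul N m (single i 1)) \<in> bcar N" if "m \<in> bcar N" for m
  using bim that by (auto simp: is_bimod_def)
 then show ?thesis by (auto simp: prj_def dual_sel fun_eq_iff)
qed

lemma dual_bimod: "is_bimod (pts C) (dual C N)"
proof -
 note n = bim[unfolded is_bimod_def]
 have cl: "lmul N s m \<in> bcar N" "rmul N m s \<in> bcar N" if "m \<in> bcar N" for s m using n that by auto
 have ladd: "lmul N s (m + m') = lmul N s m + lmul N s m'" "rmul N (m + m') s = rmul N m s + rmul N m' s"
  if "m \<in> bcar N" "m' \<in> bcar N" for s m m' using n that by auto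
 have sadd: "lmul N (s + s') m = lmul N s m + lmul N s' m" "rmul N m (s + s') = rmul N m s + rmul N m s'"
  if "m \<in> bcar N" for s s' m using n that by auto
 have sm: "lmul N (s * s') m = lmul N s (lmul N s' m)" "rmul N m (s * s') = rmul N (rmul N m s) s'"
  if "m \<in> bcar N" for s s' m using n that by auto
 have comm: "rmul N (lmul N s m) s' = lmul N s (rmul N m s')" if "m \<in> bcar N" for s s' m using n that by auto
 have cc: "lmul N (\<lambda>_. c) m = bscale N c m" "rmul N m (\<lambda>_. c) = bscale N c m" if "m \<in> bcar N" for c m
  using n that by auto
 have ext: "lmul N s m = lmul N s' m" "rmul N m s = rmul N m s'" if "m \<in> bcar N" "\<forall>i\<in>pts C. s i = s' i" for s s' m
  using n that by auto
 have mc: "s * s' = s' * (s :: 'i => 'k)" for s s' by (simp add: fun_eq_iff mult.commute)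
 have lsc: "lmul N s (bscale N c m) = bscale N c (lmul N s m)" if m: "m \<in> bcar N" for s c m
  using sm(1)[OF m, of s "\<lambda>_. c"] sm(1)[OF m, of "\<lambda>_. c" s] mc[of s "\<lambda>_. c"] cc m cl by simp
 have rsc: "rmul N (bscale N c m) s = bscale N c (rmul N m s)" if m: "m \<in> bcar N" for s c m
  using sm(2)[OF m, of s "\<lambda>_. c"] sm(2)[OF m, of "\<lambda>_. c" s] mc[of s "\<lambda>_. c"] cc m cl by simp
 have llin: "linear_on (bscale N) (bscale N) (bcar N) (lmul N s)" for s by (rule linear_onI) (simp_all add: ladd lsc)
 have rlin: "linear_on (bscale N) (bscale N) (bcar N) (\<lambda>m. rmul N m s)" for s
  by (rule linear_onI) (simp_all add: ladd rsc)
 have v: "vsp (pw (*)) (bcar (dual C N))"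
  by (rule vspI[OF vector_space_pw_mult]) (auto simp: dual_sel linear_on_def pw_def algebra_simps)
 interpret K: vector_space "(*) :: 'k => 'k => 'k" by (rule vector_space_mult)
 have u: "vsp (*) (UNIV :: 'k set)" by (rule vspI[OF vector_space_mult]) auto
 have "K.span {1} = UNIV" by (auto simp: K.span_singleton image_def)
 then have "fin_dim (*) (UNIV :: 'k set)" unfolding fin_dim_def by blast
 then have fin: "fin_dim (pw (*)) (bcar (dual C N))"
  by (rule fin_dim_linear_maps[OF bcar_vsp bcar_fin u _ v]) (use dual_linear dual_out in auto)
 show ?thesis unfolding is_bimod_def
 proof (intro conjI allI ballI impI, goal_cases)
  case 1 show ?case using v by (simp add: dual_sel vsp_def)
 next
  case 2 show ?case using v unfolding dual_sel(2) by (simp add: vsp_def)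
 next
  case 3 show ?case using fin unfolding dual_sel(2) .
 next
  case (4 s \<phi>)
  have "linear_on (bscale N) (*) (bcar N) (\<lambda>m. \<phi> (rmul N m s))"
   using cl by (intro linear_on_comp[OF rlin dual_linear[OF 4]]) auto
  from dualI[OF this] show ?case by (simp add: dual_sel(3))
 next
  case (5 s \<phi>)
  have "linear_on (bscale N) (*) (bcar N) (\<lambda>m. \<phi> (lmul N s m))"
   using cl by (intro linear_on_comp[OF llin dual_linear[OF 5]]) auto
  from dualI[OF this] show ?case by (simp add: dual_sel(4))
 next
  case (6 s m m') show ?case by (auto simp: dual_sel fun_eq_iff)
 next
  case (7 s m m') show ?case by (auto simp: dual_sel fun_eq_iff)
 next
  case (8 s s' \<phi>)
  show ?case using cl linear_on_add[OF dual_linear[OF 8]] by (auto simp: dual_sel(3) fun_eq_iff sadd)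
 next
  case (9 s s' \<phi>)
  show ?case using cl linear_on_add[OF dual_linear[OF 9]] by (auto simp: dual_sel(4) fun_eq_iff sadd)
 next
  case (10 s s' \<phi>)
  show ?case using cl by (auto simp: dual_sel(3) fun_eq_iff simp flip: sm) 
 next
  case (11 s s' \<phi>)
  show ?case using cl mc[of s s'] by (auto simp: dual_sel(4) fun_eq_iff simp flip: sm)
 next
  case (12 s s' \<phi>)
  show ?case using cl comm by (auto simp: dual_sel(3,4) fun_eq_iff)
 next
  case (13 c \<phi>)
  show ?case using cc linear_on_scale[OF dual_linear[OF 13]] dual_out[OF 13]
   by (auto simp: dual_sel(2,3) pw_def fun_eq_iff)
 next
  case (14 c \<phi>)
  show ?case using cc linear_on_scale[OF dual_linear[OF 14]] dual_out[OF 14]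
   by (auto simp: dual_sel(2,4) pw_def fun_eq_iff)
 next
  case (15 s s' \<phi>)
  then show ?case using ext(2)[of _ s s'] by (auto simp: dual_sel(3) fun_eq_iff)
 next
  case (16 s s' \<phi>)
  then show ?case using ext(1)[of _ s s'] by (auto simp: dual_sel(4) fun_eq_iff)
 qed
qed

lemma dual_bact_in:
 assumes "g \<in> Gr" "\<phi> \<in> bcar (dual C N)"
 shows "bact (dual C N) g \<phi> \<in> bcar (dual C N)"
proof -
 have "linear_on (bscale N) (*) (bcar N) (\<lambda>m. \<phi> (bact N (iv g) m))"
  using assms bact_in by (intro linear_on_comp[OF bact_linear dual_linear[OF assms(2)]]) auto
 from dualI[OF this] show ?thesis by (simp add: dual_sel(5))
qed

lemma dual_bact_apply: "m \<in> bcar N ==> bact (dual C N) g \<phi> m = \<phi> (bact N (iv g) m)" by (simp add: dual_sel(5))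

lemma dual_bact_one: "\<phi> \<in> bcar (dual C N) ==> bact (dual C N) e \<phi> = \<phi>"
 by (auto simp: dual_sel(5) fun_eq_iff bact_one dual_out)

lemma dual_bact_mult: "g \<in> Gr ==> h \<in> Gr ==> bact (dual C N) (g \<cdot> h) \<phi> = bact (dual C N) g (bact (dual C N) h \<phi>)"
 by (auto simp: dual_sel(5) fun_eq_iff bact_in inv_mult_group bact_mult)

lemma dual_bact_bcomp:
 assumes g: "g \<in> Gr" and ij: "i \<in> pts C" "j \<in> pts C" and \<phi>: "\<phi> \<in> bcomp (dual C N) i j"
 shows "bact (dual C N) g \<phi> \<in> bcomp (dual C N) (pact C g i) (pact C g j)"
proof -
 from \<phi> obtain \<phi>0 where \<phi>0: "\<phi>0 \<in> bcar (dual C N)" "\<phi> = prj (dual C N) i j \<phi>0" by (auto simp: bcomp_def prj_def)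
 have "bact (dual C N) g \<phi> = prj (dual C N) (pact C g i) (pact C g j) (bact (dual C N) g \<phi>0)"
 proof (rule ext)
  fix m
  have *: "bact N (iv g) (prj N (pact C g j) (pact C g i) m) = prj N j i (bact N (iv g) m)" if "m \<in> bcar N"
   using bact_prj[of "iv g" "pact C g j" "pact C g i" m] g ij that pact_pts by (simp add: pact_one flip: pact_mult)
  show "bact (dual C N) g \<phi> m = prj (dual C N) (pact C g i) (pact C g j) (bact (dual C N) g \<phi>0) m"
   using g * unfolding \<phi>0(2) dual_prj[OF \<phi>0(1)] dual_prj[OF dual_bact_in[OF g \<phi>0(1)]]
   by (auto simp: dual_sel(5) bact_in prj_in)
 qed
 then show ?thesis using dual_bact_in[OF g \<phi>0(1)] by (auto simp: bcomp_def prj_def)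
qed

lemma dual_gbimod: "is_gbimod C (dual C N)" unfolding is_gbimod_def
proof (intro conjI ballI allI, goal_cases)
 case 1 show ?case by (rule dual_bimod)
next
 case (2 g) then show ?case using dual_bact_in by auto
next
 case (3 g) show ?case by (rule linear_onI) (auto simp: dual_sel pw_def fun_eq_iff)
next
 case (4 \<phi>) then show ?case by (rule dual_bact_one)
next
 case (5 g h \<phi>) then show ?case by (simp add: dual_bact_mult)
next
 case (6 g i j)
 show ?case
 proof
  show "bact (dual C N) g ` bcomp (dual C N) i j \<subseteq> bcomp (dual C N) (pact C g i) (pact C g j)"
   using dual_bact_bcomp[OF 6] by blast
  show "bcomp (dual C N) (pact C g i) (pact C g j) \<subseteq> bact (dual C N) g ` bcomp (dual C N) i j"
  proof
   fix \<phi> assume \<phi>: "\<phi> \<in> bcomp (dual C N) (pact C g i) (pact C g j)"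
   have p: "\<phi> \<in> bcar (dual C N)" using \<phi> dual_bimod finite_pts unfolding bcomp_def is_bimod_def by auto
   have "bact (dual C N) (iv g) \<phi> \<in> bcomp (dual C N) i j"
    using dual_bact_bcomp[OF inv_closed[OF 6(1)] pact_pts[OF 6(1,2)] pact_pts[OF 6(1,3)] \<phi>] 6
    by (simp add: pact_one flip: pact_mult)
   moreover have "\<phi> = bact (dual C N) g (bact (dual C N) (iv g) \<phi>)"
    using 6 p by (simp add: dual_bact_one flip: dual_bact_mult)
   ultimately show "\<phi> \<in> bact (dual C N) g ` bcomp (dual C N) i j" by blast
  qed
 qed
qed

subsection \<open>Bases of the components\<close>

text \<open>One basis is fixed for each pair of points, without any compatibility with G. Whenever a
  frame is moved, vectors have to be expanded anew in the basis of the new component.\<close>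

definition Bas :: "'i => 'i => 'm set" where
 "Bas i j = (SOME B. finite B \<and> B \<subseteq> bcomp N i j \<and> is_basis (bscale N) (bcomp N i j) B)"

text \<open>The values of \<open>coord\<close> off the span are uncontrolled, so this functional
  need not vanish on the other components; only its values on \<open>bcomp N i j\<close> are
  meaningful.\<close>

definition cof :: "'i => 'i => 'm => 'm => 'k" where
 "cof i j b = (\<lambda>m. if m \<in> bcar N then coord (bscale N) (Bas i j) b m else 0)"

lemma Bas: "finite (Bas i j)" "Bas i j \<subseteq> bcomp N i j" "is_basis (bscale N) (bcomp N i j) (Bas i j)"
proof -
 have "\<exists>B. finite B \<and> B \<subseteq> bcomp N i j \<and> is_basis (bscale N) (bcomp N i j) B"
  using fin_dim_basis[OF vsp_vs[OF bcomp_vsp] bcomp_fin, of i j] by metis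
 from someI_ex[OF this] show "finite (Bas i j)" "Bas i j \<subseteq> bcomp N i j" "is_basis (bscale N) (bcomp N i j) (Bas i j)"
  by (auto simp: Bas_def)
qed

lemma Bas_bcar: "b \<in> Bas i j ==> b \<in> bcar N" using Bas(2) bcomp_bcar by blast

lemma cof_dual: "cof i j b \<in> bcar (dual C N)"
 unfolding cof_def by (rule dualI[OF linear_imp_linear_on[OF coord_linear[OF vsp_vs[OF bcomp_vsp] Bas(3)]]])

lemma cof_expand:
 assumes "m \<in> bcomp N i j"
 shows "m = (\<Sum>b\<in>Bas i j. bscale N (cof i j b m) b)"
 using coord_expand[OF vsp_vs[OF bcomp_vsp] Bas(3,1) assms] bcomp_bcar[of i j] assms by (simp add: cof_def subset_iff)

lemma cof_basis: "b \<in> Bas i j ==> b' \<in> Bas i j ==> cof i j b b' = (if b' = b then 1 else 0)"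
 using coord_basis[OF vsp_vs[OF bcomp_vsp] Bas(3)] Bas_bcar by (auto simp: cof_def)

lemma dual_expand:
 assumes "\<psi> \<in> bcar (dual C N)" "m \<in> bcomp N i j"
 shows "\<psi> m = (\<Sum>b\<in>Bas i j. \<psi> b * cof i j b m)"
proof -
 have "\<psi> m = \<psi> (\<Sum>b\<in>Bas i j. bscale N (cof i j b m) b)" using cof_expand[OF assms(2)] by simp
 also have "\<dots> = (\<Sum>b\<in>Bas i j. cof i j b m * \<psi> b)"
  by (rule linear_on_combination[OF dual_linear[OF assms(1)] bcar_vsp]) (rule Bas_bcar)
 finally show ?thesis by (simp add: mult.commute)
qed

definition ev :: "'m => ('m => 'k) => 'k" where
 "ev m \<phi> = (if \<phi> \<in> bcar (dual C N) then \<phi> m else 0)"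

end

text \<open>Everything proved for a bimodule is available for \<open>N\<close> and, with prefix
  \<open>D\<close>, for its dual. Words over the dual carry elements of the bidual, which are
  supplied by \<open>ev\<close>.\<close>

locale gbimod_dual = gbimod C N + D: gbimod C "dual C N"
 for C :: "('g, 'i) gset" and N :: "('g, 'i, 'k::field, 'm::ab_group_add) bimod"

lemma (in gbimod) gbimod_dual: "gbimod_dual C N" by unfold_locales (rule dual_gbimod)

context gbimod_dual begin

lemma ev_dual: "m \<in> bcar N ==> ev m \<in> bcar (dual C (dual C N))"
 by (auto simp: D.dual_sel(1) ev_def linear_on_def vsp_add[OF D.bcar_vsp] vsp_scale[OF D.bcar_vsp])
   (auto simp: dual_sel(2) pw_def)

lemma bact_ev:
 assumes "g \<in> Gr" "m \<in> bcar N"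
 shows "bact (dual C (dual C N)) g (ev m) = ev (bact N g m)"
 using assms D.bact_in[of "iv g"] by (auto simp: D.dual_sel(5) ev_def fun_eq_iff dual_bact_apply)

lemma dual_bcomp_apply:
 assumes "\<phi> \<in> bcomp (dual C N) j i" "m \<in> bcar N"
 shows "\<phi> m = \<phi> (prj N i j m)" using assms dual_prj[of \<phi> j i] unfolding D.bcomp_iff by metis

text \<open>Components are finite-dimensional, so on a component of the dual every element of the
  bidual is evaluation at a vector.\<close>

lemma reflexive:
 assumes \<Psi>: "\<Psi> \<in> bcar (dual C (dual C N))"
 shows "\<exists>m\<in>bcomp N i j. \<forall>\<phi>\<in>bcomp (dual C N) j i. \<Psi> \<phi> = \<phi> m"
proof
 let ?\<beta> = "\<lambda>b. prj (dual C N) j i (cof i j b)"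
 \<comment> \<open>The coordinates of m are the values of \<open>\<Psi>\<close> at the dual basis,
   projected to the component because \<open>cof\<close> is not supported there.\<close>
 define m where "m = (\<Sum>b\<in>Bas i j. bscale N (\<Psi> (?\<beta> b)) b)"
 show "m \<in> bcomp N i j" unfolding m_def using Bas(2) by (intro vsp_sum[OF bcomp_vsp] vsp_scale[OF bcomp_vsp]) auto
 show "\<forall>\<phi>\<in>bcomp (dual C N) j i. \<Psi> \<phi> = \<phi> m"
 proof
  fix \<phi> assume \<phi>: "\<phi> \<in> bcomp (dual C N) j i"
  then have p: "\<phi> \<in> bcar (dual C N)" using D.bcomp_bcar by blast
  have "\<phi> = (\<Sum>b\<in>Bas i j. pw (*) (\<phi> b) (?\<beta> b))"
  proof (rule ext)
   fix x
   show "\<phi> x = (\<Sum>b\<in>Bas i j. pw (*) (\<phi> b) (?\<beta> b)) x"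
   proof (cases "x \<in> bcar N")
    case True
    have "\<phi> x = \<phi> (prj N i j x)" by (rule dual_bcomp_apply[OF \<phi> True])
    also have "\<dots> = (\<Sum>b\<in>Bas i j. \<phi> b * cof i j b (prj N i j x))"
     using True by (intro dual_expand[OF p]) (auto simp: bcomp_prj)
    finally show ?thesis using True by (simp add: sum_apply pw_def dual_prj[OF cof_dual])
   qed (use dual_out[OF p] in \<open>simp add: sum_apply pw_def dual_prj[OF cof_dual]\<close>)
  qed
  then have "\<Psi> \<phi> = \<Psi> (\<Sum>b\<in>Bas i j. bscale (dual C N) (\<phi> b) (?\<beta> b))" by (simp add: dual_sel(2))
  also have "\<dots> = (\<Sum>b\<in>Bas i j. \<phi> b * \<Psi> (?\<beta> b))"
   by (rule linear_on_combination[OF D.dual_linear[OF \<Psi>] D.bcar_vsp]) (rule D.prj_in[OF cof_dual])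
  also have "\<dots> = \<phi> m" unfolding m_def
   using linear_on_combination[OF dual_linear[OF p] bcar_vsp, of "Bas i j" "\<lambda>b. b"] Bas_bcar
   by (simp add: mult.commute)
  finally show "\<Psi> \<phi> = \<phi> m" .
 qed
qed

end

section \<open>Representations of stabilisers and words of functionals\<close>

lemma rep_vsp: "is_rep G H V ==> vsp (scal V) (space V)"
 and rep_fin: "is_rep G H V ==> fin_dim (scal V) (space V)"
 and rep_in: "is_rep G H V ==> h \<in> H ==> v \<in> space V ==> gact V h v \<in> space V"
 and rep_linear: "is_rep G H V ==> h \<in> H ==> linear_on (scal V) (scal V) (space V) (gact V h)"
 and rep_one: "is_rep G H V ==> v \<in> space V ==> gact V \<one>\<^bsub>G\<^esub> v = v"
 and rep_mult: "is_rep G H V ==> g \<in> H ==> h \<in> H ==> v \<in> space V ==>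
  gact V (g \<otimes>\<^bsub>G\<^esub> h) v = gact V g (gact V h v)" by (auto simp: is_rep_def vsp_def)

lemma (in gset_action) rep_inv:
 assumes "rep_at i V" "i \<in> pts C" "h \<in> stab C i" "v \<in> space V"
 shows "gact V (iv h) (gact V h v) = v" "gact V h (gact V (iv h) v) = v"
proof -
 have "h \<in> Gr" using stab_Gr[OF assms(3)] .
 then show "gact V (iv h) (gact V h v) = v" "gact V h (gact V (iv h) v) = v"
  using rep_mult[OF assms(1) assms(3) stab_inv[OF assms(2,3)] assms(4)]
   rep_mult[OF assms(1) stab_inv[OF assms(2,3)] assms(3,4)] rep_one[OF assms(1,4)] by simp_all
qed

context gbimod begin

abbreviation du :: "('g, 'i, 'k, 'm => 'k) bimod" where "du \<equiv> dual C N"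

text \<open>In a word \<open>(g\<^sub>1,\<psi>\<^sub>1)\<cdots>(g\<^sub>n,\<psi>\<^sub>n)\<close> the functional \<open>\<psi>\<^sub>t\<close> is given relative to the frame \<open>k g\<^sub>1\<cdots>g\<^bsub>t-1\<^esub>\<close>;
\<open>absl\<close> and \<open>absv\<close> translate functionals and vectors to the absolute frame.\<close>

fun absl :: "'g => ('g \<times> ('m => 'k)) list => ('m => 'k) list" where
 "absl k [] = []"
| "absl k ((g, \<psi>) # w) = bact du k \<psi> # absl (k \<cdot> g) w"

fun absv :: "'g => ('g \<times> 'm) list => 'm list" where
 "absv k [] = []"
| "absv k ((g, b) # w) = bact N k b # absv (k \<cdot> g) w"

text \<open>The functionals in a word are arbitrary elements of the dual, with no condition on their
  component: contraction evaluates them only on the component selected by the frame.\<close>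

definition vw :: "'i list => ('g \<times> ('m => 'k)) list => bool" where
 "vw is w \<longleftrightarrow> gseq is (map fst w) \<and> snd ` set w \<subseteq> bcar du"

lemma vw_Nil [simp]: "vw is [] \<longleftrightarrow> (\<exists>i\<in>pts C. is = [i])" by (simp add: vw_def)

lemma vw_Cons: "vw is ((g, \<psi>) # w) \<longleftrightarrow>
  (\<exists>i j is'. is = i # j # is' \<and> i \<in> pts C \<and> g \<in> Gr \<and> \<psi> \<in> bcar du \<and> vw (j # is') w)" by (auto simp: vw_def gseq_Cons)

lemma vw_Cons_simp [simp]: "vw (i # j # is) ((g, \<psi>) # w) \<longleftrightarrow> i \<in> pts C \<and> g \<in> Gr \<and> \<psi> \<in> bcar du \<and> vw (j # is) w"
 by (auto simp: vw_Cons)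

lemma vw_gseq: "vw is w ==> gseq is (map fst w)" by (simp add: vw_def)

lemma vw_pts: "vw is w ==> set is \<subseteq> pts C" and vw_ne: "vw is w ==> is \<noteq> []"
 and vw_length: "vw is w ==> length is = Suc (length w)" by (auto simp: vw_def gseq_def)

lemma gseq_single [simp]: "gseq [i] ys \<longleftrightarrow> i \<in> pts C \<and> ys = []" "\<not> gseq [] ys" by (auto simp: gseq_def)

lemma absl_dual: "k \<in> Gr ==> vw is w ==> set (absl k w) \<subseteq> bcar du"
proof (induction w arbitrary: k "is")
 case (Cons l w)
 obtain g \<psi> where l: "l = (g, \<psi>)" by force
 from Cons(3) obtain i j is' where "is = i # j # is'" "g \<in> Gr" "\<psi> \<in> bcar du" "vw (j # is') w"
  unfolding l by (auto simp: vw_Cons)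
 then show ?case using Cons.IH[of "k \<cdot> g" "j # is'"] Cons(2) by (simp add: l dual_bact_in)
qed simp

lemma absl_length [simp]: "length (absl k w) = length w" by (induction k w rule: absl.induct) auto

text \<open>The factors \<open>comps\<close> in a frame moved by k, written recursively along the
  sequence as inductions on words require.\<close>

fun compsK :: "'g => 'i list => 'g list => 'm set list" where
 "compsK k (i # j # is) (y # ys) = bcomp N (pact C k i) (pact C (k \<cdot> y) j) # compsK (k \<cdot> y) (j # is) ys"
| "compsK k is ys = []"

lemma compsK_eq:
 "gseq is ys ==> k \<in> Gr ==> compsK k is ys =
  map (\<lambda>t. bcomp N (pact C (k \<cdot> gprod C (take t ys)) (is ! t))
           (pact C (k \<cdot> gprod C (take (Suc t) ys)) (is ! Suc t))) [0..<length ys]"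
proof (induction k "is" ys rule: compsK.induct)
 case (1 k i j "is" y ys)
 have G: "gprod C (take t ys) \<in> Gr" for t using 1(2) set_take_subset[of t ys] by (intro gprod_Gr) (auto simp: gseq_def)
 have "k \<cdot> y \<in> Gr" using 1 by simp
 with 1 G show ?case by (auto simp: map_upt_Suc m_assoc simp del: upt_Suc)
qed (auto simp: gseq_Cons)

lemma comps_compsK: "gseq is ys ==> comps C N is ys = compsK e is ys"
proof -
 assume a: "gseq is ys"
 have G: "gprod C (take t ys) \<in> Gr" for t using a set_take_subset[of t ys] by (intro gprod_Gr) (auto simp: gseq_def)
 show ?thesis using a by (simp add: compsK_eq comps_def G)
qed

lemma compsK_bcomp: "D \<in> set (compsK k is ys) ==> \<exists>i j. D = bcomp N i j"
 by (induction k "is" ys rule: compsK.induct) auto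

lemma compsK_vsp: "D \<in> set (compsK k is ys) ==> vsp (bscale N) D"
 and compsK_bcar: "D \<in> set (compsK k is ys) ==> D \<subseteq> bcar N" using compsK_bcomp bcomp_vsp bcomp_bcar by metis+

lemma compsK_length: "gseq is ys ==> length (compsK k is ys) = length ys"
 by (induction k "is" ys rule: compsK.induct) (auto simp: gseq_Cons)

lemma listset_member: "ms \<in> listset Cs ==> x \<in> set ms ==> \<exists>D\<in>set Cs. x \<in> D"
proof (induction Cs arbitrary: ms)
 case (Cons D Cs)
 then obtain m ms' where "ms = m # ms'" "m \<in> D" "ms' \<in> listset Cs" by (auto simp: set_Cons_def)
 then show ?case using Cons.IH[of ms'] Cons.prems(2) by auto
qed simp

lemma absv_bcar: "gseq is (map fst w) ==> a \<in> Gr ==> snd ` set w \<subseteq> bcar N ==> set (absv a w) \<subseteq> bcar N"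
proof (induction w arbitrary: "is" a)
 case (Cons l w)
 obtain g b where l: "l = (g, b)" by force
 from Cons.prems(1) obtain i j is' where "is = i # j # is'" "g \<in> Gr" "gseq (j # is') (map fst w)"
  by (auto simp: gseq_Cons l)
 then show ?case using Cons.IH[of "j # is'" "a \<cdot> g"] Cons.prems by (simp add: l bact_in)
qed simp

text \<open>The factor spaces depend only on the cosets: passing to representatives drops stabiliser
  elements, and these fix the points in question.\<close>

lemma compsK_tr:
 "gseq is gs ==> k \<in> stab C (hd is) ==> a \<in> Gr ==> compsK (a \<cdot> k) is gs = compsK a is (fst (tr C is k gs))"
proof (induction arbitrary: a rule: tr_induct)
 case (Cons i j "is" k g gs y h)
 have 1: "pact C (a \<cdot> k) i = pact C a i" using Cons(1,4,5) Cons.prems stab_fix[OF Cons(4)] by (simp add: pact_mult)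
 have akg: "a \<cdot> k \<cdot> g = a \<cdot> y \<cdot> h" using Cons(5,6,10,12,13) Cons.prems by (simp add: m_assoc)
 have 2: "pact C (a \<cdot> k \<cdot> g) j = pact C (a \<cdot> y) j"
  unfolding akg using Cons(2,10,12) Cons.prems stab_fix[OF Cons(11)] by (simp add: pact_mult)
 have 3: "compsK (a \<cdot> y \<cdot> h) (j # is) gs = compsK (a \<cdot> y) (j # is) (fst (tr C (j # is) h gs))"
  using Cons.IH[of "a \<cdot> y"] Cons.prems Cons(10) by simp
 have 4: "fst (tr C (i # j # is) k (g # gs)) = y # fst (tr C (j # is) h gs)"
  using Cons(7,8) by (simp add: Let_def split: prod.splits)
 show ?case unfolding 4 using 1 2 3 akg by simp
qed simp

lemma compsK_map:
 "gseq is ys ==> k \<in> Gr ==> g \<in> Gr ==>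
  list_all2 (\<lambda>D D'. bact N g ` D \<subseteq> D' \<and> linear_on (bscale N) (bscale N) D (bact N g)) (compsK k is ys) (compsK (g \<cdot> k) is ys)"
proof (induction k "is" ys rule: compsK.induct)
 case (1 k i j "is" y ys)
 have j: "j \<in> pts C" using 1(2) by (auto simp: gseq_def)
 have "bact N g ` bcomp N (pact C k i) (pact C (k \<cdot> y) j) \<subseteq> bcomp N (pact C (g \<cdot> k) i) (pact C (g \<cdot> k \<cdot> y) j)"
  using 1 j bact_image[of g "pact C k i" "pact C (k \<cdot> y) j"] by (simp add: pact_mult pact_pts m_assoc)
 then show ?case using 1 linear_on_subset[OF bact_linear bcomp_bcar] by (simp add: m_assoc)
qed auto

lemma dual_list_all2:
 assumes "set \<psi>s \<subseteq> bcar du" "length \<psi>s = length Cs" "\<And>D. D \<in> set Cs ==> D \<subseteq> bcar N"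
 shows "list_all2 (\<lambda>\<psi> D. linear_on (bscale N) (*) D \<psi>) \<psi>s Cs" unfolding list_all2_conv_all_nth using assms(2)
 by (auto intro!: linear_on_subset[OF dual_linear] subsetD[OF assms(1)] assms(3))

lemma absl_multilinear:
 assumes "k \<in> Gr" "vw is w" "gseq is ys" "vsp sv V"
 shows "multilinear (bscale N) sv sv (compsK a is ys) V (\<lambda>ms v. sv (evl (absl k w) ms) v)"
 using evl_multilinear[OF dual_list_all2[OF absl_dual[OF assms(1,2)], of "compsK a is ys"] assms(4), of 1]
  assms(2,3) compsK_bcar by (simp add: compsK_length vw_def gseq_def)

text \<open>The evaluation of functionals at vectors is invariant when G acts on both.\<close>

lemma evl_absl_shift:
 "gseq is (map fst w) ==> g \<in> Gr ==> k \<in> Gr ==> set ms \<subseteq> bcar N ==> evl (absl (g \<cdot> k) w) (map (bact N g) ms) = evl (absl k w) ms"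
proof (induction w arbitrary: "is" k ms)
 case (Cons l w)
 obtain h \<psi> where l: "l = (h, \<psi>)" by force
 show ?case
 proof (cases ms)
  case (Cons m ms')
  obtain i j is' where "is = i # j # is'" "h \<in> Gr" "gseq (j # is') (map fst w)"
   using Cons.prems(1) l by (auto simp: gseq_Cons)
  then show ?thesis using Cons.IH[of "j # is'" "k \<cdot> h" ms'] Cons.prems Cons l
   by (simp add: dual_bact_apply bact_in m_assoc inv_mult_group bact_mult bact_inv)
 qed simp
qed simp

lemma absv_shift: "gseq is (map fst w) ==> a \<in> Gr ==> k \<in> Gr ==> snd ` set w \<subseteq> bcar N ==>
  absv (a \<cdot> k) w = map (bact N a) (absv k w)"
 by (induction w arbitrary: k "is") (auto simp: gseq_Cons bact_mult m_assoc)

subsection \<open>Expansion in bases\<close>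

text \<open>\<open>bw is ys\<close> lists the basis tensors of \<open>M\<^bsub>ys\<^esub>\<close> in relative frames, and \<open>star\<close> passes to the dual basis.\<close>

fun bw :: "'i list => 'g list => ('g \<times> 'm) list set" where
 "bw (i # j # is) (y # ys) = (\<lambda>(b, w). (y, b) # w) ` (Bas i (pact C y j) \<times> bw (j # is) ys)"
| "bw is ys = {[]}"

fun star :: "'i list => ('g \<times> 'm) list => ('g \<times> ('m => 'k)) list" where
 "star (i # j # is) ((y, b) # w) = (y, cof i (pact C y j) b) # star (j # is) w"
| "star is w = []"

lemma finite_bw: "finite (bw is ys)" by (induction "is" ys rule: bw.induct) (auto simp: Bas)

lemma sum_bw_Cons: "(\<Sum>w\<in>bw (i # j # is) (y # ys). f w) = (\<Sum>b\<in>Bas i (pact C y j). \<Sum>w\<in>bw (j # is) ys. f ((y, b) # w))"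
 by (simp add: sum.reindex inj_on_def sum.cartesian_product case_prod_beta)

lemma bw_props:
 assumes "w \<in> bw is ys" "gseq is ys"
 shows "map fst w = ys" "snd ` set w \<subseteq> bcar N" "vw is (star is w)" "map fst (star is w) = ys"
  "absv k w \<in> listset (compsK k is ys) \<or> k \<notin> Gr"
proof -
 have "map fst w = ys \<and> snd ` set w \<subseteq> bcar N \<and> vw is (star is w) \<and> map fst (star is w) = ys \<and>
  (k \<in> Gr \<longrightarrow> absv k w \<in> listset (compsK k is ys))" using assms
 proof (induction "is" ys arbitrary: w k rule: bw.induct)
  case (1 i j "is" y ys)
  then obtain b w' where w: "w = (y, b) # w'" "b \<in> Bas i (pact C y j)" "w' \<in> bw (j # is) ys" by auto
  have j: "j \<in> pts C" using 1(3) by (auto simp: gseq_def)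
  have "bact N k b \<in> bcomp N (pact C k i) (pact C (k \<cdot> y) j)" if "k \<in> Gr"
   using bact_bcomp[of k i "pact C y j" b] that w(2) Bas(2) 1(3) j by (auto simp: pact_mult pact_pts)
  then show ?case using 1(1)[OF w(3), of "k \<cdot> y"] 1(3) w Bas_bcar cof_dual
   by (auto simp: Cons_in_listset simp del: listset.simps)
 qed (auto simp: gseq_Cons)
 then show "map fst w = ys" "snd ` set w \<subseteq> bcar N" "vw is (star is w)" "map fst (star is w) = ys"
  "absv k w \<in> listset (compsK k is ys) \<or> k \<notin> Gr" by auto
qed

text \<open>Each factor is expanded in the translate by its frame of the chosen basis. The
  coefficients are collected in the last argument, so that the tail is again of the form required by
  the induction hypothesis.\<close>

lemma multilinear_bw_expand:
 assumes "gseq is ys" "k \<in> Gr" "vsp sv V" "vector_space sw" "multilinear (bscale N) sv sw (compsK k is ys) V F"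
  "ms \<in> listset (compsK k is ys)" "v \<in> V"
 shows "F ms v = (\<Sum>w\<in>bw is ys. F (absv k w) (sv (evl (absl k (star is w)) ms) v))" using assms
proof (induction "is" ys arbitrary: k F ms v rule: bw.induct)
 case (1 i j "is" y ys)
 note vs = vsp_simps[OF 1(4)]
 let ?D = "bcomp N (pact C k i) (pact C (k \<cdot> y) j)" and ?B = "Bas i (pact C y j)" and ?c = "cof i (pact C y j)"
 from 1(7) obtain m ms' where ms: "ms = m # ms'" "m \<in> ?D" "ms' \<in> listset (compsK (k \<cdot> y) (j # is) ys)"
  by (auto simp: set_Cons_def)
 have pts: "i \<in> pts C" "j \<in> pts C" "y \<in> Gr" "gseq (j # is) ys" using 1(2) by (auto simp: gseq_def)
 have ky: "k \<cdot> y \<in> Gr" using 1(3) pts by simp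
 have mc: "m \<in> bcar N" using ms bcomp_bcar by blast
 have m': "bact N (iv k) m \<in> bcomp N i (pact C y j)" using bact_bcomp[OF inv_closed[OF 1(3)] _ _ ms(2)] 1(3) pts
  by (simp add: pact_pts pact_mult[symmetric] pact_one m_assoc[symmetric])
 have ml: "multilinear (bscale N) sv sw (compsK (k \<cdot> y) (j # is) ys) V (\<lambda>ms. F (n # ms))" if "n \<in> ?D" for n
  using 1(6) that by (simp add: multilinear_Cons)
 have lin: "linear_on (bscale N) sw ?D (\<lambda>m. F (m # ms) v)" if "ms \<in> listset (compsK (k \<cdot> y) (j # is) ys)" "v \<in> V" for ms v
  using 1(6) that by (simp add: multilinear_Cons)
 have kb: "bact N k b \<in> ?D" if "b \<in> ?B" for b
  using bact_bcomp[OF 1(3) pts(1) pact_pts[OF pts(3,2)]] that Bas(2) 1(3) pts by (auto simp: pact_mult)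
 have "m = bact N k (bact N (iv k) m)" using 1(3) mc by (simp add: bact_inv)
 also have "bact N (iv k) m = (\<Sum>b\<in>?B. bscale N (?c b (bact N (iv k) m)) b)" by (rule cof_expand[OF m'])
 also have "bact N k \<dots> = (\<Sum>b\<in>?B. bscale N (?c b (bact N (iv k) m)) (bact N k b))"
  by (rule linear_on_combination[OF bact_linear[OF 1(3)] bcar_vsp Bas_bcar])
 finally have m_eq: "m = (\<Sum>b\<in>?B. bscale N (?c b (bact N (iv k) m)) (bact N k b))" .
 have "F ms v = (\<Sum>b\<in>?B. sw (?c b (bact N (iv k) m)) (F (bact N k b # ms') v))"
  unfolding ms(1) by (subst m_eq, rule linear_on_combination[OF lin[OF ms(3) 1(8)] bcomp_vsp kb])
 \<comment> \<open>Linearity in the vector argument moves the scalar from the value of F into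
   v.\<close>
 also have "\<dots> = (\<Sum>b\<in>?B. F (bact N k b # ms') (sv (?c b (bact N (iv k) m)) v))"
 proof (intro sum.cong refl)
  fix b assume "b \<in> ?B"
  then have "linear_on sv sw V (F (bact N k b # ms'))" using ml[OF kb] ms(3) by (auto simp: multilinear_def)
  from linear_on_scale[OF this 1(8)]
  show "sw (?c b (bact N (iv k) m)) (F (bact N k b # ms') v) = F (bact N k b # ms') (sv (?c b (bact N (iv k) m)) v)" by simp
 qed
 also have "\<dots> = (\<Sum>b\<in>?B. \<Sum>w\<in>bw (j # is) ys. F (bact N k b # absv (k \<cdot> y) w)
   (sv (evl (absl (k \<cdot> y) (star (j # is) w)) ms') (sv (?c b (bact N (iv k) m)) v)))"
  by (intro sum.cong refl 1(1)[OF pts(4) ky 1(4,5) ml ms(3)] kb vsp_scale[OF 1(4)] 1(8))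
 also have "\<dots> = (\<Sum>w\<in>bw (i # j # is) (y # ys). F (absv k w) (sv (evl (absl k (star (i # j # is) w)) ms) v))"
  unfolding sum_bw_Cons by (intro sum.cong refl) (simp add: ms(1) vs dual_bact_apply[OF mc] mult.commute)
 finally show ?case .
qed (auto simp: gseq_Cons vsp_simps[OF assms(3)])

subsection \<open>Contraction with words of functionals\<close>

definition ctr :: "'i list => ('g, 'k, 'v::ab_group_add) rep => 'g list => ('m => 'k) list => ('m, 'v, 'k) tens => 'v" where
 "ctr is V ys \<psi>s t = lift_M C N is V ys (\<lambda>ms v. scal V (evl \<psi>s ms) v) t"

text \<open>\<open>cw is V k w x\<close> contracts the component of \<open>x\<close> in the cosets of \<open>k g\<^sub>1\<cdots>g\<^sub>t\<close> with the functionals of \<open>w\<close>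
and rewrites the result from \<open>y\<^sub>1\<cdots>y\<^sub>n \<otimes> V\<close> to \<open>k g\<^sub>1\<cdots>g\<^sub>n \<otimes> V\<close>; the value does not depend on the coset representatives.\<close>

definition cw :: "'i list => ('g, 'k, 'v::ab_group_add) rep => 'g => ('g \<times> ('m => 'k)) list
  => ('g list => ('m, 'v, 'k) tens) => 'v" where
 "cw is V k w x = (case tr C is k (map fst w) of (ys, h) => gact V (iv h) (ctr is V ys (absl k w) (x ys)))"

text \<open>Only the first letter changes: the later functionals are relative to the frame produced
  by the preceding letters, which is translated with it.\<close>

definition lact :: "'g => ('g \<times> ('m => 'k)) list => ('g \<times> ('m => 'k)) list" where
 "lact h w = (case w of [] => [] | (g, \<psi>) # w' => (h \<cdot> g, bact du h \<psi>) # w')"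

lemma lact_simps [simp]: "lact h [] = []" "lact h ((g, \<psi>) # w) = (h \<cdot> g, bact du h \<psi>) # w" by (simp_all add: lact_def)

abbreviation tsp :: "'i list => ('g, 'k, 'v::ab_group_add) rep => 'g list => ('m, 'v, 'k) tens set" where
 "tsp is V ys \<equiv> tensor (bscale N) (scal V) (comps C N is ys) (space V)"

lemma tensor_space: "vsp (scal V) (space V) ==> tensor_space (scal V) (space V)" by (rule tensor_space.intro)

lemma ctr_multilinear:
 assumes "k \<in> Gr" "vw is w" "gseq is ys" "vsp (scal V) (space V)"
 shows "multilinear (bscale N) (scal V) (scal V) (comps C N is ys) (space V) (\<lambda>ms v. scal V (evl (absl k w) ms) v)"
 using absl_multilinear[OF assms] assms(3) by (simp add: comps_compsK)

lemma
 assumes "k \<in> Gr" "vw is w" "gseq is ys" "vsp (scal V) (space V)"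
 shows ctr_linear: "linear_on (pw (*)) (scal V) (tsp is V ys) (ctr is V ys (absl k w))"
  and ctr_pure: "ms \<in> listset (comps C N is ys) ==> v \<in> space V ==>
   ctr is V ys (absl k w) (pure_M C N is V ys ms v) = scal V (evl (absl k w) ms) v"
  and ctr_in: "t \<in> tsp is V ys ==> ctr is V ys (absl k w) t \<in> space V"
proof -
 interpret tensor_space "bscale N" "scal V" "comps C N is ys" "space V" by (rule tensor_space[OF assms(4)])
 note m = ctr_multilinear[OF assms] and vs = vsp_vs[OF assms(4)]
 show "linear_on (pw (*)) (scal V) (tsp is V ys) (ctr is V ys (absl k w))"
  unfolding ctr_def using lift_linear[OF vs m] .
 show "ctr is V ys (absl k w) (pure_M C N is V ys ms v) = scal V (evl (absl k w) ms) v"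
  if "ms \<in> listset (comps C N is ys)" "v \<in> space V" unfolding ctr_def using lift_pure[OF vs m that] .
 show "ctr is V ys (absl k w) t \<in> space V" if "t \<in> tsp is V ys"
  unfolding ctr_def by (rule lift_in[OF assms(4) m _ that]) (rule vsp_scale[OF assms(4)])
qed

text \<open>The resolution of the identity by dual bases: contraction with \<open>star is w\<close>
  reads off the coefficient in V of the basis tensor w.\<close>

lemma tensor_expand:
 assumes "gseq is ys" "vsp (scal V) (space V)" "t \<in> tsp is V ys"
 shows "t = (\<Sum>w\<in>bw is ys. pure_M C N is V ys (absv e w) (ctr is V ys (absl e (star is w)) t))"
proof -
 interpret tensor_space "bscale N" "scal V" "comps C N is ys" "space V" by (rule tensor_space[OF assms(2)])
 note pm = tpure_multilinear[of _ "comps C N is ys" _ "space V" "bscale N" "scal V"]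
 have ab: "absv e w \<in> listset (comps C N is ys)" "vw is (star is w)" if "w \<in> bw is ys" for w
  using bw_props[OF that assms(1)] by (auto simp: comps_compsK[OF assms(1)])
 show ?thesis
 proof (rule tensor_eqI[OF _ _ _ assms(3), where sw = "pw (*)"], goal_cases)
  case 1 show ?case by (simp add: linear_on_def)
 next
  case 2
  have "linear_on (pw (*)) (pw (*)) (tsp is V ys) (\<lambda>t. pure_M C N is V ys (absv e w) (ctr is V ys (absl e (star is w)) t))"
   if "w \<in> bw is ys" for w
  proof (rule linear_on_comp[OF ctr_linear[OF one_closed ab(2)[OF that] assms(1,2)]])
   show "linear_on (scal V) (pw (*)) (space V) (pure_M C N is V ys (absv e w))"
    using pm[OF ab(1)[OF that] vsp_0[OF assms(2)]] ab(1)[OF that] unfolding multilinear_def by blast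
  qed (use ctr_in[OF one_closed ab(2)[OF that] assms(1,2)] in auto)
  then show ?case unfolding linear_on_def by (auto simp: sum.distrib vs_simps[OF vs_pw3(1)] intro!: sum.cong)
 next
  case (3 ms v)
  have "pure_M C N is V ys ms v = (\<Sum>w\<in>bw is ys. pure_M C N is V ys (absv e w) (scal V (evl (absl e (star is w)) ms) v))"
   using multilinear_bw_expand[OF assms(1) one_closed assms(2) vs_pw3(1), of "pure_M C N is V ys" ms v] pm[OF 3] 3
   by (simp add: comps_compsK[OF assms(1)])
  also have "\<dots> = (\<Sum>w\<in>bw is ys. pure_M C N is V ys (absv e w) (ctr is V ys (absl e (star is w)) (pure_M C N is V ys ms v)))"
   by (intro sum.cong refl) (simp add: ctr_pure[OF one_closed ab(2) assms(1,2) 3])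
  finally show ?case .
 qed
qed

lemma Mspace_tensor: "x \<in> Mspace C N is V ==> ys \<in> yseqs C is ==> x ys \<in> tsp is V ys"
 and Mspace_out: "x \<in> Mspace C N is V ==> ys \<notin> yseqs C is ==> x ys = 0" by (auto simp: Mspace_def)

lemma Mspace_vsp:
 assumes "vsp (scal V) (space V)"
 shows "vsp (pw (pw (*))) (Mspace C N is V)"
proof -
 have t: "vsp (pw (*)) (tsp is V ys)" for ys using tensor_space.tensor_vsp[OF tensor_space[OF assms]] .
 show ?thesis by (rule vspI[OF vs_pw3(2)])
   (auto simp: Mspace_def vsp_0[OF t] vsp_add[OF t] vsp_scale[OF t] pw_def[of "pw (*)"]
    vs_simps[OF vs_pw3(1)])
qed

lemma
 assumes w: "vw is w" and V: "rep_at (last is) V" and k: "k \<in> stab C (hd is)"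
 shows cw_linear: "linear_on (pw (pw (*))) (scal V) (Mspace C N is V) (cw is V k w)"
  and cw_in: "x \<in> Mspace C N is V ==> cw is V k w x \<in> space V"
proof -
 obtain ys h where t: "tr C is k (map fst w) = (ys, h)" by force
 note p = tr_props[OF vw_gseq[OF w] k t]
 have g: "gseq is ys" by (rule yseqs_gseq[OF vw_pts[OF w] p(1)])
 have last: "last is \<in> pts C" using vw_pts[OF w] vw_ne[OF w] by auto
 have h: "iv h \<in> stab C (last is)" by (rule stab_inv[OF last p(2)])
 note c = ctr_linear[OF stab_Gr[OF k] w g rep_vsp[OF V]] and ci = ctr_in[OF stab_Gr[OF k] w g rep_vsp[OF V]]
 have 1: "linear_on (pw (pw (*))) (scal V) (Mspace C N is V) (\<lambda>x. ctr is V ys (absl k w) (x ys))"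
  by (rule linear_on_comp[OF _ c, where f = "\<lambda>x. x ys"])
    (use p(1) in \<open>auto simp: linear_on_def pw_def[of "pw (*)"] Mspace_def\<close>)
 have 2: "ctr is V ys (absl k w) (x ys) \<in> space V" if "x \<in> Mspace C N is V" for x
  by (rule ci[OF Mspace_tensor[OF that p(1)]])
 show "linear_on (pw (pw (*))) (scal V) (Mspace C N is V) (cw is V k w)"
  unfolding cw_def t using linear_on_comp[OF 1 rep_linear[OF V h]] 2 by auto
 show "cw is V k w x \<in> space V" if "x \<in> Mspace C N is V" unfolding cw_def t using rep_in[OF V h 2[OF that]] by simp
qed

lemma Mspace_expand:
 assumes x: "x \<in> Mspace C N is V" and V: "rep_at (last is) V" and pts: "set is \<subseteq> pts C"
  and ys: "ys \<in> yseqs C is"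
 shows "x ys = (\<Sum>w\<in>bw is ys. pure_M C N is V ys (absv e w) (cw is V e (star is w) x))"
proof -
 have g: "gseq is ys" by (rule yseqs_gseq[OF pts ys])
 have last: "last is \<in> pts C" using pts gseq_ne[OF g] by auto
 have "cw is V e (star is w) x = ctr is V ys (absl e (star is w)) (x ys)" if "w \<in> bw is ys" for w
 proof -
  have "ctr is V ys (absl e (star is w)) (x ys) \<in> space V"
   using ctr_in[OF one_closed bw_props(3)[OF that g] g rep_vsp[OF V] Mspace_tensor[OF x ys]] .
  then show ?thesis using bw_props(4)[OF that g] rep_one[OF V] by (simp add: cw_def tr_yseqs[OF pts ys])
 qed
 then show ?thesis using tensor_expand[OF g rep_vsp[OF V] Mspace_tensor[OF x ys]] by simp
qed

text \<open>Contractions separate the elements of M(i;V) by \<open>Mspace_expand\<close>. Through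
  this principle identities between families of tensors are proved as identities in V.\<close>

lemma cw_eqI:
 assumes x: "x \<in> Mspace C N is V" "x' \<in> Mspace C N is V" and V: "rep_at (last is) V"
  and pts: "set is \<subseteq> pts C" and eq: "\<And>w. vw is w ==> cw is V e w x = cw is V e w x'"
 shows "x = x'"
proof (rule ext)
 fix ys
 show "x ys = x' ys"
 proof (cases "ys \<in> yseqs C is")
  case True
  then show ?thesis using Mspace_expand[OF x(1) V pts True] Mspace_expand[OF x(2) V pts True]
   eq bw_props(3)[OF _ yseqs_gseq[OF pts True]] by (simp cong: sum.cong)
 qed (use x in \<open>auto simp: Mspace_def\<close>)
qed

subsection \<open>The action in terms of contractions\<close>

lemma Maction_term:
 assumes ys: "gseq is ys" and g: "g \<in> stab C (hd is)" and t: "tr C is g ys = (ys', h)"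
  and V: "rep_at (last is) V"
 shows "multilinear (bscale N) (scal V) (pw (*)) (comps C N is ys) (space V)
   (\<lambda>ms v. pure_M C N is V ys' (map (bact N g) ms) (gact V h v))" (is ?m)
  and "ms \<in> listset (comps C N is ys) ==> map (bact N g) ms \<in> listset (comps C N is ys')"
proof -
 note p = tr_props[OF ys g t]
 have ys': "gseq is ys'" using yseqs_gseq[OF _ p(1)] ys by (simp add: gseq_def)
 have G: "g \<in> Gr" by (rule stab_Gr[OF g])
 have l: "list_all2 (\<lambda>D D'. bact N g ` D \<subseteq> D' \<and> linear_on (bscale N) (bscale N) D (bact N g)) (comps C N is ys) (comps C N is ys')"
  using compsK_map[OF ys one_closed G] compsK_tr[OF ys g one_closed] t G
  by (simp add: comps_compsK[OF ys] comps_compsK[OF ys'])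
 show in': "map (bact N g) ms \<in> listset (comps C N is ys')" if "ms \<in> listset (comps C N is ys)" for ms
  by (rule listset_map[OF that list_all2_mono[OF l]]) auto
 show ?m
 proof (cases "listset (comps C N is ys) = {}")
  case True
  then show ?thesis by (simp add: multilinear_def)
 next
  case False
  then obtain ms where ms: "ms \<in> listset (comps C N is ys)" by auto
  show ?thesis
   by (rule multilinear_compose_map[OF l _ rep_linear[OF V p(2)] tpure_multilinear[OF in'[OF ms] vsp_0[OF rep_vsp[OF V]]]])
     (use rep_in[OF V p(2)] in auto)
 qed
qed

text \<open>Transport by g is injective on the index set, so a single term of the defining sum
  contributes to a given component.\<close>

lemma Maction_apply:
 assumes pts: "set is \<subseteq> pts C" "is \<noteq> []" and g: "g \<in> stab C (hd is)" and ys: "ys \<in> yseqs C is"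
  and t: "tr C is g ys = (ys', h)"
 shows "Maction C N is V g x ys' =
  lift_M C N is V ys (\<lambda>ms v. pure_M C N is V ys' (map (bact N g) ms) (gact V h v)) (x ys)"
proof -
 have "Maction C N is V g x ys' = (\<Sum>zs\<in>yseqs C is. (case transport C is g zs of (ys', h) => single ys' (lift_M C N is V zs
     (\<lambda>ms v. pure_M C N is V ys' (map (bact N g) ms) (gact V h v)) (x zs))) ys')"
  by (subst Maction_def) (rule sum_apply)
 also have "\<dots> = (\<Sum>zs\<in>yseqs C is. if zs = ys then
   lift_M C N is V ys (\<lambda>ms v. pure_M C N is V ys' (map (bact N g) ms) (gact V h v)) (x ys) else 0)"
 proof (intro sum.cong refl)
  fix zs assume zs: "zs \<in> yseqs C is"
  obtain zs' h' where t': "tr C is g zs = (zs', h')" by force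
  have "ys' = zs' \<longleftrightarrow> zs = ys" using tr_inj[OF pts g zs ys] t t' by auto
  then show "(case transport C is g zs of (ys', h) => single ys' (lift_M C N is V zs
     (\<lambda>ms v. pure_M C N is V ys' (map (bact N g) ms) (gact V h v)) (x zs))) ys' =
   (if zs = ys then lift_M C N is V ys (\<lambda>ms v. pure_M C N is V ys' (map (bact N g) ms) (gact V h v)) (x ys) else 0)"
   using t t' transport_tr[OF yseqs_gseq[OF pts(1) zs] g] by (auto simp: single_apply)
 qed
 finally show ?thesis using ys finite_yseqs[OF pts] by simp
qed

lemma yseqs_preimage:
 assumes pts: "set is \<subseteq> pts C" "is \<noteq> []" and g: "g \<in> stab C (hd is)" and ys': "ys' \<in> yseqs C is"
 shows "\<exists>ys\<in>yseqs C is. \<exists>h. tr C is g ys = (ys', h)"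
proof -
 have i: "hd is \<in> pts C" using pts by auto
 obtain ys h2 where t: "tr C is (iv g \<cdot> e) ys' = (ys, h2)" by force
 have ig: "iv g \<cdot> e \<in> stab C (hd is)" using stab_inv[OF i g] stab_Gr[OF g] by simp
 show ?thesis using tr_comp[OF yseqs_gseq[OF pts(1) ys'] stab_one[OF i] g tr_yseqs[OF pts(1) ys'] t]
   tr_props(1)[OF yseqs_gseq[OF pts(1) ys'] ig t] by blast
qed

lemma Maction_in:
 assumes pts: "set is \<subseteq> pts C" "is \<noteq> []" and g: "g \<in> stab C (hd is)"
  and V: "rep_at (last is) V" and x: "x \<in> Mspace C N is V"
 shows "Maction C N is V g x \<in> Mspace C N is V" unfolding Mspace_def
proof (intro CollectI conjI ballI allI impI)
 fix ys' assume ys': "ys' \<in> yseqs C is"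
 interpret T: tensor_space "bscale N" "scal V" "comps C N is ys'" "space V" by (rule tensor_space[OF rep_vsp[OF V]])
 obtain ys h where t: "ys \<in> yseqs C is" "tr C is g ys = (ys', h)" using yseqs_preimage[OF pts g ys'] by blast
 interpret S: tensor_space "bscale N" "scal V" "comps C N is ys" "space V" by (rule tensor_space[OF rep_vsp[OF V]])
 have gy: "gseq is ys" by (rule yseqs_gseq[OF pts(1) t(1)])
 note m = Maction_term[OF gy g t(2) V]
 have "lift_M C N is V ys (\<lambda>ms v. pure_M C N is V ys' (map (bact N g) ms) (gact V h v)) (x ys) \<in> tsp is V ys'"
  by (rule S.lift_in[OF T.tensor_vsp m(1) _ Mspace_tensor[OF x t(1)]])
    (rule T.tpure_in_tensor[OF m(2) rep_in[OF V tr_props(2)[OF gy g t(2)]]])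
 then show "Maction C N is V g x ys' \<in> tsp is V ys'" by (subst Maction_apply[OF pts g t])
next
 fix ys' assume "ys' \<notin> yseqs C is"
 then show "Maction C N is V g x ys' = 0"
  using tr_props(1)[OF yseqs_gseq[OF pts(1)] g] transport_tr[OF yseqs_gseq[OF pts(1)] g]
  by (subst Maction_def, subst sum_apply, intro sum.neutral) (auto simp: single_apply split: prod.splits)
qed

text \<open>The action of g amounts to a change of frame. The functionals translate by
  \<open>evl_absl_shift\<close>, the coset representatives by \<open>tr_comp\<close>.\<close>

lemma cw_Maction:
 assumes w: "vw is w" and k: "k \<in> stab C (hd is)" and g: "g \<in> stab C (hd is)"
  and V: "rep_at (last is) V" and x: "x \<in> Mspace C N is V"
 shows "cw is V k w (Maction C N is V g x) = cw is V (iv g \<cdot> k) w x"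
proof -
 note pts = vw_pts[OF w] vw_ne[OF w] and gs = vw_gseq[OF w] and vV = rep_vsp[OF V]
 have ipts: "hd is \<in> pts C" "last is \<in> pts C" using pts by auto
 have G: "g \<in> Gr" "k \<in> Gr" using g k by (auto intro: stab_Gr)
 have igk: "iv g \<cdot> k \<in> stab C (hd is)" by (intro stab_mult stab_inv ipts g k)
 obtain ys' h where t': "tr C is k (map fst w) = (ys', h)" by force
 obtain ys h2 where t: "tr C is (iv g \<cdot> k) (map fst w) = (ys, h2)" by force
 note p' = tr_props[OF gs k t'] and p = tr_props[OF gs igk t]
 have tg: "tr C is g ys = (ys', h \<cdot> iv h2)" by (rule tr_comp[OF gs k g t' t])
 have hG: "h \<in> Gr" "h2 \<in> Gr" using p'(2) p(2) by (auto intro: stab_Gr)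
 have hh: "h \<cdot> iv h2 \<in> stab C (last is)" by (intro stab_mult stab_inv ipts p(2) p'(2))
 have gy: "gseq is ys" "gseq is ys'" using yseqs_gseq[OF pts(1)] p(1) p'(1) by auto
 interpret T: tensor_space "bscale N" "scal V" "comps C N is ys'" "space V" by (rule tensor_space[OF vV])
 interpret S: tensor_space "bscale N" "scal V" "comps C N is ys" "space V" by (rule tensor_space[OF vV])
 note m = Maction_term[OF gy(1) g tg V]
 note c' = ctr_linear[OF G(2) w gy(2) vV] and c = ctr_linear[OF stab_Gr[OF igk] w gy(1) vV]
 have xt: "x ys \<in> tsp is V ys" by (rule Mspace_tensor[OF x p(1)])
 have "ctr is V ys' (absl k w) (Maction C N is V g x ys') =
   lift_M C N is V ys (\<lambda>ms v. ctr is V ys' (absl k w) (pure_M C N is V ys' (map (bact N g) ms) (gact V (h \<cdot> iv h2) v))) (x ys)"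
  unfolding Maction_apply[OF pts g p(1) tg] by (rule S.linear_lift_comp[OF T.tensor_vsp m(1) _ c' vsp_vs[OF vV] xt])
    (rule T.tpure_in_tensor[OF m(2) rep_in[OF V hh]])
 also have "\<dots> = gact V (h \<cdot> iv h2) (ctr is V ys (absl (iv g \<cdot> k) w) (x ys))"
 proof (rule S.lift_unique[symmetric, OF vsp_vs[OF vV] _ _ _ xt])
  show "multilinear (bscale N) (scal V) (scal V) (comps C N is ys) (space V)
    (\<lambda>ms v. ctr is V ys' (absl k w) (pure_M C N is V ys' (map (bact N g) ms) (gact V (h \<cdot> iv h2) v)))"
   by (rule S.multilinear_linear_comp[OF m(1) _ c']) (rule T.tpure_in_tensor[OF m(2) rep_in[OF V hh]])
  show "linear_on (pw (*)) (scal V) (tsp is V ys) (\<lambda>t. gact V (h \<cdot> iv h2) (ctr is V ys (absl (iv g \<cdot> k) w) t))"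
   by (rule linear_on_comp[OF c rep_linear[OF V hh]])
     (use ctr_in[OF stab_Gr[OF igk] w gy(1) vV] in auto)
  fix ms v assume ms: "ms \<in> listset (comps C N is ys)" and v: "v \<in> space V"
  have msb: "set ms \<subseteq> bcar N"
  proof -
   show ?thesis using listset_member[OF ms] compsK_bcar comps_compsK[OF gy(1)] by (metis subset_iff)
  qed
  have "evl (absl k w) (map (bact N g) ms) = evl (absl (iv g \<cdot> k) w) ms"
   using evl_absl_shift[OF gs G(1) stab_Gr[OF igk] msb] G by (simp add: mult_iv_cancel)
  then show "gact V (h \<cdot> iv h2) (ctr is V ys (absl (iv g \<cdot> k) w) (pure_M C N is V ys ms v)) =
     ctr is V ys' (absl k w) (pure_M C N is V ys' (map (bact N g) ms) (gact V (h \<cdot> iv h2) v))"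
   by (simp add: ctr_pure[OF stab_Gr[OF igk] w gy(1) vV ms v] ctr_pure[OF G(2) w gy(2) vV m(2)[OF ms] rep_in[OF V hh v]]
     linear_on_scale[OF rep_linear[OF V hh] v])
 qed
 finally have eq: "ctr is V ys' (absl k w) (Maction C N is V g x ys') = gact V (h \<cdot> iv h2) (ctr is V ys (absl (iv g \<cdot> k) w) (x ys))" .
 have "ctr is V ys (absl (iv g \<cdot> k) w) (x ys) \<in> space V" by (rule ctr_in[OF stab_Gr[OF igk] w gy(1) vV xt])
 \<comment> \<open>The stabiliser element h of the frame k cancels, and \<open>h2\<close>, belonging
   to the frame inverse(g) k, remains.\<close>
 then have "gact V (iv h) (gact V (h \<cdot> iv h2) (ctr is V ys (absl (iv g \<cdot> k) w) (x ys))) = gact V (iv h2) (ctr is V ys (absl (iv g \<cdot> k) w) (x ys))"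
  using rep_mult[OF V stab_inv[OF ipts(2) p'(2)] hh, symmetric] hG by (simp add: mult_iv_cancel)
 then show ?thesis unfolding cw_def t t' prod.case eq .
qed

subsection \<open>Covariant functions on words\<close>

text \<open>The elements g h and g have the same coset at that position, and the factor h enters the
  product at the next letter in both cases.\<close>

lemma tr_move:
 assumes "gseq is (gs @ g # g2 # gs')" "k \<in> stab C (hd is)" "h \<in> stab C (is ! Suc (length gs))"
 shows "tr C is k (gs @ g \<cdot> h # g2 # gs') = tr C is k (gs @ g # h \<cdot> g2 # gs')" using assms
proof (induction gs arbitrary: "is" k)
 case Nil
 then obtain i j l is' where i: "is = i # j # l # is'" "i \<in> pts C" "j \<in> pts C" "g \<in> Gr" "g2 \<in> Gr"
  by (auto simp: gseq_Cons)
 have hG: "h \<in> Gr" "k \<in> Gr" using Nil i stab_Gr[of h j] stab_Gr[of k i] by simp_all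
 have "crep C j (k \<cdot> (g \<cdot> h)) = crep C j (k \<cdot> g)"
  using crep_mult_stab[of j "k \<cdot> g" h] Nil(3) i hG by (simp add: m_assoc)
 then show ?case using i hG crep(2)[of j "k \<cdot> g"] by (simp add: Let_def m_assoc)
next
 case (Cons a gs)
 then obtain i j is' where i: "is = i # j # is'" "i \<in> pts C" "a \<in> Gr" "gseq (j # is') (gs @ g # g2 # gs')"
  by (auto simp: gseq_Cons)
 have j: "j \<in> pts C" using i(4) by (auto simp: gseq_def)
 have "k \<in> Gr" using Cons(3) i stab_Gr[of k i] by simp
 then have "iv (crep C j (k \<cdot> a)) \<cdot> (k \<cdot> a) \<in> stab C j" using crep(3)[OF j] i by simp
 then show ?case using Cons.IH[OF i(4)] Cons.prems(3) i by (simp add: Let_def)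
qed

lemma tr_move_last:
 assumes "gseq is (gs @ [g])" "k \<in> stab C (hd is)" "h \<in> stab C (is ! Suc (length gs))" "tr C is k (gs @ [g]) = (ys, h0)"
 shows "tr C is k (gs @ [g \<cdot> h]) = (ys, h0 \<cdot> h)" using assms
proof (induction gs arbitrary: "is" k ys h0)
 case Nil
 then obtain i j where i: "is = [i, j]" "i \<in> pts C" "j \<in> pts C" "g \<in> Gr" by (auto simp: gseq_Cons)
 have hG: "h \<in> Gr" "k \<in> Gr" using Nil i stab_Gr[of h j] stab_Gr[of k i] by simp_all
 have "crep C j (k \<cdot> (g \<cdot> h)) = crep C j (k \<cdot> g)"
  using crep_mult_stab[of j "k \<cdot> g" h] Nil(3) i hG by (simp add: m_assoc)
 then show ?case using i hG crep(2)[of j "k \<cdot> g"] Nil(4) by (auto simp: Let_def m_assoc)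
next
 case (Cons a gs)
 then obtain i j is' where i: "is = i # j # is'" "i \<in> pts C" "a \<in> Gr" "gseq (j # is') (gs @ [g])"
  by (auto simp: gseq_Cons)
 have j: "j \<in> pts C" using i(4) by (auto simp: gseq_def)
 have "k \<in> Gr" using Cons(3) i stab_Gr[of k i] by simp
 then have s: "iv (crep C j (k \<cdot> a)) \<cdot> (k \<cdot> a) \<in> stab C j" using crep(3)[OF j] i by simp
 obtain ys1 h1 where t: "tr C (j # is') (iv (crep C j (k \<cdot> a)) \<cdot> (k \<cdot> a)) (gs @ [g]) = (ys1, h1)" by force
 have "ys = crep C j (k \<cdot> a) # ys1" "h0 = h1" using Cons.prems(4) t i by (auto simp: Let_def)
 then show ?case using Cons.IH[OF i(4) _ _ t] s Cons.prems(3) i by (simp add: Let_def)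
qed

lemma absl_move:
 assumes "vw is (p @ (g, \<psi>) # q)" "k \<in> Gr" "h \<in> Gr"
 shows "absl k (p @ (g \<cdot> h, \<psi>) # q) = absl k (p @ (g, \<psi>) # lact h q)" using assms
proof (induction p arbitrary: "is" k)
 case Nil
 then show ?case
 proof (cases q)
  case (Cons l q')
  obtain g2 \<psi>2 where l: "l = (g2, \<psi>2)" by force
  from Nil have "g \<in> Gr" "g2 \<in> Gr" unfolding Cons l by (auto simp: vw_Cons)
  then show ?thesis using Nil unfolding Cons l by (simp add: dual_bact_mult m_assoc)
 qed simp
qed (auto simp: vw_Cons)

lemma vw_append_replace: "vw is (p @ (g, \<psi>) # q) ==> g' \<in> Gr ==> \<psi>' \<in> bcar du ==> vw is (p @ (g', \<psi>') # q)"
 by (induction p arbitrary: "is") (auto simp: vw_Cons)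

lemma vw_append_Gr: "vw is (p @ (g, \<psi>) # q) ==> g \<in> Gr" "vw is (p @ (g, \<psi>) # q) ==> \<psi> \<in> bcar du"
 "vw is (p @ (g, \<psi>) # q) ==> is ! length p \<in> pts C" "vw is (p @ (g, \<psi>) # q) ==> is ! Suc (length p) \<in> pts C"
 by (auto simp: vw_def gseq_def)

text \<open>The conditions that characterise the functions \<open>w \<mapsto> cw is V e w x\<close> with \<open>x \<in> M(is;V)\<close>.\<close>

definition wx :: "'i list => ('g, 'k, 'v::ab_group_add) rep => (('g \<times> ('m => 'k)) list => 'v) => bool" where
 "wx is V \<xi> \<longleftrightarrow> (\<forall>w. vw is w \<longrightarrow> \<xi> w \<in> space V) \<and>
   (\<forall>p g \<psi> q. vw is (p @ (g, \<psi>) # q) \<longrightarrow>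
    \<xi> (p @ (g, \<psi>) # q) = (\<Sum>b\<in>Bas (is ! length p) (pact C g (is ! Suc (length p))).
     scal V (\<psi> b) (\<xi> (p @ (g, cof (is ! length p) (pact C g (is ! Suc (length p))) b) # q)))) \<and>
   (\<forall>p g \<psi> q h. vw is (p @ (g, \<psi>) # q) \<and> h \<in> stab C (is ! Suc (length p)) \<longrightarrow>
    \<xi> (p @ (g \<cdot> h, \<psi>) # q) = (if q = [] then gact V (iv h) (\<xi> (p @ [(g, \<psi>)])) else \<xi> (p @ (g, \<psi>) # lact h q)))"

text \<open>Linearity of the evaluation in one letter. The frame of that letter is undone first,
  which brings the vector into the component whose basis is used.\<close>

lemma evl_absl_expand:
 assumes "vw is (p @ (g, \<psi>) # q)" "k \<in> Gr" "ms \<in> listset (compsK k is (map fst (p @ (g, \<psi>) # q)))"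
 shows "evl (absl k (p @ (g, \<psi>) # q)) ms =
  (\<Sum>b\<in>Bas (is ! length p) (pact C g (is ! Suc (length p))).
   \<psi> b * evl (absl k (p @ (g, cof (is ! length p) (pact C g (is ! Suc (length p))) b) # q)) ms)" using assms
proof (induction p arbitrary: "is" k ms)
 case Nil
 then obtain i j is' where i: "is = i # j # is'" "i \<in> pts C" "g \<in> Gr" "\<psi> \<in> bcar du" "vw (j # is') q" by (auto simp: vw_Cons)
 have j: "j \<in> pts C" using vw_pts[OF i(5)] by simp
 from Nil(3) obtain m ms' where ms: "ms = m # ms'" "m \<in> bcomp N (pact C k i) (pact C (k \<cdot> g) j)"
  by (auto simp: i set_Cons_def)
 have mc: "m \<in> bcar N" using ms bcomp_bcar by blast
 have m': "bact N (iv k) m \<in> bcomp N i (pact C g j)" using bact_bcomp[OF inv_closed[OF Nil(2)] _ _ ms(2)] i j Nil(2)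
  by (simp add: pact_pts pact_mult[symmetric] pact_one m_assoc[symmetric])
 show ?case using dual_expand[OF i(4) m'] mc by (simp add: i ms(1) dual_bact_apply sum_distrib_right mult.assoc)
next
 case (Cons l p)
 obtain a \<phi> where l: "l = (a, \<phi>)" by force
 from Cons(2) obtain i j is' where i: "is = i # j # is'" "a \<in> Gr" "vw (j # is') (p @ (g, \<psi>) # q)"
  unfolding l by (auto simp: vw_Cons)
 from Cons(4) obtain m ms' where ms: "ms = m # ms'" "ms' \<in> listset (compsK (k \<cdot> a) (j # is') (map fst (p @ (g, \<psi>) # q)))"
  by (auto simp: i l set_Cons_def)
 show ?case using Cons.IH[OF i(3) _ ms(2)] Cons(3) i by (simp add: i l ms(1) sum_distrib_left mult_ac)
qed

text \<open>Linearity in a letter comes from \<open>evl\<close>. Balancing holds because neither the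
  transport (\<open>tr_move\<close>) nor the translated functionals (\<open>absl_move\<close>)
  depend on which of two adjacent letters absorbs a stabiliser element; past the last letter it acts
  on V.\<close>

lemma cw_wx:
 assumes pts: "set is \<subseteq> pts C" "is \<noteq> []" and V: "rep_at (last is) V"
  and x: "x \<in> Mspace C N is V" and k: "k \<in> stab C (hd is)"
 shows "wx is V (\<lambda>w. cw is V k w x)" unfolding wx_def
proof (intro conjI allI impI, goal_cases)
 case (1 w) show ?case by (rule cw_in[OF 1 V k x])
next
 case (2 p g \<psi> q)
 let ?B = "Bas (is ! length p) (pact C g (is ! Suc (length p)))" and ?c = "cof (is ! length p) (pact C g (is ! Suc (length p)))"
 let ?w = "p @ (g, \<psi>) # q" and ?w' = "\<lambda>b. p @ (g, ?c b) # q"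
 have w': "vw is (?w' b)" for b using vw_append_replace[OF 2] vw_append_Gr[OF 2] cof_dual by blast
 note gs = vw_gseq[OF 2] and vV = rep_vsp[OF V] and kG = stab_Gr[OF k]
 obtain ys h where t: "tr C is k (map fst ?w) = (ys, h)" by force
 note p = tr_props[OF gs k t]
 have gy: "gseq is ys" by (rule yseqs_gseq[OF pts(1) p(1)])
 interpret S: tensor_space "bscale N" "scal V" "comps C N is ys" "space V" by (rule tensor_space[OF vV])
 have last: "last is \<in> pts C" using pts by auto
 have h: "iv h \<in> stab C (last is)" by (rule stab_inv[OF last p(2)])
 have xt: "x ys \<in> tsp is V ys" by (rule Mspace_tensor[OF x p(1)])
 have ck: "comps C N is ys = compsK k is (map fst ?w)"
  using compsK_tr[OF gs k one_closed] t kG by (simp add: comps_compsK[OF gy])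
 note vs = vsp_simps[OF vV]
 have "ctr is V ys (absl k ?w) (x ys) = (\<Sum>b\<in>?B. scal V (\<psi> b) (ctr is V ys (absl k (?w' b)) (x ys)))"
 proof (rule S.tensor_eqI[OF ctr_linear[OF kG 2 gy vV] _ _ xt])
  show "linear_on (pw (*)) (scal V) (tsp is V ys) (\<lambda>t. \<Sum>b\<in>?B. scal V (\<psi> b) (ctr is V ys (absl k (?w' b)) t))"
   using ctr_linear[OF kG w' gy vV] unfolding linear_on_def
   by (auto simp: vs sum.distrib mult.commute intro!: sum.cong)
  fix ms v assume ms: "ms \<in> listset (comps C N is ys)" and v: "v \<in> space V"
  have "evl (absl k ?w) ms = (\<Sum>b\<in>?B. \<psi> b * evl (absl k (?w' b)) ms)" using evl_absl_expand[OF 2 kG] ms ck by simp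
  then show "ctr is V ys (absl k ?w) (pure_M C N is V ys ms v) =
    (\<Sum>b\<in>?B. scal V (\<psi> b) (ctr is V ys (absl k (?w' b)) (pure_M C N is V ys ms v)))"
   by (simp add: ctr_pure[OF kG 2 gy vV ms v] ctr_pure[OF kG w' gy vV ms v] vs)
 qed
 then have "gact V (iv h) (ctr is V ys (absl k ?w) (x ys)) =
   (\<Sum>b\<in>?B. scal V (\<psi> b) (gact V (iv h) (ctr is V ys (absl k (?w' b)) (x ys))))"
  using linear_on_combination[OF rep_linear[OF V h] vV, of ?B "\<lambda>b. ctr is V ys (absl k (?w' b)) (x ys)" \<psi>]
   ctr_in[OF kG w' gy vV xt] by simp
 then show ?case using t by (simp add: cw_def)
next
 case (3 p g \<psi> q h)
 then have w: "vw is (p @ (g, \<psi>) # q)" and h: "h \<in> stab C (is ! Suc (length p))" by auto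
 note kG = stab_Gr[OF k] and hG = stab_Gr[OF h] and gs = vw_gseq[OF w]
 show ?case
 proof (cases q)
  case Nil
  obtain ys h0 where t: "tr C is k (map fst p @ [g]) = (ys, h0)" by force
  have gs': "gseq is (map fst p @ [g])" using gs Nil by simp
  note p = tr_props[OF gs' k t]
  have gy: "gseq is ys" by (rule yseqs_gseq[OF pts(1) p(1)])
  have t2: "tr C is k (map fst p @ [g \<cdot> h]) = (ys, h0 \<cdot> h)" using tr_move_last[OF gs' k _ t] h by simp
  have last: "last is \<in> pts C" using pts by auto
  have "last is = is ! Suc (length p)" using vw_length[OF w] Nil pts by (simp add: last_conv_nth)
  then have h': "iv h \<in> stab C (last is)" "iv h0 \<in> stab C (last is)" using stab_inv[OF last] h p(2) by auto
  have "ctr is V ys (absl k (p @ [(g, \<psi>)])) (x ys) \<in> space V"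
   using ctr_in[OF kG _ gy rep_vsp[OF V] Mspace_tensor[OF x p(1)]] w Nil by simp
  from rep_mult[OF V h' this] show ?thesis
   using t t2 absl_move[OF w kG hG] Nil stab_Gr[OF p(2)] hG by (simp add: cw_def inv_mult_group)
 next
  case (Cons l q')
  obtain g2 \<psi>2 where l: "l = (g2, \<psi>2)" by force
  have "tr C is k (map fst (p @ (g \<cdot> h, \<psi>) # q)) = tr C is k (map fst (p @ (g, \<psi>) # lact h q))"
   using tr_move[of "is" "map fst p" g g2 "map fst q'" k h] gs k h by (simp add: Cons l)
  then show ?thesis using absl_move[OF w kG hG] Cons by (simp add: cw_def)
 qed
qed

text \<open>Fixing the first letter leaves a function of the same kind on the remaining word. Normal
  forms and the splitting off of the first step both rest on this.\<close>

lemma wx_tail: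
 assumes "wx (i # j # is) V \<xi>" "i \<in> pts C" "g \<in> Gr" "\<psi> \<in> bcar du"
 shows "wx (j # is) V (\<lambda>w. \<xi> ((g, \<psi>) # w))"
proof -
 note w = assms(1)[unfolded wx_def]
 show ?thesis unfolding wx_def
 proof (intro conjI allI impI, goal_cases)
  case (1 w') then show ?case using w[THEN conjunct1, rule_format, of "(g, \<psi>) # w'"] assms by simp
 next
  case (2 p g' \<psi>' q)
  then show ?case using w[THEN conjunct2, THEN conjunct1, rule_format, of "(g, \<psi>) # p" g' \<psi>' q] assms by simp
 next
  case (3 p g' \<psi>' q h)
  then show ?case using w[THEN conjunct2, THEN conjunct2, rule_format, of "(g, \<psi>) # p" g' \<psi>' q h] assms by simp
 qed
qed

text \<open>The normal form of a word: representatives replace the g_t, dual basis functionals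
  replace the given ones. The element k in front is the stabiliser element not yet absorbed, and the
  empty word hands it over to V; it is what makes the induction run.\<close>

lemma wx_normal:
 assumes "vw is w" "wx is V \<xi>" "rep_at (last is) V" "k \<in> stab C (hd is)"
  "tr C is k (map fst w) = (ys, h)"
 shows "(if w = [] then gact V (iv k) (\<xi> []) else \<xi> (lact k w)) =
  gact V (iv h) (\<Sum>w'\<in>bw is ys. scal V (evl (absl k w) (absv e w')) (\<xi> (star is w')))" using assms
proof (induction w arbitrary: "is" \<xi> k ys h)
 case Nil
 then obtain i where "is = [i]" "i \<in> pts C" by auto
 then show ?case using Nil by (auto simp: vsp_simps[OF rep_vsp[OF Nil(3)]])
next
 case (Cons l w)
 obtain g \<psi> where l: "l = (g, \<psi>)" by force
 from Cons(2) obtain i j is' where i: "is = i # j # is'" "i \<in> pts C" "g \<in> Gr" "\<psi> \<in> bcar du" "vw (j # is') w"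
  unfolding l by (auto simp: vw_Cons)
 have j: "j \<in> pts C" using vw_pts[OF i(5)] by simp
 have k: "k \<in> stab C i" using Cons.prems(4) i by simp
 have kG: "k \<in> Gr" by (rule stab_Gr[OF k])
 define y where "y = crep C j (k \<cdot> g)"
 define h1 where "h1 = iv y \<cdot> (k \<cdot> g)"
 have kg: "k \<cdot> g \<in> Gr" using kG i by simp
 note c = crep[OF j kg, folded y_def, folded h1_def]
 have h1G: "h1 \<in> Gr" by (rule stab_Gr[OF c(3)])
 have yh: "k \<cdot> g = y \<cdot> h1" using c(2) kg by (simp add: h1_def mult_iv_cancel)
 obtain ys1 h' where t: "tr C (j # is') h1 (map fst w) = (ys1, h')" by force
 have ys: "ys = y # ys1" "h = h'" using Cons.prems(5) t i l by (auto simp: Let_def y_def h1_def)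
 have k\<psi>: "bact du k \<psi> \<in> bcar du" by (rule dual_bact_in[OF kG i(4)])
 have V: "rep_at (last (j # is')) V" using Cons.prems(3) i by simp
 have gy: "gseq (j # is') ys1" using yseqs_gseq tr_props(1)[OF vw_gseq[OF i(5)] _ t] c(3) vw_pts[OF i(5)] by simp
 let ?\<xi> = "\<lambda>w. \<xi> ((y, bact du k \<psi>) # w)" and ?B = "Bas i (pact C y j)" and ?c = "cof i (pact C y j)"
 have wt: "wx (j # is') V ?\<xi>" using wx_tail Cons.prems(2) i c(2) k\<psi> by blast
 note wx3 = Cons.prems(2)[unfolded wx_def, THEN conjunct2, THEN conjunct2, rule_format, of "[]" y "bact du k \<psi>" w h1]
 note wx2 = Cons.prems(2)[unfolded wx_def, THEN conjunct2, THEN conjunct1, rule_format, of "[]" y "bact du k \<psi>"]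
 \<comment> \<open>Writing k g = y h1, the balancing condition moves \<open>h1\<close> into the next
   letter, or into V if there is none; the functional at y is then expanded in the dual
   basis.\<close>
 have "\<xi> (lact k ((g, \<psi>) # w)) = \<xi> ((y \<cdot> h1, bact du k \<psi>) # w)" by (simp add: yh)
 also have "\<dots> = (if w = [] then gact V (iv h1) (?\<xi> []) else ?\<xi> (lact h1 w))" using wx3 i c k\<psi> by simp
 also have "\<dots> = gact V (iv h') (\<Sum>w'\<in>bw (j # is') ys1. scal V (evl (absl h1 w) (absv e w')) (?\<xi> (star (j # is') w')))"
  by (rule Cons.IH[OF i(5) wt V _ t]) (simp add: c(3))
 also have "(\<Sum>w'\<in>bw (j # is') ys1. scal V (evl (absl h1 w) (absv e w')) (?\<xi> (star (j # is') w'))) =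
   (\<Sum>w'\<in>bw (j # is') ys1. \<Sum>b\<in>?B. scal V (evl (absl h1 w) (absv e w')) (scal V (bact du k \<psi> b) (\<xi> ((y, ?c b) # star (j # is') w'))))"
 proof (intro sum.cong refl)
  fix w' assume w': "w' \<in> bw (j # is') ys1"
  have "?\<xi> (star (j # is') w') = (\<Sum>b\<in>?B. scal V (bact du k \<psi> b) (\<xi> ((y, ?c b) # star (j # is') w')))"
   using wx2[of "star (j # is') w'"] bw_props(3)[OF w' gy] i c k\<psi> by simp
  then show "scal V (evl (absl h1 w) (absv e w')) (?\<xi> (star (j # is') w')) =
    (\<Sum>b\<in>?B. scal V (evl (absl h1 w) (absv e w')) (scal V (bact du k \<psi> b) (\<xi> ((y, ?c b) # star (j # is') w'))))"
   by (simp add: vsp_simps(9)[OF rep_vsp[OF V]])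
 qed
 also have "\<dots> = (\<Sum>b\<in>?B. \<Sum>w'\<in>bw (j # is') ys1. scal V (evl (absl k ((g, \<psi>) # w)) (absv e ((y, b) # w'))) (\<xi> (star (i # j # is') ((y, b) # w'))))"
 proof (subst sum.swap, intro sum.cong refl)
  fix b w' assume b: "b \<in> ?B" and w': "w' \<in> bw (j # is') ys1"
  note p = bw_props[OF w' gy]
  have set: "set (absv e w') \<subseteq> bcar N" using absv_bcar[of "j # is'" w' e] p gy by simp
  have "absv y w' = map (bact N y) (absv e w')" using absv_shift[of "j # is'" w' y e] p gy c(2) by simp
  then have "evl (absl (k \<cdot> g) w) (absv y w') = evl (absl h1 w) (absv e w')"
   using evl_absl_shift[OF vw_gseq[OF i(5)] c(2) h1G set] yh by simp
  then show "scal V (evl (absl h1 w) (absv e w')) (scal V (bact du k \<psi> b) (\<xi> ((y, ?c b) # star (j # is') w'))) =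
    scal V (evl (absl k ((g, \<psi>) # w)) (absv e ((y, b) # w'))) (\<xi> (star (i # j # is') ((y, b) # w')))"
   using c(2) Bas_bcar[OF b] by (simp add: vsp_simps(3)[OF rep_vsp[OF V]] bact_one mult.commute)
 qed
 finally show ?case unfolding l ys i(1) sum_bw_Cons by (simp only: list.simps if_False)
qed

definition unwx :: "'i list => ('g, 'k, 'v::ab_group_add) rep => (('g \<times> ('m => 'k)) list => 'v) => 'g list => ('m, 'v, 'k) tens" where
 "unwx is V \<xi> ys = (if ys \<in> yseqs C is then \<Sum>w\<in>bw is ys. pure_M C N is V ys (absv e w) (\<xi> (star is w)) else 0)"

text \<open>The two sides of \<open>cw_unwx\<close> satisfy the conditions in \<open>wx\<close>, and
  on the words \<open>star is w\<close> they agree by construction; \<open>wx_normal\<close> reduces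
  all words to these.\<close>

lemma
 assumes pts: "set is \<subseteq> pts C" "is \<noteq> []" and V: "rep_at (last is) V" and \<xi>: "wx is V \<xi>"
 shows unwx_in: "unwx is V \<xi> \<in> Mspace C N is V"
  and cw_unwx: "vw is w ==> cw is V e w (unwx is V \<xi>) = \<xi> w"
proof -
 have \<xi>in: "\<xi> (star is w) \<in> space V" if "w \<in> bw is ys" "gseq is ys" for w ys
  using \<xi> bw_props(3)[OF that] by (auto simp: wx_def)
 have ab: "absv e w \<in> listset (comps C N is ys)" if "w \<in> bw is ys" "gseq is ys" for w ys
  using bw_props(5)[OF that, of e] comps_compsK[OF that(2)] by simp
 show "unwx is V \<xi> \<in> Mspace C N is V" unfolding Mspace_def
 proof (intro CollectI conjI ballI allI impI)
  fix ys assume ys: "ys \<in> yseqs C is"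
  note gy = yseqs_gseq[OF pts(1) ys]
  interpret S: tensor_space "bscale N" "scal V" "comps C N is ys" "space V" by (rule tensor_space[OF rep_vsp[OF V]])
  show "unwx is V \<xi> ys \<in> tsp is V ys" unfolding unwx_def
   using ys \<xi>in[OF _ gy] ab[OF _ gy] by (auto intro!: vsp_sum[OF S.tensor_vsp] S.tpure_in_tensor)
 qed (simp add: unwx_def)
 show "cw is V e w (unwx is V \<xi>) = \<xi> w" if w: "vw is w"
 proof -
  obtain ys h where t: "tr C is e (map fst w) = (ys, h)" by force
  have one: "e \<in> stab C (hd is)" using pts by (intro stab_one) auto
  note p = tr_props[OF vw_gseq[OF w] one t]
  note gy = yseqs_gseq[OF pts(1) p(1)]
  note cl = ctr_linear[OF one_closed w gy rep_vsp[OF V]] and cp = ctr_pure[OF one_closed w gy rep_vsp[OF V]]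
  interpret S: tensor_space "bscale N" "scal V" "comps C N is ys" "space V" by (rule tensor_space[OF rep_vsp[OF V]])
  have "ctr is V ys (absl e w) (unwx is V \<xi> ys) =
    (\<Sum>w'\<in>bw is ys. ctr is V ys (absl e w) (pure_M C N is V ys (absv e w') (\<xi> (star is w'))))"
   unfolding unwx_def using p(1)
   by (simp add: linear_on_sum[OF cl S.tensor_vsp] S.tpure_in_tensor[OF ab[OF _ gy] \<xi>in[OF _ gy]])
  also have "\<dots> = (\<Sum>w'\<in>bw is ys. scal V (evl (absl e w) (absv e w')) (\<xi> (star is w')))"
   by (intro sum.cong refl cp ab[OF _ gy] \<xi>in[OF _ gy])
  finally have "cw is V e w (unwx is V \<xi>) = (if w = [] then gact V (iv e) (\<xi> []) else \<xi> (lact e w))"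
   using wx_normal[OF w \<xi> V one t] by (simp add: cw_def t)
  also have "\<dots> = \<xi> w"
  proof (cases w)
   case Nil
   then show ?thesis using \<xi> w rep_one[OF V] by (auto simp: wx_def)
  next
   case (Cons l w')
   obtain g \<psi> where l: "l = (g, \<psi>)" by force
   have "g \<in> Gr" "\<psi> \<in> bcar du" using w unfolding Cons l by (auto simp: vw_Cons)
   then show ?thesis unfolding Cons l by (simp add: dual_bact_one)
  qed
  finally show ?thesis .
 qed
qed

end

context gbimod begin

subsection \<open>Intertwiners as operators on words\<close>

text \<open>Checked on contractions, where g merely changes the frame and linearity is
  known.\<close>

lemma Maction_linear:
 assumes pts: "set is \<subseteq> pts C" "is \<noteq> []" and V: "rep_at (last is) V" and g: "g \<in> stab C (hd is)"
 shows "linear_on (pw (pw (*))) (pw (pw (*))) (Mspace C N is V) (Maction C N is V g)"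
proof -
 note M = Mspace_vsp[OF rep_vsp[OF V], of "is"] and Mi = Maction_in[OF pts g V]
 have i: "hd is \<in> pts C" using pts by auto
 have g': "iv g \<cdot> e \<in> stab C (hd is)" using stab_inv[OF i g] stab_Gr[OF g] by simp
 note lin = cw_linear[OF _ V]
 show ?thesis
 proof (rule linear_onI)
  fix x y assume xy: "x \<in> Mspace C N is V" "y \<in> Mspace C N is V"
  show "Maction C N is V g (x + y) = Maction C N is V g x + Maction C N is V g y"
  proof (rule cw_eqI[OF _ _ V pts(1)])
   fix w assume w: "vw is w"
   note l = lin[OF w stab_one[OF i]] lin[OF w g'] and c = cw_Maction[OF w stab_one[OF i] g V]
   show "cw is V e w (Maction C N is V g (x + y)) = cw is V e w (Maction C N is V g x + Maction C N is V g y)"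
    using c[OF xy(1)] c[OF xy(2)] c[OF vsp_add[OF M xy]] linear_on_add[OF l(2) xy] linear_on_add[OF l(1) Mi[OF xy(1)] Mi[OF xy(2)]] by simp
  qed (intro Mi vsp_add[OF M] xy)+
 next
  fix a x assume x: "x \<in> Mspace C N is V"
  show "Maction C N is V g (pw (pw (*)) a x) = pw (pw (*)) a (Maction C N is V g x)"
  proof (rule cw_eqI[OF _ _ V pts(1)])
   fix w assume w: "vw is w"
   note l = lin[OF w stab_one[OF i]] lin[OF w g'] and c = cw_Maction[OF w stab_one[OF i] g V]
   show "cw is V e w (Maction C N is V g (pw (pw (*)) a x)) = cw is V e w (pw (pw (*)) a (Maction C N is V g x))"
    using c[OF x] c[OF vsp_scale[OF M x]] linear_on_scale[OF l(2) x] linear_on_scale[OF l(1) Mi[OF x]] by simp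
  qed (intro Mi vsp_scale[OF M] x)+
 qed
qed

lemma Hom_in: "f \<in> Hom C N is U V ==> u \<in> space U ==> f u \<in> Mspace C N is V"
 and Hom_out: "f \<in> Hom C N is U V ==> u \<notin> space U ==> f u = 0"
 and Hom_linear: "f \<in> Hom C N is U V ==> linear_on (scal U) (pw (pw (*))) (space U) f"
 and Hom_equiv: "f \<in> Hom C N is U V ==> g \<in> stab C (hd is) ==> u \<in> space U ==> f (gact U g u) = Maction C N is V g (f u)"
 by (auto simp: Hom_def)

lemma HomI:
 assumes "\<And>u. u \<notin> space U ==> f u = 0" "\<And>u. u \<in> space U ==> f u \<in> Mspace C N is V"
  "linear_on (scal U) (pw (pw (*))) (space U) f"
  "\<And>g u. g \<in> stab C (hd is) ==> u \<in> space U ==> f (gact U g u) = Maction C N is V g (f u)"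
 shows "f \<in> Hom C N is U V" using assms by (auto simp: Hom_def)

definition opr :: "'i list => ('g, 'k, 'v::ab_group_add) rep => ('g, 'k, 'm, 'v) morph => ('g \<times> ('m => 'k)) list => 'v => 'v" where
 "opr is V f w u = cw is V e w (f u)"

definition reps_at :: "'i list => ('g, 'k, 'v::ab_group_add) rep => ('g, 'k, 'v) rep => bool" where
 "reps_at is U V \<longleftrightarrow> set is \<subseteq> pts C \<and> is \<noteq> [] \<and> rep_at (hd is) U \<and> rep_at (last is) V"

lemma reps_atD:
 assumes "reps_at is U V"
 shows "set is \<subseteq> pts C" "is \<noteq> []" "rep_at (hd is) U" "rep_at (last is) V"
  "hd is \<in> pts C" "last is \<in> pts C" using assms by (auto simp: reps_at_def)

lemma Hom_vsp:
 assumes r: "reps_at is U V"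
 shows "vsp hscale (Hom C N is U V)"
proof -
 note d = reps_atD[OF r]
 note M = Mspace_vsp[OF rep_vsp[OF d(4)], of "is"]
 show ?thesis
 proof (rule vspI[OF vs_pw3(3)])
  show "0 \<in> Hom C N is U V" using linear_on_0[OF Maction_linear[OF d(1,2,4)] vsp_0[OF M]] vsp_0[OF M]
   by (auto simp: Hom_def linear_on_def vs_simps[OF vs_pw3(2)])
 next
  fix f f' assume f: "f \<in> Hom C N is U V" "f' \<in> Hom C N is U V"
  show "f + f' \<in> Hom C N is U V"
  proof (rule HomI)
   show "linear_on (scal U) (pw (pw (*))) (space U) (f + f')" using Hom_linear[OF f(1)] Hom_linear[OF f(2)]
    by (auto simp: linear_on_def vs_simps[OF vs_pw3(2)])
  qed (use Hom_in[OF f(1)] Hom_in[OF f(2)] Hom_out[OF f(1)] Hom_out[OF f(2)] Hom_equiv[OF f(1)] Hom_equiv[OF f(2)]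
    linear_on_add[OF Maction_linear[OF d(1,2,4)]] in \<open>auto intro: vsp_add[OF M]\<close>)
 next
  fix c f assume f: "f \<in> Hom C N is U V"
  show "hscale c f \<in> Hom C N is U V"
  proof (rule HomI)
   show "linear_on (scal U) (pw (pw (*))) (space U) (hscale c f)"
    using Hom_linear[OF f] unfolding pw_def[of "pw (pw (*))"]
    by (auto simp: linear_on_def vs_simps[OF vs_pw3(2)] mult.commute)
  qed (use Hom_in[OF f] Hom_out[OF f] Hom_equiv[OF f]
    linear_on_scale[OF Maction_linear[OF d(1,2,4)]] in
    \<open>auto intro: vsp_scale[OF M] simp: pw_def[of "pw (pw (*))"] vs_simps[OF vs_pw3(2)]\<close>)
 qed
qed

lemma opr_in: "reps_at is U V ==> f \<in> Hom C N is U V ==> vw is w ==> u \<in> space U ==> opr is V f w u \<in> space V"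
 unfolding opr_def using reps_atD[of "is" U V] by (intro cw_in stab_one Hom_in) auto

lemma opr_linear:
 assumes "reps_at is U V" "f \<in> Hom C N is U V" "vw is w"
 shows "linear_on (scal U) (scal V) (space U) (opr is V f w)" unfolding opr_def[abs_def]
 by (rule linear_on_comp[OF Hom_linear[OF assms(2)] cw_linear[OF assms(3) reps_atD(4)[OF assms(1)] stab_one[OF reps_atD(5)[OF assms(1)]]]])
   (use Hom_in[OF assms(2)] in auto)

lemma opr_add:
 assumes "reps_at is U V" "f \<in> Hom C N is U V" "f' \<in> Hom C N is U V" "vw is w" "u \<in> space U"
 shows "opr is V (f + f') w u = opr is V f w u + opr is V f' w u"
 using linear_on_add[OF cw_linear[OF assms(4) reps_atD(4)[OF assms(1)] stab_one[OF reps_atD(5)[OF assms(1)]]]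
   Hom_in[OF assms(2,5)] Hom_in[OF assms(3,5)]] by (simp add: opr_def)

lemma opr_scale:
 assumes "reps_at is U V" "f \<in> Hom C N is U V" "vw is w" "u \<in> space U"
 shows "opr is V (hscale c f) w u = scal V c (opr is V f w u)" unfolding opr_def pw_def[of "pw (pw (*))"]
 by (rule linear_on_scale[OF cw_linear[OF assms(3) reps_atD(4)[OF assms(1)] stab_one[OF reps_atD(5)[OF assms(1)]]]])
   (rule Hom_in[OF assms(2,4)])

lemma opr_linear_morph:
 assumes "reps_at is U V" "vw is w" "u \<in> space U"
 shows "linear_on hscale (scal V) (Hom C N is U V) (\<lambda>f. opr is V f w u)"
 using opr_add[OF assms(1) _ _ assms(2,3)] opr_scale[OF assms(1) _ assms(2,3)] by (intro linear_onI) auto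

lemma opr_eqI:
 assumes "reps_at is U V" "f \<in> Hom C N is U V" "f' \<in> Hom C N is U V"
  "\<And>w u. vw is w ==> u \<in> space U ==> opr is V f w u = opr is V f' w u"
 shows "f = f'"
proof (rule ext)
 fix u
 show "f u = f' u"
 proof (cases "u \<in> space U")
  case True
  show ?thesis by (rule cw_eqI[OF Hom_in[OF assms(2) True] Hom_in[OF assms(3) True] reps_atD(4,1)[OF assms(1)]])
     (use assms(4)[OF _ True] in \<open>simp add: opr_def\<close>)
 qed (simp add: Hom_out[OF assms(2)] Hom_out[OF assms(3)])
qed

lemma opr_wx:
 assumes "reps_at is U V" "f \<in> Hom C N is U V" "u \<in> space U"
 shows "wx is V (\<lambda>w. opr is V f w u)"
 unfolding opr_def using reps_atD[OF assms(1)] by (intro cw_wx Hom_in[OF assms(2,3)] stab_one)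

text \<open>Both the transport and the translated functionals see k and the first letter only
  through their product.\<close>

lemma cw_lact:
 assumes "vw is w" "k \<in> Gr"
 shows "cw is V k w x = (if w = [] then gact V (iv k) (ctr is V [] [] (x [])) else cw is V e (lact k w) x)"
proof (cases w)
 case Nil
 then show ?thesis using assms by (auto simp: cw_def)
next
 case (Cons l w')
 obtain g \<psi> where l: "l = (g, \<psi>)" by force
 from assms(1) obtain i j is' where i: "is = i # j # is'" "g \<in> Gr" "\<psi> \<in> bcar du"
  unfolding Cons l by (auto simp: vw_Cons)
 show ?thesis using i assms(2) dual_bact_one[OF dual_bact_in[OF assms(2) i(3)]] by (simp add: Cons l cw_def Let_def)
qed

lemma opr_gact:
 assumes r: "reps_at is U V" and f: "f \<in> Hom C N is U V" and w: "vw is w" and k: "k \<in> stab C (hd is)" and u: "u \<in> space U"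
 shows "opr is V f w (gact U k u) = (if w = [] then gact V k (opr is V f [] u) else opr is V f (lact (iv k) w) u)"
proof -
 note d = reps_atD[OF r]
 have kG: "k \<in> Gr" by (rule stab_Gr[OF k])
 have "opr is V f w (gact U k u) = cw is V (iv k) w (f u)"
  using cw_Maction[OF w stab_one[OF d(5)] k d(4) Hom_in[OF f u]] Hom_equiv[OF f k u] kG by (simp add: opr_def)
 moreover have "opr is V f [] u = ctr is V [] [] (f u [])" if "w = []"
  using that w opr_in[OF r f _ u, of "[]"] rep_one[OF d(4)] cw_lact[OF w one_closed, of V "f u"] opr_in[OF r f w u] 
   ctr_in[OF one_closed, of "is" "[]" "[]" V "f u []"] Mspace_tensor[OF Hom_in[OF f u], of "[]"] rep_vsp[OF d(4)]
  by (auto simp: opr_def)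
 ultimately show ?thesis using cw_lact[OF w inv_closed[OF kG], of V "f u"] kG by (auto simp: opr_def)
qed

text \<open>The converse of \<open>opr\<close>: intertwiners may be given by their operators. The
  element \<open>f u\<close> is assembled by \<open>unwx\<close>, and linearity and equivariance of
  f are read off from contractions.\<close>

lemma Hom_construct:
 assumes r: "reps_at is U V"
  and wx: "\<And>u. u \<in> space U ==> wx is V (\<lambda>w. F w u)"
  and lin: "\<And>w. vw is w ==> linear_on (scal U) (scal V) (space U) (F w)"
  and eqv: "\<And>w k u. vw is w ==> k \<in> stab C (hd is) ==> u \<in> space U ==>
   F w (gact U k u) = (if w = [] then gact V k (F [] u) else F (lact (iv k) w) u)"
 obtains f where "f \<in> Hom C N is U V" "\<And>w u. vw is w ==> u \<in> space U ==> opr is V f w u = F w u"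
proof -
 note d = reps_atD[OF r]
 define f where "f u = (if u \<in> space U then unwx is V (\<lambda>w. F w u) else 0)" for u
 note M = Mspace_vsp[OF rep_vsp[OF d(4)], of "is"] and vU = rep_vsp[OF d(3)]
 have fin: "f u \<in> Mspace C N is V" if "u \<in> space U" for u
  using unwx_in[OF d(1,2,4) wx[OF that]] that by (simp add: f_def)
 have op: "opr is V f w u = F w u" if "vw is w" "u \<in> space U" for w u
  using cw_unwx[OF d(1,2,4) wx[OF that(2)] that(1)] that by (simp add: opr_def f_def)
 have cl: "linear_on (pw (pw (*))) (scal V) (Mspace C N is V) (cw is V e w)" if "vw is w" for w
  by (rule cw_linear[OF that d(4) stab_one[OF d(5)]])
 have "f \<in> Hom C N is U V"
 proof (rule HomI)
  show "linear_on (scal U) (pw (pw (*))) (space U) f"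
  proof (rule linear_onI)
   fix x y assume xy: "x \<in> space U" "y \<in> space U"
   show "f (x + y) = f x + f y"
   proof (rule cw_eqI[OF _ _ d(4,1)])
    show "cw is V e w (f (x + y)) = cw is V e w (f x + f y)" if w: "vw is w" for w
     using linear_on_add[OF cl[OF w] fin[OF xy(1)] fin[OF xy(2)]] linear_on_add[OF lin[OF w] xy]
      op[OF w] xy vsp_add[OF vU xy] by (simp add: opr_def)
   qed (intro fin vsp_add[OF M] vsp_add[OF vU] xy)+
  next
   fix c x assume x: "x \<in> space U"
   show "f (scal U c x) = pw (pw (*)) c (f x)"
   proof (rule cw_eqI[OF _ _ d(4,1)])
    show "cw is V e w (f (scal U c x)) = cw is V e w (pw (pw (*)) c (f x))" if w: "vw is w" for w
     using linear_on_scale[OF cl[OF w] fin[OF x]] linear_on_scale[OF lin[OF w] x]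
      op[OF w] x vsp_scale[OF vU x] by (simp add: opr_def)
   qed (intro fin vsp_scale[OF M] vsp_scale[OF vU] x)+
  qed
  fix k u assume k: "k \<in> stab C (hd is)" and u: "u \<in> space U"
  have ku: "gact U k u \<in> space U" by (rule rep_in[OF d(3) k u])
  have kG: "k \<in> Gr" by (rule stab_Gr[OF k])
  show "f (gact U k u) = Maction C N is V k (f u)"
  proof (rule cw_eqI[OF fin[OF ku] Maction_in[OF d(1,2) k d(4) fin[OF u]] d(4,1)])
   fix w assume w: "vw is w"
   have "cw is V e w (f (gact U k u)) = F w (gact U k u)" using op[OF w ku] by (simp add: opr_def)
   also have "\<dots> = (if w = [] then gact V k (F [] u) else F (lact (iv k) w) u)" by (rule eqv[OF w k u])
   also have "\<dots> = cw is V (iv k) w (f u)"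
   proof (cases w)
    case Nil
    have "ctr is V [] [] (f u []) \<in> space V"
     using ctr_in[OF one_closed, of "is" "[]" "[]" V "f u []"] Mspace_tensor[OF fin[OF u], of "[]"] rep_vsp[OF d(4)] w Nil
     by auto
    then have "F [] u = ctr is V [] [] (f u [])"
     using op[OF w u] cw_lact[OF w one_closed, of V "f u"] Nil rep_one[OF d(4)] by (simp add: opr_def)
    then show ?thesis using cw_lact[OF w inv_closed[OF kG], of V "f u"] Nil kG by simp
   next
    case (Cons l w')
    obtain g \<psi> where l: "l = (g, \<psi>)" by force
    have "vw is (lact (iv k) w)" using w kG unfolding Cons l by (auto simp: vw_Cons dual_bact_in)
    then show ?thesis using op[of "lact (iv k) w" u] u cw_lact[OF w inv_closed[OF kG], of V "f u"] Cons by (simp add: opr_def)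
   qed
   also have "\<dots> = cw is V e w (Maction C N is V k (f u))"
    using cw_Maction[OF w stab_one[OF d(5)] k d(4) fin[OF u]] kG by simp
   finally show "cw is V e w (f (gact U k u)) = cw is V e w (Maction C N is V k (f u))" .
  qed
 qed (use fin in \<open>auto simp: f_def\<close>)
 with op that show ?thesis by blast
qed

lemma vw_append:
 assumes "is \<noteq> []" "is' \<noteq> []" "last is = hd is'" "length w = length is - 1"
 shows "vw (is @ tl is') (w @ w') \<longleftrightarrow> vw is w \<and> vw is' w'"
proof -
 obtain js j where "is": "is = js @ [j]" using assms(1) by (metis append_butlast_last_id)
 obtain is1 where is': "is' = j # is1" using assms(2,3) "is" by (cases is') auto
 show ?thesis using assms(4) unfolding vw_def gseq_def "is" is' by auto
qed

lemma compsK_append: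
 "gseq is ys ==> last is = hd is' ==> is' \<noteq> [] ==> k \<in> Gr ==>
  compsK k (is @ tl is') (ys @ ys') = compsK k is ys @ compsK (k \<cdot> gprod C ys) is' ys'"
proof (induction k "is" ys rule: compsK.induct)
 case (1 k i j "is" y ys)
 have "gprod C ys \<in> Gr" using 1(2) by (intro gprod_Gr) (auto simp: gseq_def)
 then show ?case using 1 by (simp add: m_assoc)
next
 case ("2_3" k i)
 then show ?case by (cases is') auto
qed (auto simp: gseq_Cons)

lemma absl_append: "set (map fst w) \<subseteq> Gr ==> k \<in> Gr ==> absl k (w @ w') = absl k w @ absl (k \<cdot> gprod C (map fst w)) w'"
 by (induction k w rule: absl.induct) (auto simp: m_assoc)

lemma vw_split:
 assumes "reps_at is U V" "reps_at is' V' W" "last is = hd is'" "vw (is @ tl is') w''"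
 obtains w w' where "w'' = w @ w'" "vw is w" "vw is' w'"
proof -
 note d = reps_atD[OF assms(1)] and d' = reps_atD[OF assms(2)]
 have "length w'' = length is + length is' - 2" using vw_length[OF assms(4)] d(2) d'(2) by (cases "is"; cases is') auto
 then have "length (take (length is - 1) w'') = length is - 1" using d'(2) by (cases is') auto
 then show ?thesis using vw_append[OF d(2) d'(2) assms(3), of "take (length is - 1) w''" "drop (length is - 1) w''"] assms(4) that
  by (metis append_take_drop_id)
qed

lemma reps_at_append:
 assumes "reps_at is U V" "reps_at is' V' W" "last is = hd is'"
 shows "reps_at (is @ tl is') U W" using assms unfolding reps_at_def by (cases is') (auto split: if_splits)

text \<open>One term of \<open>circ\<close> as a lift inside a lift. When a concatenated word is
  contracted, its second part arrives in the frame h, where h is what remains of k g_1...g_m after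
  y_1...y_m is split off.\<close>

lemma circ_term:
 fixes f :: "('g, 'k, 'm, 'v::ab_group_add) morph"
 assumes rV: "rep_at (last is) V" and rW: "rep_at (last is') W"
  and l: "last is = hd is'" and pts: "set is \<subseteq> pts C" "is \<noteq> []" "set is' \<subseteq> pts C" "is' \<noteq> []"
  and f': "f' \<in> Hom C N is' V W" and ys: "ys \<in> yseqs C is" and ys': "ys' \<in> yseqs C is'"
 defines "F ms v \<equiv> lift_M C N is' W ys' (\<lambda>ms' w. pure_M C N (is @ tl is') W (ys @ ys') (ms @ map (bact N (gprod C ys)) ms') w) (f' v ys')"
 shows "multilinear (bscale N) (scal V) (pw (*)) (comps C N is ys) (space V) F"
  and "ms \<in> listset (comps C N is ys) ==> v \<in> space V ==> F ms v \<in> tsp (is @ tl is') W (ys @ ys')"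
  and "vw (is @ tl is') (w @ w') ==> length w = length is - 1 ==> k \<in> Gr ==> h \<in> Gr ==> k \<cdot> gprod C (map fst w) = gprod C ys \<cdot> h ==>
   ms \<in> listset (comps C N is ys) ==> v \<in> space V ==>
   ctr (is @ tl is') W (ys @ ys') (absl k (w @ w')) (F ms v) = scal W (evl (absl k w) ms) (ctr is' W ys' (absl h w') (f' v ys'))"
proof -
 let ?y = "gprod C ys" and ?is = "is @ tl is'" and ?ys = "ys @ ys'"
 have pts'': "set ?is \<subseteq> pts C" using pts by (cases is') auto
 have last: "last ?is = last is'" using l pts by (cases is') auto
 have ys'': "?ys \<in> yseqs C ?is" using yseqs_append[OF pts(2,4) l] ys ys' yseqs_length[OF ys] by simp
 note g = yseqs_gseq[OF pts(1) ys] and g' = yseqs_gseq[OF pts(3) ys'] and g'' = yseqs_gseq[OF pts'' ys'']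
 have yG: "?y \<in> Gr" using g by (intro gprod_Gr) (auto simp: gseq_def)
 have vV: "vsp (scal V) (space V)" and vW: "vsp (scal W) (space W)" by (rule rep_vsp[OF rV], rule rep_vsp[OF rW])
 have comps'': "comps C N ?is ?ys = comps C N is ys @ compsK ?y is' ys'"
  using compsK_append[OF g l pts(4) one_closed] yG by (simp add: comps_compsK[OF g] comps_compsK[OF g''])
 interpret S: tensor_space "bscale N" "scal V" "comps C N is ys" "space V" by (rule tensor_space[OF vV])
 interpret S': tensor_space "bscale N" "scal W" "comps C N is' ys'" "space W" by (rule tensor_space[OF vW])
 interpret S'': tensor_space "bscale N" "scal W" "comps C N ?is ?ys" "space W" by (rule tensor_space[OF vW])
 have la: "list_all2 (\<lambda>D D'. bact N ?y ` D \<subseteq> D' \<and> linear_on (bscale N) (bscale N) D (bact N ?y)) (comps C N is' ys') (compsK ?y is' ys')"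
  using compsK_map[OF g' one_closed yG] yG by (simp add: comps_compsK[OF g'])
 have map_in: "map (bact N ?y) ms' \<in> listset (compsK ?y is' ys')" if "ms' \<in> listset (comps C N is' ys')" for ms'
  by (rule listset_map[OF that list_all2_mono[OF la]]) auto
 have app_in: "ms @ map (bact N ?y) ms' \<in> listset (comps C N ?is ?ys)"
  if "ms \<in> listset (comps C N is ys)" "ms' \<in> listset (comps C N is' ys')" for ms ms'
  unfolding comps'' by (rule listset_append'[OF that(1) map_in[OF that(2)]])
 let ?K = "\<lambda>ms ms' w. pure_M C N ?is W ?ys (ms @ map (bact N ?y) ms') w"
 have Kml: "multilinear (bscale N) (scal W) (pw (*)) (comps C N is' ys') (space W) (?K ms)" if ms: "ms \<in> listset (comps C N is ys)" for ms
 proof (cases "listset (comps C N is' ys') = {}")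
  case True
  then show ?thesis by (simp add: multilinear_def)
 next
  case False
  then obtain ms' where ms': "ms' \<in> listset (comps C N is' ys')" by auto
  have "multilinear (bscale N) (scal W) (pw (*)) (comps C N is ys @ compsK ?y is' ys') (space W) (pure_M C N ?is W ?ys)"
   using tpure_multilinear[OF app_in[OF ms ms'] vsp_0[OF vW]] unfolding comps'' .
  from multilinear_append[OF this ms]
  have "multilinear (bscale N) (scal W) (pw (*)) (compsK ?y is' ys') (space W) (\<lambda>ms'. pure_M C N ?is W ?ys (ms @ ms'))" .
  from multilinear_compose_map[OF la _ _ this, of "\<lambda>v. v" "space W" "scal W"] show ?thesis
   by (simp add: linear_on_def)
 qed
 have Kin: "?K ms ms' w \<in> tsp ?is W ?ys" if "ms \<in> listset (comps C N is ys)" "ms' \<in> listset (comps C N is' ys')" "w \<in> space W" for ms ms' w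
  by (rule S''.tpure_in_tensor[OF app_in[OF that(1,2)] that(3)])
 have f'in: "f' v ys' \<in> tsp is' W ys'" if "v \<in> space V" for v by (rule Mspace_tensor[OF Hom_in[OF f' that] ys'])
 show ml: "multilinear (bscale N) (scal V) (pw (*)) (comps C N is ys) (space V) F" unfolding F_def
 proof (rule multilinear_lift[OF vW vs_pw3(1) _ Kml])
  show "vsp (bscale N) D" if "D \<in> set (comps C N is ys)" for D using that compsK_vsp by (simp add: comps_compsK[OF g])
  show "linear_on (scal V) (pw (*)) (space V) (\<lambda>v. f' v ys')"
   using Hom_linear[OF f'] by (auto simp: linear_on_def pw_def[of "pw (*)"])
  fix ms t ds w assume *: "ms \<in> listset (comps C N is ys)" "t < length (comps C N is ys)" "ds \<in> listset (comps C N is' ys')" "w \<in> space W"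
  have "linear_on (bscale N) (pw (*)) (comps C N ?is ?ys ! t) (\<lambda>m. pure_M C N ?is W ?ys ((ms @ map (bact N ?y) ds)[t := m]) w)"
   using tpure_multilinear[OF app_in[OF *(1,3)] *(4), of "bscale N" "scal W"] app_in[OF *(1,3)] *(2,4)
   unfolding multilinear_def comps'' by simp
  then show "linear_on (bscale N) (pw (*)) (comps C N is ys ! t) (\<lambda>m. ?K (ms[t := m]) ds w)"
   using *(2) listset_length[OF *(1)] unfolding comps'' by (simp add: nth_append list_update_append)
 qed (use f'in in auto)
 show "F ms v \<in> tsp ?is W ?ys" if "ms \<in> listset (comps C N is ys)" "v \<in> space V"
  unfolding F_def by (rule S'.lift_in[OF S''.tensor_vsp Kml[OF that(1)] Kin[OF that(1)] f'in[OF that(2)]])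
 assume w: "vw ?is (w @ w')" "length w = length is - 1" and k: "k \<in> Gr" "h \<in> Gr" "k \<cdot> gprod C (map fst w) = ?y \<cdot> h"
  and ms: "ms \<in> listset (comps C N is ys)" and v: "v \<in> space V"
 have ww: "vw is w" "vw is' w'" using w vw_append[OF pts(2,4) l] by auto
 have sub: "set (map fst w) \<subseteq> Gr" using vw_gseq[OF ww(1)] by (simp add: gseq_def)
 note cl = ctr_linear[OF k(1) w(1) g'' vW] and cp = ctr_pure[OF k(1) w(1) g'' vW]
 note cl' = ctr_linear[OF k(2) ww(2) g' vW] and cp' = ctr_pure[OF k(2) ww(2) g' vW]
 have "ctr ?is W ?ys (absl k (w @ w')) (F ms v) =
   lift_M C N is' W ys' (\<lambda>ms' x. ctr ?is W ?ys (absl k (w @ w')) (?K ms ms' x)) (f' v ys')"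
  unfolding F_def by (rule S'.linear_lift_comp[OF S''.tensor_vsp Kml[OF ms] Kin[OF ms] cl vsp_vs[OF vW] f'in[OF v]])
 also have "\<dots> = scal W (evl (absl k w) ms) (ctr is' W ys' (absl h w') (f' v ys'))"
 proof (rule S'.lift_unique[symmetric, OF vsp_vs[OF vW] _ _ _ f'in[OF v]])
  show "multilinear (bscale N) (scal W) (scal W) (comps C N is' ys') (space W) (\<lambda>ms' x. ctr ?is W ?ys (absl k (w @ w')) (?K ms ms' x))"
   by (rule S'.multilinear_linear_comp[OF Kml[OF ms] Kin[OF ms] cl])
  show "linear_on (pw (*)) (scal W) (tsp is' W ys') (\<lambda>t. scal W (evl (absl k w) ms) (ctr is' W ys' (absl h w') t))"
   using cl' by (auto simp: linear_on_def vsp_simps[OF vW] mult.commute)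
  fix ms' x assume ms': "ms' \<in> listset (comps C N is' ys')" and x: "x \<in> space W"
  have msb: "set ms' \<subseteq> bcar N" using listset_member[OF ms'] compsK_bcar comps_compsK[OF g'] by (metis subset_iff)
  have "evl (absl k (w @ w')) (ms @ map (bact N ?y) ms') = evl (absl k w) ms * evl (absl (?y \<cdot> h) w') (map (bact N ?y) ms')"
   using absl_append[OF sub k(1)] k(3) listset_length[OF ms] w(2) yseqs_length[OF ys] compsK_length[OF g]
   by (simp add: evl_append comps_compsK[OF g])
  also have "evl (absl (?y \<cdot> h) w') (map (bact N ?y) ms') = evl (absl h w') ms'"
   by (rule evl_absl_shift[OF vw_gseq[OF ww(2)] yG k(2) msb])
  finally show "scal W (evl (absl k w) ms) (ctr is' W ys' (absl h w') (pure_M C N is' W ys' ms' x)) =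
    ctr ?is W ?ys (absl k (w @ w')) (?K ms ms' x)"
   by (simp add: cp[OF app_in[OF ms ms'] x] cp'[OF ms' x] vsp_simps[OF vW])
 qed
 finally show "ctr ?is W ?ys (absl k (w @ w')) (F ms v) = scal W (evl (absl k w) ms) (ctr is' W ys' (absl h w') (f' v ys'))" .
qed

text \<open>The stabiliser element left over by the first word is passed to f' by the definition of
  contraction and disappears by equivariance of f'. This is why composition does not depend on the
  representatives.\<close>

lemma
 fixes f :: "('g, 'k, 'm, 'v::ab_group_add) morph"
 assumes r: "reps_at is U V" and r': "reps_at is' V W" and l: "last is = hd is'"
  and f: "f \<in> Hom C N is U V" and f': "f' \<in> Hom C N is' V W"
 shows circ_Hom: "circ C N is V is' W f' f \<in> Hom C N (is @ tl is') U W"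
  and opr_circ: "vw is w ==> vw is' w' ==> u \<in> space U ==>
   opr (is @ tl is') W (circ C N is V is' W f' f) (w @ w') u = opr is' W f' w' (opr is V f w u)"
proof -
 note d = reps_atD[OF r] and d' = reps_atD[OF r']
 let ?is = "is @ tl is'" and ?c = "circ C N is V is' W f' f"
 have pts'': "set ?is \<subseteq> pts C" using d(1) d'(1,2) by (cases is') auto
 have last: "last ?is = last is'" using l d'(2) by (cases is') auto
 have ne: "?is \<noteq> []" and hd: "hd ?is = hd is" using d(2) by auto
 have rW: "rep_at (last ?is) W" using d'(4) last by simp
 note vV = rep_vsp[OF d(4)] and vW = rep_vsp[OF d'(4)]
 note ct = circ_term[OF d(4) d'(4) l d(1,2) d'(1,2) f']
 define F where "F ys ys' ms v = lift_M C N is' W ys' (\<lambda>ms' w. pure_M C N ?is W (ys @ ys') (ms @ map (bact N (gprod C ys)) ms') w) (f' v ys')" for ys ys' ms v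
 have c_app: "?c u (ys @ ys') = lift_M C N is V ys (F ys ys') (f u ys)" if ys: "ys \<in> yseqs C is" and ys': "ys' \<in> yseqs C is'" for u ys ys'
 proof -
  have len: "length is - 1 = length ys" using yseqs_length[OF ys] by simp
  have in': "ys @ ys' \<in> yseqs C ?is" using yseqs_append[OF d(2) d'(2) l] ys ys' len by simp
  show ?thesis unfolding circ_def F_def by (simp only: in' len if_True Let_def) simp
 qed
 have split: "\<exists>ys ys'. zs = ys @ ys' \<and> ys \<in> yseqs C is \<and> ys' \<in> yseqs C is'" if "zs \<in> yseqs C ?is" for zs
 proof -
  have "length zs = length is + length is' - 2" using yseqs_length[OF that] d(2) d'(2) by (cases "is"; cases is') auto
  then have "length (take (length is - 1) zs) = length is - 1" using d'(2) by (cases is') auto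
  then show ?thesis using yseqs_append[OF d(2) d'(2) l, of "take (length is - 1) zs" "drop (length is - 1) zs"] that
   by (metis append_take_drop_id)
 qed
 have c_out: "?c u zs = 0" if "zs \<notin> yseqs C ?is" for u zs using that by (simp add: circ_def)
 have fin: "f u ys \<in> tsp is V ys" if "u \<in> space U" "ys \<in> yseqs C is" for u ys
  by (rule Mspace_tensor[OF Hom_in[OF f that(1)] that(2)])
 have c_in: "?c u \<in> Mspace C N ?is W" if u: "u \<in> space U" for u unfolding Mspace_def
 proof (intro CollectI conjI ballI allI impI)
  fix zs assume "zs \<in> yseqs C ?is"
  then obtain ys ys' where zs: "zs = ys @ ys'" "ys \<in> yseqs C is" "ys' \<in> yseqs C is'" using split by blast
  interpret S: tensor_space "bscale N" "scal V" "comps C N is ys" "space V" by (rule tensor_space[OF vV])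
  interpret S'': tensor_space "bscale N" "scal W" "comps C N ?is zs" "space W" by (rule tensor_space[OF vW])
  show "?c u zs \<in> tsp ?is W zs" unfolding zs(1) c_app[OF zs(2,3)]
   unfolding F_def by (rule S.lift_in[OF S''.tensor_vsp[unfolded zs(1)] ct(1,2)[OF zs(2,3)] fin[OF u zs(2)]])
 qed (use c_out in simp)
 \<comment> \<open>All frames k in the stabiliser are needed, since the equivariance of
   \<open>circ\<close> compares the frames e and \<open>iv k\<close>.\<close>
 have key: "cw ?is W k (w @ w') (?c u) = opr is' W f' w' (cw is V k w (f u))"
  if w: "vw is w" and w': "vw is' w'" and u: "u \<in> space U" and k: "k \<in> stab C (hd is)" for w w' u k
 proof -
  have kG: "k \<in> Gr" by (rule stab_Gr[OF k])
  have len: "length w = length is - 1" using vw_length[OF w] by simp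
  have w'': "vw ?is (w @ w')" using vw_append[OF d(2) d'(2) l len] w w' by simp
  obtain ys h where t: "tr C is k (map fst w) = (ys, h)" by force
  note p = tr_props[OF vw_gseq[OF w] k t]
  have hl: "h \<in> stab C (hd is')" using p(2) l by simp
  have hG: "h \<in> Gr" by (rule stab_Gr[OF p(2)])
  obtain ys' h' where t': "tr C is' h (map fst w') = (ys', h')" by force
  note p' = tr_props[OF vw_gseq[OF w'] hl t']
  have t'': "tr C ?is k (map fst (w @ w')) = (ys @ ys', h')" using tr_append[OF vw_gseq[OF w] k d'(2) l t t'] by simp
  have g: "gseq is ys" and g': "gseq is' ys'" and g'': "gseq ?is (ys @ ys')"
   using yseqs_gseq[OF d(1) p(1)] yseqs_gseq[OF d'(1) p'(1)] yseqs_gseq[OF pts''] yseqs_append[OF d(2) d'(2) l] p(1) p'(1) yseqs_length[OF p(1)] by auto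
  interpret S: tensor_space "bscale N" "scal V" "comps C N is ys" "space V" by (rule tensor_space[OF vV])
  interpret S'': tensor_space "bscale N" "scal W" "comps C N ?is (ys @ ys')" "space W" by (rule tensor_space[OF vW])
  note ct' = ct[OF p(1) p'(1), folded F_def]
  note cl'' = ctr_linear[OF kG w'' g'' vW] and cl = ctr_linear[OF kG w g vV] and cl' = ctr_linear[OF hG w' g' vW]
  let ?A = "\<lambda>v. ctr is' W ys' (absl h w') (f' v ys')"
  have Alin: "linear_on (scal V) (scal W) (space V) ?A" by (rule linear_on_comp[OF _ cl', where f = "\<lambda>v. f' v ys'"])
     (use Hom_linear[OF f'] Mspace_tensor[OF Hom_in[OF f'] p'(1)] in \<open>auto simp: linear_on_def pw_def[of "pw (*)"]\<close>)
  have "ctr ?is W (ys @ ys') (absl k (w @ w')) (?c u (ys @ ys')) =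
    lift_M C N is V ys (\<lambda>ms v. ctr ?is W (ys @ ys') (absl k (w @ w')) (F ys ys' ms v)) (f u ys)"
   unfolding c_app[OF p(1) p'(1)]
   by (rule S.linear_lift_comp[OF S''.tensor_vsp ct'(1,2) cl'' vsp_vs[OF vW] fin[OF u p(1)]])
  also have "\<dots> = ?A (ctr is V ys (absl k w) (f u ys))"
  proof (rule S.lift_unique[symmetric, OF vsp_vs[OF vW] _ _ _ fin[OF u p(1)]])
   show "multilinear (bscale N) (scal V) (scal W) (comps C N is ys) (space V) (\<lambda>ms v. ctr ?is W (ys @ ys') (absl k (w @ w')) (F ys ys' ms v))"
    by (rule S.multilinear_linear_comp[OF ct'(1,2) cl''])
   show "linear_on (pw (*)) (scal W) (tsp is V ys) (\<lambda>t. ?A (ctr is V ys (absl k w) t))"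
    by (rule linear_on_comp[OF cl Alin]) (use ctr_in[OF kG w g vV] in auto)
   fix ms v assume ms: "ms \<in> listset (comps C N is ys)" and v: "v \<in> space V"
   show "?A (ctr is V ys (absl k w) (pure_M C N is V ys ms v)) = ctr ?is W (ys @ ys') (absl k (w @ w')) (F ys ys' ms v)"
    using ct'(3)[OF w'' len kG hG p(3) ms v] linear_on_scale[OF Alin v] ctr_pure[OF kG w g vV ms v] by simp
  qed
  finally have eq: "ctr ?is W (ys @ ys') (absl k (w @ w')) (?c u (ys @ ys')) = ?A (ctr is V ys (absl k w) (f u ys))" .
  \<comment> \<open>The contraction of \<open>f u\<close> after the correction by the inverse of h;
    the uncorrected one is h applied to it.\<close>
  define v1 where "v1 = cw is V k w (f u)"
  have v1: "v1 \<in> space V" unfolding v1_def by (rule cw_in[OF w d(4) k Hom_in[OF f u]])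
  have "ctr is V ys (absl k w) (f u ys) \<in> space V" by (rule ctr_in[OF kG w g vV fin[OF u p(1)]])
  then have c1: "ctr is V ys (absl k w) (f u ys) = gact V h v1"
   using rep_inv[OF d(4,6) p(2)] by (simp add: v1_def cw_def t)
  have "cw ?is W k (w @ w') (?c u) = gact W (iv h') (ctr is' W ys' (absl h w') (f' (gact V h v1) ys'))"
   unfolding cw_def t'' prod.case eq c1 ..
  also have "\<dots> = cw is' W h w' (f' (gact V h v1))" by (simp add: cw_def t')
  also have "\<dots> = cw is' W (iv h \<cdot> h) w' (f' v1)"
   using Hom_equiv[OF f' hl v1] cw_Maction[OF w' hl hl d'(4) Hom_in[OF f' v1]] by simp
  also have "\<dots> = opr is' W f' w' v1" using hG by (simp add: opr_def)
  finally show ?thesis by (simp add: v1_def)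
 qed
 show "?c \<in> Hom C N ?is U W"
 proof (rule HomI)
  show "?c u = 0" if u: "u \<notin> space U" for u
  proof
   fix zs
   show "?c u zs = 0 zs"
   proof (cases "zs \<in> yseqs C ?is")
    case True
    then obtain ys ys' where zs: "zs = ys @ ys'" "ys \<in> yseqs C is" "ys' \<in> yseqs C is'" using split by blast
    interpret S: tensor_space "bscale N" "scal V" "comps C N is ys" "space V" by (rule tensor_space[OF vV])
    have "f u ys = 0" using Hom_out[OF f u] by simp
    then show ?thesis unfolding zs(1) c_app[OF zs(2,3)]
     using linear_on_0[OF S.lift_linear[OF vs_pw3(1) ct(1)[OF zs(2,3), folded F_def]] vsp_0[OF S.tensor_vsp]] by simp
   qed (simp add: c_out)
  qed
  show "?c u \<in> Mspace C N ?is W" if "u \<in> space U" for u by (rule c_in[OF that])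
  have lin_zs: "linear_on (scal U) (pw (*)) (space U) (\<lambda>u. ?c u zs)" for zs
  proof (cases "zs \<in> yseqs C ?is")
   case True
   then obtain ys ys' where zs: "zs = ys @ ys'" "ys \<in> yseqs C is" "ys' \<in> yseqs C is'" using split by blast
   interpret S: tensor_space "bscale N" "scal V" "comps C N is ys" "space V" by (rule tensor_space[OF vV])
   show ?thesis unfolding zs(1) c_app[OF zs(2,3)]
    by (rule linear_on_comp[OF _ S.lift_linear[OF vs_pw3(1) ct(1)[OF zs(2,3), folded F_def]], where f = "\<lambda>u. f u ys"])
      (use Hom_linear[OF f] fin[OF _ zs(2)] in \<open>auto simp: linear_on_def pw_def[of "pw (*)"]\<close>)
  next
   case False
   then show ?thesis by (simp add: c_out linear_on_def vs_simps[OF vs_pw3(1)])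
  qed
  show "linear_on (scal U) (pw (pw (*))) (space U) ?c" using lin_zs by (auto simp: linear_on_def pw_def[of "pw (*)"])
  fix k u assume "k \<in> stab C (hd ?is)" and u: "u \<in> space U"
  then have k: "k \<in> stab C (hd is)" using hd by simp
  show "?c (gact U k u) = Maction C N ?is W k (?c u)"
  proof (rule cw_eqI[OF c_in[OF rep_in[OF d(3) k u]] Maction_in[OF pts'' ne _ rW c_in[OF u]] rW pts''])
   fix w'' assume w'': "vw ?is w''"
   obtain w w' where ww: "w'' = w @ w'" "vw is w" "vw is' w'" using vw_split[OF r r' l w''] .
   have ik: "iv k \<in> stab C (hd is)" by (rule stab_inv[OF d(5) k])
   have "cw ?is W e w'' (?c (gact U k u)) = opr is' W f' w' (cw is V e w (f (gact U k u)))"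
    using key[OF ww(2,3) rep_in[OF d(3) k u] stab_one[OF d(5)]] ww(1) by simp
   also have "cw is V e w (f (gact U k u)) = cw is V (iv k) w (f u)"
    using Hom_equiv[OF f k u] cw_Maction[OF ww(2) stab_one[OF d(5)] k d(4) Hom_in[OF f u]] stab_Gr[OF k] by simp
   also have "opr is' W f' w' \<dots> = cw ?is W (iv k) w'' (?c u)" using key[OF ww(2,3) u ik] ww(1) by simp
   also have "\<dots> = cw ?is W e w'' (Maction C N ?is W k (?c u))"
    using cw_Maction[OF w'' _ _ rW c_in[OF u], of e k] stab_one[OF d(5)] k hd stab_Gr[OF k] by simp
   finally show "cw ?is W e w'' (?c (gact U k u)) = cw ?is W e w'' (Maction C N ?is W k (?c u))" .
  qed (use k hd in simp)
 qed
 show "opr ?is W ?c (w @ w') u = opr is' W f' w' (opr is V f w u)" if "vw is w" "vw is' w'" "u \<in> space U"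
  using key[OF that stab_one[OF d(5)]] by (simp add: opr_def)
qed

lemma
 assumes i: "i \<in> pts C" and U: "rep_at i U"
 shows id_hom_Hom: "id_hom N U \<in> Hom C N [i] U U"
  and opr_id_hom: "u \<in> space U ==> opr [i] U (id_hom N U) [] u = u"
proof -
 have r: "reps_at [i] U U" using i U by (simp add: reps_at_def)
 have g: "gseq [i] []" and w: "vw [i] []" using i by auto
 have c: "comps C N [i] [] = []" by (simp add: comps_def)
 note vU = rep_vsp[OF U]
 interpret S: tensor_space "bscale N" "scal U" "comps C N [i] []" "space U" by (rule tensor_space[OF vU])
 let ?f = "id_hom N U"
 have fu: "?f u = single [] (pure_M C N [i] U [] [] u)" if "u \<in> space U" for u using that by (simp add: id_hom_def c)
 have fin: "?f u \<in> Mspace C N [i] U" if "u \<in> space U" for u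
  using S.tpure_in_tensor[of "[]" u] that fu[OF that] by (auto simp: Mspace_def single_def c)
 have op: "opr [i] U ?f [] u = u" if u: "u \<in> space U" for u
  using ctr_pure[OF one_closed w g vU, of "[]" u] u fu[OF u] rep_one[OF U] vsp_simps(4)[OF vU]
  by (simp add: opr_def cw_def single_def c)
 have ve: "vw [i] w' \<longleftrightarrow> w' = []" for w' using i by (auto simp: vw_def)
 have "linear_on (scal U) (pw (*)) (space U) (pure_M C N [i] U [] [])"
  using tpure_multilinear[of "[]" "comps C N [i] []" 0 "space U" "bscale N" "scal U"] vsp_0[OF vU] unfolding c multilinear_Nil by simp
 then have lin: "linear_on (scal U) (pw (pw (*))) (space U) ?f"
  by (auto simp: linear_on_def fu vsp_add[OF vU] vsp_scale[OF vU] fun_eq_iff single_def pw_def)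
 show "?f \<in> Hom C N [i] U U"
 proof (rule HomI)
  fix g u assume g: "g \<in> stab C (hd [i])" and u: "u \<in> space U"
  have gi: "g \<in> stab C i" using g by simp
  have gG: "g \<in> Gr" by (rule stab_Gr[OF gi])
  have gu: "gact U g u \<in> space U" by (rule rep_in[OF U gi u])
  show "?f (gact U g u) = Maction C N [i] U g (?f u)"
  proof (rule cw_eqI[OF fin[OF gu] Maction_in[OF _ _ g _ fin[OF u]]])
   fix w' assume "vw [i] w'"
   then have w': "w' = []" using ve by simp
   have "cw [i] U e [] (Maction C N [i] U g (?f u)) = cw [i] U (iv g) [] (?f u)"
    using cw_Maction[OF w _ g _ fin[OF u], of e] i U stab_one[OF i] gG by simp
   also have "\<dots> = gact U g (ctr [i] U [] [] (?f u []))" using cw_lact[OF w inv_closed[OF gG], of U "?f u"] gG by simp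
   also have "ctr [i] U [] [] (?f u []) = u"
    using ctr_pure[OF one_closed w \<open>gseq [i] []\<close> vU, of "[]" u] u fu[OF u] vsp_simps(4)[OF vU]
    by (simp add: single_def c)
   finally show "cw [i] U e w' (?f (gact U g u)) = cw [i] U e w' (Maction C N [i] U g (?f u))"
    using op[OF gu] w' by (simp add: opr_def)
  qed (use i U in auto)
 qed (use fin lin in \<open>auto simp: id_hom_def\<close>)
 show "opr [i] U ?f [] u = u" if "u \<in> space U" by (rule op[OF that])
qed

lemma Mspace_fin_dim:
 assumes V: "rep_at (last is) V" and pts: "set is \<subseteq> pts C" "is \<noteq> []"
 shows "fin_dim (pw (pw (*))) (Mspace C N is V)"
proof -
 note vV = rep_vsp[OF V]
 obtain B where B: "finite B" "B \<subseteq> space V" "is_basis (scal V) (space V) B"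
  using fin_dim_basis[OF vsp_vs[OF vV] rep_fin[OF V]] .
 define E where "E = (\<lambda>(ys, w, b). single ys (pure_M C N is V ys (absv e w) b))"
 define I where "I = Sigma (yseqs C is) (\<lambda>ys. bw is ys \<times> B)"
 have fI: "finite I" unfolding I_def using finite_yseqs[OF pts] finite_bw B by auto
 show ?thesis
 proof (rule fin_dim_subset[OF Mspace_vsp[OF vV] _ finite_imageI[OF fI, of E]], rule subsetI)
  fix x assume x: "x \<in> Mspace C N is V"
  let ?a = "\<lambda>(ys, w, b). coord (scal V) B b (cw is V e (star is w) x)"
  have "x = (\<Sum>t\<in>I. pw (pw (*)) (?a t) (E t))"
  proof (intro ext)
   fix zs \<beta>
   have S: "(\<Sum>t\<in>I. pw (pw (*)) (?a t) (E t)) zs \<beta> = (\<Sum>t\<in>I. ?a t * E t zs \<beta>)" by (simp add: sum_apply pw_def)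
   show "x zs \<beta> = (\<Sum>t\<in>I. pw (pw (*)) (?a t) (E t)) zs \<beta>"
   proof (cases "zs \<in> yseqs C is")
    case True
    have g: "gseq is zs" by (rule yseqs_gseq[OF pts(1) True])
    have hd: "hd is \<in> pts C" using pts by auto
    have w1: "pure_M C N is V zs (absv e w) (cw is V e (star is w) x) =
      (\<Sum>b\<in>B. pw (*) (coord (scal V) B b (cw is V e (star is w) x)) (pure_M C N is V zs (absv e w) b))" if w: "w \<in> bw is zs" for w
    proof -
     have ab: "absv e w \<in> listset (comps C N is zs)" using bw_props(5)[OF w g, of e] comps_compsK[OF g] by simp
     have pl: "linear_on (scal V) (pw (*)) (space V) (pure_M C N is V zs (absv e w))"
      using tpure_multilinear[OF ab vsp_0[OF vV], of "bscale N" "scal V"] ab unfolding multilinear_def by blast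
     have "cw is V e (star is w) x \<in> space V" by (rule cw_in[OF bw_props(3)[OF w g] V stab_one[OF hd] x])
     then have "pure_M C N is V zs (absv e w) (cw is V e (star is w) x) =
       pure_M C N is V zs (absv e w) (\<Sum>b\<in>B. scal V (coord (scal V) B b (cw is V e (star is w) x)) b)"
      using coord_expand[OF vsp_vs[OF vV] B(3,1)] by simp
     also have "\<dots> = (\<Sum>b\<in>B. pw (*) (coord (scal V) B b (cw is V e (star is w) x)) (pure_M C N is V zs (absv e w) b))"
      using B(2) by (intro linear_on_combination[OF pl vV]) auto
     finally show ?thesis .
    qed
    have "(\<Sum>t\<in>I. ?a t * E t zs \<beta>) = (\<Sum>ys\<in>yseqs C is. \<Sum>t\<in>bw is ys \<times> B. ?a (ys, t) * E (ys, t) zs \<beta>)"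
     unfolding I_def using finite_yseqs[OF pts] finite_bw B(1) by (subst sum.Sigma) (auto intro!: sum.cong)
    also have "\<dots> = (\<Sum>ys\<in>yseqs C is. if ys = zs then (\<Sum>t\<in>bw is zs \<times> B. ?a (zs, t) * E (zs, t) zs \<beta>) else 0)"
     by (intro sum.cong refl) (auto simp: E_def single_def intro!: sum.neutral)
    also have "\<dots> = (\<Sum>t\<in>bw is zs \<times> B. ?a (zs, t) * E (zs, t) zs \<beta>)" using finite_yseqs[OF pts] True by simp
    also have "\<dots> = (\<Sum>w\<in>bw is zs. \<Sum>b\<in>B. ?a (zs, w, b) * E (zs, w, b) zs \<beta>)"
     by (simp add: sum.cartesian_product split_def)
    also have "\<dots> = (\<Sum>w\<in>bw is zs. pure_M C N is V zs (absv e w) (cw is V e (star is w) x) \<beta>)"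
     by (intro sum.cong refl) (simp add: w1 sum_apply E_def pw_def single_def)
    also have "\<dots> = x zs \<beta>" using Mspace_expand[OF x V pts(1) True] by (simp add: sum_apply)
    finally show ?thesis using S by simp
   next
    case False
    then have "E t zs \<beta> = 0" if "t \<in> I" for t using that by (auto simp: E_def I_def single_def)
    then show ?thesis using S Mspace_out[OF x False] by simp
   qed
  qed
  also have "\<dots> \<in> Modules.module.span (pw (pw (*))) (E ` I)" by (rule in_span_sum[OF vs_pw3(2)]) auto
  finally show "x \<in> Modules.module.span (pw (pw (*))) (E ` I)" .
 qed
qed

lemma Hom_fin_dim:
 assumes r: "reps_at is U V"
 shows "fin_dim hscale (Hom C N is U V)"
proof -
 note d = reps_atD[OF r]
 show ?thesis
  by (rule fin_dim_linear_maps[OF rep_vsp[OF d(3)] rep_fin[OF d(3)] Mspace_vsp[OF rep_vsp[OF d(4)]] Mspace_fin_dim[OF d(4,1,2)] Hom_vsp[OF r]])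
    (use Hom_linear Hom_in Hom_out in blast)+
qed

end

section \<open>Schur's lemma and complete reducibility\<close>

text \<open>In contrast to \<open>Hom\<close>, maps are not normalised outside the space, and the
  two representations may live on different types. The module M(i;V) itself can therefore be a
  source or a target.\<close>

definition eqvar :: "'g set => ('g, 'k, 'u::ab_group_add) rep => ('g, 'k, 'v::ab_group_add) rep => ('u => 'v) => bool" where
 "eqvar H U V f \<longleftrightarrow> f ` space U \<subseteq> space V \<and> linear_on (scal U) (scal V) (space U) f \<and>
   (\<forall>h\<in>H. \<forall>u\<in>space U. f (gact U h u) = gact V h (f u))"

lemma eqvar_in: "eqvar H U V f ==> u \<in> space U ==> f u \<in> space V"
 and eqvar_linear: "eqvar H U V f ==> linear_on (scal U) (scal V) (space U) f"
 and eqvar_gact: "eqvar H U V f ==> h \<in> H ==> u \<in> space U ==> f (gact U h u) = gact V h (f u)"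
 by (auto simp: eqvar_def)

lemma eqvar_comp: "eqvar H U V f ==> eqvar H V W g ==> eqvar H U W (\<lambda>u. g (f u))"
 unfolding eqvar_def by (auto simp: linear_on_def image_subset_iff)

lemma irreducible_rep_is_rep: "irreducible_rep G H V ==> is_rep G H V" by (simp add: irreducible_rep_def)

lemma irreducible_subspace:
 assumes "irreducible_rep G H V" "vsp (scal V) W" "W \<subseteq> space V" "\<And>h w. h \<in> H ==> w \<in> W ==> gact V h w \<in> W"
 shows "W = {0} \<or> W = space V" using assms unfolding irreducible_rep_def vsp_def by (metis image_subsetI)

lemma schur_bij:
 assumes U: "irreducible_rep G H U" and V: "irreducible_rep G H V" and f: "eqvar H U V f"
  and u: "u \<in> space U" "f u \<noteq> 0"
 shows "bij_betw f (space U) (space V)"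
proof -
 note rU = irreducible_rep_is_rep[OF U] and rV = irreducible_rep_is_rep[OF V]
 note vU = rep_vsp[OF rU] and vV = rep_vsp[OF rV]
 have "{x \<in> space U. f x = 0} = {0} \<or> {x \<in> space U. f x = 0} = space U"
 proof (rule irreducible_subspace[OF U])
  show "vsp (scal U) {x \<in> space U. f x = 0}" by (rule vsp_kernel[OF eqvar_linear[OF f] vU vsp_vs[OF vV]])
  fix h w assume h: "h \<in> H" and w: "w \<in> {x \<in> space U. f x = 0}"
  show "gact U h w \<in> {x \<in> space U. f x = 0}"
   using w rep_in[OF rU h] eqvar_gact[OF f h] linear_on_0[OF rep_linear[OF rV h] vsp_0[OF vV]] by auto
 qed auto
 then have ker: "{x \<in> space U. f x = 0} = {0}" using u by auto
 have "f ` space U = {0} \<or> f ` space U = space V"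
 proof (rule irreducible_subspace[OF V])
  show "vsp (scal V) (f ` space U)" by (rule vsp_image[OF eqvar_linear[OF f] vU vsp_vs[OF vV]])
  fix h w assume h: "h \<in> H" and w: "w \<in> f ` space U"
  then obtain x where "x \<in> space U" "w = f x" by auto
  then show "gact V h w \<in> f ` space U" using eqvar_gact[OF f h] rep_in[OF rU h] by force
 qed (use eqvar_in[OF f] in auto)
 then have "f ` space U = space V" using u by auto
 moreover have "inj_on f (space U)"
 proof (rule inj_onI)
  fix x y assume "x \<in> space U" "y \<in> space U" "f x = f y"
  then have "x - y \<in> {x \<in> space U. f x = 0}" using linear_on_diff[OF eqvar_linear[OF f] vU] vsp_diff[OF vU] by simp
  then show "x = y" using ker by auto
 qed
 ultimately show ?thesis by (simp add: bij_betw_def)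
qed

lemma bij_eqvar_rep_isomorphic:
 "eqvar H U V f ==> bij_betw f (space U) (space V) ==> rep_isomorphic H U V"
 unfolding rep_isomorphic_def eqvar_def by auto

lemma rep_isomorphic_eqvar:
 assumes "rep_isomorphic H U V"
 obtains f where "eqvar H U V f" "bij_betw f (space U) (space V)"
 using assms unfolding rep_isomorphic_def eqvar_def by (auto simp: bij_betw_def)

lemma eqvar_inverse:
 assumes f: "eqvar H U V f" "bij_betw f (space U) (space V)" and U: "is_rep G H U"
 shows "eqvar H V U (inv_into (space U) f)"
proof -
 let ?g = "inv_into (space U) f"
 note vU = rep_vsp[OF U]
 have g: "?g y \<in> space U" "f (?g y) = y" if "y \<in> space V" for y
  using f(2) that by (auto simp: bij_betw_def inv_into_into f_inv_into_f)
 have gf: "?g (f x) = x" if "x \<in> space U" for x using f(2) that by (auto simp: bij_betw_def)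
 have "linear_on (scal V) (scal U) (space V) ?g"
 proof (rule linear_onI)
  fix x y assume "x \<in> space V" "y \<in> space V"
  then have "x + y = f (?g x + ?g y)" using g linear_on_add[OF eqvar_linear[OF f(1)]] by simp
  then show "?g (x + y) = ?g x + ?g y" using gf g vsp_add[OF vU] \<open>x \<in> _\<close> \<open>y \<in> _\<close> by simp
 next
  fix c x assume "x \<in> space V"
  then have "scal V c x = f (scal U c (?g x))" using g linear_on_scale[OF eqvar_linear[OF f(1)]] by simp
  then show "?g (scal V c x) = scal U c (?g x)" using gf g vsp_scale[OF vU] \<open>x \<in> _\<close> by simp
 qed
 moreover have "?g (gact V h y) = gact U h (?g y)" if "h \<in> H" "y \<in> space V" for h y
 proof -
  have "gact V h y = f (gact U h (?g y))" using g eqvar_gact[OF f(1)] that by simp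
  then show ?thesis using gf g rep_in[OF U] that by simp
 qed
 ultimately show ?thesis using g by (auto simp: eqvar_def)
qed

subsection \<open>Schur's lemma over an algebraically closed field\<close>

text \<open>Here \<open>E p\<close> is p(f) v. Among the nonzero p with p(f) v = 0 one of least
  degree is taken; it is not constant, so it has a root r and factors as (X - r) q, and q(f) v is an
  eigenvector by minimality.\<close>

lemma eigenvector_exists:
 fixes s :: "'k::alg_closed_field => 'a::ab_group_add => 'a"
 assumes A: "vsp s A" "fin_dim s A" and f: "linear_on s s A f" "f ` A \<subseteq> A" and v: "v \<in> A" "v \<noteq> 0"
 shows "\<exists>r. \<exists>w\<in>A. w \<noteq> 0 \<and> f w = s r w"
proof -
 interpret vector_space s using A by (simp add: vsp_def)
 define E where "E p = (\<Sum>i\<le>degree p. s (coeff p i) ((f ^^ i) v))" for p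
 have fi: "(f ^^ i) v \<in> A" for i by (induction i) (use v f in auto)
 have E_N: "E p = (\<Sum>i\<le>n. s (coeff p i) ((f ^^ i) v))" if "degree p \<le> n" for p n
  unfolding E_def by (rule sum.mono_neutral_left) (use that in \<open>auto simp: coeff_eq_0\<close>)
 have E_add: "E (p + q) = E p + E q" for p q
  using E_N[of "p + q" "max (degree p) (degree q)"] E_N[of p "max (degree p) (degree q)"] E_N[of q "max (degree p) (degree q)"]
  by (simp add: degree_add_le scale_left_distrib sum.distrib)
 have E_smult: "E (smult c p) = s c (E p)" for c p
  using E_N[of "smult c p" "degree p"] by (simp add: E_def scale_sum_right degree_smult_le)
 have E_in: "E p \<in> A" for p unfolding E_def by (intro vsp_sum[OF A(1)] vsp_scale[OF A(1)] fi)
 have E_shift: "E (pCons 0 p) = f (E p)" for p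
 proof -
  have "E (pCons 0 p) = (\<Sum>i\<le>Suc (degree p). s (coeff (pCons 0 p) i) ((f ^^ i) v))"
   by (rule E_N) (simp add: degree_pCons_le)
  also have "\<dots> = (\<Sum>i\<le>degree p. s (coeff p i) (f ((f ^^ i) v)))" by (subst sum.atMost_Suc_shift) simp
  also have "\<dots> = f (E p)" unfolding E_def by (rule linear_on_combination[OF f(1) A(1), symmetric]) (rule fi)
  finally show ?thesis .
 qed
 have E_monom: "E (monom c i) = s c ((f ^^ i) v)" for c i
  using E_N[of "monom c i" i] by (simp add: degree_monom_le if_distrib[of "\<lambda>x. s x _"] cong: if_cong)
 \<comment> \<open>Otherwise the vectors v, f v, ..., up to the power \<open>card B\<close> would be
   distinct and independent, one more than the spanning set B allows.\<close>
 have ex: "\<exists>p. p \<noteq> 0 \<and> E p = 0"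
 proof (rule ccontr)
  assume "\<not> ?thesis"
  then have n: "E p \<noteq> 0" if "p \<noteq> 0" for p using that by blast
  obtain B where B: "finite B" "span B = A" using A(2) by (auto simp: fin_dim_def)
  let ?S = "(\<lambda>i. (f ^^ i) v) ` {..card B}"
  have inj: "inj_on (\<lambda>i. (f ^^ i) v) {..card B}"
  proof (rule inj_onI, rule ccontr)
   fix i j assume *: "(f ^^ i) v = (f ^^ j) v" "i \<noteq> j"
   have "coeff (monom 1 i + smult (-1) (monom 1 j)) i = (1::'k)" using *(2) by simp
   then have "monom 1 i + smult (-1) (monom 1 j) \<noteq> (0 :: 'k poly)" by (metis coeff_0 zero_neq_one)
   moreover have "E (monom 1 i + smult (-1) (monom 1 j)) = 0" by (simp only: E_add E_smult E_monom) (simp add: *)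
   ultimately show False using n by blast
  qed
  have "independent ?S"
  proof (rule ccontr)
   assume "\<not> ?thesis"
   then obtain u i0 where u: "i0 \<le> card B" "u ((f ^^ i0) v) \<noteq> 0" "(\<Sum>x\<in>?S. s (u x) x) = 0"
    by (subst (asm) dependent_finite) auto
   define p where "p = (\<Sum>i\<le>card B. monom (u ((f ^^ i) v)) i)"
   have E_sum: "E (sum q I) = (\<Sum>i\<in>I. E (q i))" for q and I :: "nat set"
    by (induction I rule: infinite_finite_induct) (simp_all add: E_add, simp_all add: E_def)
   have "E p = (\<Sum>x\<in>?S. s (u x) x)" unfolding p_def E_sum E_monom using inj by (simp add: sum.reindex)
   moreover have "coeff p i0 = u ((f ^^ i0) v)" using u(1) by (simp add: p_def coeff_sum)
   ultimately have "p \<noteq> 0" "E p = 0" using u by (metis coeff_0, simp)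
   then show False using n by blast
  qed
  then have "card ?S \<le> card B" using independent_span_bound[OF B(1), of ?S] B(2) fi by auto
  then show False using card_image[OF inj] by simp
 qed
 define p where "p = arg_min degree (\<lambda>p. p \<noteq> 0 \<and> E p = 0)"
 have p: "p \<noteq> 0" "E p = 0" and min: "degree p \<le> degree q" if "q \<noteq> 0" "E q = 0" for q
  using arg_min_nat_lemma[of "\<lambda>p. p \<noteq> 0 \<and> E p = 0" _ degree] ex that unfolding p_def by blast+
 have p: "p \<noteq> 0" "E p = 0" using ex p by blast+
 have "degree p > 0"
 proof (rule ccontr)
  assume "\<not> ?thesis"
  then have "degree p = 0" by simp
  then obtain c where c: "p = [:c:]" by (rule degree_eq_zeroE)
  then have "E p = s c v" using E_monom[of c 0] by (simp add: monom_0)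
  then show False using p v c by simp
 qed
 then obtain r where "poly p r = 0" using alg_closed_imp_poly_has_root by blast
 then obtain q where q: "p = [:- r, 1:] * q" by (auto simp: poly_eq_0_iff_dvd elim: dvdE)
 have q0: "q \<noteq> 0" using p q by auto
 have "degree p = degree [:- r, 1:] + degree q" unfolding q by (rule degree_mult_eq) (use q0 in auto)
 then have "degree p = Suc (degree q)" by simp
 then have "E q \<noteq> 0" using min[of q] q0 by auto
 have "p = smult (- r) q + pCons 0 q" using q by simp
 then have "E p = s (- r) (E q) + f (E q)" by (simp only: E_add E_smult E_shift)
 then have "f (E q) = s r (E q)" using p(2) by (simp add: add_eq_0_iff2)
 then show ?thesis using \<open>E q \<noteq> 0\<close> E_in by blast
qed

lemma schur_scalar:
 fixes U :: "('g, 'k::alg_closed_field, 'v::ab_group_add) rep"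
 assumes U: "irreducible_rep G H U" and f: "eqvar H U U f"
 shows "\<exists>c. \<forall>u\<in>space U. f u = scal U c u"
proof -
 note rU = irreducible_rep_is_rep[OF U]
 note vU = rep_vsp[OF rU]
 note vs = vsp_simps[OF vU]
 obtain v where v: "v \<in> space U" "v \<noteq> 0" using U vsp_0[OF vU] by (auto simp: irreducible_rep_def)
 obtain r w where w: "w \<in> space U" "w \<noteq> 0" "f w = scal U r w"
  using eigenvector_exists[OF vU rep_fin[OF rU] eqvar_linear[OF f] _ v] eqvar_in[OF f] by blast
 have "{u \<in> space U. f u = scal U r u} = {0} \<or> {u \<in> space U. f u = scal U r u} = space U"
 proof (rule irreducible_subspace[OF U])
  show "vsp (scal U) {u \<in> space U. f u = scal U r u}" by (rule vspI[OF vsp_vs[OF vU]])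
     (auto simp: vsp_0[OF vU] vsp_add[OF vU] vsp_scale[OF vU] vs linear_on_0[OF eqvar_linear[OF f] vsp_0[OF vU]]
      linear_on_add[OF eqvar_linear[OF f]] linear_on_scale[OF eqvar_linear[OF f]] mult.commute)
  show "gact U h w \<in> {u \<in> space U. f u = scal U r u}" if "h \<in> H" "w \<in> {u \<in> space U. f u = scal U r u}" for h w
   using that rep_in[OF rU] eqvar_gact[OF f] linear_on_scale[OF rep_linear[OF rU]] by auto
 qed auto
 then show ?thesis using w by blast
qed

subsection \<open>Complete reducibility\<close>

locale finite_subgroup = group G for G :: "'g monoid" (structure) +
 fixes H :: "'g set"
 assumes sub: "subgroup H G" and fin: "finite H"
begin

lemma H_carrier: "h \<in> H ==> h \<in> carrier G" using sub by (rule subgroup.mem_carrier)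

lemma H_mult: "g \<in> H ==> h \<in> H ==> g \<otimes> h \<in> H"
 and H_inv: "h \<in> H ==> inv h \<in> H"
 and H_one: "\<one> \<in> H" using sub by (auto intro: subgroup.m_closed subgroup.m_inv_closed subgroup.one_closed)

lemma H_cancel: "g \<in> H ==> h \<in> H ==> g \<otimes> (inv g \<otimes> h) = h" "g \<in> H ==> h \<in> H ==> inv g \<otimes> (g \<otimes> h) = h"
 by (auto simp: m_assoc[symmetric] H_carrier)

lemma sum_reindex_left: "k \<in> H ==> (\<Sum>h\<in>H. f (k \<otimes> h)) = (\<Sum>h\<in>H. f h)"
 by (rule sum.reindex_bij_witness[of _ "\<lambda>h. inv k \<otimes> h" "\<lambda>h. k \<otimes> h"])
   (auto simp: H_cancel H_mult H_inv)

lemma maschke: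
 fixes A :: "('g, 'k::field, 'x::ab_group_add) rep"
 assumes A: "is_rep G H A" and Z: "vsp (scal A) Z" "Z \<subseteq> space A" "\<And>h z. h \<in> H ==> z \<in> Z ==> gact A h z \<in> Z"
  and card: "of_nat (card H) \<noteq> (0::'k)"
 shows "\<exists>P. eqvar H A A P \<and> P ` space A \<subseteq> Z \<and> (\<forall>z\<in>Z. P z = z)"
proof -
 note vX = rep_vsp[OF A]
 note vs = vsp_simps[OF vX]
 interpret vector_space "scal A" by (rule vsp_vs[OF vX])
 interpret vector_space_pair "scal A" "scal A" ..
 obtain B where B: "finite B" "B \<subseteq> Z" "is_basis (scal A) Z B"
  using fin_dim_basis[OF vector_space_axioms fin_dim_subspace[OF Z(1) rep_fin[OF A] Z(2)]] .
 \<comment> \<open>A linear retraction onto Z, read off from a basis of Z. Averaging over H makes it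
   equivariant, and it stays the identity on Z because Z is invariant.\<close>
 define Q where "Q x = (\<Sum>b\<in>B. scal A (coord (scal A) B b x) b)" for x
 have Qlin: "linear_on (scal A) (scal A) (space A) Q" using coord_linear[OF vector_space_axioms B(3)]
  by (intro linear_onI) (simp_all add: Q_def Vector_Spaces.linear_iff vs sum.distrib)
 have QZ: "Q x \<in> Z" for x unfolding Q_def using B(2) by (intro vsp_sum[OF Z(1)] vsp_scale[OF Z(1)]) auto
 have Qz: "Q z = z" if "z \<in> Z" for z using coord_expand[OF vector_space_axioms B(3,1) that] by (simp add: Q_def)
 define P where "P x = scal A (1 / of_nat (card H)) (\<Sum>h\<in>H. gact A h (Q (gact A (inv h) x)))" for x
 have t_in: "gact A h (Q y) \<in> Z" if "h \<in> H" for h y using Z(3) QZ that by blast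
 have PZ: "P x \<in> Z" for x unfolding P_def using t_in by (intro vsp_scale[OF Z(1)] vsp_sum[OF Z(1)])
 have trm: "linear_on (scal A) (scal A) (space A) (\<lambda>x. gact A h (Q (gact A (inv h) x)))" if h: "h \<in> H" for h
  by (rule linear_on_comp[OF linear_on_comp[OF rep_linear[OF A H_inv[OF h]] Qlin] rep_linear[OF A h]])
    (use rep_in[OF A H_inv[OF h]] QZ Z(2) in auto)
 have "linear_on (scal A) (scal A) (space A) P"
 proof (rule linear_onI)
  fix x y assume "x \<in> space A" "y \<in> space A"
  then have "(\<Sum>h\<in>H. gact A h (Q (gact A (inv h) (x + y)))) =
    (\<Sum>h\<in>H. gact A h (Q (gact A (inv h) x)) + gact A h (Q (gact A (inv h) y)))"
   using linear_on_add[OF trm] by (intro sum.cong) auto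
  then show "P (x + y) = P x + P y" by (simp add: P_def sum.distrib vs)
 next
  fix c x assume "x \<in> space A"
  then have "(\<Sum>h\<in>H. gact A h (Q (gact A (inv h) (scal A c x)))) =
    (\<Sum>h\<in>H. scal A c (gact A h (Q (gact A (inv h) x))))" using linear_on_scale[OF trm] by (intro sum.cong) auto
  then show "P (scal A c x) = scal A c (P x)" by (simp add: P_def vs(3) mult.commute flip: vs(9))
 qed
 moreover have "P (gact A k x) = gact A k (P x)" if k: "k \<in> H" and x: "x \<in> space A" for k x
 proof -
  have "gact A k (P x) = scal A (1 / of_nat (card H)) (gact A k (\<Sum>h\<in>H. gact A h (Q (gact A (inv h) x))))"
   unfolding P_def by (rule linear_on_scale[OF rep_linear[OF A k]]) (use t_in Z(2) in \<open>auto intro!: vsp_sum[OF vX]\<close>)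
  also have "gact A k (\<Sum>h\<in>H. gact A h (Q (gact A (inv h) x))) = (\<Sum>h\<in>H. gact A k (gact A h (Q (gact A (inv h) x))))"
   by (rule linear_on_sum[OF rep_linear[OF A k] vX]) (use t_in Z(2) in auto)
  also have "\<dots> = (\<Sum>h\<in>H. gact A (k \<otimes> h) (Q (gact A (inv (k \<otimes> h)) (gact A k x))))"
  proof (intro sum.cong refl)
   fix h assume h: "h \<in> H"
   have "gact A (inv (k \<otimes> h)) (gact A k x) = gact A (inv (k \<otimes> h) \<otimes> k) x"
    using rep_mult[OF A H_inv[OF H_mult[OF k h]] k x] by simp
   also have "inv (k \<otimes> h) \<otimes> k = inv h" using h k H_carrier by (simp add: inv_mult_group m_assoc)
   finally show "gact A k (gact A h (Q (gact A (inv h) x))) = gact A (k \<otimes> h) (Q (gact A (inv (k \<otimes> h)) (gact A k x)))"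
    using rep_mult[OF A k h, of "Q (gact A (inv h) x)"] subsetD[OF Z(2) QZ] by simp
  qed
  also have "\<dots> = (\<Sum>h\<in>H. gact A h (Q (gact A (inv h) (gact A k x))))"
   by (rule sum_reindex_left[OF k, of "\<lambda>h. gact A h (Q (gact A (inv h) (gact A k x)))"])
  finally show ?thesis by (simp add: P_def)
 qed
 moreover have "P z = z" if z: "z \<in> Z" for z
 proof -
  have "gact A h (Q (gact A (inv h) z)) = z" if h: "h \<in> H" for h
   using Qz[OF Z(3)[OF H_inv[OF h] z]] rep_mult[OF A h H_inv[OF h], of z] Z(2) z rep_one[OF A, of z] H_carrier[OF h] by auto
  then have "P z = scal A (1 / of_nat (card H)) (\<Sum>h\<in>H. z)" by (simp add: P_def)
  also have "(\<Sum>h\<in>H. z) = scal A (of_nat (card H)) z"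
  proof -
   have "(\<Sum>h\<in>H. scal A 1 z) = scal A (\<Sum>h\<in>H. 1) z" by (rule vs(10)[symmetric])
   then show ?thesis by (simp add: vs)
  qed
  finally show ?thesis using card by (simp add: vs)
 qed
 ultimately show ?thesis using PZ Z(2) by (intro exI[of _ P]) (auto simp: eqvar_def)
qed

text \<open>Completeness of R speaks only of representations on \<open>nat => 'k\<close>. A basis of
  Z transports the representation there; \<open>\<kappa>\<close> takes coordinates and
  \<open>\<theta>\<close> recombines them.\<close>

lemma irr_complete:
 fixes Z :: "('g, 'k::field, 'x::ab_group_add) rep" and R :: "('g, 'k, 'v::ab_group_add) rep set"
 assumes Z: "irreducible_rep G H Z" and R: "irr_reps G H R"
 shows "\<exists>U\<in>R. rep_isomorphic H U Z"
proof -
 note rZ = irreducible_rep_is_rep[OF Z]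
 note vZ = rep_vsp[OF rZ]
 note vs = vsp_simps[OF vZ]
 obtain B where B: "finite B" "B \<subseteq> space Z" "is_basis (scal Z) (space Z) B"
  using fin_dim_basis[OF vsp_vs[OF vZ] rep_fin[OF rZ]] .
 obtain \<beta> where \<beta>: "bij_betw \<beta> {0..<card B} B" using ex_bij_betw_nat_finite[OF B(1)] by blast
 define d where "d = card B"
 let ?c = "coord (scal Z) B"
 define S where "S = {a :: nat => 'k. \<forall>n\<ge>d. a n = 0}"
 define \<theta> where "\<theta> a = (\<Sum>n<d. scal Z (a n) (\<beta> n))" for a :: "nat => 'k"
 define \<kappa> where "\<kappa> z = (\<lambda>n. if n < d then ?c (\<beta> n) z else 0)" for z
 have \<beta>in: "\<beta> n \<in> B" if "n < d" for n using \<beta> that by (auto simp: bij_betw_def d_def)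
 have \<theta>in: "\<theta> a \<in> space Z" for a unfolding \<theta>_def using \<beta>in B(2) by (intro vsp_sum[OF vZ] vsp_scale[OF vZ]) auto
 have \<kappa>in: "\<kappa> z \<in> S" for z by (simp add: \<kappa>_def S_def)
 have \<theta>\<kappa>: "\<theta> (\<kappa> z) = z" if "z \<in> space Z" for z
 proof -
  have "\<theta> (\<kappa> z) = (\<Sum>n\<in>{0..<card B}. scal Z (?c (\<beta> n) z) (\<beta> n))" by (simp add: \<theta>_def \<kappa>_def d_def atLeast0LessThan)
  also have "\<dots> = (\<Sum>b\<in>B. scal Z (?c b z) b)" by (rule sum.reindex_bij_betw[OF \<beta>])
  finally show ?thesis using coord_expand[OF vsp_vs[OF vZ] B(3,1) that] by simp
 qed
 have clin: "?c b (x + y) = ?c b x + ?c b y" "?c b (scal Z k x) = k * ?c b x" for b x y k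
  using coord_linear[OF vsp_vs[OF vZ] B(3), of b] by (auto simp: Vector_Spaces.linear_iff)
 have \<kappa>\<theta>: "\<kappa> (\<theta> a) = a" if "a \<in> S" for a
 proof
  fix n
  show "\<kappa> (\<theta> a) n = a n"
  proof (cases "n < d")
   case True
   have "?c (\<beta> n) (\<theta> a) = (\<Sum>m<d. a m * ?c (\<beta> n) (\<beta> m))" unfolding \<theta>_def
    by (rule linear_on_combination[OF linear_imp_linear_on[OF coord_linear[OF vsp_vs[OF vZ] B(3)]] vZ])
      (use \<beta>in B(2) in auto)
   also have "\<dots> = (\<Sum>m<d. if m = n then a m else 0)"
   proof (intro sum.cong refl)
    fix m assume "m \<in> {..<d}"
    then have "\<beta> m = \<beta> n \<longleftrightarrow> m = n" using \<beta> True by (auto simp: bij_betw_def d_def dest: inj_onD)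
    then show "a m * ?c (\<beta> n) (\<beta> m) = (if m = n then a m else 0)"
     using coord_basis[OF vsp_vs[OF vZ] B(3) \<beta>in, of m "\<beta> n"] \<open>m \<in> _\<close> by auto
   qed
   finally show ?thesis using True by (simp add: \<kappa>_def)
  qed (use that in \<open>simp add: \<kappa>_def S_def\<close>)
 qed
 have \<theta>lin: "\<theta> (a + b) = \<theta> a + \<theta> b" "\<theta> (pw (*) k a) = scal Z k (\<theta> a)" for a b k
  by (simp_all add: \<theta>_def pw_def vs sum.distrib)
 have \<kappa>lin: "\<kappa> (x + y) = \<kappa> x + \<kappa> y" "\<kappa> (scal Z k x) = pw (*) k (\<kappa> x)" for x y k
  by (auto simp: \<kappa>_def clin fun_eq_iff pw_def)
 \<comment> \<open>The action of Z conjugated by the coordinate maps.\<close>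
 define V0 :: "('g, 'k, nat => 'k) rep" where
  "V0 = \<lparr>space = S, scal = pw (*), gact = (\<lambda>h a. \<kappa> (gact Z h (\<theta> a)))\<rparr>"
 have sel: "space V0 = S" "scal V0 = pw (*)" "gact V0 h a = \<kappa> (gact Z h (\<theta> a))" for h a by (simp_all add: V0_def)
 have vS: "vsp (pw (*)) S" and finS: "fin_dim (pw (*)) S"
  using finite_support_space[of "{..<d}"] by (simp_all add: S_def not_less)
 have r0: "is_rep G H V0" unfolding is_rep_def
 proof (intro conjI ballI, goal_cases)
  case 1 show ?case unfolding sel by (rule vector_space_pw_mult)
 next
  case 2 show ?case using vS unfolding sel by (simp add: vsp_def)
 next
  case 3 show ?case using finS unfolding sel .
 next
  case (4 h) show ?case unfolding sel using \<kappa>in by auto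
 next
  case (5 h) show ?case unfolding sel
   using linear_on_add[OF rep_linear[OF rZ 5] \<theta>in \<theta>in] linear_on_scale[OF rep_linear[OF rZ 5] \<theta>in]
   by (intro linear_onI) (simp_all add: \<theta>lin \<kappa>lin)
 next
  case (6 v) then show ?case unfolding sel using rep_one[OF rZ \<theta>in] \<kappa>\<theta> by simp
 next
  case (7 g h v) then show ?case unfolding sel using rep_mult[OF rZ 7(1,2) \<theta>in] \<theta>\<kappa>[OF rep_in[OF rZ 7(2) \<theta>in]] by simp
 qed
 have \<theta>e: "eqvar H V0 Z \<theta>"
  unfolding eqvar_def sel using \<theta>in \<theta>lin \<theta>\<kappa>[OF rep_in[OF rZ _ \<theta>in]] by (auto intro!: linear_onI)
 have \<theta>b: "bij_betw \<theta> (space V0) (space Z)" unfolding sel by (rule bij_betwI[of _ _ _ \<kappa>]) (use \<theta>in \<kappa>in \<theta>\<kappa> \<kappa>\<theta> in auto)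
 have "irreducible_rep G H V0" unfolding irreducible_rep_def
 proof (intro conjI allI impI)
  show "space V0 \<noteq> {0}"
  proof
   assume "space V0 = {0}"
   then have "space Z = {\<theta> 0}" using \<theta>b by (metis bij_betw_def image_empty image_insert)
   then have "space Z = {0}" using vsp_0[OF vZ] by auto
   then show False using Z by (simp add: irreducible_rep_def)
  qed
  fix W assume W: "W \<subseteq> space V0" "Modules.module.subspace (scal V0) W \<and> (\<forall>h\<in>H. gact V0 h ` W \<subseteq> W)"
  have vW: "vsp (pw (*)) W" using W(2) vector_space_pw_mult unfolding sel vsp_def by blast
  have "\<theta> ` W = {0} \<or> \<theta> ` W = space Z"
  proof (rule irreducible_subspace[OF Z])
   show "vsp (scal Z) (\<theta> ` W)" by (rule vsp_image[OF _ vW vsp_vs[OF vZ]]) (auto intro!: linear_onI simp: \<theta>lin)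
   fix h w assume h: "h \<in> H" "w \<in> \<theta> ` W"
   then obtain x where x: "x \<in> W" "w = \<theta> x" by auto
   have "gact Z h w = \<theta> (gact V0 h x)" using eqvar_gact[OF \<theta>e h(1)] x W(1) by auto
   then show "gact Z h w \<in> \<theta> ` W" using W(2) h(1) x(1) by blast
  qed (use \<theta>in in auto)
  moreover have "W = \<kappa> ` \<theta> ` W" using \<kappa>\<theta> W(1) unfolding sel by (force simp: image_image)
  moreover have "\<kappa> ` {0} = {0}" by (auto simp: \<kappa>_def fun_eq_iff linear_on_0[OF linear_imp_linear_on[OF coord_linear[OF vsp_vs[OF vZ] B(3)]], of UNIV])
  moreover have "\<kappa> ` space Z = space V0" using \<theta>\<kappa> \<kappa>\<theta> \<kappa>in \<theta>in unfolding sel by (metis (no_types, opaque_lifting) image_eqI image_subsetI subsetI subset_antisym)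
  ultimately show "W = {0} \<or> W = space V0" by auto
 qed (rule r0)
 then obtain U where U: "U \<in> R" "rep_isomorphic H U V0" using R sel(2) unfolding irr_reps_def by blast
 obtain f where f: "eqvar H U V0 f" "bij_betw f (space U) (space V0)" by (rule rep_isomorphic_eqvar[OF U(2)])
 have "rep_isomorphic H U Z"
  using bij_betw_trans[OF f(2) \<theta>b] by (intro bij_eqvar_rep_isomorphic[OF eqvar_comp[OF f(1) \<theta>e]]) (simp add: comp_def)
 then show ?thesis using U(1) by blast
qed

text \<open>Induction over the invariant subspaces Y of a fixed A, so that all inclusions and
  projections are maps into and out of A itself. Maschke's projection P onto an irreducible part of
  Y is split off, and the kernel of P in Y is smaller.\<close>

lemma sub_decomposition:
 fixes A :: "('g, 'k::field, 'x::ab_group_add) rep" and R :: "('g, 'k, 'v::ab_group_add) rep set"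
 assumes A: "is_rep G H A" and R: "irr_reps G H R" and card: "of_nat (card H) \<noteq> (0::'k)"
  and Y: "vsp (scal A) Y" "Y \<subseteq> space A" "\<And>h y. h \<in> H ==> y \<in> Y ==> gact A h y \<in> Y"
 shows "\<exists>(n::nat) V \<iota> \<pi>. (\<forall>a<n. V a \<in> R \<and> eqvar H (V a) A (\<iota> a) \<and> eqvar H A (V a) (\<pi> a)) \<and> (\<forall>y\<in>Y. y = (\<Sum>a<n. \<iota> a (\<pi> a y)))"
 using Y
proof (induction "vector_space.dim (scal A) Y" arbitrary: Y rule: less_induct)
 case (less Y)
 note vX = rep_vsp[OF A]
 note vs = vsp_simps[OF vX]
 let ?dim = "vector_space.dim (scal A)"
 show ?case
 proof (cases "Y = {0}")
  case True
  then show ?thesis by (intro exI[of _ 0]) auto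
 next
  case False
  \<comment> \<open>A nonzero invariant subspace of least dimension is irreducible.\<close>
  define good where "good Z \<longleftrightarrow> vsp (scal A) Z \<and> Z \<subseteq> Y \<and> (\<forall>h\<in>H. \<forall>z\<in>Z. gact A h z \<in> Z) \<and> Z \<noteq> {0}" for Z
  have "good Y" using less.prems False by (auto simp: good_def)
  then obtain Z where Z: "good Z" "\<And>Z'. good Z' ==> ?dim Z \<le> ?dim Z'" using arg_min_nat_lemma[of good Y ?dim] by blast
  have Z': "vsp (scal A) Z" "Z \<subseteq> Y" "\<And>h z. h \<in> H ==> z \<in> Z ==> gact A h z \<in> Z" "Z \<noteq> {0}" using Z(1) by (auto simp: good_def)
  have ZX: "Z \<subseteq> space A" using Z'(2) less.prems(2) by blast
  have finZ: "fin_dim (scal A) Z" by (rule fin_dim_subspace[OF Z'(1) rep_fin[OF A] ZX])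
  define XZ where "XZ = A\<lparr>space := Z\<rparr>"
  have sel: "space XZ = Z" "scal XZ = scal A" "gact XZ = gact A" by (simp_all add: XZ_def)
  have irrZ: "irreducible_rep G H XZ" unfolding irreducible_rep_def sel
  proof (intro conjI allI impI)
   show "is_rep G H XZ" unfolding is_rep_def sel
    using Z' finZ rep_linear[OF A] rep_one[OF A] rep_mult[OF A] ZX by (auto simp: vsp_def intro!: linear_on_subset[OF rep_linear[OF A] ZX])
   fix W assume W: "W \<subseteq> Z" "Modules.module.subspace (scal A) W \<and> (\<forall>h\<in>H. gact A h ` W \<subseteq> W)"
   have vW: "vsp (scal A) W" using W(2) vsp_vs[OF vX] by (simp add: vsp_def)
   show "W = {0} \<or> W = Z"
   proof (rule ccontr)
    assume c: "\<not> (W = {0} \<or> W = Z)"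
    moreover have "\<forall>h\<in>H. \<forall>z\<in>W. gact A h z \<in> W" using W(2) by blast
    ultimately have "good W" using W(1) Z'(2) vW by (auto simp: good_def)
    then have "?dim Z \<le> ?dim W" by (rule Z(2))
    moreover have "?dim W < ?dim Z" using c W(1) by (intro fin_dim_psubset_dim[OF vW finZ]) auto
    ultimately show False by simp
   qed
  qed (rule Z'(4))
  obtain U where U: "U \<in> R" "rep_isomorphic H U XZ" using irr_complete[OF irrZ R] by blast
  have rU: "is_rep G H U" using U(1) R by (auto simp: irr_reps_def irreducible_rep_def)
  obtain \<theta> where \<theta>: "eqvar H U XZ \<theta>" "bij_betw \<theta> (space U) (space XZ)" by (rule rep_isomorphic_eqvar[OF U(2)])
  note \<theta>' = eqvar_inverse[OF \<theta> rU]
  let ?\<theta>' = "inv_into (space U) \<theta>"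
  obtain P where P: "eqvar H A A P" "P ` space A \<subseteq> Z" "\<forall>z\<in>Z. P z = z" using maschke[OF A Z'(1) ZX Z'(3) card] by blast
  let ?Y = "{y \<in> Y. P y = 0}"
  have Plin: "linear_on (scal A) (scal A) Y P" by (rule linear_on_subset[OF eqvar_linear[OF P(1)] less.prems(2)])
  have vY': "vsp (scal A) ?Y" by (rule vsp_kernel[OF Plin less.prems(1) vsp_vs[OF vX]])
  have "Y \<noteq> ?Y"
  proof -
   obtain z where "z \<in> Z" "z \<noteq> 0" using Z'(4) vsp_0[OF Z'(1)] by blast
   then have "z \<in> Y" "P z \<noteq> 0" using P(3) Z'(2) by auto
   then show ?thesis by blast
  qed
  then have "?dim ?Y < ?dim Y"
   by (intro fin_dim_psubset_dim[OF vY' fin_dim_subspace[OF less.prems(1) rep_fin[OF A] less.prems(2)]]) blast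
  moreover have "gact A h y \<in> ?Y" if "h \<in> H" "y \<in> ?Y" for h y
   using that less.prems eqvar_gact[OF P(1)] linear_on_0[OF rep_linear[OF A] vsp_0[OF vX]] by (auto simp: subset_iff)
  ultimately have "\<exists>(n::nat) V \<iota> \<pi>. (\<forall>a<n. V a \<in> R \<and> eqvar H (V a) A (\<iota> a) \<and> eqvar H A (V a) (\<pi> a)) \<and> (\<forall>y\<in>?Y. y = (\<Sum>a<n. \<iota> a (\<pi> a y)))"
   using less.prems(2) by (intro less.hyps vY') auto
  then obtain n V \<iota> \<pi> where IH: "\<And>a. a < n ==> V a \<in> R \<and> eqvar H (V a) A (\<iota> a) \<and> eqvar H A (V a) (\<pi> a)"
   "\<And>y. y \<in> ?Y ==> y = (\<Sum>a<(n::nat). \<iota> a (\<pi> a y))" by blast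
  define V' where "V' a = (if a < n then V a else U)" for a
  define \<iota>' where "\<iota>' a = (if a < n then \<iota> a else \<theta>)" for a
  \<comment> \<open>The maps from the induction hypothesis resolve only the kernel of P, so they are
    preceded by the projection x - P x onto it.\<close>
  define \<pi>' where "\<pi>' a = (if a < n then (\<lambda>x. \<pi> a (x - P x)) else (\<lambda>x. ?\<theta>' (P x)))" for a
  have dP: "eqvar H A A (\<lambda>x. x - P x)"
   unfolding eqvar_def using eqvar_in[OF P(1)] linear_on_add[OF eqvar_linear[OF P(1)]] linear_on_scale[OF eqvar_linear[OF P(1)]]
    eqvar_gact[OF P(1)] linear_on_diff[OF rep_linear[OF A] vX] by (auto intro!: linear_onI vsp_diff[OF vX] simp: vs)
  have \<theta>A: "eqvar H U A \<theta>" using \<theta>(1) ZX unfolding eqvar_def sel by auto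
  have PXZ: "eqvar H A XZ P" using P(1,2) unfolding eqvar_def sel by auto
  have "V' a \<in> R \<and> eqvar H (V' a) A (\<iota>' a) \<and> eqvar H A (V' a) (\<pi>' a)" if "a < Suc n" for a
   using IH(1) U(1) \<theta>A eqvar_comp[OF dP] eqvar_comp[OF PXZ \<theta>'] by (auto simp: V'_def \<iota>'_def \<pi>'_def)
  moreover have "y = (\<Sum>a<Suc n. \<iota>' a (\<pi>' a y))" if y: "y \<in> Y" for y
  proof -
   have yX: "y \<in> space A" using y less.prems(2) by blast
   have PZ: "P y \<in> Z" using P(2) yX by blast
   have "P (y - P y) = 0" using linear_on_diff[OF eqvar_linear[OF P(1)] vX yX] eqvar_in[OF P(1) yX] P(3) PZ by simp
   moreover have "y - P y \<in> Y" using vsp_diff[OF less.prems(1) y] PZ Z'(2) by blast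
   ultimately have "y - P y = (\<Sum>a<n. \<iota> a (\<pi> a (y - P y)))" using IH(2) by blast
   moreover have "\<theta> (?\<theta>' (P y)) = P y" using \<theta>(2) PZ unfolding sel bij_betw_def by (auto simp: f_inv_into_f)
   ultimately show ?thesis by (simp add: \<iota>'_def \<pi>'_def diff_eq_eq)
  qed
  ultimately show ?thesis by (intro exI[of _ "Suc n"] exI[of _ V'] exI[of _ \<iota>'] exI[of _ \<pi>']) blast
 qed
qed

lemma decomposition:
 fixes A :: "('g, 'k::field, 'x::ab_group_add) rep" and R :: "('g, 'k, 'v::ab_group_add) rep set"
 assumes A: "is_rep G H A" and R: "irr_reps G H R" and card: "of_nat (card H) \<noteq> (0::'k)"
 shows "\<exists>(n::nat) V \<iota> \<pi>. (\<forall>a<n. V a \<in> R \<and> eqvar H (V a) A (\<iota> a) \<and> eqvar H A (V a) (\<pi> a)) \<and>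
  (\<forall>x\<in>space A. x = (\<Sum>a<n. \<iota> a (\<pi> a x)))"
 by (rule sub_decomposition[OF A R card rep_vsp[OF A] subset_refl rep_in[OF A]])

text \<open>Every irreducible W is a quotient of the regular representation by a |-> sum of a(g) g
  v0. Some summand in a decomposition of the latter maps nontrivially to W, and Schur's lemma
  identifies it with W.\<close>

lemma finite_irr_reps:
 fixes R :: "('g, 'k::field, 'v::ab_group_add) rep set"
 assumes R: "irr_reps G H R" and card: "of_nat (card H) \<noteq> (0::'k)"
 shows "finite R"
proof -
 define S where "S = {a :: 'g => 'k. \<forall>g. g \<notin> H \<longrightarrow> a g = 0}"
 note vS = finite_support_space(1)[OF fin, where 'k = 'k, folded S_def]
 define A :: "('g, 'k, 'g => 'k) rep" where
  "A = \<lparr>space = S, scal = pw (*), gact = (\<lambda>h a g. if g \<in> H then a (inv h \<otimes> g) else 0)\<rparr>"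
 have sel: "space A = S" "scal A = pw (*)" "gact A h a = (\<lambda>g. if g \<in> H then a (inv h \<otimes> g) else 0)" for h a
  by (simp_all add: A_def)
 note finS = finite_support_space(2)[OF fin, where 'k = 'k, folded S_def]
 have A: "is_rep G H A" unfolding is_rep_def
 proof (intro conjI ballI, goal_cases)
  case 1 show ?case unfolding sel by (rule vector_space_pw_mult)
 next
  case 2 show ?case using vS unfolding sel by (simp add: vsp_def)
 next
  case 3 show ?case using finS unfolding sel .
 next
  case (4 h) show ?case unfolding sel by (auto simp: S_def)
 next
  case (5 h) show ?case unfolding sel by (intro linear_onI) (auto simp: fun_eq_iff pw_def)
 next
  case (6 v) then show ?case unfolding sel by (auto simp: S_def fun_eq_iff H_carrier)
 next
  case (7 g h v) then show ?case unfolding sel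
   by (auto simp: fun_eq_iff inv_mult_group H_carrier m_assoc H_mult H_inv)
 qed
 obtain n :: nat and V :: "nat => ('g, 'k, 'v) rep" and \<iota> \<pi> where dec0:
  "\<forall>a<n. V a \<in> R \<and> eqvar H (V a) A (\<iota> a) \<and> eqvar H A (V a) (\<pi> a)" "\<forall>x\<in>space A. x = (\<Sum>a<n. \<iota> a (\<pi> a x))"
  using decomposition[OF A R card] by blast
 have dec: "\<And>a. a < n ==> V a \<in> R" "\<And>a. a < n ==> eqvar H (V a) A (\<iota> a)"
  "\<And>a. a < n ==> eqvar H A (V a) (\<pi> a)" "\<And>x. x \<in> space A ==> x = (\<Sum>a<n. \<iota> a (\<pi> a x))" using dec0 by blast+
 have "R \<subseteq> V ` {..<n}"
 proof
  fix W assume W: "W \<in> R"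
  have irrW: "irreducible_rep G H W" using R W by (auto simp: irr_reps_def)
  note rW = irreducible_rep_is_rep[OF irrW]
  note vW = rep_vsp[OF rW]
  note vs = vsp_simps[OF vW]
  obtain v0 where v0: "v0 \<in> space W" "v0 \<noteq> 0" using irrW vsp_0[OF vW] by (auto simp: irreducible_rep_def)
  define p where "p a = (\<Sum>g\<in>H. scal W (a g) (gact W g v0))" for a :: "'g => 'k"
  have p: "eqvar H A W p" unfolding eqvar_def sel
  proof (intro conjI ballI)
   show "p ` S \<subseteq> space W" using rep_in[OF rW _ v0(1)] by (auto simp: p_def intro!: vsp_sum[OF vW] vsp_scale[OF vW])
   show "linear_on (pw (*)) (scal W) S p" by (intro linear_onI) (simp_all add: p_def pw_def vs sum.distrib)
   fix h a assume h: "h \<in> H"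
   have "gact W h (p a) = (\<Sum>g\<in>H. scal W (a g) (gact W h (gact W g v0)))"
    unfolding p_def by (rule linear_on_combination[OF rep_linear[OF rW h] vW]) (rule rep_in[OF rW _ v0(1)])
   also have "\<dots> = (\<Sum>g\<in>H. scal W (a (inv h \<otimes> (h \<otimes> g))) (gact W (h \<otimes> g) v0))"
    by (intro sum.cong refl) (simp add: H_cancel h rep_mult[OF rW h _ v0(1)])
   also have "\<dots> = (\<Sum>g\<in>H. scal W (a (inv h \<otimes> g)) (gact W g v0))"
    by (rule sum_reindex_left[OF h, of "\<lambda>g. scal W (a (inv h \<otimes> g)) (gact W g v0)"])
   finally show "p (\<lambda>g. if g \<in> H then a (inv h \<otimes> g) else 0) = gact W h (p a)" by (simp add: p_def cong: if_cong)
  qed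
  have s: "single \<one> 1 \<in> space A" unfolding sel by (auto simp: S_def single_def H_one)
  \<comment> \<open>The unit mass at 1 goes to \<open>v0\<close>, which is nonzero; hence the
    quotient map cannot vanish on all summands.\<close>
  have "p (single \<one> 1) = (\<Sum>g\<in>H. if g = \<one> then v0 else 0)"
   unfolding p_def by (intro sum.cong refl) (auto simp: single_def vs rep_one[OF rW v0(1)])
  then have ps: "p (single \<one> 1) = v0" using fin H_one by simp
  have "p (single \<one> 1) = p (\<Sum>a<n. \<iota> a (\<pi> a (single \<one> 1)))" by (rule arg_cong[OF dec(4)[OF s]])
  also have "\<dots> = (\<Sum>a<n. p (\<iota> a (\<pi> a (single \<one> 1))))"
   by (rule linear_on_sum[OF eqvar_linear[OF p] rep_vsp[OF A]]) (auto intro!: eqvar_in[OF dec(2)] eqvar_in[OF dec(3)] s)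
  finally have "(\<Sum>a<n. p (\<iota> a (\<pi> a (single \<one> 1)))) \<noteq> 0" using ps v0(2) by simp
  then obtain a where "a \<in> {..<n}" and a2: "p (\<iota> a (\<pi> a (single \<one> 1))) \<noteq> 0"
   by (rule sum.not_neutral_contains_not_neutral)
  then have a: "a < n" "p (\<iota> a (\<pi> a (single \<one> 1))) \<noteq> 0" by auto
  have irrV: "irreducible_rep G H (V a)" using R dec(1)[OF a(1)] by (auto simp: irr_reps_def)
  have c: "eqvar H (V a) W (\<lambda>x. p (\<iota> a x))" by (rule eqvar_comp[OF dec(2)[OF a(1)] p])
  have "bij_betw (\<lambda>x. p (\<iota> a x)) (space (V a)) (space W)"
   using a(2) by (intro schur_bij[OF irrV irrW c]) (rule eqvar_in[OF dec(3)[OF a(1)] s])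
  then have "rep_isomorphic H (V a) W" by (rule bij_eqvar_rep_isomorphic[OF c])
  then have "V a = W" using R W dec(1)[OF a(1)] by (auto simp: irr_reps_def)
  then show "W \<in> V ` {..<n}" using a(1) by auto
 qed
 then show ?thesis using finite_subset by blast
qed

end

subsection \<open>The pairing as a sum over words\<close>

context gbimod_dual begin

text \<open>The pairing of \<open>f\<close> and \<open>\<phi>\<close> becomes the sum, over basis words \<open>w\<close>, of the operator of \<open>\<phi>\<close> at the
reversed word \<open>dwd w\<close> after the operator of \<open>f\<close> at the dual word \<open>star is w\<close>.\<close>

definition dwd :: "('g \<times> 'm) list => ('g \<times> (('m => 'k) => 'k)) list" where
 "dwd w = rev (map (\<lambda>(y, b). (iv y, ev (bact N (iv y) b))) w)"

lemma dwd_simps: "dwd [] = []" "dwd ((y, b) # w) = dwd w @ [(iv y, ev (bact N (iv y) b))]" by (simp_all add: dwd_def)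

lemma map_fst_dwd: "map fst (dwd w) = map iv (rev (map fst w))" by (simp add: dwd_def rev_map case_prod_beta)

text \<open>In absolute terms, starting at the end point of w, the reversed word evaluates at the
  basis tensors moved by the inverse of y_1...y_n. These are the arguments that the pairing feeds to
  the functionals.\<close>

lemma D_absl_dwd:
 "gseq is (map fst w) ==> snd ` set w \<subseteq> bcar N ==>
  D.absl e (dwd w) = rev (map (\<lambda>m. ev (bact N (iv (gprod C (map fst w))) m)) (absv e w))"
proof (induction w arbitrary: "is")
 case (Cons l w)
 obtain y b where l: "l = (y, b)" by force
 from Cons.prems(1) obtain i j is' where i: "is = i # j # is'" "y \<in> Gr" "gseq (j # is') (map fst w)"
  by (auto simp: gseq_Cons l)
 have b: "b \<in> bcar N" and w: "snd ` set w \<subseteq> bcar N" using Cons.prems(2) by (auto simp: l)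
 have sub: "set (map fst w) \<subseteq> Gr" using i(3) by (simp add: gseq_def)
 then have G: "gprod C (map fst w) \<in> Gr" by (rule gprod_Gr)
 have sub': "set (map fst (dwd w)) \<subseteq> Gr" unfolding map_fst_dwd using sub by auto
 have gd: "gprod C (map fst (dwd w)) = iv (gprod C (map fst w))" unfolding map_fst_dwd by (rule gprod_inv_rev[OF sub])
 have vb: "set (absv e w) \<subseteq> bcar N" by (rule absv_bcar[OF i(3) one_closed w])
 have "absv y w = map (bact N y) (absv e w)" using absv_shift[OF i(3) i(2) one_closed w] i(2) by simp
 then have "map (\<lambda>m. ev (bact N (iv (y \<cdot> gprod C (map fst w))) m)) (absv y w) =
   map (\<lambda>m. ev (bact N (iv (gprod C (map fst w))) m)) (absv e w)"
  using vb i(2) G by (auto simp: bact_mult[symmetric] inv_mult_group m_assoc subset_iff)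
 then show ?case using Cons.IH[OF i(3) w] D.absl_append[OF sub' one_closed, of "[(iv y, ev (bact N (iv y) b))]"] i(2) b G
  by (simp add: l dwd_simps gd bact_ev bact_in bact_one inv_mult_group bact_mult[symmetric])
qed (simp add: dwd_simps)

lemma dwd_vw: "gseq is (map fst w) ==> snd ` set w \<subseteq> bcar N ==> D.vw (rev is) (dwd w)"
proof -
 assume g: "gseq is (map fst w)" and w: "snd ` set w \<subseteq> bcar N"
 have "y \<in> Gr" "b \<in> bcar N" if "(y, b) \<in> set w" for y b using g w that by (force simp: gseq_def)+
 then have "snd ` set (dwd w) \<subseteq> bcar (dual C du)" "set (map fst (dwd w)) \<subseteq> Gr"
  by (auto simp: dwd_def intro!: ev_dual bact_in)
 then show ?thesis using g by (auto simp: D.vw_def gseq_def map_fst_dwd)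
qed

lemma sum_yseqs_Cons: "(\<Sum>ys\<in>yseqs C (i # j # is). f ys) = (\<Sum>y\<in>cos_reps C j. \<Sum>ys\<in>yseqs C (j # is). f (y # ys))"
 by (simp add: yseqs_Cons_image sum.reindex inj_on_def sum.cartesian_product case_prod_beta)

text \<open>The target of \<open>\<phi>\<close> is not tied to the source of f: comparing two paths
  leads to different representations at the same point.\<close>

definition T :: "'i list => ('g, 'k, 'v::ab_group_add) rep => ('g, 'k, 'v) rep
  => ('g, 'k, 'm, 'v) morph => ('g, 'k, 'm => 'k, 'v) morph => 'v => 'v" where
 "T is V U f \<phi> u = (\<Sum>ys\<in>yseqs C is. \<Sum>w\<in>bw is ys. D.opr (rev is) U \<phi> (dwd w) (opr is V f (star is w) u))"

lemma evl_rev: "length \<psi>s = length ms ==> evl (rev \<psi>s) ms = evl \<psi>s (rev ms)" unfolding evl_def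
 by (metis length_rev prod_list.rev rev_map rev_rev_ident zip_rev)

lemma reps_at_rev: "reps_at is U V ==> D.reps_at (rev is) V U"
 unfolding reps_at_def D.reps_at_def by (auto simp: hd_rev last_rev)

text \<open>The right-hand side in the definition of \<open>pairing\<close>, computed before it is
  known to be a multiple of u. The value \<open>f u ys\<close> is expanded in basis tensors, and the
  inner lift at such a tensor is an operator of \<open>\<phi>\<close> at the reversed word.\<close>

lemma pairing_sum:
 assumes r: "reps_at is U V" and f: "f \<in> Hom C N is U V" and \<phi>: "\<phi> \<in> Hom C du (rev is) V U" and u: "u \<in> space U"
 shows "(\<Sum>ys\<in>yseqs C is. case dual_index C is ys of (xs, h\<^sub>0) =>
     lift_M C N is V ys (\<lambda>ms v.
      lift_M C du (rev is) U xs (\<lambda>\<phi>s w.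
       scal U (\<Prod>(\<psi>, m)\<leftarrow>zip (rev \<phi>s) ms. \<psi> (bact N (iv (gprod C ys)) m))
        (gact U (iv h\<^sub>0) w))
      (\<phi> v xs))
     (f u ys)) = T is V U f \<phi> u" (is "(\<Sum>ys\<in>_. ?L ys) = _") unfolding T_def
proof (rule sum.cong[OF refl])
 fix ys assume ys: "ys \<in> yseqs C is"
 note d = reps_atD[OF r] and vU = rep_vsp[OF reps_atD(3)[OF r]] and vV = rep_vsp[OF reps_atD(4)[OF r]]
 note vsU = vsp_vs[OF vU]
 note g = yseqs_gseq[OF d(1) ys]
 have gr: "gseq (rev is) (map iv (rev ys))" using g by (auto simp: gseq_def)
 have Y: "gprod C ys \<in> Gr" using g by (intro gprod_Gr) (auto simp: gseq_def)
 have hr: "hd (rev is) = last is" "last (rev is) = hd is" using d(2) by (auto simp: hd_rev last_rev)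
 obtain xs h0 where t: "tr C (rev is) e (map iv (rev ys)) = (xs, h0)" by force
 have di: "dual_index C is ys = (xs, h0)" using dual_index_tr[OF g] t by simp
 have e1: "e \<in> stab C (hd (rev is))" using hr stab_one[OF d(6)] by simp
 note p = tr_props[OF gr e1 t]
 have h0: "h0 \<in> stab C (hd is)" and ih0: "iv h0 \<in> stab C (hd is)" using p(2) stab_inv[OF d(5)] hr by auto
 have ptr: "set (rev is) \<subseteq> pts C" using d(1) by simp
 have gx: "gseq (rev is) xs" by (rule yseqs_gseq[OF ptr p(1)])
 have glin: "linear_on (scal U) (scal U) (space U) (gact U (iv h0))" by (rule rep_linear[OF d(3) ih0])
 let ?a = "bact N (iv (gprod C ys))"
 let ?D = "comps C du (rev is) xs"
 interpret S: tensor_space "bscale N" "scal V" "comps C N is ys" "space V" by (rule tensor_space[OF vV])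
 interpret S': tensor_space "bscale du" "scal U" ?D "space U" by (rule tensor_space[OF vU])
 have Dsub: "E \<subseteq> bcar du" if "E \<in> set ?D" for E using that D.compsK_bcar by (simp add: D.comps_compsK[OF gx])
 have Csub: "E \<subseteq> bcar N" "vsp (bscale N) E" if "E \<in> set (comps C N is ys)" for E
  using that compsK_bcar compsK_vsp by (simp_all add: comps_compsK[OF g])
 have lenD: "length ?D = length ys" and lenC: "length (comps C N is ys) = length ys"
  using yseqs_length[OF ys] yseqs_length[OF p(1)] by (simp_all add: comps_def)
 have ms_b: "set ms \<subseteq> bcar N" "length ms = length ys" if "ms \<in> listset (comps C N is ys)" for ms
  using listset_member[OF that] Csub listset_length[OF that] lenC by (blast, simp)
 have \<phi>s_b: "set \<phi>s \<subseteq> bcar du" "length \<phi>s = length ys" if "\<phi>s \<in> listset ?D" for \<phi>s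
  using D.listset_member[OF that] Dsub listset_length[OF that] lenD by (blast, simp)
 \<comment> \<open>The product is read in two ways: as a function of the vectors for fixed
   functionals (\<open>pr1\<close>), and as a function of the functionals for fixed vectors
   (\<open>pr2\<close>). The outer and the inner lift need one each.\<close>
 define pr where "pr \<phi>s ms = (\<Prod>(\<psi>, m)\<leftarrow>zip (rev \<phi>s) ms. \<psi> (?a m))" for \<phi>s :: "('m => 'k) list" and ms
 have pr1: "pr \<phi>s ms = evl (map (\<lambda>\<psi> m. \<psi> (?a m)) (rev \<phi>s)) ms" for \<phi>s ms
  unfolding pr_def evl_def by (rule arg_cong[where f = prod_list]) (simp add: zip_map1 case_prod_beta)
 have pr2: "pr \<phi>s ms = evl (rev (map (\<lambda>m. ev (?a m)) ms)) \<phi>s" if "\<phi>s \<in> listset ?D" "length ms = length ys" for \<phi>s ms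
 proof -
  have "pr \<phi>s ms = evl (map (\<lambda>m. ev (?a m)) ms) (rev \<phi>s)" unfolding pr_def using \<phi>s_b(1)[OF that(1)]
  proof (induction "rev \<phi>s" ms arbitrary: \<phi>s rule: list_induct2')
   case (4 x xs y ys)
   then have "\<phi>s = rev xs @ [x]" by (metis rev_eq_Cons_iff)
   then show ?case using 4(1)[of "rev xs"] 4(3) by (simp add: ev_def)
  qed (auto simp: evl_def)
  also have "\<dots> = evl (rev (map (\<lambda>m. ev (?a m)) ms)) \<phi>s" using \<phi>s_b(2)[OF that(1)] that(2) by (simp add: evl_rev)
  finally show ?thesis .
 qed
 let ?K = "\<lambda>ms \<phi>s w. scal U (pr \<phi>s ms) (gact U (iv h0) w)"
 let ?Q = "\<lambda>ms v. lift_M C du (rev is) U xs (?K ms) (\<phi> v xs)"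
 have evm: "set (rev (map (\<lambda>m. ev (?a m)) ms)) \<subseteq> bcar (dual C du)" if "set ms \<subseteq> bcar N" for ms
  using that Y by (auto intro!: ev_dual bact_in)
 have Kml0: "multilinear (bscale du) (scal U) (scal U) ?D (space U) (\<lambda>\<phi>s w. scal U (evl (rev (map (\<lambda>m. ev (?a m)) ms)) \<phi>s) w)"
  if ms: "ms \<in> listset (comps C N is ys)" for ms
  using evl_multilinear[OF D.dual_list_all2[OF evm[OF ms_b(1)[OF ms]], of ?D] vU, of 1] lenD ms_b(2)[OF ms] Dsub by simp
 have Keq: "?K ms \<phi>s w = gact U (iv h0) (scal U (evl (rev (map (\<lambda>m. ev (?a m)) ms)) \<phi>s) w)"
  if "ms \<in> listset (comps C N is ys)" "\<phi>s \<in> listset ?D" "w \<in> space U" for ms \<phi>s w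
  using pr2[OF that(2) ms_b(2)[OF that(1)]] linear_on_scale[OF glin that(3)] by simp
 have Kml: "multilinear (bscale du) (scal U) (scal U) ?D (space U) (?K ms)" if ms: "ms \<in> listset (comps C N is ys)" for ms
 proof -
  have Dv: "vsp (bscale du) E" if "E \<in> set ?D" for E using that D.compsK_vsp by (simp add: D.comps_compsK[OF gx])
  have "multilinear (bscale du) (scal U) (scal U) ?D (space U) (\<lambda>\<phi>s w. gact U (iv h0) (scal U (evl (rev (map (\<lambda>m. ev (?a m)) ms)) \<phi>s) w))"
   by (rule S'.multilinear_linear_comp[OF Kml0[OF ms] vsp_scale[OF vU] glin])
  then show ?thesis
   using multilinear_cong[of ?D "space U" "?K ms" "\<lambda>\<phi>s w. gact U (iv h0) (scal U (evl (rev (map (\<lambda>m. ev (?a m)) ms)) \<phi>s) w)" "scal U" "bscale du" "scal U", OF Keq[OF ms] vU Dv]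
   by blast
 qed
 have \<phi>in: "\<phi> v xs \<in> tensor (bscale du) (scal U) ?D (space U)" if "v \<in> space V" for v
  by (rule D.Mspace_tensor[OF D.Hom_in[OF \<phi> that] p(1)])
 have \<phi>lin: "linear_on (scal V) (pw (*)) (space V) (\<lambda>v. \<phi> v xs)"
  using D.Hom_linear[OF \<phi>] by (auto simp: linear_on_def pw_def[of "pw (*)"])
 have Qml: "multilinear (bscale N) (scal V) (scal U) (comps C N is ys) (space V) ?Q"
 proof (rule multilinear_lift[OF vU vsU Csub(2) Kml _ \<phi>lin])
  fix ms t ds w assume *: "ms \<in> listset (comps C N is ys)" "t < length (comps C N is ys)" "ds \<in> listset ?D" "w \<in> space U"
  have "list_all2 (\<lambda>\<psi> E. linear_on (bscale N) (*) E \<psi>) (map (\<lambda>\<psi> m. \<psi> (?a m)) (rev ds)) (comps C N is ys)"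
   unfolding list_all2_conv_all_nth
  proof (intro conjI allI impI)
   show "length (map (\<lambda>\<psi> m. \<psi> (?a m)) (rev ds)) = length (comps C N is ys)" using \<phi>s_b(2)[OF *(3)] lenC by simp
   fix s assume s: "s < length (map (\<lambda>\<psi> m. \<psi> (?a m)) (rev ds))"
   then have "rev ds ! s \<in> bcar du" using \<phi>s_b(1)[OF *(3)] by (metis length_map nth_mem set_rev subset_iff)
   then have "linear_on (bscale N) (*) (bcar N) (\<lambda>m. (rev ds ! s) (?a m))"
    using Y bact_in by (intro linear_on_comp[OF bact_linear dual_linear]) auto
   moreover have "comps C N is ys ! s \<subseteq> bcar N" using s \<phi>s_b(2)[OF *(3)] lenC by (intro Csub(1) nth_mem) simp
   ultimately show "linear_on (bscale N) (*) (comps C N is ys ! s) (map (\<lambda>\<psi> m. \<psi> (?a m)) (rev ds) ! s)"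
    using s by (simp add: linear_on_subset)
  qed
  from evl_multilinear[OF this vU, of 1]
  show "linear_on (bscale N) (scal U) (comps C N is ys ! t) (\<lambda>m. ?K (ms[t := m]) ds w)"
   using *(1,2) rep_in[OF d(3) ih0 *(4)] unfolding multilinear_def pr1 by simp
 qed (use \<phi>in in auto)
 have Qval: "?Q (absv e w) v = D.opr (rev is) U \<phi> (dwd w) v" if w: "w \<in> bw is ys" and v: "v \<in> space V" for w v
 proof -
  note b = bw_props[OF w g]
  have ms: "absv e w \<in> listset (comps C N is ys)" using b(5)[of e] comps_compsK[OF g] by simp
  have ab: "D.absl e (dwd w) = rev (map (\<lambda>m. ev (?a m)) (absv e w))" using D_absl_dwd[of "is" w] b g by simp
  have "?Q (absv e w) v = lift_M C du (rev is) U xs (\<lambda>\<phi>s w'. gact U (iv h0) (scal U (evl (D.absl e (dwd w)) \<phi>s) w')) (\<phi> v xs)"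
   unfolding ab
   by (rule S'.lift_cong[OF Keq[OF ms] vsU Kml[OF ms] S'.multilinear_linear_comp[OF Kml0[OF ms] vsp_scale[OF vU] glin] \<phi>in[OF v]])
  also have "\<dots> = gact U (iv h0) (D.ctr (rev is) U xs (D.absl e (dwd w)) (\<phi> v xs))" unfolding D.ctr_def ab
   by (rule S'.linear_lift_comp[OF vU Kml0[OF ms] vsp_scale[OF vU] glin vsU \<phi>in[OF v], symmetric])
  also have "\<dots> = D.opr (rev is) U \<phi> (dwd w) v" using t b(1) by (simp add: D.opr_def D.cw_def map_fst_dwd)
  finally show ?thesis .
 qed
 have fexp: "f u ys = (\<Sum>w\<in>bw is ys. pure_M C N is V ys (absv e w) (opr is V f (star is w) u))"
  unfolding opr_def by (rule Mspace_expand[OF Hom_in[OF f u] d(4,1) ys])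
 note Ql = S.lift_linear[OF vsU Qml] and Qp = S.lift_pure[OF vsU Qml]
 have ab: "absv e w \<in> listset (comps C N is ys)" if "w \<in> bw is ys" for w
  using bw_props(5)[OF that g, of e] comps_compsK[OF g] by simp
 have oin: "opr is V f (star is w) u \<in> space V" if "w \<in> bw is ys" for w
  by (rule opr_in[OF r f bw_props(3)[OF that g] u])
 have "lift_M C N is V ys ?Q (f u ys) = (\<Sum>w\<in>bw is ys. lift_M C N is V ys ?Q (pure_M C N is V ys (absv e w) (opr is V f (star is w) u)))"
  unfolding fexp by (rule linear_on_sum[OF Ql S.tensor_vsp S.tpure_in_tensor[OF ab oin]])
 also have "\<dots> = (\<Sum>w\<in>bw is ys. D.opr (rev is) U \<phi> (dwd w) (opr is V f (star is w) u))"
  by (intro sum.cong refl) (simp add: Qp[OF ab oin] Qval[OF _ oin])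
 finally show "?L ys = (\<Sum>w\<in>bw is ys. D.opr (rev is) U \<phi> (dwd w) (opr is V f (star is w) u))"
  unfolding di prod.case pr_def .
qed

text \<open>A nonzero vector of U makes the scalar in the definite description unique.\<close>

lemma pairing_eqI:
 assumes r: "reps_at is U V" and f: "f \<in> Hom C N is U V" and \<phi>: "\<phi> \<in> Hom C du (rev is) V U" and U: "space U \<noteq> {0}"
  and c: "\<And>u. u \<in> space U ==> T is V U f \<phi> u = scal U c u"
 shows "pairing C N is U V f \<phi> = c"
proof -
 note vU = rep_vsp[OF reps_atD(3)[OF r]]
 obtain u0 where u0: "u0 \<in> space U" "u0 \<noteq> 0" using U vsp_0[OF vU] by blast
 have "pairing C N is U V f \<phi> = (THE c. \<forall>u\<in>space U. scal U c u = T is V U f \<phi> u)"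
  unfolding pairing_def using pairing_sum[OF r f \<phi>] by (simp cong: ball_cong)
 also have "\<dots> = c"
 proof (rule the_equality)
  fix c' assume "\<forall>u\<in>space U. scal U c' u = T is V U f \<phi> u"
  then have "scal U c' u0 = scal U c u0" using c u0(1) by simp
  then show "c' = c" using u0(2) vector_space.scale_right_imp_eq[OF vsp_vs[OF vU]] by blast
 qed (simp add: c)
 finally show ?thesis .
qed

lemma T_Nil:
 assumes "i \<in> pts C"
 shows "T [i] V U f \<phi> u = D.opr [i] U \<phi> [] (opr [i] V f [] u)"
proof -
 have "yseqs C [i] = {[]}" by auto
 then show ?thesis by (simp add: T_def dwd_simps)
qed

text \<open>Word concatenation reverses under \<open>dwd\<close>, so the first letter of f meets the
  last letter of \<open>\<phi>\<close>. The remaining letters sum up to the \<open>T\<close> of the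
  tails, acting between the two outer operators. The middle representations V and V' may
  differ.\<close>

lemma T_Cons:
 assumes r1: "reps_at [i, j] U V" and r2: "reps_at (j # is) V W" and r1': "reps_at [i, j] U' V'" and r2': "reps_at (j # is) V' W"
  and f1: "f1 \<in> Hom C N [i, j] U V" and f2: "f2 \<in> Hom C N (j # is) V W"
  and \<phi>1: "\<phi>1 \<in> Hom C du [j, i] V' U'" and \<phi>2: "\<phi>2 \<in> Hom C du (rev (j # is)) W V'" and u: "u \<in> space U"
 shows "T (i # j # is) W U' (circ C N [i, j] V (j # is) W f2 f1) (circ C du (rev (j # is)) V' [j, i] U' \<phi>1 \<phi>2) u =
  (\<Sum>y\<in>cos_reps C j. \<Sum>b\<in>Bas i (pact C y j). D.opr [j, i] U' \<phi>1 (dwd [(y, b)])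
    (T (j # is) W V' f2 \<phi>2 (opr [i, j] V f1 (star [i, j] [(y, b)]) u)))"
proof -
 note d1 = reps_atD[OF r1] and d2 = reps_atD[OF r2]
 have ij: "i \<in> pts C" "j \<in> pts C" using d1(1) by auto
 have Dr1: "D.reps_at [j, i] V' U'" using reps_at_rev[OF r1'] by simp
 note Dr2 = reps_at_rev[OF r2']
 have key: "D.opr (rev (i # j # is)) U' (circ C du (rev (j # is)) V' [j, i] U' \<phi>1 \<phi>2) (dwd ((y, b) # w))
   (opr (i # j # is) W (circ C N [i, j] V (j # is) W f2 f1) (star (i # j # is) ((y, b) # w)) u) =
   D.opr [j, i] U' \<phi>1 (dwd [(y, b)]) (D.opr (rev (j # is)) V' \<phi>2 (dwd w)
    (opr (j # is) W f2 (star (j # is) w) (opr [i, j] V f1 (star [i, j] [(y, b)]) u)))"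
  if y: "y \<in> cos_reps C j" and b: "b \<in> Bas i (pact C y j)" and ys: "ys \<in> yseqs C (j # is)" and w: "w \<in> bw (j # is) ys" for y b ys w
 proof -
  have yG: "y \<in> Gr" using cos_reps_Gr ij y by blast
  note gy = yseqs_gseq[OF d2(1) ys] and bp = bw_props[OF w yseqs_gseq[OF d2(1) ys]]
  have v1: "vw [i, j] (star [i, j] [(y, b)])" using ij yG cof_dual by simp
  have o1: "opr [i, j] V f1 (star [i, j] [(y, b)]) u \<in> space V" by (rule opr_in[OF r1 f1 v1 u])
  have "opr ([i, j] @ tl (j # is)) W (circ C N [i, j] V (j # is) W f2 f1) (star [i, j] [(y, b)] @ star (j # is) w) u =
    opr (j # is) W f2 (star (j # is) w) (opr [i, j] V f1 (star [i, j] [(y, b)]) u)"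
   by (rule opr_circ[OF r1 r2 _ f1 f2 v1 bp(3) u]) simp
  then have 1: "opr (i # j # is) W (circ C N [i, j] V (j # is) W f2 f1) (star (i # j # is) ((y, b) # w)) u =
    opr (j # is) W f2 (star (j # is) w) (opr [i, j] V f1 (star [i, j] [(y, b)]) u)" by simp
  have o2: "opr (j # is) W f2 (star (j # is) w) (opr [i, j] V f1 (star [i, j] [(y, b)]) u) \<in> space W"
   by (rule opr_in[OF r2 f2 bp(3) o1])
  have v2: "D.vw (rev (j # is)) (dwd w)" using dwd_vw[of "j # is" w] bp gy by simp
  have v3: "D.vw [j, i] (dwd [(y, b)])" using dwd_vw[of "[i, j]" "[(y, b)]"] ij yG Bas_bcar[OF b] by simp
  have "D.opr (rev (j # is) @ tl [j, i]) U' (circ C du (rev (j # is)) V' [j, i] U' \<phi>1 \<phi>2) (dwd w @ dwd [(y, b)]) x =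
    D.opr [j, i] U' \<phi>1 (dwd [(y, b)]) (D.opr (rev (j # is)) V' \<phi>2 (dwd w) x)" if "x \<in> space W" for x
   by (rule D.opr_circ[OF Dr2 Dr1 _ \<phi>2 \<phi>1 v2 v3 that]) simp
  then show ?thesis unfolding 1 using o2 by (simp add: dwd_simps)
 qed
 have lin1: "linear_on (scal V') (scal U') (space V') (D.opr [j, i] U' \<phi>1 (dwd [(y, b)]))" if "y \<in> cos_reps C j" "b \<in> Bas i (pact C y j)" for y b
  using dwd_vw[of "[i, j]" "[(y, b)]"] ij cos_reps_Gr[OF ij(2) that(1)] Bas_bcar[OF that(2)] by (intro D.opr_linear[OF Dr1 \<phi>1]) simp
 have inV: "D.opr (rev (j # is)) V' \<phi>2 (dwd w) (opr (j # is) W f2 (star (j # is) w) (opr [i, j] V f1 (star [i, j] [(y, b)]) u)) \<in> space V'"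
  if y: "y \<in> cos_reps C j" and b: "b \<in> Bas i (pact C y j)" and ys: "ys \<in> yseqs C (j # is)" and w: "w \<in> bw (j # is) ys" for y b ys w
 proof -
  note gy = yseqs_gseq[OF d2(1) ys] and bp = bw_props[OF w yseqs_gseq[OF d2(1) ys]]
  have v1: "vw [i, j] (star [i, j] [(y, b)])" using ij cos_reps_Gr[OF ij(2) y] cof_dual by simp
  have v2: "D.vw (rev (j # is)) (dwd w)" using dwd_vw[of "j # is" w] bp gy by simp
  show ?thesis by (intro D.opr_in[OF Dr2 \<phi>2 v2] opr_in[OF r2 f2 bp(3)] opr_in[OF r1 f1 v1] u)
 qed
 have "T (i # j # is) W U' (circ C N [i, j] V (j # is) W f2 f1) (circ C du (rev (j # is)) V' [j, i] U' \<phi>1 \<phi>2) u =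
   (\<Sum>y\<in>cos_reps C j. \<Sum>ys\<in>yseqs C (j # is). \<Sum>b\<in>Bas i (pact C y j). \<Sum>w\<in>bw (j # is) ys.
    D.opr [j, i] U' \<phi>1 (dwd [(y, b)]) (D.opr (rev (j # is)) V' \<phi>2 (dwd w)
    (opr (j # is) W f2 (star (j # is) w) (opr [i, j] V f1 (star [i, j] [(y, b)]) u))))"
  unfolding T_def sum_yseqs_Cons sum_bw_Cons by (intro sum.cong refl key)
 also have "\<dots> = (\<Sum>y\<in>cos_reps C j. \<Sum>b\<in>Bas i (pact C y j). \<Sum>ys\<in>yseqs C (j # is). \<Sum>w\<in>bw (j # is) ys.
    D.opr [j, i] U' \<phi>1 (dwd [(y, b)]) (D.opr (rev (j # is)) V' \<phi>2 (dwd w)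
    (opr (j # is) W f2 (star (j # is) w) (opr [i, j] V f1 (star [i, j] [(y, b)]) u))))"
  by (intro sum.cong refl sum.swap)
 also have "\<dots> = (\<Sum>y\<in>cos_reps C j. \<Sum>b\<in>Bas i (pact C y j). D.opr [j, i] U' \<phi>1 (dwd [(y, b)])
    (T (j # is) W V' f2 \<phi>2 (opr [i, j] V f1 (star [i, j] [(y, b)]) u)))"
 proof (intro sum.cong refl)
  fix y b assume y: "y \<in> cos_reps C j" and b: "b \<in> Bas i (pact C y j)"
  note vV' = rep_vsp[OF reps_atD(3)[OF r2']]
  show "(\<Sum>ys\<in>yseqs C (j # is). \<Sum>w\<in>bw (j # is) ys.
    D.opr [j, i] U' \<phi>1 (dwd [(y, b)]) (D.opr (rev (j # is)) V' \<phi>2 (dwd w)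
    (opr (j # is) W f2 (star (j # is) w) (opr [i, j] V f1 (star [i, j] [(y, b)]) u)))) =
    D.opr [j, i] U' \<phi>1 (dwd [(y, b)]) (T (j # is) W V' f2 \<phi>2 (opr [i, j] V f1 (star [i, j] [(y, b)]) u))"
   unfolding T_def by (subst linear_on_sum[OF lin1[OF y b] vV'], intro vsp_sum[OF vV'] inV[OF y b], assumption+)
     (intro sum.cong refl linear_on_sum[OF lin1[OF y b] vV', symmetric] inV[OF y b])
 qed
 finally show ?thesis .
qed

end

subsection \<open>Families on a single letter\<close>

context gbimod begin

lemma vw_single [simp]: "vw [i] w \<longleftrightarrow> i \<in> pts C \<and> w = []" by (auto simp: vw_def)

text \<open>Linear families of operators \<open>U \<rightarrow> V\<close> indexed by one letter; the intertwiners \<open>U \<rightarrow> M(i,j;V)\<close> are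
those fixed by the action \<open>tw\<close> of \<open>G\<^sub>i \<times> G\<^sub>j\<close>, so they are obtained by averaging.\<close>

definition locf :: "'i => 'i => ('g, 'k, 'v::ab_group_add) rep => ('g, 'k, 'v) rep => ('g => ('m => 'k) => 'v => 'v) => bool" where
 "locf i j U V F \<longleftrightarrow> (\<forall>g\<in>Gr. \<forall>\<psi>\<in>bcar du.
   (\<forall>u\<in>space U. F g \<psi> u \<in> space V) \<and> linear_on (scal U) (scal V) (space U) (F g \<psi>) \<and>
   (\<forall>u\<in>space U. F g \<psi> u = (\<Sum>b\<in>Bas i (pact C g j). scal V (\<psi> b) (F g (cof i (pact C g j) b) u))))"

lemma locfD:
 assumes "locf i j U V F" "g \<in> Gr" "\<psi> \<in> bcar du"
 shows "u \<in> space U ==> F g \<psi> u \<in> space V" "linear_on (scal U) (scal V) (space U) (F g \<psi>)"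
  "u \<in> space U ==> F g \<psi> u = (\<Sum>b\<in>Bas i (pact C g j). scal V (\<psi> b) (F g (cof i (pact C g j) b) u))"
 using assms unfolding locf_def by blast+

definition tw :: "('g, 'k, 'v::ab_group_add) rep => ('g, 'k, 'v) rep => 'g => 'g => ('g => ('m => 'k) => 'v => 'v)
  => 'g => ('m => 'k) => 'v => 'v" where
 "tw U V k h F = (\<lambda>g \<psi> u. gact V h (F (iv k \<cdot> g \<cdot> h) (bact du (iv k) \<psi>) (gact U (iv k) u)))"

definition rep2 :: "'i => 'i => ('g, 'k, 'v::ab_group_add) rep => ('g, 'k, 'v) rep => bool" where
 "rep2 i j U V \<longleftrightarrow> i \<in> pts C \<and> j \<in> pts C \<and> rep_at i U \<and> rep_at j V"

lemma rep2D: "rep2 i j U V ==> i \<in> pts C" "rep2 i j U V ==> j \<in> pts C"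
  "rep2 i j U V ==> rep_at i U" "rep2 i j U V ==> rep_at j V" by (auto simp: rep2_def)

lemma rep2_reps_at: "rep2 i j U V \<longleftrightarrow> reps_at [i, j] U V" by (auto simp: rep2_def reps_at_def)

text \<open>The expansion condition is the point: the twisted family is expanded in the component of
  inverse(k) g h, but the basis belonging to g is required.\<close>

lemma locf_tw:
 assumes r: "rep2 i j U V" and F: "locf i j U V F" and k: "k \<in> stab C i" and h: "h \<in> stab C j"
 shows "locf i j U V (tw U V k h F)" unfolding locf_def
proof (intro ballI conjI)
 note d = rep2D[OF r]
 note vV = rep_vsp[OF d(4)]
 have kG: "k \<in> Gr" "h \<in> Gr" using k h stab_Gr by blast+
 have ik: "iv k \<in> stab C i" by (rule stab_inv[OF d(1) k])
 fix g \<psi> assume g: "g \<in> Gr" and \<psi>: "\<psi> \<in> bcar du"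
 let ?g = "iv k \<cdot> g \<cdot> h"
 have gG: "?g \<in> Gr" using kG g by simp
 have k\<psi>: "bact du (iv k) \<psi> \<in> bcar du" if "\<psi> \<in> bcar du" for \<psi> using that kG by (simp add: dual_bact_in)
 note L = locfD[OF F gG k\<psi>]
 have gj: "pact C ?g j = pact C (iv k) (pact C g j)" using kG g d(2) stab_fix[OF h] by (simp add: pact_mult pact_pts)
 show tin: "tw U V k h F g \<psi> u \<in> space V" if "u \<in> space U" for u
  unfolding tw_def by (intro rep_in[OF d(4) h] L(1)[OF \<psi>] rep_in[OF d(3) ik] that)
 show "linear_on (scal U) (scal V) (space U) (tw U V k h F g \<psi>)" unfolding tw_def
  by (rule linear_on_comp[OF linear_on_comp[OF rep_linear[OF d(3) ik] L(2)[OF \<psi>]] rep_linear[OF d(4) h]])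
    (use rep_in[OF d(3) ik] L(1)[OF \<psi>] in auto)
 fix u assume u: "u \<in> space U"
 define u' where "u' = gact U (iv k) u"
 have u': "u' \<in> space U" unfolding u'_def by (rule rep_in[OF d(3) ik u])
 let ?B = "Bas i (pact C g j)" and ?B' = "Bas i (pact C ?g j)" and ?c = "cof i (pact C g j)" and ?c' = "cof i (pact C ?g j)"
 have kb: "bact N k b' \<in> bcomp N i (pact C g j)" if "b' \<in> ?B'" for b'
  using bact_bcomp[OF kG(1) d(1) pact_pts[OF gG d(2)] subsetD[OF Bas(2) that]] kG g d(2) stab_fix[OF k] gj
  by (simp add: pact_pts flip: pact_mult) (simp add: pact_mult pact_pts pact_one flip: m_assoc)
 have app: "bact du (iv k) \<psi> b' = \<psi> (bact N k b')" if "b' \<in> ?B'" for b' \<psi>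
  using Bas_bcar[OF that] kG by (simp add: dual_bact_apply)
 have "F ?g (bact du (iv k) \<psi>) u' = (\<Sum>b'\<in>?B'. scal V (\<psi> (bact N k b')) (F ?g (?c' b') u'))"
  using L(3)[OF \<psi> u'] app by (simp cong: sum.cong)
 \<comment> \<open>The translate \<open>bact N k b'\<close> lies in the component of g, so the value
   of \<open>\<psi>\<close> at it can be re-expanded in the basis of that component.\<close>
 also have "\<dots> = (\<Sum>b'\<in>?B'. \<Sum>b\<in>?B. scal V (\<psi> b) (scal V (bact du (iv k) (?c b) b') (F ?g (?c' b') u')))"
  using dual_expand[OF \<psi> kb] by (intro sum.cong refl) (simp add: app vsp_simps[OF vV])
 also have "\<dots> = (\<Sum>b\<in>?B. scal V (\<psi> b) (\<Sum>b'\<in>?B'. scal V (bact du (iv k) (?c b) b') (F ?g (?c' b') u')))"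
  by (subst sum.swap) (simp add: vsp_simps(9)[OF vV])
 also have "\<dots> = (\<Sum>b\<in>?B. scal V (\<psi> b) (F ?g (bact du (iv k) (?c b)) u'))" using L(3)[OF cof_dual u'] by simp
 finally have eq: "F ?g (bact du (iv k) \<psi>) u' = (\<Sum>b\<in>?B. scal V (\<psi> b) (F ?g (bact du (iv k) (?c b)) u'))" .
 show "tw U V k h F g \<psi> u = (\<Sum>b\<in>?B. scal V (\<psi> b) (tw U V k h F g (?c b) u))" unfolding tw_def u'_def[symmetric] eq
  by (rule linear_on_combination[OF rep_linear[OF d(4) h] vV L(1)[OF cof_dual u']])
qed

lemma locf_sum:
 assumes r: "rep2 i j U V" and F: "\<And>a. a \<in> A ==> locf i j U V (F a)"
 shows "locf i j U V (\<lambda>g \<psi> u. \<Sum>a\<in>A. F a g \<psi> u)" unfolding locf_def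
proof (intro ballI conjI)
 note vV = rep_vsp[OF rep2D(4)[OF r]] and vU = rep_vsp[OF rep2D(3)[OF r]]
 fix g \<psi> assume g: "g \<in> Gr" and \<psi>: "\<psi> \<in> bcar du"
 note L = locfD[OF F g \<psi>]
 show "(\<Sum>a\<in>A. F a g \<psi> u) \<in> space V" if "u \<in> space U" for u using L(1) that by (intro vsp_sum[OF vV])
 show "linear_on (scal U) (scal V) (space U) (\<lambda>u. \<Sum>a\<in>A. F a g \<psi> u)"
  using L(2) by (auto simp: linear_on_def sum.distrib vsp_simps(9)[OF vV])
 show "(\<Sum>a\<in>A. F a g \<psi> u) = (\<Sum>b\<in>Bas i (pact C g j). scal V (\<psi> b) (\<Sum>a\<in>A. F a g (cof i (pact C g j) b) u))" if "u \<in> space U" for u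
  using L(3) that by (simp add: vsp_simps(9)[OF vV] cong: sum.cong) (rule sum.swap)
qed

lemma Hom_locf:
 assumes r: "rep2 i j U V" and f: "f \<in> Hom C N [i, j] U V"
 shows "locf i j U V (\<lambda>g \<psi> u. opr [i, j] V f [(g, \<psi>)] u)" unfolding locf_def
proof (intro ballI conjI)
 note r' = r[unfolded rep2_reps_at] and d = rep2D[OF r]
 fix g \<psi> assume g: "g \<in> Gr" and \<psi>: "\<psi> \<in> bcar du"
 have w: "vw [i, j] [(g, \<psi>)]" using d g \<psi> by simp
 show "opr [i, j] V f [(g, \<psi>)] u \<in> space V" if "u \<in> space U" for u by (rule opr_in[OF r' f w that])
 show "linear_on (scal U) (scal V) (space U) (opr [i, j] V f [(g, \<psi>)])" by (rule opr_linear[OF r' f w])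
 show "opr [i, j] V f [(g, \<psi>)] u = (\<Sum>b\<in>Bas i (pact C g j). scal V (\<psi> b) (opr [i, j] V f [(g, cof i (pact C g j) b)] u))"
  if "u \<in> space U" for u
  using opr_wx[OF r' f that, unfolded wx_def, THEN conjunct2, THEN conjunct1, rule_format, of "[]" g \<psi> "[]"] w by simp
qed

text \<open>Equivariance of f accounts for k, and balancing at the last letter for h.\<close>

lemma Hom_tw:
 assumes r: "rep2 i j U V" and f: "f \<in> Hom C N [i, j] U V" and k: "k \<in> stab C i" and h: "h \<in> stab C j"
  and g: "g \<in> Gr" and \<psi>: "\<psi> \<in> bcar du" and u: "u \<in> space U"
 shows "tw U V k h (\<lambda>g \<psi> u. opr [i, j] V f [(g, \<psi>)] u) g \<psi> u = opr [i, j] V f [(g, \<psi>)] u"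
proof -
 note r' = r[unfolded rep2_reps_at] and d = rep2D[OF r]
 have kG: "k \<in> Gr" "h \<in> Gr" using k h stab_Gr by blast+
 have ik: "iv k \<in> stab C i" by (rule stab_inv[OF d(1) k])
 let ?g = "iv k \<cdot> g" and ?\<psi> = "bact du (iv k) \<psi>" and ?u = "gact U (iv k) u"
 have w: "vw [i, j] [(?g, ?\<psi>)]" "vw [i, j] [(g, \<psi>)]" using d g \<psi> kG by (simp_all add: dual_bact_in)
 have u': "?u \<in> space U" by (rule rep_in[OF d(3) ik u])
 have 1: "opr [i, j] V f [(?g \<cdot> h, ?\<psi>)] ?u = gact V (iv h) (opr [i, j] V f [(?g, ?\<psi>)] ?u)"
  using opr_wx[OF r' f u', unfolded wx_def, THEN conjunct2, THEN conjunct2, rule_format, of "[]" ?g ?\<psi> "[]" h] w h by simp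
 have "opr [i, j] V f [(?g, ?\<psi>)] ?u = opr [i, j] V f (lact (iv (iv k)) [(?g, ?\<psi>)]) u"
  using opr_gact[OF r' f w(1) _ u, of "iv k"] ik by simp
 also have "lact (iv (iv k)) [(?g, ?\<psi>)] = [(g, \<psi>)]"
  using kG g \<psi> by (simp add: mult_iv_cancel dual_bact_mult[symmetric] dual_bact_one)
 finally show ?thesis unfolding tw_def 1 using rep_inv(2)[OF d(4,2) h] opr_in[OF r' f w(2) u] by simp
qed

text \<open>Translating the summation index over G_j or over G_i shows that the sum of all twists is
  balanced and equivariant, hence comes from an intertwiner. The sum is left undivided, which
  suffices for non-degeneracy.\<close>

lemma avg_Hom:
 assumes r: "rep2 i j U V" and F: "locf i j U V F"
 obtains f where "f \<in> Hom C N [i, j] U V"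
  "\<And>g \<psi> u. g \<in> Gr ==> \<psi> \<in> bcar du ==> u \<in> space U ==>
    opr [i, j] V f [(g, \<psi>)] u = (\<Sum>k\<in>stab C i. \<Sum>h\<in>stab C j. tw U V k h F g \<psi> u)"
proof -
 note r' = r[unfolded rep2_reps_at] and d = rep2D[OF r]
 note vV = rep_vsp[OF d(4)]
 let ?A = "\<lambda>g \<psi> u. \<Sum>k\<in>stab C i. \<Sum>h\<in>stab C j. tw U V k h F g \<psi> u"
 have A: "locf i j U V ?A" by (intro locf_sum[OF r] locf_tw[OF r F])
 interpret Si: finite_subgroup "grp C" "stab C i" by (intro finite_subgroup.intro finite_subgroup_axioms.intro is_group stab_subgroup d(1) finite_stab)
 interpret Sj: finite_subgroup "grp C" "stab C j" by (intro finite_subgroup.intro finite_subgroup_axioms.intro is_group stab_subgroup d(2) finite_stab)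
 \<comment> \<open>The words along \<open>[i, j]\<close> have exactly one letter; the value 0
   elsewhere is a default.\<close>
 define F' where "F' w u = (case w of [(g, \<psi>)] => ?A g \<psi> u | _ => 0)" for w u
 have F': "F' [(g, \<psi>)] u = ?A g \<psi> u" for g \<psi> u by (simp add: F'_def)
 have vw1: "vw [i, j] w \<longleftrightarrow> (\<exists>g \<psi>. w = [(g, \<psi>)] \<and> g \<in> Gr \<and> \<psi> \<in> bcar du)" for w using d by (cases w) (auto simp: vw_Cons)
 have vw2: "vw [i, j] (p @ (g, \<psi>) # q) \<longleftrightarrow> p = [] \<and> q = [] \<and> g \<in> Gr \<and> \<psi> \<in> bcar du" for p g \<psi> q
  unfolding vw1 by (auto simp: append_eq_Cons_conv)
 have twin: "tw U V k h F g \<psi> u \<in> space V" if "k \<in> stab C i" "h \<in> stab C j" "g \<in> Gr" "\<psi> \<in> bcar du" "u \<in> space U" for k h g \<psi> u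
  by (rule locfD(1)[OF locf_tw[OF r F that(1,2)] that(3-5)])
 have right: "?A (g \<cdot> h') \<psi> u = gact V (iv h') (?A g \<psi> u)"
  if g: "g \<in> Gr" and \<psi>: "\<psi> \<in> bcar du" and u: "u \<in> space U" and h': "h' \<in> stab C j" for g \<psi> u h'
 proof -
  have h'G: "h' \<in> Gr" and ih': "iv h' \<in> stab C j" using stab_Gr[OF h'] stab_inv[OF d(2) h'] by auto
  have "gact V (iv h') (?A g \<psi> u) = (\<Sum>k\<in>stab C i. gact V (iv h') (\<Sum>h\<in>stab C j. tw U V k h F g \<psi> u))"
   by (intro linear_on_sum[OF rep_linear[OF d(4) ih'] vV] vsp_sum[OF vV] twin g \<psi> u)
  also have "\<dots> = (\<Sum>k\<in>stab C i. \<Sum>h\<in>stab C j. gact V (iv h') (tw U V k h F g \<psi> u))"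
   by (intro sum.cong refl linear_on_sum[OF rep_linear[OF d(4) ih'] vV] twin g \<psi> u)
  also have "\<dots> = (\<Sum>k\<in>stab C i. \<Sum>h\<in>stab C j. tw U V k (iv h' \<cdot> h) F (g \<cdot> h') \<psi> u)"
  proof (intro sum.cong refl)
   fix k h assume k: "k \<in> stab C i" and h: "h \<in> stab C j"
   have G: "k \<in> Gr" "h \<in> Gr" using k h stab_Gr by blast+
   have "F (iv k \<cdot> g \<cdot> h) (bact du (iv k) \<psi>) (gact U (iv k) u) \<in> space V"
    using G g \<psi> by (intro locfD(1)[OF F] rep_in[OF d(3) stab_inv[OF d(1) k] u]) (auto simp: dual_bact_in)
   then show "gact V (iv h') (tw U V k h F g \<psi> u) = tw U V k (iv h' \<cdot> h) F (g \<cdot> h') \<psi> u"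
    using rep_mult[OF d(4) ih' h] G g h'G by (simp add: tw_def m_assoc mult_iv_cancel)
  qed
  also have "\<dots> = ?A (g \<cdot> h') \<psi> u" by (intro sum.cong refl Sj.sum_reindex_left[OF ih'])
  finally show ?thesis by simp
 qed
 have left: "?A g \<psi> (gact U k' u) = ?A (iv k' \<cdot> g) (bact du (iv k') \<psi>) u"
  if g: "g \<in> Gr" and \<psi>: "\<psi> \<in> bcar du" and u: "u \<in> space U" and k': "k' \<in> stab C i" for g \<psi> u k'
 proof -
  have k'G: "k' \<in> Gr" and ik': "iv k' \<in> stab C i" using stab_Gr[OF k'] stab_inv[OF d(1) k'] by auto
  have "?A (iv k' \<cdot> g) (bact du (iv k') \<psi>) u = (\<Sum>k\<in>stab C i. \<Sum>h\<in>stab C j. tw U V (k' \<cdot> k) h F g \<psi> (gact U k' u))"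
  proof (intro sum.cong refl)
   fix k h assume k: "k \<in> stab C i" and h: "h \<in> stab C j"
   have G: "k \<in> Gr" "h \<in> Gr" and ik: "iv k \<in> stab C i" "iv (k' \<cdot> k) \<in> stab C i"
    using k h stab_Gr stab_inv[OF d(1)] stab_mult[OF d(1) k' k] by blast+
   have "gact U (iv (k' \<cdot> k)) (gact U k' u) = gact U (iv (k' \<cdot> k) \<cdot> k') u" using rep_mult[OF d(3) ik(2) k' u] by simp
   also have "iv (k' \<cdot> k) \<cdot> k' = iv k" using G k'G by (simp add: inv_mult_group m_assoc)
   finally show "tw U V k h F (iv k' \<cdot> g) (bact du (iv k') \<psi>) u = tw U V (k' \<cdot> k) h F g \<psi> (gact U k' u)"
    using G k'G g by (simp add: tw_def inv_mult_group dual_bact_mult m_assoc)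
  qed
  also have "\<dots> = ?A g \<psi> (gact U k' u)"
   by (rule Si.sum_reindex_left[OF k', of "\<lambda>k. \<Sum>h\<in>stab C j. tw U V k h F g \<psi> (gact U k' u)"])
  finally show ?thesis by simp
 qed
 obtain f where f: "f \<in> Hom C N [i, j] U V" "\<And>w u. vw [i, j] w ==> u \<in> space U ==> opr [i, j] V f w u = F' w u"
 proof (rule Hom_construct[OF r', where F = F'])
  show "wx [i, j] V (\<lambda>w. F' w u)" if u: "u \<in> space U" for u unfolding wx_def
  proof (intro conjI allI impI, goal_cases)
   case (1 w)
   then show ?case using locfD(1)[OF A _ _ u] by (auto simp: vw1 F')
  next
   case (2 p g \<psi> q)
   then have *: "p = []" "q = []" "g \<in> Gr" "\<psi> \<in> bcar du" unfolding vw2 by auto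
   then show ?case using locfD(3)[OF A *(3,4) u] by (simp add: F')
  next
   case (3 p g \<psi> q h)
   then have *: "p = []" "q = []" "g \<in> Gr" "\<psi> \<in> bcar du" "h \<in> stab C j" unfolding vw2 by auto
   then show ?case using right[OF *(3,4) u *(5)] by (simp add: F')
  qed
  show "linear_on (scal U) (scal V) (space U) (F' w)" if w: "vw [i, j] w" for w
  proof -
   obtain g \<psi> where *: "w = [(g, \<psi>)]" "g \<in> Gr" "\<psi> \<in> bcar du" using w unfolding vw1 by blast
   have "F' w = ?A g \<psi>" by (rule ext) (simp add: *(1) F')
   then show ?thesis using locfD(2)[OF A *(2,3)] by simp
  qed
  show "F' w (gact U k u) = (if w = [] then gact V k (F' [] u) else F' (lact (iv k) w) u)"
   if w: "vw [i, j] w" and k: "k \<in> stab C (hd [i, j])" and u: "u \<in> space U" for w k u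
  proof -
   obtain g \<psi> where *: "w = [(g, \<psi>)]" "g \<in> Gr" "\<psi> \<in> bcar du" using w unfolding vw1 by blast
   then show ?thesis using left[OF *(2,3) u, of k] k by (simp add: F')
  qed
 qed blast
 show ?thesis by (rule that[OF f(1)]) (use f(2) d in \<open>simp add: F'\<close>)
qed

end

section \<open>Traces, and the pairing as a sum over the whole group\<close>

text \<open>The sum is the trace of the operator u |-> sum of l_k(u) a_k, computed in a basis; the
  zero operator has trace 0.\<close>

lemma trace_zero:
 assumes vU: "vsp s U" and fU: "fin_dim s U" and a: "\<And>k. k \<in> K ==> a k \<in> U"
  and l: "\<And>k. k \<in> K ==> linear_on s (*) U (l k)"
  and zero: "\<And>u. u \<in> U ==> (\<Sum>k\<in>K. s (l k u) (a k)) = 0"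
 shows "(\<Sum>k\<in>K. l k (a k)) = 0"
proof -
 note vs = vsp_vs[OF vU]
 obtain B where B: "finite B" "B \<subseteq> U" "is_basis s U B" using fin_dim_basis[OF vs fU] .
 let ?c = "coord s B"
 have cl: "linear_on s (*) U (?c b)" for b by (rule linear_imp_linear_on[OF coord_linear[OF vs B(3)]])
 have "(\<Sum>k\<in>K. l k (a k)) = (\<Sum>k\<in>K. \<Sum>b\<in>B. ?c b (a k) * l k b)"
 proof (intro sum.cong refl)
  fix k assume k: "k \<in> K"
  have "l k (a k) = l k (\<Sum>b\<in>B. s (?c b (a k)) b)" using coord_expand[OF vs B(3,1) a[OF k]] by simp
  also have "\<dots> = (\<Sum>b\<in>B. ?c b (a k) * l k b)" using B(2) by (intro linear_on_combination[OF l[OF k] vU]) auto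
  finally show "l k (a k) = (\<Sum>b\<in>B. ?c b (a k) * l k b)" .
 qed
 also have "\<dots> = (\<Sum>b\<in>B. \<Sum>k\<in>K. l k b * ?c b (a k))" by (subst sum.swap) (simp add: mult.commute)
 also have "\<dots> = (\<Sum>b\<in>B. ?c b (\<Sum>k\<in>K. s (l k b) (a k)))"
  by (intro sum.cong refl linear_on_combination[OF cl vU, symmetric] a)
 also have "\<dots> = 0" using zero B(2) linear_on_0[OF cl vsp_0[OF vU]] by (intro sum.neutral) auto
 finally show ?thesis .
qed

lemma functional_exists:
 fixes s :: "'k::field => 'a::ab_group_add => 'a"
 assumes "vector_space s" "x \<noteq> 0"
 shows "\<exists>l. (\<forall>A. linear_on s (*) A l) \<and> l x = 1"
proof -
 interpret vector_space s by fact
 have b: "is_basis s (span {x}) {x}" using assms(2) by (simp add: is_basis_def)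
 show ?thesis using linear_imp_linear_on[OF coord_linear[OF assms(1) b]] coord_basis[OF assms(1) b, of x x] by (intro exI[of _ "coord s {x} x"]) simp
qed

context gbimod_dual begin

text \<open>\<open>S0\<close> is the pairing with the sum over \<open>[G/G\<^sub>j]\<close> replaced by a sum over \<open>G\<close>. Unlike the pairing it
makes sense for families that are not invariant.\<close>

definition sg :: "'i => 'i => ('g => ('m => 'k) => 'v::ab_group_add => 'v) => ('g => (('m => 'k) => 'k) => 'v => 'v) => 'g => 'v => 'v" where
 "sg i j F \<Phi> g u = (\<Sum>b\<in>Bas i (pact C g j). \<Phi> (iv g) (ev (bact N (iv g) b)) (F g (cof i (pact C g j) b) u))"

definition S0 :: "'i => 'i => ('g => ('m => 'k) => 'v::ab_group_add => 'v) => ('g => (('m => 'k) => 'k) => 'v => 'v) => 'v => 'v" where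
 "S0 i j F \<Phi> u = (\<Sum>g\<in>Gr. sg i j F \<Phi> g u)"

lemma rep2_sym: "rep2 i j U V ==> D.rep2 j i V U" by (auto simp: rep2_def D.rep2_def)

lemma locf_ev_linear:
 assumes r: "rep2 i j U V" and \<Phi>: "D.locf j i V U \<Phi>" and g: "g \<in> Gr" and v: "v \<in> space V"
 shows "linear_on (bscale N) (scal U) (bcar N) (\<lambda>m. \<Phi> g (ev m) v)"
proof -
 note vs = vsp_simps[OF rep_vsp[OF rep2D(3)[OF r]]]
 have e: "\<Phi> g (ev m) v = (\<Sum>b\<in>D.Bas j (pact C g i). scal U (b m) (\<Phi> g (D.cof j (pact C g i) b) v))" if "m \<in> bcar N" for m
  using D.locfD(3)[OF \<Phi> g ev_dual[OF that] v] D.Bas_bcar by (simp add: ev_def cong: sum.cong)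
 show ?thesis
 proof (rule linear_onI)
  fix x y assume xy: "x \<in> bcar N" "y \<in> bcar N"
  show "\<Phi> g (ev (x + y)) v = \<Phi> g (ev x) v + \<Phi> g (ev y) v"
   unfolding e[OF xy(1)] e[OF xy(2)] e[OF vsp_add[OF bcar_vsp xy]] sum.distrib[symmetric]
   by (intro sum.cong refl) (simp add: linear_on_add[OF dual_linear[OF D.Bas_bcar] xy] vs)
 next
  fix c x assume x: "x \<in> bcar N"
  show "\<Phi> g (ev (bscale N c x)) v = scal U c (\<Phi> g (ev x) v)" unfolding e[OF x] e[OF vsp_scale[OF bcar_vsp x]] vs(9)
   by (intro sum.cong refl) (simp add: linear_on_scale[OF dual_linear[OF D.Bas_bcar] x] vs)
 qed
qed

text \<open>The sum over \<open>Bas\<close> may be replaced by one over any family of vectors and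
  functionals that resolves the identity of the component. This is needed because the chosen bases
  are not permuted by G.\<close>

lemma sg_basis:
 assumes r: "rep2 i j U V" and r': "rep2 i j U' V" and F: "locf i j U V F" and \<Phi>: "D.locf j i V U' \<Phi>" and g: "g \<in> Gr" and u: "u \<in> space U"
  and c: "\<And>a. a \<in> A ==> c a \<in> bcomp N i (pact C g j)" and c': "\<And>a. a \<in> A ==> c' a \<in> bcar du"
  and expand: "\<And>m. m \<in> bcomp N i (pact C g j) ==> m = (\<Sum>a\<in>A. bscale N (c' a m) (c a))"
 shows "(\<Sum>a\<in>A. \<Phi> (iv g) (ev (bact N (iv g) (c a))) (F g (c' a) u)) = sg i j F \<Phi> g u"
proof -
 note d = rep2D[OF r] and d' = rep2D[OF r']
 note vV = rep_vsp[OF d(4)] and vU' = rep_vsp[OF d'(3)]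
 have ig: "iv g \<in> Gr" using g by simp
 let ?B = "Bas i (pact C g j)" and ?c = "cof i (pact C g j)"
 have cc: "c a \<in> bcar N" if "a \<in> A" for a using c[OF that] bcomp_bcar by blast
 have xin: "F g (?c b) u \<in> space V" for b by (rule locfD(1)[OF F g cof_dual u])
 have lin: "linear_on (scal V) (scal U') (space V) (\<Phi> (iv g) (ev (bact N (iv g) m)))" if "m \<in> bcar N" for m
  using D.locfD(2)[OF \<Phi> ig ev_dual[OF bact_in[OF ig that]]] .
 have "(\<Sum>a\<in>A. \<Phi> (iv g) (ev (bact N (iv g) (c a))) (F g (c' a) u)) =
   (\<Sum>a\<in>A. \<Sum>b\<in>?B. scal U' (c' a b) (\<Phi> (iv g) (ev (bact N (iv g) (c a))) (F g (?c b) u)))"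
 proof (intro sum.cong refl)
  fix a assume a: "a \<in> A"
  have "F g (c' a) u = (\<Sum>b\<in>?B. scal V (c' a b) (F g (?c b) u))" by (rule locfD(3)[OF F g c'[OF a] u])
  then show "\<Phi> (iv g) (ev (bact N (iv g) (c a))) (F g (c' a) u) = (\<Sum>b\<in>?B. scal U' (c' a b) (\<Phi> (iv g) (ev (bact N (iv g) (c a))) (F g (?c b) u)))"
   by (simp add: linear_on_combination[OF lin[OF cc[OF a]] vV xin])
 qed
 also have "\<dots> = (\<Sum>b\<in>?B. \<Sum>a\<in>A. scal U' (c' a b) (\<Phi> (iv g) (ev (bact N (iv g) (c a))) (F g (?c b) u)))" by (rule sum.swap)
 also have "\<dots> = sg i j F \<Phi> g u" unfolding sg_def
 proof (intro sum.cong refl)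
  fix b assume b: "b \<in> ?B"
  have l2: "linear_on (bscale N) (scal U') (bcar N) (\<lambda>m. \<Phi> (iv g) (ev (bact N (iv g) m)) (F g (?c b) u))"
   by (rule linear_on_comp[OF bact_linear[OF ig] locf_ev_linear[OF r' \<Phi> ig xin]]) (use bact_in[OF ig] in auto)
  have "b = (\<Sum>a\<in>A. bscale N (c' a b) (c a))" using expand b Bas(2) by blast
  then have "\<Phi> (iv g) (ev (bact N (iv g) b)) (F g (?c b) u) = \<Phi> (iv g) (ev (bact N (iv g) (\<Sum>a\<in>A. bscale N (c' a b) (c a)))) (F g (?c b) u)" by simp
  also have "\<dots> = (\<Sum>a\<in>A. scal U' (c' a b) (\<Phi> (iv g) (ev (bact N (iv g) (c a))) (F g (?c b) u)))"
   by (rule linear_on_combination[OF l2 bcar_vsp cc])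
  finally show "(\<Sum>a\<in>A. scal U' (c' a b) (\<Phi> (iv g) (ev (bact N (iv g) (c a))) (F g (?c b) u))) = \<Phi> (iv g) (ev (bact N (iv g) b)) (F g (?c b) u)" by simp
 qed
 finally show ?thesis .
qed

lemma sg_in:
 assumes r: "rep2 i j U V" and r': "rep2 i j U' V" and F: "locf i j U V F" and \<Phi>: "D.locf j i V U' \<Phi>" and g: "g \<in> Gr" and u: "u \<in> space U"
 shows "sg i j F \<Phi> g u \<in> space U'" unfolding sg_def using g
 by (intro vsp_sum[OF rep_vsp[OF rep2D(3)[OF r']]] D.locfD(1)[OF \<Phi>] locfD(1)[OF F] ev_dual bact_in Bas_bcar cof_dual u) auto

text \<open>Twisting both families by the same pair conjugates by k: the action of h cancels between
  the two operators, and the shift of g by k and h is absorbed by the sum over all of G.\<close>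

lemma S0_tw:
 assumes r: "rep2 i j U V" and r': "rep2 i j U' V" and F: "locf i j U V F" and \<Phi>: "D.locf j i V U' \<Phi>"
  and k: "k \<in> stab C i" and h: "h \<in> stab C j" and u: "u \<in> space U"
 shows "S0 i j (tw U V k h F) (D.tw V U' h k \<Phi>) u = gact U' k (S0 i j F \<Phi> (gact U (iv k) u))"
proof -
 note d = rep2D[OF r] and d' = rep2D[OF r']
 have G: "k \<in> Gr" "h \<in> Gr" using k h stab_Gr by blast+
 define u' where "u' = gact U (iv k) u"
 have u': "u' \<in> space U" unfolding u'_def by (rule rep_in[OF d(3) stab_inv[OF d(1) k] u])
 note gl = rep_linear[OF d'(3) k] and vU' = rep_vsp[OF d'(3)]
 have sgt: "sg i j (tw U V k h F) (D.tw V U' h k \<Phi>) g u = gact U' k (sg i j F \<Phi> (iv k \<cdot> g \<cdot> h) u')" if g: "g \<in> Gr" for g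
 proof -
  let ?g = "iv k \<cdot> g \<cdot> h"
  have gG: "?g \<in> Gr" using G g by simp
  have gj: "pact C ?g j = pact C (iv k) (pact C g j)" using G g d(2) stab_fix[OF h] by (simp add: pact_mult pact_pts)
  have ki: "pact C (iv k) i = i" by (rule stab_fix[OF stab_inv[OF d(1) k]])
  let ?B = "Bas i (pact C g j)" and ?c = "cof i (pact C g j)"
  have in1: "bact N (iv k) b \<in> bcomp N i (pact C ?g j)" if "b \<in> ?B" for b
   using bact_bcomp[OF inv_closed[OF G(1)] d(1) pact_pts[OF g d(2)] subsetD[OF Bas(2) that]] ki gj by simp
  have ex: "m = (\<Sum>b\<in>?B. bscale N (bact du (iv k) (?c b) m) (bact N (iv k) b))" if m: "m \<in> bcomp N i (pact C ?g j)" for m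
  proof -
   have mb: "m \<in> bcar N" using m bcomp_bcar by blast
   have "bact N k m \<in> bcomp N (pact C k i) (pact C k (pact C ?g j))"
    by (rule bact_bcomp[OF G(1) d(1) pact_pts[OF gG d(2)] m])
   then have km: "bact N k m \<in> bcomp N i (pact C g j)"
    using stab_fix[OF k] G g d(2) unfolding gj by (simp add: pact_mult[symmetric] pact_pts pact_one mult_iv_cancel)
   have "m = bact N (iv k) (bact N k m)" using bact_inv(2)[OF G(1) mb] by simp
   also have "bact N k m = (\<Sum>b\<in>?B. bscale N (?c b (bact N k m)) b)" by (rule cof_expand[OF km])
   also have "bact N (iv k) \<dots> = (\<Sum>b\<in>?B. bscale N (?c b (bact N k m)) (bact N (iv k) b))"
    by (rule linear_on_combination[OF bact_linear[OF inv_closed[OF G(1)]] bcar_vsp Bas_bcar])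
   finally show ?thesis using mb G by (simp add: dual_bact_apply)
  qed
  have xin: "F ?g (bact du (iv k) (?c b)) u' \<in> space V" for b
   by (rule locfD(1)[OF F gG dual_bact_in[OF inv_closed[OF G(1)] cof_dual] u'])
  have tin: "\<Phi> (iv ?g) (ev (bact N (iv ?g) (bact N (iv k) b))) (F ?g (bact du (iv k) (?c b)) u') \<in> space U'" if b: "b \<in> ?B" for b
   using gG G Bas_bcar[OF b] by (intro D.locfD(1)[OF \<Phi>] ev_dual bact_in xin) auto
  have "sg i j (tw U V k h F) (D.tw V U' h k \<Phi>) g u =
    (\<Sum>b\<in>?B. gact U' k (\<Phi> (iv ?g) (ev (bact N (iv ?g) (bact N (iv k) b))) (F ?g (bact du (iv k) (?c b)) u')))"
   unfolding sg_def
  proof (intro sum.cong refl)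
   fix b assume b: "b \<in> ?B"
   have bb: "b \<in> bcar N" by (rule Bas_bcar[OF b])
   have 1: "iv h \<cdot> iv g \<cdot> k = iv ?g" using G g by (simp add: inv_mult_group m_assoc)
   have "bact N (iv h) (bact N (iv g) b) = bact N (iv h \<cdot> iv g) b" using bact_mult[of "iv h" "iv g" b] bb G g by simp
   also have "iv h \<cdot> iv g = iv ?g \<cdot> iv k" using G g by (simp add: inv_mult_group m_assoc)
   also have "bact N (iv ?g \<cdot> iv k) b = bact N (iv ?g) (bact N (iv k) b)" using bact_mult[of "iv ?g" "iv k" b] bb G gG by simp
   finally have 2: "bact (dual C du) (iv h) (ev (bact N (iv g) b)) = ev (bact N (iv ?g) (bact N (iv k) b))"
    using bact_ev[of "iv h" "bact N (iv g) b"] bact_in[of "iv g" b] bb G g by simp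
   show "D.tw V U' h k \<Phi> (iv g) (ev (bact N (iv g) b)) (tw U V k h F g (?c b) u) =
     gact U' k (\<Phi> (iv ?g) (ev (bact N (iv ?g) (bact N (iv k) b))) (F ?g (bact du (iv k) (?c b)) u'))"
    unfolding D.tw_def tw_def u'_def[symmetric] 1 2 rep_inv(1)[OF d(4,2) h xin] ..
  qed
  also have "\<dots> = gact U' k (\<Sum>b\<in>?B. \<Phi> (iv ?g) (ev (bact N (iv ?g) (bact N (iv k) b))) (F ?g (bact du (iv k) (?c b)) u'))"
   by (rule linear_on_sum[OF gl vU' tin, symmetric])
  also have "(\<Sum>b\<in>?B. \<Phi> (iv ?g) (ev (bact N (iv ?g) (bact N (iv k) b))) (F ?g (bact du (iv k) (?c b)) u')) = sg i j F \<Phi> ?g u'"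
   by (rule sg_basis[OF r r' F \<Phi> gG u' in1 dual_bact_in[OF inv_closed[OF G(1)] cof_dual] ex])
  finally show ?thesis .
 qed
 have "S0 i j (tw U V k h F) (D.tw V U' h k \<Phi>) u = (\<Sum>g\<in>Gr. gact U' k (sg i j F \<Phi> (iv k \<cdot> g \<cdot> h) u'))"
  unfolding S0_def by (intro sum.cong refl sgt)
 also have "\<dots> = gact U' k (\<Sum>g\<in>Gr. sg i j F \<Phi> (iv k \<cdot> g \<cdot> h) u')"
  using G by (intro linear_on_sum[OF gl vU', symmetric] sg_in[OF r r' F \<Phi> _ u']) auto
 \<comment> \<open>The substitution g |-> inverse(k) g h permutes G; it would not permute a set of
   coset representatives.\<close>
 also have "(\<Sum>g\<in>Gr. sg i j F \<Phi> (iv k \<cdot> g \<cdot> h) u') = S0 i j F \<Phi> u'" unfolding S0_def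
  by (rule sum.reindex_bij_witness[of _ "\<lambda>g. k \<cdot> g \<cdot> iv h" "\<lambda>g. iv k \<cdot> g \<cdot> h"])
    (use G in \<open>auto simp: m_assoc mult_iv_cancel\<close>)
 finally show ?thesis by (simp add: u'_def)
qed

lemma S0_cong:
 assumes "\<And>g \<psi> u. g \<in> Gr ==> \<psi> \<in> bcar du ==> u \<in> space U ==> F g \<psi> u = F' g \<psi> u \<and> F g \<psi> u \<in> space V"
  "\<And>g \<Psi> v. g \<in> Gr ==> \<Psi> \<in> bcar (dual C du) ==> v \<in> space V ==> \<Phi> g \<Psi> v = \<Phi>' g \<Psi> v" "u \<in> space U"
 shows "S0 i j F \<Phi> u = S0 i j F' \<Phi>' u" unfolding S0_def sg_def
proof (intro sum.cong refl)
 fix g b assume g: "g \<in> Gr" and b: "b \<in> Bas i (pact C g j)"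
 have "ev (bact N (iv g) b) \<in> bcar (dual C du)" using g Bas_bcar[OF b] by (intro ev_dual bact_in) auto
 then show "\<Phi> (iv g) (ev (bact N (iv g) b)) (F g (cof i (pact C g j) b) u) = \<Phi>' (iv g) (ev (bact N (iv g) b)) (F' g (cof i (pact C g j) b) u)"
  using assms(1)[OF g cof_dual assms(3), of i "pact C g j" b] assms(2) g by (metis inv_closed)
qed

lemma T_pair: 
 assumes "i \<in> pts C" "j \<in> pts C"
 shows "T [i, j] V U f \<phi> u = (\<Sum>y\<in>cos_reps C j. sg i j (\<lambda>g \<psi>. opr [i, j] V f [(g, \<psi>)]) (\<lambda>g \<Psi>. D.opr [j, i] U \<phi> [(g, \<Psi>)]) y u)"
proof -
 have "yseqs C [j] = {[]}" by auto
 then show ?thesis unfolding T_def sum_yseqs_Cons sum_bw_Cons sg_def by (simp add: dwd_def)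
qed

text \<open>For intertwiners the term at y h does not depend on h in G_j, and every element of G is
  such a product in exactly one way.\<close>

lemma S0_T:
 assumes r: "rep2 i j U V" and r': "rep2 i j U' V" and f: "f \<in> Hom C N [i, j] U V" and \<phi>: "\<phi> \<in> Hom C du [j, i] V U'" and u: "u \<in> space U"
 shows "S0 i j (\<lambda>g \<psi>. opr [i, j] V f [(g, \<psi>)]) (\<lambda>g \<Psi>. D.opr [j, i] U' \<phi> [(g, \<Psi>)]) u =
  scal U' (of_nat (card (stab C j))) (T [i, j] V U' f \<phi> u)"
proof -
 note d = rep2D[OF r] and d' = rep2D[OF r']
 note Dr' = rep2_sym[OF r']
 let ?F = "\<lambda>g \<psi>. opr [i, j] V f [(g, \<psi>)]" and ?\<Phi> = "\<lambda>g \<Psi>. D.opr [j, i] U' \<phi> [(g, \<Psi>)]"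
 note F = Hom_locf[OF r f] and \<Phi> = D.Hom_locf[OF Dr' \<phi>]
 note vs = vsp_simps[OF rep_vsp[OF d'(3)]]
 have e: "e \<in> stab C i" "e \<in> stab C j" using d stab_one by auto
 have sgh: "sg i j ?F ?\<Phi> (y \<cdot> h) u = sg i j ?F ?\<Phi> y u" if y: "y \<in> Gr" and h: "h \<in> stab C j" for y h
 proof -
  have hG: "h \<in> Gr" by (rule stab_Gr[OF h])
  have p: "pact C (y \<cdot> h) j = pact C y j" using y hG d(2) stab_fix[OF h] by (simp add: pact_mult)
  show ?thesis unfolding sg_def p
  proof (intro sum.cong refl)
   fix b assume b: "b \<in> Bas i (pact C y j)"
   have bb: "b \<in> bcar N" by (rule Bas_bcar[OF b])
   let ?c = "cof i (pact C y j) b"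
   have yh: "y \<cdot> h \<in> Gr" using y hG by simp
   have in1: "?F (y \<cdot> h) ?c u \<in> space V" by (rule locfD(1)[OF F yh cof_dual u])
   have "gact V h (?F (y \<cdot> h) ?c u) = ?F y ?c u"
    using Hom_tw[OF r f e(1) h y cof_dual u] y hG rep_one[OF d(3) u] by (simp add: tw_def dual_bact_one[OF cof_dual])
   then have 1: "?F (y \<cdot> h) ?c u = gact V (iv h) (?F y ?c u)" using rep_inv(1)[OF d(4,2) h in1] by simp
   have evb: "ev (bact N (iv y) b) \<in> bcar (dual C du)" using y bb by (intro ev_dual bact_in) auto
   have yin: "?F y ?c u \<in> space V" by (rule locfD(1)[OF F y cof_dual u])
   have "bact (dual C du) (iv h) (ev (bact N (iv y) b)) = ev (bact N (iv (y \<cdot> h)) b)"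
    using bact_ev[of "iv h" "bact N (iv y) b"] bact_in[of "iv y" b] bact_mult[of "iv h" "iv y" b] y hG bb by (simp add: inv_mult_group)
   moreover have "iv h \<cdot> iv y \<cdot> e = iv (y \<cdot> h)" using y hG by (simp add: inv_mult_group)
   moreover have "?\<Phi> (iv (y \<cdot> h)) (ev (bact N (iv (y \<cdot> h)) b)) (gact V (iv h) (?F y ?c u)) \<in> space U'"
    using yh bb by (intro D.locfD(1)[OF \<Phi>] ev_dual bact_in rep_in[OF d(4) stab_inv[OF d(2) h]] yin) auto
   ultimately have "?\<Phi> (iv (y \<cdot> h)) (ev (bact N (iv (y \<cdot> h)) b)) (gact V (iv h) (?F y ?c u)) = ?\<Phi> (iv y) (ev (bact N (iv y) b)) (?F y ?c u)"
    using D.Hom_tw[OF Dr' \<phi> h e(1) inv_closed[OF y] evb yin] rep_one[OF d'(3)] by (simp add: D.tw_def)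
   then show "?\<Phi> (iv (y \<cdot> h)) (ev (bact N (iv (y \<cdot> h)) b)) (?F (y \<cdot> h) ?c u) = ?\<Phi> (iv y) (ev (bact N (iv y) b)) (?F y ?c u)"
    unfolding 1 .
  qed
 qed
 have "S0 i j ?F ?\<Phi> u = (\<Sum>(y, h)\<in>cos_reps C j \<times> stab C j. sg i j ?F ?\<Phi> (y \<cdot> h) u)" unfolding S0_def
 proof (rule sum.reindex_bij_witness[of _ "\<lambda>(y, h). y \<cdot> h" "\<lambda>g. (crep C j g, iv (crep C j g) \<cdot> g)"], goal_cases)
  case (1 g) then show ?case using crep[OF d(2), of g] by (simp add: mult_iv_cancel)
 next
  case (2 g) then show ?case using crep[OF d(2), of g] by simp
 next
  case (3 p)
  then show ?case using cos_reps_Gr[OF d(2)] stab_Gr crep_mult_stab[OF d(2)] crep_cos_reps[OF d(2)]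
   by (auto simp: mult_iv_cancel)
 next
  case (4 p)
  then show ?case using cos_reps_Gr[OF d(2)] stab_Gr by auto
 next
  case (5 g) then show ?case using crep[OF d(2), of g] by (simp add: mult_iv_cancel)
 qed
 also have "\<dots> = (\<Sum>y\<in>cos_reps C j. \<Sum>h\<in>stab C j. sg i j ?F ?\<Phi> y u)"
  unfolding sum.cartesian_product[symmetric] by (intro sum.cong refl sgh cos_reps_Gr[OF d(2)])
 also have "\<dots> = (\<Sum>y\<in>cos_reps C j. scal U' (of_nat (card (stab C j))) (sg i j ?F ?\<Phi> y u))"
 proof (intro sum.cong refl)
  fix y
  have "(\<Sum>h\<in>stab C j. scal U' 1 (sg i j ?F ?\<Phi> y u)) = scal U' (\<Sum>h\<in>stab C j. 1) (sg i j ?F ?\<Phi> y u)" by (rule vs(10)[symmetric])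
  then show "(\<Sum>h\<in>stab C j. sg i j ?F ?\<Phi> y u) = scal U' (of_nat (card (stab C j))) (sg i j ?F ?\<Phi> y u)" by (simp add: vs)
 qed
 finally show ?thesis unfolding T_pair[OF d(1,2)] vs(9) .
qed

lemma T_linear_f:
 assumes r: "reps_at is U V" and r': "reps_at is U' V" and \<phi>: "\<phi> \<in> Hom C du (rev is) V U'" and u: "u \<in> space U"
 shows "linear_on hscale (scal U') (Hom C N is U V) (\<lambda>f. T is V U' f \<phi> u)"
proof -
 note d = reps_atD[OF r] and vs = vsp_simps[OF rep_vsp[OF reps_atD(3)[OF r']]]
 have t: "linear_on hscale (scal U') (Hom C N is U V) (\<lambda>f. D.opr (rev is) U' \<phi> (dwd w) (opr is V f (star is w) u))"
  if ys: "ys \<in> yseqs C is" and w: "w \<in> bw is ys" for ys w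
 proof -
  note g = yseqs_gseq[OF d(1) ys] and b = bw_props[OF w yseqs_gseq[OF d(1) ys]]
  have v: "D.vw (rev is) (dwd w)" using dwd_vw[of "is" w] b g by simp
  show ?thesis by (rule linear_on_comp[OF opr_linear_morph[OF r b(3) u] D.opr_linear[OF reps_at_rev[OF r'] \<phi> v]])
     (use opr_in[OF r _ b(3) u] in auto)
 qed
 show ?thesis unfolding T_def linear_on_def vs(9) sum.distrib[symmetric]
  using linear_on_add[OF t] linear_on_scale[OF t] by (auto intro!: sum.cong)
qed

lemma T_linear_phi:
 assumes r: "reps_at is U V" and r': "reps_at is U' V" and f: "f \<in> Hom C N is U V" and u: "u \<in> space U"
 shows "linear_on hscale (scal U') (Hom C du (rev is) V U') (\<lambda>\<phi>. T is V U' f \<phi> u)"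
proof -
 note d = reps_atD[OF r] and vs = vsp_simps[OF rep_vsp[OF reps_atD(3)[OF r']]]
 have t: "linear_on hscale (scal U') (Hom C du (rev is) V U') (\<lambda>\<phi>. D.opr (rev is) U' \<phi> (dwd w) (opr is V f (star is w) u))"
  if ys: "ys \<in> yseqs C is" and w: "w \<in> bw is ys" for ys w
 proof -
  note g = yseqs_gseq[OF d(1) ys] and b = bw_props[OF w yseqs_gseq[OF d(1) ys]]
  have v: "D.vw (rev is) (dwd w)" using dwd_vw[of "is" w] b g by simp
  show ?thesis by (rule D.opr_linear_morph[OF reps_at_rev[OF r'] v opr_in[OF r f b(3) u]])
 qed
 show ?thesis unfolding T_def linear_on_def vs(9) sum.distrib[symmetric]
  using linear_on_add[OF t] linear_on_scale[OF t] by (auto intro!: sum.cong)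
qed

lemma T_in_linear:
 assumes r: "reps_at is U V" and r': "reps_at is U' V" and f: "f \<in> Hom C N is U V" and \<phi>: "\<phi> \<in> Hom C du (rev is) V U'"
 shows "u \<in> space U ==> T is V U' f \<phi> u \<in> space U'" and "linear_on (scal U) (scal U') (space U) (T is V U' f \<phi>)"
proof -
 note d = reps_atD[OF r] and vs = vsp_simps[OF rep_vsp[OF reps_atD(3)[OF r']]]
 note vU' = rep_vsp[OF reps_atD(3)[OF r']]
 have t: "linear_on (scal U) (scal U') (space U) (\<lambda>u. D.opr (rev is) U' \<phi> (dwd w) (opr is V f (star is w) u))"
  "u \<in> space U ==> D.opr (rev is) U' \<phi> (dwd w) (opr is V f (star is w) u) \<in> space U'"
  if ys: "ys \<in> yseqs C is" and w: "w \<in> bw is ys" for ys w u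
 proof -
  note g = yseqs_gseq[OF d(1) ys] and b = bw_props[OF w yseqs_gseq[OF d(1) ys]]
  have v: "D.vw (rev is) (dwd w)" using dwd_vw[of "is" w] b g by simp
  show "linear_on (scal U) (scal U') (space U) (\<lambda>u. D.opr (rev is) U' \<phi> (dwd w) (opr is V f (star is w) u))"
   by (rule linear_on_comp[OF opr_linear[OF r f b(3)] D.opr_linear[OF reps_at_rev[OF r'] \<phi> v]])
     (use opr_in[OF r f b(3)] in auto)
  show "u \<in> space U ==> D.opr (rev is) U' \<phi> (dwd w) (opr is V f (star is w) u) \<in> space U'"
   by (intro D.opr_in[OF reps_at_rev[OF r'] \<phi> v] opr_in[OF r f b(3)])
 qed
 show "u \<in> space U ==> T is V U' f \<phi> u \<in> space U'" unfolding T_def by (intro vsp_sum[OF vU'] t(2))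
 show "linear_on (scal U) (scal U') (space U) (T is V U' f \<phi>)"
  unfolding T_def linear_on_def vs(9) sum.distrib[symmetric]
  using linear_on_add[OF t(1)] linear_on_scale[OF t(1)] by (auto intro!: sum.cong)
qed

end

section \<open>Equivariance and non-degeneracy of the pairing on arrows\<close>

text \<open>The condition on the order of G in the form in which it is applied: orders of
  stabilisers are invertible.\<close>

locale gbimod_coprime = gbimod_dual C N
 for C :: "('g, 'i) gset" and N :: "('g, 'i, 'k::alg_closed_field, 'm::ab_group_add) bimod" +
 assumes card_stab: "i \<in> pts C ==> of_nat (card (stab C i)) \<noteq> (0 :: 'k)"
begin

lemma rep2_reps_at': "rep2 i j U V ==> reps_at [i, j] U V" by (simp add: rep2_reps_at)

text \<open>The families of f and \<open>\<phi>\<close> are fixed by the twist with (k, e), so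
  \<open>S0_tw\<close> gives equivariance of the sum over G. Division by |G_j| transfers it to
  \<open>T\<close>.\<close>

lemma T_eqvar:
 assumes r: "rep2 i j U V" and r': "rep2 i j U' V" and f: "f \<in> Hom C N [i, j] U V" and \<phi>: "\<phi> \<in> Hom C du [j, i] V U'"
 shows "eqvar (stab C i) U U' (T [i, j] V U' f \<phi>)"
proof -
 note d = rep2D[OF r] and d' = rep2D[OF r']
 note Dr' = rep2_sym[OF r']
 note vU' = rep_vsp[OF d'(3)]
 note vs = vsp_simps[OF vU']
 have \<phi>r: "\<phi> \<in> Hom C du (rev [i, j]) V U'" using \<phi> by simp
 note Tp = T_in_linear[OF rep2_reps_at'[OF r] rep2_reps_at'[OF r'] f \<phi>r]
 let ?F = "\<lambda>g \<psi>. opr [i, j] V f [(g, \<psi>)]" and ?\<Phi> = "\<lambda>g \<Psi>. D.opr [j, i] U' \<phi> [(g, \<Psi>)]"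
 note F = Hom_locf[OF r f] and \<Phi> = D.Hom_locf[OF Dr' \<phi>]
 let ?c = "of_nat (card (stab C j)) :: 'k"
 have "T [i, j] V U' f \<phi> (gact U k u) = gact U' k (T [i, j] V U' f \<phi> u)" if k: "k \<in> stab C i" and u: "u \<in> space U" for k u
 proof -
  have e: "e \<in> stab C j" using d stab_one by auto
  have ku: "gact U k u \<in> space U" by (rule rep_in[OF d(3) k u])
  have "S0 i j ?F ?\<Phi> (gact U k u) = S0 i j (tw U V k e ?F) (D.tw V U' e k ?\<Phi>) (gact U k u)"
   by (rule S0_cong[where U = U and V = V])
     (use Hom_tw[OF r f k e] D.Hom_tw[OF Dr' \<phi> e k] locfD(1)[OF F] ku in auto)
  also have "\<dots> = gact U' k (S0 i j ?F ?\<Phi> (gact U (iv k) (gact U k u)))" by (rule S0_tw[OF r r' F \<Phi> k e ku])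
  also have "gact U (iv k) (gact U k u) = u" by (rule rep_inv(1)[OF d(3,1) k u])
  finally have "scal U' ?c (T [i, j] V U' f \<phi> (gact U k u)) = gact U' k (scal U' ?c (T [i, j] V U' f \<phi> u))"
   using S0_T[OF r r' f \<phi> u] S0_T[OF r r' f \<phi> ku] by simp
  also have "\<dots> = scal U' ?c (gact U' k (T [i, j] V U' f \<phi> u))"
   by (rule linear_on_scale[OF rep_linear[OF d'(3) k] Tp(1)[OF u]])
  finally have "scal U' (1 / ?c * ?c) (T [i, j] V U' f \<phi> (gact U k u)) = scal U' (1 / ?c * ?c) (gact U' k (T [i, j] V U' f \<phi> u))"
   unfolding vs(3)[symmetric] by simp
  then show ?thesis using card_stab[OF d(2)] by (simp add: vs)
 qed
 then show ?thesis using Tp by (auto simp: eqvar_def)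
qed

lemma T_zero:
 assumes r: "rep2 i j U V" and r': "rep2 i j U' V" and f: "f \<in> Hom C N [i, j] U V" and \<phi>: "\<phi> \<in> Hom C du [j, i] V U'"
  and irr: "irr_reps (grp C) (stab C i) R" "U \<in> R" "U' \<in> R" "U \<noteq> U'" and u: "u \<in> space U"
 shows "T [i, j] V U' f \<phi> u = 0"
proof (rule ccontr)
 assume "T [i, j] V U' f \<phi> u \<noteq> 0"
 moreover have "irreducible_rep (grp C) (stab C i) U" "irreducible_rep (grp C) (stab C i) U'" using irr by (auto simp: irr_reps_def)
 ultimately have "bij_betw (T [i, j] V U' f \<phi>) (space U) (space U')" using schur_bij[OF _ _ T_eqvar[OF r r' f \<phi>] u] by blast
 then show False using irr bij_eqvar_rep_isomorphic[OF T_eqvar[OF r r' f \<phi>]] by (auto simp: irr_reps_def)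
qed

text \<open>By Schur's lemma \<open>T\<close> is a scalar operator. This is what makes the definite
  description in \<open>pairing\<close> meaningful.\<close>

lemma T_pairing:
 assumes r: "rep2 i j U V" and f: "f \<in> Hom C N [i, j] U V" and \<phi>: "\<phi> \<in> Hom C du [j, i] V U"
  and irr: "irreducible_rep (grp C) (stab C i) U" and u: "u \<in> space U"
 shows "T [i, j] V U f \<phi> u = scal U (pairing C N [i, j] U V f \<phi>) u"
proof -
 obtain c where c: "\<forall>u\<in>space U. T [i, j] V U f \<phi> u = scal U c u"
  using schur_scalar[OF irr T_eqvar[OF r r f \<phi>]] by blast
 have "pairing C N [i, j] U V f \<phi> = c"
  using c \<phi> irr by (intro pairing_eqI[OF rep2_reps_at'[OF r] f]) (auto simp: irreducible_rep_def)
 then show ?thesis using c u by simp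
qed

text \<open>The conjugates of the operator u |-> l(u) x all have trace l(x), so their sum over G_i
  has trace |G_i| l(x); a vanishing sum forces l(x) = 0.\<close>

lemma rank_one_sum:
 fixes U :: "('g, 'k, 'v::ab_group_add) rep"
 assumes i: "i \<in> pts C" and U: "rep_at i U" and l: "linear_on (scal U) (*) (space U) l" and x: "x \<in> space U"
  and zero: "\<And>u. u \<in> space U ==> (\<Sum>k\<in>stab C i. gact U k (scal U (l (gact U (iv k) u)) x)) = 0"
 shows "l x = 0"
proof -
 have "(\<Sum>k\<in>stab C i. l (gact U (iv k) (gact U k x))) = 0"
 proof (rule trace_zero[OF rep_vsp[OF U] rep_fin[OF U], of "stab C i" "\<lambda>k. gact U k x" "\<lambda>k u. l (gact U (iv k) u)"])
  show "gact U k x \<in> space U" if "k \<in> stab C i" for k by (rule rep_in[OF U that x])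
  show "linear_on (scal U) (*) (space U) (\<lambda>u. l (gact U (iv k) u))" if k: "k \<in> stab C i" for k
   by (rule linear_on_comp[OF rep_linear[OF U stab_inv[OF i k]] l]) (use rep_in[OF U stab_inv[OF i k]] in auto)
  show "(\<Sum>k\<in>stab C i. scal U (l (gact U (iv k) u)) (gact U k x)) = 0" if u: "u \<in> space U" for u
   using zero[OF u] linear_on_scale[OF rep_linear[OF U] x] by (simp cong: sum.cong)
 qed
 then show ?thesis using rep_inv(1)[OF U i _ x] card_stab[OF i] by simp
qed

text \<open>A nonzero value of f at one letter \<open>g0\<close> and one basis functional is
  detected by some linear form \<open>\<mu>\<close> on V. Put l(u) for \<open>\<mu>\<close> of that
  value. For every x in U an averaged test family turns the vanishing of all pairings into the
  vanishing of the averaged rank one operator with form l and vector x. Then l vanishes on U,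
  although l(u0) = 1.\<close>

lemma nondegenerate_left:
 assumes r: "rep2 i j U V" and f: "f \<in> Hom C N [i, j] U V"
  and zero: "\<And>\<phi> u. \<phi> \<in> Hom C du [j, i] V U ==> u \<in> space U ==> T [i, j] V U f \<phi> u = 0"
 shows "f = 0"
proof (rule ccontr)
 assume "f \<noteq> 0"
 note d = rep2D[OF r] and r1 = rep2_reps_at'[OF r]
 note vV = rep_vsp[OF d(4)] and vU = rep_vsp[OF d(3)]
 note vsU = vsp_simps[OF vU]
 let ?F = "\<lambda>g \<psi>. opr [i, j] V f [(g, \<psi>)]"
 note F = Hom_locf[OF r f] and Dr = rep2_sym[OF r]
 have "\<exists>w u. vw [i, j] w \<and> u \<in> space U \<and> opr [i, j] V f w u \<noteq> opr [i, j] V 0 w u"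
  using opr_eqI[OF r1 f vsp_0[OF Hom_vsp[OF r1]]] \<open>f \<noteq> 0\<close> by blast
 then obtain w u0 where w: "vw [i, j] w" "u0 \<in> space U" "opr [i, j] V f w u0 \<noteq> opr [i, j] V 0 w u0" by blast
 have z: "opr [i, j] V 0 w u0 = 0" by (rule linear_on_0[OF opr_linear_morph[OF r1 w(1,2)] vsp_0[OF Hom_vsp[OF r1]]])
 obtain g0 \<psi> where g: "w = [(g0, \<psi>)]" "g0 \<in> Gr" "\<psi> \<in> bcar du" using w(1) d by (cases w) (auto simp: vw_Cons)
 let ?B = "Bas i (pact C g0 j)" and ?c = "cof i (pact C g0 j)"
 have "(\<Sum>b\<in>?B. scal V (\<psi> b) (?F g0 (?c b) u0)) \<noteq> 0" using w(3) z locfD(3)[OF F g(2,3) w(2)] g(1) by simp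
 then obtain b where b: "b \<in> ?B" and b2: "scal V (\<psi> b) (?F g0 (?c b) u0) \<noteq> 0" by (rule sum.not_neutral_contains_not_neutral)
 have v0: "?F g0 (?c b) u0 \<noteq> 0" using b2 vsp_simps(6)[OF vV] by metis
 obtain \<mu> where \<mu>: "\<And>A. linear_on (scal V) (*) A \<mu>" "\<mu> (?F g0 (?c b) u0) = 1"
  using functional_exists[OF vsp_vs[OF vV] v0] by blast
 have ig: "iv g0 \<in> Gr" using g(2) by simp
 have pj: "pact C g0 j \<in> pts C" by (rule pact_pts[OF g(2) d(2)])
 \<comment> \<open>The functional \<open>cof\<close> is not supported on its component, but the test
   functional must lie in a component of the dual; projecting does not change its values on the
   basis.\<close>
 define \<beta>0 where "\<beta>0 = prj du (pact C g0 j) i (?c b)"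
 define \<beta> where "\<beta> = bact du (iv g0) \<beta>0"
 have \<beta>0: "\<beta>0 \<in> bcomp du (pact C g0 j) i" unfolding \<beta>0_def D.bcomp_prj using cof_dual by blast
 have \<beta>: "\<beta> \<in> bcomp du j (pact C (iv g0) i)"
  using D.bact_bcomp[OF ig pj d(1) \<beta>0] g(2) d(2) unfolding \<beta>_def by (simp add: pact_mult[symmetric] pact_one)
 have \<beta>c: "\<beta> \<in> bcar du" using \<beta> D.bcomp_bcar by blast
 have \<beta>b: "\<beta> (bact N (iv g0) b') = (if b' = b then 1 else 0)" if b': "b' \<in> ?B" for b'
 proof -
  have bb: "b' \<in> bcar N" by (rule Bas_bcar[OF b'])
  have "\<beta> (bact N (iv g0) b') = \<beta>0 b'" unfolding \<beta>_def using dual_bact_apply[OF bact_in[OF ig bb]] g(2) bact_inv(1)[OF g(2) bb] by simp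
  also have "\<dots> = ?c b (prj N i (pact C g0 j) b')" unfolding \<beta>0_def using dual_prj[OF cof_dual] bb by simp
  also have "prj N i (pact C g0 j) b' = b'" using subsetD[OF Bas(2) b'] by (simp add: bcomp_iff)
  finally show ?thesis using cof_basis[OF b b'] by simp
 qed
 define l where "l u = \<mu> (?F g0 (?c b) u)" for u
 have l: "linear_on (scal U) (*) (space U) l" unfolding l_def
  by (rule linear_on_comp[OF locfD(2)[OF F g(2) cof_dual] \<mu>(1)[of UNIV]]) auto
 have "l x = 0" if x: "x \<in> space U" for x
 proof (rule rank_one_sum[OF d(1,3) l x])
  \<comment> \<open>A family concentrated at the single group element inverse(g0), of rank one
    there: v goes to a multiple of x. Its average is an intertwiner.\<close>
  define \<Phi>0 where "\<Phi>0 g \<Psi> v = (if g = iv g0 then scal U (\<Psi> \<beta> * \<mu> v) x else 0)" for g :: 'g and \<Psi> :: "('m => 'k) => 'k" and v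
  have \<Phi>0: "D.locf j i V U \<Phi>0" unfolding D.locf_def
  proof (intro ballI conjI)
   fix g \<Psi> assume g': "g \<in> Gr" and \<Psi>: "\<Psi> \<in> bcar (dual C du)"
   show "\<Phi>0 g \<Psi> v \<in> space U" for v unfolding \<Phi>0_def using vsp_scale[OF vU x] vsp_0[OF vU] by auto
   show "linear_on (scal V) (scal U) (space V) (\<Phi>0 g \<Psi>)"
    using linear_on_add[OF \<mu>(1)[of UNIV]] linear_on_scale[OF \<mu>(1)[of UNIV]]
    by (intro linear_onI) (auto simp: \<Phi>0_def vsU distrib_left mult_ac)
   fix v
   show "\<Phi>0 g \<Psi> v = (\<Sum>b\<in>D.Bas j (pact C g i). scal U (\<Psi> b) (\<Phi>0 g (D.cof j (pact C g i) b) v))"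
   proof (cases "g = iv g0")
    case True
    have "\<Psi> \<beta> = (\<Sum>b\<in>D.Bas j (pact C g i). \<Psi> b * D.cof j (pact C g i) b \<beta>)"
     using D.dual_expand[OF \<Psi>, of \<beta> j "pact C g i"] \<beta> True by simp
    then show ?thesis using True by (simp add: \<Phi>0_def vsU sum_distrib_right mult.assoc)
   qed (simp add: \<Phi>0_def vsU)
  qed
  obtain \<phi> where \<phi>: "\<phi> \<in> Hom C du [j, i] V U"
   "\<And>g \<Psi> v. g \<in> Gr ==> \<Psi> \<in> bcar (dual C du) ==> v \<in> space V ==>
    D.opr [j, i] U \<phi> [(g, \<Psi>)] v = (\<Sum>h\<in>stab C j. \<Sum>k\<in>stab C i. D.tw V U h k \<Phi>0 g \<Psi> v)"
   by (rule D.avg_Hom[OF Dr \<Phi>0]) blast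
  fix u assume u: "u \<in> space U"
  let ?R = "\<lambda>k. gact U k (scal U (l (gact U (iv k) u)) x)"
  \<comment> \<open>In the double sum only g = g0 and the chosen basis vector b survive.\<close>
  have S00: "S0 i j ?F \<Phi>0 u' = scal U (l u') x" if "u' \<in> space U" for u'
  proof -
   have "S0 i j ?F \<Phi>0 u' = (\<Sum>g\<in>Gr. if g = g0 then sg i j ?F \<Phi>0 g0 u' else 0)" unfolding S0_def
   proof (intro sum.cong refl)
    fix g assume "g \<in> Gr"
    then have "iv g = iv g0 \<longleftrightarrow> g = g0" using g(2) by (metis inv_inv)
    then show "sg i j ?F \<Phi>0 g u' = (if g = g0 then sg i j ?F \<Phi>0 g0 u' else 0)" by (auto simp: sg_def \<Phi>0_def)
   qed
   also have "\<dots> = sg i j ?F \<Phi>0 g0 u'" using g(2) finite_Gr by simp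
   also have "\<dots> = (\<Sum>b'\<in>?B. if b' = b then scal U (l u') x else 0)"
    unfolding sg_def using \<beta>b \<beta>c by (intro sum.cong refl) (simp add: \<Phi>0_def ev_def l_def vsU)
   finally show ?thesis using b Bas(1) by simp
  qed
  have Tz: "T [i, j] V U f \<phi> u = 0" by (rule zero[OF \<phi>(1) u])
  have "0 = S0 i j ?F (\<lambda>g \<Psi>. D.opr [j, i] U \<phi> [(g, \<Psi>)]) u" using S0_T[OF r r f \<phi>(1) u] Tz by (simp add: vsU)
  also have "\<dots> = S0 i j ?F (\<lambda>g \<Psi> v. \<Sum>h\<in>stab C j. \<Sum>k\<in>stab C i. D.tw V U h k \<Phi>0 g \<Psi> v) u"
   by (rule S0_cong[where U = U and V = V]) (use \<phi>(2) locfD(1)[OF F] u in auto)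
  also have "\<dots> = (\<Sum>h\<in>stab C j. \<Sum>k\<in>stab C i. S0 i j ?F (D.tw V U h k \<Phi>0) u)"
   unfolding S0_def sg_def by (subst sum.swap, subst (2) sum.swap, subst (4) sum.swap, subst (3) sum.swap) (rule refl)
  also have "\<dots> = (\<Sum>h\<in>stab C j. \<Sum>k\<in>stab C i. ?R k)"
  proof (intro sum.cong refl)
   fix h k assume h: "h \<in> stab C j" and k: "k \<in> stab C i"
   have "S0 i j ?F (D.tw V U h k \<Phi>0) u = S0 i j (tw U V k h ?F) (D.tw V U h k \<Phi>0) u"
    by (rule S0_cong[where U = U and V = V]) (use Hom_tw[OF r f k h] locfD(1)[OF F] u in auto)
   also have "\<dots> = gact U k (S0 i j ?F \<Phi>0 (gact U (iv k) u))" by (rule S0_tw[OF r r F \<Phi>0 k h u])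
   also have "\<dots> = ?R k" using S00[OF rep_in[OF d(3) stab_inv[OF d(1) k] u]] by simp
   finally show "S0 i j ?F (D.tw V U h k \<Phi>0) u = ?R k" .
  qed
  also have "\<dots> = scal U (of_nat (card (stab C j))) (\<Sum>k\<in>stab C i. ?R k)"
  proof -
   let ?X = "\<Sum>k\<in>stab C i. ?R k"
   have "(\<Sum>h\<in>stab C j. scal U 1 ?X) = scal U (\<Sum>h\<in>stab C j. 1) ?X" by (rule vsU(10)[symmetric])
   then show ?thesis by (simp add: vsU)
  qed
  finally have "scal U (of_nat (card (stab C j))) (\<Sum>k\<in>stab C i. ?R k) = 0" by (rule sym)
  then show "(\<Sum>k\<in>stab C i. ?R k) = 0" unfolding vsU(11) using card_stab[OF d(2)] by blast
 qed
 then have "l u0 = 0" using w(2) by blast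
 then show False using \<mu>(2) by (simp add: l_def)
qed

text \<open>The same argument with the roles exchanged: now \<open>\<phi>\<close> is given, and the
  averaged test family sends u to a multiple of a fixed \<open>v0\<close>. The resulting rank one
  operator on U has form l and vector x, where x is a nonzero value of \<open>\<phi>\<close> and
  l(x) = 1.\<close>

lemma nondegenerate_right:
 assumes r: "rep2 i j U V" and \<phi>: "\<phi> \<in> Hom C du [j, i] V U"
  and zero: "\<And>f u. f \<in> Hom C N [i, j] U V ==> u \<in> space U ==> T [i, j] V U f \<phi> u = 0"
 shows "\<phi> = 0"
proof (rule ccontr)
 assume "\<phi> \<noteq> 0"
 note d = rep2D[OF r] and Dr = rep2_sym[OF r]
 have Dr1: "D.reps_at [j, i] V U" using Dr by (simp add: D.rep2_reps_at)
 note vV = rep_vsp[OF d(4)] and vU = rep_vsp[OF d(3)]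
 note vsU = vsp_simps[OF vU] and vsV = vsp_simps[OF vV]
 let ?\<Phi> = "\<lambda>g \<Psi>. D.opr [j, i] U \<phi> [(g, \<Psi>)]"
 note \<Phi> = D.Hom_locf[OF Dr \<phi>]
 have "\<exists>w u. D.vw [j, i] w \<and> u \<in> space V \<and> D.opr [j, i] U \<phi> w u \<noteq> D.opr [j, i] U 0 w u"
  using D.opr_eqI[OF Dr1 \<phi> vsp_0[OF D.Hom_vsp[OF Dr1]]] \<open>\<phi> \<noteq> 0\<close> by blast
 then obtain w v0 where w: "D.vw [j, i] w" "v0 \<in> space V" "D.opr [j, i] U \<phi> w v0 \<noteq> D.opr [j, i] U 0 w v0" by blast
 have z: "D.opr [j, i] U 0 w v0 = 0" by (rule linear_on_0[OF D.opr_linear_morph[OF Dr1 w(1,2)] vsp_0[OF D.Hom_vsp[OF Dr1]]])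
 obtain g1 \<Psi> where g: "w = [(g1, \<Psi>)]" "g1 \<in> Gr" "\<Psi> \<in> bcar (dual C du)" using w(1) d by (cases w) (auto simp: D.vw_Cons)
 \<comment> \<open>The words of \<open>\<phi>\<close> carry elements of the bidual; the expansion in
   the component shows that only an evaluation at some m matters.\<close>
 obtain m where m: "m \<in> bcomp N (pact C g1 i) j" "\<forall>\<phi>\<in>bcomp du j (pact C g1 i). \<Psi> \<phi> = \<phi> m"
  using reflexive[OF g(3), of "pact C g1 i" j] by blast
 have mb: "m \<in> bcar N" using m(1) bcomp_bcar by blast
 have "?\<Phi> g1 \<Psi> v0 = ?\<Phi> g1 (ev m) v0"
 proof -
  have "\<Psi> b = ev m b" if "b \<in> D.Bas j (pact C g1 i)" for b
   using m(2) D.Bas(2) D.Bas_bcar[OF that] that by (auto simp: ev_def)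
  then show ?thesis using D.locfD(3)[OF \<Phi> g(2,3) w(2)] D.locfD(3)[OF \<Phi> g(2) ev_dual[OF mb] w(2)] by (simp cong: sum.cong)
 qed
 then have x0: "?\<Phi> g1 (ev m) v0 \<noteq> 0" using w(3) z g(1) by simp
 define x where "x = ?\<Phi> g1 (ev m) v0"
 have x: "x \<in> space U" unfolding x_def by (rule D.locfD(1)[OF \<Phi> g(2) ev_dual[OF mb] w(2)])
 have "x \<noteq> 0" using x0 by (simp add: x_def)
 then obtain l where l: "\<And>A. linear_on (scal U) (*) A l" "l x = 1" using functional_exists[OF vsp_vs[OF vU]] by blast
 define g0 where "g0 = iv g1"
 have g0: "g0 \<in> Gr" "iv g0 = g1" using g(2) by (auto simp: g0_def)
 define m0 where "m0 = bact N g0 m"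
 have m0: "m0 \<in> bcomp N i (pact C g0 j)"
  using bact_bcomp[OF g0(1) pact_pts[OF g(2) d(1)] d(2) m(1)] g(2) d(1) unfolding m0_def g0_def by (simp add: pact_mult[symmetric] pact_one)
 have m0m: "bact N g1 m0 = m" unfolding m0_def g0_def by (rule bact_inv(1)[OF g(2) mb])
 \<comment> \<open>Concentrated at \<open>g0\<close>, the inverse of \<open>g1\<close>, and testing
   functionals at \<open>m0\<close>, which \<open>g1\<close> carries to m.\<close>
 define F0 where "F0 g \<psi> u = (if g = g0 then scal V (\<psi> m0 * l u) v0 else 0)" for g :: 'g and \<psi> :: "'m => 'k" and u
 have F0: "locf i j U V F0" unfolding locf_def
 proof (intro ballI conjI)
  fix g \<psi> assume g': "g \<in> Gr" and \<psi>: "\<psi> \<in> bcar du"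
  show "F0 g \<psi> u \<in> space V" for u unfolding F0_def using vsp_scale[OF vV w(2)] vsp_0[OF vV] by auto
  show "linear_on (scal U) (scal V) (space U) (F0 g \<psi>)"
   using linear_on_add[OF l(1)[of UNIV]] linear_on_scale[OF l(1)[of UNIV]]
   by (intro linear_onI) (auto simp: F0_def vsV distrib_left mult_ac)
  fix u
  show "F0 g \<psi> u = (\<Sum>b\<in>Bas i (pact C g j). scal V (\<psi> b) (F0 g (cof i (pact C g j) b) u))"
  proof (cases "g = g0")
   case True
   then show ?thesis using dual_expand[OF \<psi> m0] by (simp add: F0_def vsV sum_distrib_right mult.assoc)
  qed (simp add: F0_def vsV)
 qed
 obtain f where f: "f \<in> Hom C N [i, j] U V"
  "\<And>g \<psi> u. g \<in> Gr ==> \<psi> \<in> bcar du ==> u \<in> space U ==>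
   opr [i, j] V f [(g, \<psi>)] u = (\<Sum>k\<in>stab C i. \<Sum>h\<in>stab C j. tw U V k h F0 g \<psi> u)" by (rule avg_Hom[OF r F0]) blast
 let ?F = "\<lambda>g \<psi>. opr [i, j] V f [(g, \<psi>)]"
 have S00: "S0 i j F0 ?\<Phi> u' = scal U (l u') x" if "u' \<in> space U" for u'
 proof -
  let ?B = "Bas i (pact C g0 j)" and ?c = "cof i (pact C g0 j)"
  have l1: "linear_on (scal V) (scal U) (space V) (?\<Phi> g1 (ev n))" if "n \<in> bcar N" for n
   by (rule D.locfD(2)[OF \<Phi> g(2) ev_dual[OF that]])
  have l2: "linear_on (bscale N) (scal U) (bcar N) (\<lambda>n. ?\<Phi> g1 (ev (bact N g1 n)) v0)"
   by (rule linear_on_comp[OF bact_linear[OF g(2)] locf_ev_linear[OF r \<Phi> g(2) w(2)]]) (use bact_in[OF g(2)] in auto)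
  have "S0 i j F0 ?\<Phi> u' = (\<Sum>g\<in>Gr. if g = g0 then sg i j F0 ?\<Phi> g0 u' else 0)" unfolding S0_def
  proof (intro sum.cong refl)
   fix g assume g': "g \<in> Gr"
   have "?\<Phi> (iv g) (ev (bact N (iv g) b)) 0 = 0" if "b \<in> Bas i (pact C g j)" for b
    using linear_on_0[OF D.locfD(2)[OF \<Phi> inv_closed[OF g'] ev_dual[OF bact_in[OF inv_closed[OF g'] Bas_bcar[OF that]]]] vsp_0[OF vV]] .
   then show "sg i j F0 ?\<Phi> g u' = (if g = g0 then sg i j F0 ?\<Phi> g0 u' else 0)" by (auto simp: sg_def F0_def)
  qed
  also have "\<dots> = sg i j F0 ?\<Phi> g0 u'" using g0(1) finite_Gr by simp
  also have "\<dots> = (\<Sum>b\<in>?B. scal U (l u') (scal U (?c b m0) (?\<Phi> g1 (ev (bact N g1 b)) v0)))" unfolding sg_def g0(2)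
  proof (intro sum.cong refl)
   fix b assume b: "b \<in> ?B"
   show "?\<Phi> g1 (ev (bact N g1 b)) (F0 g0 (?c b) u') = scal U (l u') (scal U (?c b m0) (?\<Phi> g1 (ev (bact N g1 b)) v0))"
    using linear_on_scale[OF l1[OF bact_in[OF g(2) Bas_bcar[OF b]]] w(2)] by (simp add: F0_def vsU mult.commute)
  qed
  also have "\<dots> = scal U (l u') (\<Sum>b\<in>?B. scal U (?c b m0) (?\<Phi> g1 (ev (bact N g1 b)) v0))" by (simp add: vsU(9))
  also have "(\<Sum>b\<in>?B. scal U (?c b m0) (?\<Phi> g1 (ev (bact N g1 b)) v0)) = ?\<Phi> g1 (ev (bact N g1 (\<Sum>b\<in>?B. bscale N (?c b m0) b))) v0"
   by (rule linear_on_combination[OF l2 bcar_vsp Bas_bcar, symmetric])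
  also have "(\<Sum>b\<in>?B. bscale N (?c b m0) b) = m0" using cof_expand[OF m0] by simp
  finally show ?thesis by (simp add: m0m x_def)
 qed
 have "l x = 0"
 proof (rule rank_one_sum[OF d(1,3) l(1) x])
  fix u assume u: "u \<in> space U"
  let ?R = "\<lambda>k. gact U k (scal U (l (gact U (iv k) u)) x)"
  have Tz: "T [i, j] V U f \<phi> u = 0" by (rule zero[OF f(1) u])
  have twF: "locf i j U V (tw U V k h F0)" if "k \<in> stab C i" "h \<in> stab C j" for k h by (rule locf_tw[OF r F0 that])
  have twin: "tw U V k h F0 g (cof i (pact C g j) b) u \<in> space V" if "k \<in> stab C i" "h \<in> stab C j" "g \<in> Gr" for k h g b
   by (rule locfD(1)[OF twF[OF that(1,2)] that(3) cof_dual u])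
  have "0 = S0 i j ?F ?\<Phi> u" using S0_T[OF r r f(1) \<phi> u] Tz by (simp add: vsU)
  also have "\<dots> = S0 i j (\<lambda>g \<psi> u. \<Sum>k\<in>stab C i. \<Sum>h\<in>stab C j. tw U V k h F0 g \<psi> u) ?\<Phi> u"
   by (rule S0_cong[where U = U and V = V]) (use f(2) locfD(1)[OF Hom_locf[OF r f(1)]] u in auto)
  also have "\<dots> = (\<Sum>g\<in>Gr. \<Sum>b\<in>Bas i (pact C g j). \<Sum>k\<in>stab C i. \<Sum>h\<in>stab C j.
    ?\<Phi> (iv g) (ev (bact N (iv g) b)) (tw U V k h F0 g (cof i (pact C g j) b) u))" unfolding S0_def sg_def
  proof (intro sum.cong refl)
   fix g b assume g': "g \<in> Gr" and b: "b \<in> Bas i (pact C g j)"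
   have l1: "linear_on (scal V) (scal U) (space V) (?\<Phi> (iv g) (ev (bact N (iv g) b)))"
    by (rule D.locfD(2)[OF \<Phi> inv_closed[OF g'] ev_dual[OF bact_in[OF inv_closed[OF g'] Bas_bcar[OF b]]]])
   have "?\<Phi> (iv g) (ev (bact N (iv g) b)) (\<Sum>k\<in>stab C i. \<Sum>h\<in>stab C j. tw U V k h F0 g (cof i (pact C g j) b) u) =
     (\<Sum>k\<in>stab C i. ?\<Phi> (iv g) (ev (bact N (iv g) b)) (\<Sum>h\<in>stab C j. tw U V k h F0 g (cof i (pact C g j) b) u))"
    by (intro linear_on_sum[OF l1 vV] vsp_sum[OF vV] twin g')
   also have "\<dots> = (\<Sum>k\<in>stab C i. \<Sum>h\<in>stab C j. ?\<Phi> (iv g) (ev (bact N (iv g) b)) (tw U V k h F0 g (cof i (pact C g j) b) u))"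
    by (intro sum.cong refl linear_on_sum[OF l1 vV] twin g')
   finally show "?\<Phi> (iv g) (ev (bact N (iv g) b)) (\<Sum>k\<in>stab C i. \<Sum>h\<in>stab C j. tw U V k h F0 g (cof i (pact C g j) b) u) =
     (\<Sum>k\<in>stab C i. \<Sum>h\<in>stab C j. ?\<Phi> (iv g) (ev (bact N (iv g) b)) (tw U V k h F0 g (cof i (pact C g j) b) u))" .
  qed
  also have "\<dots> = (\<Sum>k\<in>stab C i. \<Sum>h\<in>stab C j. S0 i j (tw U V k h F0) ?\<Phi> u)"
   unfolding S0_def sg_def by (subst sum.swap, subst (2) sum.swap, subst (4) sum.swap, subst (3) sum.swap) (rule refl)
  also have "\<dots> = (\<Sum>k\<in>stab C i. \<Sum>h\<in>stab C j. ?R k)"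
  proof (intro sum.cong refl)
   fix h k assume h: "h \<in> stab C j" and k: "k \<in> stab C i"
   have "S0 i j (tw U V k h F0) ?\<Phi> u = S0 i j (tw U V k h F0) (D.tw V U h k ?\<Phi>) u"
    by (rule S0_cong[where U = U and V = V]) (use D.Hom_tw[OF Dr \<phi> h k] locfD(1)[OF twF[OF k h]] u in auto)
   also have "\<dots> = gact U k (S0 i j F0 ?\<Phi> (gact U (iv k) u))" by (rule S0_tw[OF r r F0 \<Phi> k h u])
   also have "\<dots> = ?R k" using S00[OF rep_in[OF d(3) stab_inv[OF d(1) k] u]] by simp
   finally show "S0 i j (tw U V k h F0) ?\<Phi> u = ?R k" .
  qed
  also have "\<dots> = (\<Sum>h\<in>stab C j. \<Sum>k\<in>stab C i. ?R k)" by (rule sum.swap)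
  also have "\<dots> = scal U (of_nat (card (stab C j))) (\<Sum>k\<in>stab C i. ?R k)"
  proof -
   let ?X = "\<Sum>k\<in>stab C i. ?R k"
   have "(\<Sum>h\<in>stab C j. scal U 1 ?X) = scal U (\<Sum>h\<in>stab C j. 1) ?X" by (rule vsU(10)[symmetric])
   then show ?thesis by (simp add: vsU)
  qed
  finally have "scal U (of_nat (card (stab C j))) (\<Sum>k\<in>stab C i. ?R k) = 0" by (rule sym)
  then show "(\<Sum>k\<in>stab C i. ?R k) = 0" unfolding vsU(11) using card_stab[OF d(2)] by blast
 qed
 then show False using l(2) by simp
qed

text \<open>Linearity and non-degeneracy of the pairing are inherited from \<open>T\<close> through
  \<open>T_pairing\<close>; the rest is the general fact on dual bases.\<close>

lemma dual_basis_arrows: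
 assumes r: "rep2 i j U V" and irr: "irreducible_rep (grp C) (stab C i) U"
  and B: "is_basis hscale (Hom C N [i, j] U V) B" and b: "b \<in> B"
 shows "\<exists>!\<phi>. \<phi> \<in> Hom C du [j, i] V U \<and> (\<forall>b'\<in>B. pairing C N [i, j] U V b' \<phi> = (if b' = b then 1 else 0))"
proof -
 note d = rep2D[OF r] and r1 = rep2_reps_at'[OF r] and Dr = rep2_sym[OF r]
 have Dr1: "D.reps_at [j, i] V U" using Dr by (simp add: D.rep2_reps_at)
 note vU = rep_vsp[OF d(3)]
 note vs = vsp_simps[OF vU]
 \<comment> \<open>Scalars are compared through their action on one nonzero vector.\<close>
 obtain u0 where u0: "u0 \<in> space U" "u0 \<noteq> 0" using irr vsp_0[OF vU] by (auto simp: irreducible_rep_def)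
 have inj: "c = c'" if "scal U c u0 = scal U c' u0" for c c'
  using that u0(2) vector_space.scale_right_imp_eq[OF vsp_vs[OF vU]] by blast
 have finB: "finite B" by (rule basis_finite[OF vs_pw3(3) Hom_fin_dim[OF r1] B])
 note Tp = T_pairing[OF r _ _ irr]
 have rv: "rev [i, j] = [j, i]" by simp
 note Tf = T_linear_f[OF r1 r1, unfolded rv] and Tphi = T_linear_phi[OF r1 r1, unfolded rv]
 note vE = Hom_vsp[OF r1] and vF = D.Hom_vsp[OF Dr1]
 show ?thesis
 proof (rule dual_basis_exists1[OF vs_pw3(3) finB B vF, where \<beta> = "pairing C N [i, j] U V"])
  fix x assume x: "x \<in> Hom C du [j, i] V U"
  show "linear_on hscale (*) (Hom C N [i, j] U V) (\<lambda>f. pairing C N [i, j] U V f x)"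
  proof (rule linear_onI)
   fix f f' assume f: "f \<in> Hom C N [i, j] U V" "f' \<in> Hom C N [i, j] U V"
   show "pairing C N [i, j] U V (f + f') x = pairing C N [i, j] U V f x + pairing C N [i, j] U V f' x"
    using linear_on_add[OF Tf[OF x u0(1)] f] Tp[OF f(1) x u0(1)] Tp[OF f(2) x u0(1)] Tp[OF vsp_add[OF vE f] x u0(1)]
    by (intro inj) (simp add: vs)
  next
   fix c f assume f: "f \<in> Hom C N [i, j] U V"
   show "pairing C N [i, j] U V (hscale c f) x = c * pairing C N [i, j] U V f x"
    using linear_on_scale[OF Tf[OF x u0(1)] f] Tp[OF f x u0(1)] Tp[OF vsp_scale[OF vE f] x u0(1)]
    by (intro inj) (simp add: vs)
  qed
  show "x = 0" if "\<And>f. f \<in> Hom C N [i, j] U V ==> pairing C N [i, j] U V f x = 0"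
   by (rule nondegenerate_right[OF r x]) (simp add: Tp[OF _ x] that vs)
 next
  fix f assume f: "f \<in> Hom C N [i, j] U V"
  show "linear_on hscale (*) (Hom C du [j, i] V U) (pairing C N [i, j] U V f)"
  proof (rule linear_onI)
   fix x x' assume x: "x \<in> Hom C du [j, i] V U" "x' \<in> Hom C du [j, i] V U"
   show "pairing C N [i, j] U V f (x + x') = pairing C N [i, j] U V f x + pairing C N [i, j] U V f x'"
    using linear_on_add[OF Tphi[OF f u0(1)] x] Tp[OF f x(1) u0(1)] Tp[OF f x(2) u0(1)] Tp[OF f vsp_add[OF vF x] u0(1)]
    by (intro inj) (simp add: vs)
  next
   fix c x assume x: "x \<in> Hom C du [j, i] V U"
   show "pairing C N [i, j] U V f (hscale c x) = c * pairing C N [i, j] U V f x"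
    using linear_on_scale[OF Tphi[OF f u0(1)] x] Tp[OF f x u0(1)] Tp[OF f vsp_scale[OF vF x] u0(1)]
    by (intro inj) (simp add: vs)
  qed
  show "f = 0" if "\<And>x. x \<in> Hom C du [j, i] V U ==> pairing C N [i, j] U V f x = 0"
   by (rule nondegenerate_left[OF r f]) (simp add: Tp[OF f] that vs)
 qed (rule b)
qed

end

context gbimod begin

subsection \<open>Splitting off the first step\<close>

definition Mrep :: "'i list => ('g, 'k, 'v::ab_group_add) rep => ('g, 'k, 'g list => ('m, 'v, 'k) tens) rep" where
 "Mrep is V = \<lparr>space = Mspace C N is V, scal = pw (pw (*)), gact = Maction C N is V\<rparr>"

lemma Mrep_sel: "space (Mrep is V) = Mspace C N is V" "scal (Mrep is V) = pw (pw (*))" "gact (Mrep is V) = Maction C N is V"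
 by (simp_all add: Mrep_def)

lemma Mrep_is_rep:
 assumes V: "rep_at (last is) V" and pts: "set is \<subseteq> pts C" "is \<noteq> []"
 shows "rep_at (hd is) (Mrep is V)"
proof -
 have i: "hd is \<in> pts C" using pts by auto
 note M = Maction_in[OF pts _ V] and cM = cw_Maction[OF _ _ _ V] and one = stab_one[OF i]
 show ?thesis unfolding is_rep_def Mrep_sel
 proof (intro conjI ballI)
  show "vector_space (pw (pw (*)) :: 'k => (('g list => ('m, 'v, 'k) tens) => _))" by (rule vs_pw3)
  show "Modules.module.subspace (pw (pw (*))) (Mspace C N is V)"
   using Mspace_vsp[OF rep_vsp[OF V]] by (simp add: vsp_def)
  show "fin_dim (pw (pw (*))) (Mspace C N is V)" by (rule Mspace_fin_dim[OF V pts])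
  show "linear_on (pw (pw (*))) (pw (pw (*))) (Mspace C N is V) (Maction C N is V h)" if "h \<in> stab C (hd is)" for h
   by (rule Maction_linear[OF pts V that])
  show "Maction C N is V h ` Mspace C N is V \<subseteq> Mspace C N is V" if "h \<in> stab C (hd is)" for h using M[OF that] by auto
  show "Maction C N is V e x = x" if x: "x \<in> Mspace C N is V" for x
   by (rule cw_eqI[OF M[OF one x] x V pts(1)]) (simp add: cM[OF _ one one x])
  fix g h x assume g: "g \<in> stab C (hd is)" and h: "h \<in> stab C (hd is)" and x: "x \<in> Mspace C N is V"
  have G: "g \<in> Gr" "h \<in> Gr" using g h stab_Gr by blast+
  show "Maction C N is V (g \<cdot> h) x = Maction C N is V g (Maction C N is V h x)"
  proof (rule cw_eqI[OF M[OF stab_mult[OF i g h] x] M[OF g M[OF h x]] V pts(1)])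
   fix w assume w: "vw is w"
   show "cw is V e w (Maction C N is V (g \<cdot> h) x) = cw is V e w (Maction C N is V g (Maction C N is V h x))"
    using cM[OF w one stab_mult[OF i g h] x] cM[OF w one g M[OF h x]] cM[OF w stab_inv[OF i g] h x] G
    by (simp add: inv_mult_group)
  qed
 qed
qed

lemma cw_lact_Mspace:
 assumes "vw is w" "k \<in> stab C (hd is)" "x \<in> Mspace C N is V" "rep_at (last is) V"
 shows "cw is V k w x = (if w = [] then gact V (iv k) (cw is V e [] x) else cw is V e (lact k w) x)"
proof (cases "w = []")
 case True
 then obtain i where i: "is = [i]" "i \<in> pts C" using assms(1) by auto
 have "ctr is V [] [] (x []) \<in> space V"
  using ctr_in[OF one_closed, of "is" "[]" "[]" V "x []"] Mspace_tensor[OF assms(3), of "[]"] rep_vsp[OF assms(4)] i by simp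
 then have "cw is V e [] x = ctr is V [] [] (x [])" using cw_lact[of "is" "[]" e V x] i rep_one[OF assms(4)] by simp
 then show ?thesis using cw_lact[OF assms(1) stab_Gr[OF assms(2)], of V x] True by simp
next
 case False
 then show ?thesis using cw_lact[OF assms(1) stab_Gr[OF assms(2)], of V x] by simp
qed

lemma circ_id_left:
 assumes r: "reps_at is U V" and f: "f \<in> Hom C N is U V" and i: "last is = i"
 shows "circ C N is V [i] V (id_hom N V) f = f"
proof -
 note d = reps_atD[OF r]
 have I: "id_hom N V \<in> Hom C N [i] V V" and r': "reps_at [i] V V" using id_hom_Hom d i by (auto simp: reps_at_def)
 show ?thesis
 proof (rule opr_eqI[OF r _ f])
  show "circ C N is V [i] V (id_hom N V) f \<in> Hom C N is U V" using circ_Hom[OF r r' _ f I] i by simp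
  fix w u assume w: "vw is w" and u: "u \<in> space U"
  have "opr (is @ tl [i]) V (circ C N is V [i] V (id_hom N V) f) (w @ []) u = opr [i] V (id_hom N V) [] (opr is V f w u)"
   by (rule opr_circ[OF r r' _ f I w _ u]) (use i d in auto)
  then show "opr is V (circ C N is V [i] V (id_hom N V) f) w u = opr is V f w u"
   using opr_id_hom[of i V] i d opr_in[OF r f w u] by simp
 qed
qed

lemma circ_id_right:
 assumes r: "reps_at is U V" and f: "f \<in> Hom C N is U V" and i: "hd is = i"
 shows "circ C N [i] U is V f (id_hom N U) = f"
proof -
 note d = reps_atD[OF r]
 have I: "id_hom N U \<in> Hom C N [i] U U" and r': "reps_at [i] U U" using id_hom_Hom d i by (auto simp: reps_at_def)
 have a: "[i] @ tl is = is" using d i by (cases "is") auto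
 show ?thesis
 proof (rule opr_eqI[OF r _ f])
  show "circ C N [i] U is V f (id_hom N U) \<in> Hom C N is U V" using circ_Hom[OF r' r _ I f] i unfolding a by simp
  fix w u assume w: "vw is w" and u: "u \<in> space U"
  have "opr ([i] @ tl is) V (circ C N [i] U is V f (id_hom N U)) ([] @ w) u = opr is V f w (opr [i] U (id_hom N U) [] u)"
   by (rule opr_circ[OF r' r _ I f _ w u]) (use i d in auto)
  then show "opr is V (circ C N [i] U is V f (id_hom N U)) w u = opr is V f w u"
   using opr_id_hom[of i U] i d u unfolding a by simp
 qed
qed

text \<open>Both sides have the same operators, because composition of operators along a word cut
  into three pieces is associative.\<close>

lemma circ_assoc:
 assumes r1: "reps_at is U V" and r2: "reps_at is' V W" and r3: "reps_at js W Y"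
  and l: "last is = hd is'" "last is' = hd js"
  and f: "f \<in> Hom C N is U V" and f': "f' \<in> Hom C N is' V W" and f'': "f'' \<in> Hom C N js W Y"
 shows "circ C N is V (is' @ tl js) Y (circ C N is' W js Y f'' f') f = circ C N (is @ tl is') W js Y f'' (circ C N is V is' W f' f)"
proof -
 note r12 = reps_at_append[OF r1 r2 l(1)] and r23 = reps_at_append[OF r2 r3 l(2)]
 have l1: "last is = hd (is' @ tl js)" using l reps_atD(2)[OF r2] by simp
 have l2: "last (is @ tl is') = hd js" using l reps_atD(2)[OF r2] by (cases is') (auto split: if_splits)
 have a: "(is @ tl is') @ tl js = is @ tl (is' @ tl js)" using reps_atD(2)[OF r2] by (cases is') auto
 note gf = circ_Hom[OF r1 r2 l(1) f f'] and hg = circ_Hom[OF r2 r3 l(2) f' f'']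
 show ?thesis
 proof (rule opr_eqI[OF reps_at_append[OF r1 r23 l1] circ_Hom[OF r1 r23 l1 f hg] circ_Hom[OF r12 r3 l2 gf f'', unfolded a]])
  fix w u assume w: "vw (is @ tl (is' @ tl js)) w" and u: "u \<in> space U"
  obtain w1 w4 where 1: "w = w1 @ w4" "vw is w1" "vw (is' @ tl js) w4" using vw_split[OF r1 r23 l1 w] .
  obtain w2 w3 where 2: "w4 = w2 @ w3" "vw is' w2" "vw js w3" using vw_split[OF r2 r3 l(2) 1(3)] .
  have 3: "vw (is @ tl is') (w1 @ w2)"
   using 1 2 vw_append[OF reps_atD(2)[OF r1] reps_atD(2)[OF r2] l(1)] vw_length[OF 1(2)] by simp
  show "opr (is @ tl (is' @ tl js)) Y (circ C N is V (is' @ tl js) Y (circ C N is' W js Y f'' f') f) w u =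
    opr (is @ tl (is' @ tl js)) Y (circ C N (is @ tl is') W js Y f'' (circ C N is V is' W f' f)) w u"
   using opr_circ[OF r1 r23 l1 f hg 1(2,3) u] opr_circ[OF r2 r3 l(2) f' f'' 2(2,3) opr_in[OF r1 f 1(2) u]]
    opr_circ[OF r12 r3 l2 gf f'' 3 2(3) u, unfolded a] opr_circ[OF r1 r2 l(1) f f' 1(2) 2(2) u]
   by (simp add: 1(1) 2(1))
 qed
qed

lemma circ_linear:
 assumes r: "reps_at is U V" and r': "reps_at is' V W" and l: "last is = hd is'"
 shows circ_linear_right: "f' \<in> Hom C N is' V W ==> linear_on hscale hscale (Hom C N is U V) (\<lambda>f. circ C N is V is' W f' f)"
  and circ_linear_left: "f \<in> Hom C N is U V ==> linear_on hscale hscale (Hom C N is' V W) (\<lambda>f'. circ C N is V is' W f' f)"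
proof -
 let ?is = "is @ tl is'"
 note r'' = reps_at_append[OF r r' l] and w_split = vw_split[OF r r' l]
 note vH = Hom_vsp[OF r] and vH' = Hom_vsp[OF r'] and vH'' = Hom_vsp[OF r'']
 note cH = circ_Hom[OF r r' l] and oc = opr_circ[OF r r' l]
 show "linear_on hscale hscale (Hom C N is U V) (\<lambda>f. circ C N is V is' W f' f)" if f': "f' \<in> Hom C N is' V W"
 proof (rule linear_onI)
  fix x y assume xy: "x \<in> Hom C N is U V" "y \<in> Hom C N is U V"
  show "circ C N is V is' W f' (x + y) = circ C N is V is' W f' x + circ C N is V is' W f' y"
  proof (rule opr_eqI[OF r'' cH[OF vsp_add[OF vH xy] f'] vsp_add[OF vH'' cH[OF xy(1) f'] cH[OF xy(2) f']]])
   fix w'' u assume w'': "vw ?is w''" and u: "u \<in> space U"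
   obtain w w' where w: "w'' = w @ w'" "vw is w" "vw is' w'" using w_split[OF w''] .
   show "opr ?is W (circ C N is V is' W f' (x + y)) w'' u = opr ?is W (circ C N is V is' W f' x + circ C N is V is' W f' y) w'' u"
    using oc[OF vsp_add[OF vH xy] f' w(2,3) u] oc[OF xy(1) f' w(2,3) u] oc[OF xy(2) f' w(2,3) u]
     opr_add[OF r'' cH[OF xy(1) f'] cH[OF xy(2) f'] w'' u] opr_add[OF r xy w(2) u]
     linear_on_add[OF opr_linear[OF r' f' w(3)] opr_in[OF r xy(1) w(2) u] opr_in[OF r xy(2) w(2) u]] by (simp add: w(1))
  qed
 next
  fix c x assume x: "x \<in> Hom C N is U V"
  show "circ C N is V is' W f' (hscale c x) = hscale c (circ C N is V is' W f' x)"
  proof (rule opr_eqI[OF r'' cH[OF vsp_scale[OF vH x] f'] vsp_scale[OF vH'' cH[OF x f']]])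
   fix w'' u assume w'': "vw ?is w''" and u: "u \<in> space U"
   obtain w w' where w: "w'' = w @ w'" "vw is w" "vw is' w'" using w_split[OF w''] .
   show "opr ?is W (circ C N is V is' W f' (hscale c x)) w'' u = opr ?is W (hscale c (circ C N is V is' W f' x)) w'' u"
    using oc[OF vsp_scale[OF vH x] f' w(2,3) u] oc[OF x f' w(2,3) u]
     opr_scale[OF r'' cH[OF x f'] w'' u] opr_scale[OF r x w(2) u]
     linear_on_scale[OF opr_linear[OF r' f' w(3)] opr_in[OF r x w(2) u]] by (simp add: w(1))
  qed
 qed
 show "linear_on hscale hscale (Hom C N is' V W) (\<lambda>f'. circ C N is V is' W f' f)" if f: "f \<in> Hom C N is U V"
 proof (rule linear_onI)
  fix x y assume xy: "x \<in> Hom C N is' V W" "y \<in> Hom C N is' V W"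
  show "circ C N is V is' W (x + y) f = circ C N is V is' W x f + circ C N is V is' W y f"
  proof (rule opr_eqI[OF r'' cH[OF f vsp_add[OF vH' xy]] vsp_add[OF vH'' cH[OF f xy(1)] cH[OF f xy(2)]]])
   fix w'' u assume w'': "vw ?is w''" and u: "u \<in> space U"
   obtain w w' where w: "w'' = w @ w'" "vw is w" "vw is' w'" using w_split[OF w''] .
   show "opr ?is W (circ C N is V is' W (x + y) f) w'' u = opr ?is W (circ C N is V is' W x f + circ C N is V is' W y f) w'' u"
    using oc[OF f vsp_add[OF vH' xy] w(2,3) u] oc[OF f xy(1) w(2,3) u] oc[OF f xy(2) w(2,3) u]
     opr_add[OF r'' cH[OF f xy(1)] cH[OF f xy(2)] w'' u] opr_add[OF r' xy w(3) opr_in[OF r f w(2) u]] by (simp add: w(1))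
  qed
 next
  fix c x assume x: "x \<in> Hom C N is' V W"
  show "circ C N is V is' W (hscale c x) f = hscale c (circ C N is V is' W x f)"
  proof (rule opr_eqI[OF r'' cH[OF f vsp_scale[OF vH' x]] vsp_scale[OF vH'' cH[OF f x]]])
   fix w'' u assume w'': "vw ?is w''" and u: "u \<in> space U"
   obtain w w' where w: "w'' = w @ w'" "vw is w" "vw is' w'" using w_split[OF w''] .
   show "opr ?is W (circ C N is V is' W (hscale c x) f) w'' u = opr ?is W (hscale c (circ C N is V is' W x f)) w'' u"
    using oc[OF f vsp_scale[OF vH' x] w(2,3) u] oc[OF f x w(2,3) u]
     opr_scale[OF r'' cH[OF f x] w'' u] opr_scale[OF r' x w(3) opr_in[OF r f w(2) u]] by (simp add: w(1))
  qed
 qed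
qed

end

context gbimod_coprime begin

text \<open>For a family fixed by all twists the average of \<open>avg_Hom\<close> is |G_i| |G_j|
  times the family, and this number is invertible.\<close>

lemma invariant_Hom:
 assumes r: "rep2 i j U V" and F: "locf i j U V F"
  and inv: "\<And>k h g \<psi> u. k \<in> stab C i ==> h \<in> stab C j ==> g \<in> Gr ==> \<psi> \<in> bcar du ==> u \<in> space U ==>
   tw U V k h F g \<psi> u = F g \<psi> u"
 shows "\<exists>f\<in>Hom C N [i, j] U V. \<forall>g\<in>Gr. \<forall>\<psi>\<in>bcar du. \<forall>u\<in>space U. opr [i, j] V f [(g, \<psi>)] u = F g \<psi> u"
proof -
 note d = rep2D[OF r] and r1 = rep2_reps_at'[OF r]
 note vs = vsp_simps[OF rep_vsp[OF d(4)]]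
 obtain f where f: "f \<in> Hom C N [i, j] U V"
  "\<And>g \<psi> u. g \<in> Gr ==> \<psi> \<in> bcar du ==> u \<in> space U ==>
   opr [i, j] V f [(g, \<psi>)] u = (\<Sum>k\<in>stab C i. \<Sum>h\<in>stab C j. tw U V k h F g \<psi> u)" by (rule avg_Hom[OF r F]) blast
 let ?c = "of_nat (card (stab C i)) * of_nat (card (stab C j)) :: 'k"
 have c: "?c \<noteq> 0" using card_stab d by simp
 show ?thesis
 proof (intro bexI[of _ "hscale (1 / ?c) f"] ballI)
  fix g \<psi> u assume g: "g \<in> Gr" and \<psi>: "\<psi> \<in> bcar du" and u: "u \<in> space U"
  have w: "vw [i, j] [(g, \<psi>)]" using d g \<psi> by simp
  have "opr [i, j] V f [(g, \<psi>)] u = (\<Sum>k\<in>stab C i. \<Sum>h\<in>stab C j. scal V 1 (F g \<psi> u))"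
   using f(2)[OF g \<psi> u] inv[OF _ _ g \<psi> u] by (simp add: vs cong: sum.cong)
  also have "\<dots> = scal V (\<Sum>k\<in>stab C i. \<Sum>h\<in>stab C j. 1) (F g \<psi> u)" unfolding vs(10) ..
  also have "(\<Sum>k\<in>stab C i. \<Sum>h\<in>stab C j. 1) = ?c" by simp
  finally show "opr [i, j] V (hscale (1 / ?c) f) [(g, \<psi>)] u = F g \<psi> u"
   using opr_scale[OF r1 f(1) w u] c by (simp add: vs)
 qed (rule vsp_scale[OF Hom_vsp[OF r1] f(1)])
qed

text \<open>With the first letter frozen, f becomes an invariant family of operators from U to the
  module M(j,...;W). Splitting that module into irreducibles inserts the projections and inclusions:
  the projected families are the first factors, the inclusions are the second factors.\<close>

lemma Hom_split:
 assumes r: "reps_at (i # j # is) U W" and f: "f \<in> Hom C N (i # j # is) U W" and R: "irr_reps (grp C) (stab C j) R"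
 shows "\<exists>(n::nat) V f1 f2. (\<forall>a<n. V a \<in> R \<and> f1 a \<in> Hom C N [i, j] U (V a) \<and> f2 a \<in> Hom C N (j # is) (V a) W) \<and>
  f = (\<Sum>a<n. circ C N [i, j] (V a) (j # is) W (f2 a) (f1 a))"
proof -
 note d = reps_atD[OF r]
 have ij: "i \<in> pts C" "j \<in> pts C" and pts: "set (j # is) \<subseteq> pts C" "j # is \<noteq> []" using d(1) by auto
 have rU: "rep_at i U" and rW: "rep_at (last (j # is)) W" using d by auto
 note vU = rep_vsp[OF rU] and vW = rep_vsp[OF rW]
 note MW = Mspace_vsp[OF vW, of "j # is"]
 \<comment> \<open>The element of M(j,...;W) whose contractions are those of f with the letter
   (g,\<psi>) put in front. As its values lie on another type, the family is not an intertwiner in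
   the sense of \<open>Hom\<close> before it is projected to members of R.\<close>
 define x where "x g \<psi> u = unwx (j # is) W (\<lambda>w. opr (i # j # is) W f ((g, \<psi>) # w) u)" for g \<psi> u
 have wxt: "wx (j # is) W (\<lambda>w. opr (i # j # is) W f ((g, \<psi>) # w) u)" if "g \<in> Gr" "\<psi> \<in> bcar du" "u \<in> space U" for g \<psi> u
  by (rule wx_tail[OF opr_wx[OF r f that(3)] ij(1) that(1,2)])
 have xin: "x g \<psi> u \<in> Mspace C N (j # is) W" if "g \<in> Gr" "\<psi> \<in> bcar du" "u \<in> space U" for g \<psi> u
  unfolding x_def by (rule unwx_in[OF pts rW wxt[OF that]])
 have cwx: "cw (j # is) W e w (x g \<psi> u) = opr (i # j # is) W f ((g, \<psi>) # w) u"
  if "g \<in> Gr" "\<psi> \<in> bcar du" "u \<in> space U" "vw (j # is) w" for g \<psi> u w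
  unfolding x_def by (rule cw_unwx[OF pts rW wxt[OF that(1-3)] that(4)])
 have one: "e \<in> stab C (hd (j # is))" using stab_one[OF ij(2)] by simp
 note cl = cw_linear[OF _ rW one]
 have x_add: "x g \<psi> (u + u') = x g \<psi> u + x g \<psi> u'" if g: "g \<in> Gr" "\<psi> \<in> bcar du" and u: "u \<in> space U" "u' \<in> space U" for g \<psi> u u'
 proof (rule cw_eqI[OF xin[OF g vsp_add[OF vU u]] vsp_add[OF MW xin[OF g u(1)] xin[OF g u(2)]] rW pts(1)])
  fix w assume w: "vw (j # is) w"
  have ww: "vw (i # j # is) ((g, \<psi>) # w)" using w g ij by simp
  show "cw (j # is) W e w (x g \<psi> (u + u')) = cw (j # is) W e w (x g \<psi> u + x g \<psi> u')"
   using linear_on_add[OF cl[OF w] xin[OF g u(1)] xin[OF g u(2)]] linear_on_add[OF opr_linear[OF r f ww] u]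
    cwx[OF g _ w] u vsp_add[OF vU u] by simp
 qed
 have x_scale: "x g \<psi> (scal U c u) = pw (pw (*)) c (x g \<psi> u)" if g: "g \<in> Gr" "\<psi> \<in> bcar du" and u: "u \<in> space U" for g \<psi> u c
 proof (rule cw_eqI[OF xin[OF g vsp_scale[OF vU u]] vsp_scale[OF MW xin[OF g u]] rW pts(1)])
  fix w assume w: "vw (j # is) w"
  have ww: "vw (i # j # is) ((g, \<psi>) # w)" using w g ij by simp
  show "cw (j # is) W e w (x g \<psi> (scal U c u)) = cw (j # is) W e w (pw (pw (*)) c (x g \<psi> u))"
   using linear_on_scale[OF cl[OF w] xin[OF g u]] linear_on_scale[OF opr_linear[OF r f ww] u]
    cwx[OF g _ w] u vsp_scale[OF vU u] by simp
 qed
 have x_expand: "x g \<psi> u = (\<Sum>b\<in>Bas i (pact C g j). pw (pw (*)) (\<psi> b) (x g (cof i (pact C g j) b) u))"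
  if g: "g \<in> Gr" "\<psi> \<in> bcar du" and u: "u \<in> space U" for g \<psi> u
 proof (rule cw_eqI[OF xin[OF g u] _ rW pts(1)])
  have cin: "x g (cof i (pact C g j) b) u \<in> Mspace C N (j # is) W" for b by (rule xin[OF g(1) cof_dual u])
  show "(\<Sum>b\<in>Bas i (pact C g j). pw (pw (*)) (\<psi> b) (x g (cof i (pact C g j) b) u)) \<in> Mspace C N (j # is) W"
   by (intro vsp_sum[OF MW] vsp_scale[OF MW] cin)
  fix w assume w: "vw (j # is) w"
  have ww: "vw (i # j # is) ([] @ (g, \<psi>) # w)" using w g ij by simp
  show "cw (j # is) W e w (x g \<psi> u) = cw (j # is) W e w (\<Sum>b\<in>Bas i (pact C g j). pw (pw (*)) (\<psi> b) (x g (cof i (pact C g j) b) u))"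
   using opr_wx[OF r f u, unfolded wx_def, THEN conjunct2, THEN conjunct1, rule_format, OF ww]
    linear_on_combination[OF cl[OF w] MW, of "Bas i (pact C g j)" "\<lambda>b. x g (cof i (pact C g j) b) u" \<psi>] cin
    cwx[OF g u w] cwx[OF g(1) cof_dual u w] by simp
 qed
 \<comment> \<open>Invariance under k is equivariance of f. Invariance under h is balancing between
   the first letter and the rest, since the action of h on the module moves the frame of the
   rest.\<close>
 have x_tw: "Maction C N (j # is) W h (x (iv k \<cdot> g \<cdot> h) (bact du (iv k) \<psi>) (gact U (iv k) u)) = x g \<psi> u"
  if k: "k \<in> stab C i" and h: "h \<in> stab C j" and g: "g \<in> Gr" "\<psi> \<in> bcar du" and u: "u \<in> space U" for k h g \<psi> u
 proof -
  have G: "k \<in> Gr" "h \<in> Gr" using k h stab_Gr by blast+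
  have ik: "iv k \<in> stab C i" and ih: "iv h \<in> stab C j" using stab_inv ij k h by auto
  let ?g = "iv k \<cdot> g" and ?\<psi> = "bact du (iv k) \<psi>" and ?u = "gact U (iv k) u"
  have g': "?g \<in> Gr" "?g \<cdot> h \<in> Gr" "?\<psi> \<in> bcar du" using G g by (auto simp: dual_bact_in)
  have u': "?u \<in> space U" by (rule rep_in[OF rU ik u])
  note xi = xin[OF g'(2,3) u']
  have hh: "h \<in> stab C (hd (j # is))" "iv h \<in> stab C (hd (j # is))" using h ih by auto
  show ?thesis
  proof (rule cw_eqI[OF Maction_in[OF pts hh(1) rW xi] xin[OF g u] rW pts(1)])
   fix w assume w: "vw (j # is) w"
   have ww: "vw (i # j # is) ([] @ (?g, ?\<psi>) # w)" "vw (i # j # is) ((?g, ?\<psi>) # w)" "vw (i # j # is) ((g, \<psi>) # w)"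
    using w g g' ij by simp_all
   have rg: "opr (i # j # is) W f ((?g, ?\<psi>) # w) ?u = opr (i # j # is) W f ((g, \<psi>) # w) u"
    using opr_gact[OF r f ww(2) _ u, of "iv k"] ik G g by (simp add: mult_iv_cancel dual_bact_mult[symmetric] dual_bact_one)
   note cov = opr_wx[OF r f u', unfolded wx_def, THEN conjunct2, THEN conjunct2, rule_format]
   have "cw (j # is) W e w (Maction C N (j # is) W h (x (?g \<cdot> h) ?\<psi> ?u)) = cw (j # is) W (iv h) w (x (?g \<cdot> h) ?\<psi> ?u)"
    using cw_Maction[OF w one hh(1) rW xi] G by simp
   also have "\<dots> = (if w = [] then gact W h (cw (j # is) W e [] (x (?g \<cdot> h) ?\<psi> ?u)) else cw (j # is) W e (lact (iv h) w) (x (?g \<cdot> h) ?\<psi> ?u))"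
    using cw_lact_Mspace[OF w hh(2) xi rW] G by simp
   also have "\<dots> = opr (i # j # is) W f ((?g, ?\<psi>) # w) ?u"
   proof (cases w)
    case Nil
    have is0: "is = []" using w Nil by simp
    have "opr (i # j # is) W f [(?g \<cdot> h, ?\<psi>)] ?u = gact W (iv h) (opr (i # j # is) W f [(?g, ?\<psi>)] ?u)"
     using cov[of "[]" ?g ?\<psi> "[]" h] ww(1) h by (simp add: Nil)
    then show ?thesis using Nil cwx[OF g'(2,3) u', of "[]"] w rep_inv(2)[of j W h] ij(2) rW h opr_in[OF r f ww(2) u'] is0 by simp
   next
    case (Cons l w')
    obtain g2 \<psi>2 where l: "l = (g2, \<psi>2)" by force
    from w have g2: "g2 \<in> Gr" "\<psi>2 \<in> bcar du" unfolding Cons l by (auto simp: vw_Cons)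
    have wl: "vw (j # is) (lact (iv h) w)" using w G unfolding Cons l by (auto simp: vw_Cons dual_bact_in)
    have "opr (i # j # is) W f ((?g \<cdot> h, ?\<psi>) # lact (iv h) w) ?u = opr (i # j # is) W f ((?g, ?\<psi>) # lact h (lact (iv h) w)) ?u"
     using cov[of "[]" ?g ?\<psi> "lact (iv h) w" h] wl g' ij h by (simp add: Cons l)
    also have "lact h (lact (iv h) w) = w" using G g2 by (simp add: Cons l mult_iv_cancel dual_bact_mult[symmetric] dual_bact_one)
    finally show ?thesis using cwx[OF g'(2,3) u' wl] Cons by simp
   qed
   finally show "cw (j # is) W e w (Maction C N (j # is) W h (x (?g \<cdot> h) ?\<psi> ?u)) = cw (j # is) W e w (x g \<psi> u)"
    using rg cwx[OF g u w] by simp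
  qed
 qed
 interpret Sj: finite_subgroup "grp C" "stab C j"
  by (intro finite_subgroup.intro finite_subgroup_axioms.intro is_group stab_subgroup ij(2) finite_stab)
 have rX: "rep_at j (Mrep (j # is) W)" using Mrep_is_rep[OF rW pts] by simp
 obtain n :: nat and V \<iota> \<pi> where dec: "\<forall>a<n. V a \<in> R \<and> eqvar (stab C j) (V a) (Mrep (j # is) W) (\<iota> a) \<and> eqvar (stab C j) (Mrep (j # is) W) (V a) (\<pi> a)"
  "\<forall>y\<in>space (Mrep (j # is) W). y = (\<Sum>a<n. \<iota> a (\<pi> a y))" using Sj.decomposition[OF rX R card_stab[OF ij(2)]] by blast
 have rV: "rep_at j (V a)" if "a < n" for a using dec(1) that R by (auto simp: irr_reps_def irreducible_rep_def)
 have \<pi>: "\<pi> a y \<in> space (V a)" "linear_on (pw (pw (*))) (scal (V a)) (Mspace C N (j # is) W) (\<pi> a)"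
   "h \<in> stab C j ==> \<pi> a (Maction C N (j # is) W h y) = gact (V a) h (\<pi> a y)"
  if "a < n" "y \<in> Mspace C N (j # is) W" for a y h
  using dec(1) that unfolding eqvar_def Mrep_sel image_subset_iff by blast+
 \<comment> \<open>The projection of an invariant family to a summand is again invariant and takes
   values in a representation on the right type.\<close>
 have "\<exists>f1\<in>Hom C N [i, j] U (V a). \<forall>g\<in>Gr. \<forall>\<psi>\<in>bcar du. \<forall>u\<in>space U. opr [i, j] (V a) f1 [(g, \<psi>)] u = \<pi> a (x g \<psi> u)" if a: "a < n" for a
 proof (rule invariant_Hom)
  show "rep2 i j U (V a)" using ij rU rV[OF a] by (simp add: rep2_def)
  show "locf i j U (V a) (\<lambda>g \<psi> u. \<pi> a (x g \<psi> u))" unfolding locf_def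
  proof (intro ballI conjI)
   fix g \<psi> assume g: "g \<in> Gr" "\<psi> \<in> bcar du"
   show "\<pi> a (x g \<psi> u) \<in> space (V a)" if "u \<in> space U" for u by (rule \<pi>(1)[OF a xin[OF g that]])
   show "linear_on (scal U) (scal (V a)) (space U) (\<lambda>u. \<pi> a (x g \<psi> u))"
    by (rule linear_on_comp[OF _ \<pi>(2)[OF a vsp_0[OF MW]], where f = "x g \<psi>"])
      (use x_add[OF g] x_scale[OF g] xin[OF g] in \<open>auto intro!: linear_onI\<close>)
   fix u assume u: "u \<in> space U"
   show "\<pi> a (x g \<psi> u) = (\<Sum>b\<in>Bas i (pact C g j). scal (V a) (\<psi> b) (\<pi> a (x g (cof i (pact C g j) b) u)))"
    by (subst x_expand[OF g u], rule linear_on_combination[OF \<pi>(2)[OF a vsp_0[OF MW]] MW], rule xin[OF g(1) cof_dual u])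
  qed
  fix k h g \<psi> u assume k: "k \<in> stab C i" and h: "h \<in> stab C j" and g: "g \<in> Gr" "\<psi> \<in> bcar du" and u: "u \<in> space U"
  have "x (iv k \<cdot> g \<cdot> h) (bact du (iv k) \<psi>) (gact U (iv k) u) \<in> Mspace C N (j # is) W"
   using stab_Gr[OF k] stab_Gr[OF h] g by (intro xin rep_in[OF rU stab_inv[OF ij(1) k] u]) (auto simp: dual_bact_in)
  from \<pi>(3)[OF a this h] show "tw U (V a) k h (\<lambda>g \<psi> u. \<pi> a (x g \<psi> u)) g \<psi> u = \<pi> a (x g \<psi> u)"
   unfolding tw_def x_tw[OF k h g u] by simp
 qed
 then obtain f1 where f1: "\<And>a. a < n ==> f1 a \<in> Hom C N [i, j] U (V a)"
  "\<And>a g \<psi> u. a < n ==> g \<in> Gr ==> \<psi> \<in> bcar du ==> u \<in> space U ==> opr [i, j] (V a) (f1 a) [(g, \<psi>)] u = \<pi> a (x g \<psi> u)"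
  by metis
 \<comment> \<open>The inclusion of the summand, set to zero outside as \<open>Hom\<close>
   demands.\<close>
 define f2 where "f2 a v = (if v \<in> space (V a) then \<iota> a v else 0)" for a v
 have f2: "f2 a \<in> Hom C N (j # is) (V a) W" if a: "a < n" for a
 proof (rule HomI)
  have i: "eqvar (stab C j) (V a) (Mrep (j # is) W) (\<iota> a)" using dec(1) a by blast
  note vV = rep_vsp[OF rV[OF a]]
  show "f2 a v = 0" if "v \<notin> space (V a)" for v using that by (simp add: f2_def)
  show "f2 a v \<in> Mspace C N (j # is) W" if "v \<in> space (V a)" for v
   using eqvar_in[OF i that] that by (simp add: f2_def Mrep_sel)
  show "linear_on (scal (V a)) (pw (pw (*))) (space (V a)) (f2 a)" using eqvar_linear[OF i] unfolding Mrep_sel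
   by (auto simp: f2_def linear_on_def vsp_add[OF vV] vsp_scale[OF vV])
  show "f2 a (gact (V a) g v) = Maction C N (j # is) W g (f2 a v)" if "g \<in> stab C (hd (j # is))" "v \<in> space (V a)" for g v
   using eqvar_gact[OF i] that rep_in[OF rV[OF a]] by (simp add: f2_def Mrep_sel)
 qed
 have r1: "reps_at [i, j] U (V a)" and r2: "reps_at (j # is) (V a) W" if "a < n" for a
  using ij rU rV[OF that] rW pts by (auto simp: reps_at_def)
 have cH: "circ C N [i, j] (V a) (j # is) W (f2 a) (f1 a) \<in> Hom C N (i # j # is) U W" if a: "a < n" for a
  using circ_Hom[OF r1[OF a] r2[OF a] _ f1(1)[OF a] f2[OF a]] by simp
 have sH: "(\<Sum>a<n. circ C N [i, j] (V a) (j # is) W (f2 a) (f1 a)) \<in> Hom C N (i # j # is) U W"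
  using cH by (intro vsp_sum[OF Hom_vsp[OF r]]) auto
 have "f = (\<Sum>a<n. circ C N [i, j] (V a) (j # is) W (f2 a) (f1 a))"
 proof (rule opr_eqI[OF r f sH])
  fix w' u assume w': "vw (i # j # is) w'" and u: "u \<in> space U"
  then obtain g \<psi> w where w: "w' = (g, \<psi>) # w" "g \<in> Gr" "\<psi> \<in> bcar du" "vw (j # is) w" by (cases w') (auto simp: vw_Cons)
  have l: "vw [i, j] [(g, \<psi>)]" using w ij by simp
  note xi = xin[OF w(2,3) u]
  have "opr (i # j # is) W (\<Sum>a<n. circ C N [i, j] (V a) (j # is) W (f2 a) (f1 a)) w' u =
    (\<Sum>a<n. opr (i # j # is) W (circ C N [i, j] (V a) (j # is) W (f2 a) (f1 a)) w' u)"
   using cH by (intro linear_on_sum[OF opr_linear_morph[OF r w' u] Hom_vsp[OF r]]) auto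
  also have "\<dots> = (\<Sum>a<n. cw (j # is) W e w (\<iota> a (\<pi> a (x g \<psi> u))))"
  proof (intro sum.cong refl)
   fix a assume "a \<in> {..<n}"
   then have a: "a < n" by simp
   have "opr ([i, j] @ tl (j # is)) W (circ C N [i, j] (V a) (j # is) W (f2 a) (f1 a)) ([(g, \<psi>)] @ w) u =
     opr (j # is) W (f2 a) w (opr [i, j] (V a) (f1 a) [(g, \<psi>)] u)"
    by (rule opr_circ[OF r1[OF a] r2[OF a] _ f1(1)[OF a] f2[OF a] l w(4) u]) simp
   then show "opr (i # j # is) W (circ C N [i, j] (V a) (j # is) W (f2 a) (f1 a)) w' u = cw (j # is) W e w (\<iota> a (\<pi> a (x g \<psi> u)))"
    using f1(2)[OF a w(2,3) u] \<pi>(1)[OF a xi] by (simp add: w(1) opr_def f2_def)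
  qed
  also have "\<dots> = cw (j # is) W e w (\<Sum>a<n. \<iota> a (\<pi> a (x g \<psi> u)))"
  proof (rule linear_on_sum[OF cl[OF w(4)] MW, symmetric])
   fix a assume "a \<in> {..<n}"
   then have a: "a < n" by simp
   have "eqvar (stab C j) (V a) (Mrep (j # is) W) (\<iota> a)" using dec(1) a by blast
   from eqvar_in[OF this \<pi>(1)[OF a xi]] show "\<iota> a (\<pi> a (x g \<psi> u)) \<in> Mspace C N (j # is) W" by (simp add: Mrep_sel)
  qed
  also have "(\<Sum>a<n. \<iota> a (\<pi> a (x g \<psi> u))) = x g \<psi> u" using dec(2) xi by (simp add: Mrep_sel)
  also have "cw (j # is) W e w (x g \<psi> u) = opr (i # j # is) W f w' u" using cwx[OF w(2,3) u w(4)] w(1) by simp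
  finally show "opr (i # j # is) W f w' u = opr (i # j # is) W (\<Sum>a<n. circ C N [i, j] (V a) (j # is) W (f2 a) (f1 a)) w' u" by simp
 qed
 then show ?thesis using dec(1) f1(1) f2 by (intro exI[of _ n] exI[of _ V] exI[of _ f1] exI[of _ f2]) auto
qed

end

section \<open>Paths of the quiver and orthogonality of their intertwiners\<close>

context wf_digraph begin

lemma paths_Nil [simp]: "(x, []) \<in> paths G \<longleftrightarrow> x \<in> verts G" by (auto simp: paths_def awalk_Nil_iff)

lemma paths_Cons [simp]: "(x, a # p) \<in> paths G \<longleftrightarrow> a \<in> arcs G \<and> x = tail G a \<and> (head G a, p) \<in> paths G"
 by (auto simp: paths_def awalk_Cons_iff)

lemma path_end_simps [simp]: "path_end G x [] = x" "path_end G x (a # p) = path_end G (head G a) p"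
 by (auto simp: path_end_def)

lemma path_in_verts: "(x, p) \<in> paths G ==> x \<in> verts G \<and> path_end G x p \<in> verts G" by (induction p arbitrary: x) auto

lemma paths_append: "(x, p @ q) \<in> paths G \<longleftrightarrow> (x, p) \<in> paths G \<and> (path_end G x p, q) \<in> paths G"
 using path_in_verts by (induction p arbitrary: x) auto

lemma path_end_append: "path_end G x (p @ q) = path_end G (path_end G x p) q" by (induction p arbitrary: x) auto

end

locale intertwiner_quiver = gbimod_coprime C N
 for C :: "('g, 'i) gset" and N :: "('g, 'i, 'k::alg_closed_field, 'm::ab_group_add) bimod" +
 fixes irr :: "'i => ('g, 'k, 'v::ab_group_add) rep set"
  and Q :: "(('g, 'i, 'k, 'v) vertex, 'a) pre_digraph"
  and lab :: "'a => ('g, 'k, 'm, 'v) morph"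
 assumes irr_pts: "i \<in> pts C ==> irr_reps (grp C) (stab C i) (irr i)"
  and QG: "is_QG C N irr Q lab"
begin

sublocale Q: wf_digraph Q using QG by (simp add: is_QG_def)

abbreviation vlist where "vlist x p \<equiv> map fst (Q.awalk_verts x p)"
abbreviation pend where "pend \<equiv> path_end Q"
abbreviation pmap where "pmap \<equiv> path_map C N Q lab"
abbreviation Icar where "Icar \<equiv> carrier (Intw C N irr)"
abbreviation darr where "darr \<equiv> dual_arrow C N Q lab"
abbreviation F where "F \<equiv> f_path C N Q lab"
abbreviation \<Phi> where "\<Phi> \<equiv> phi_path C N Q lab"

lemma verts_Q: "verts Q = Sigma (orb_reps C) irr" using QG by (simp add: is_QG_def)

lemma irr_irreducible: "i \<in> pts C ==> U \<in> irr i ==> irreducible_rep (grp C) (stab C i) U"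
 using irr_pts by (auto simp: irr_reps_def)

lemma vert: "x \<in> verts Q ==> fst x \<in> orb_reps C" "x \<in> verts Q ==> fst x \<in> pts C"
 "x \<in> verts Q ==> snd x \<in> irr (fst x)" "x \<in> verts Q ==> rep_at (fst x) (snd x)"
 "x \<in> verts Q ==> irreducible_rep (grp C) (stab C (fst x)) (snd x)"
proof -
 show 1: "fst x \<in> orb_reps C" "fst x \<in> pts C" "snd x \<in> irr (fst x)" if "x \<in> verts Q" for x
  using that orb_reps_pts by (auto simp: verts_Q)
 show 2: "irreducible_rep (grp C) (stab C (fst x)) (snd x)" if "x \<in> verts Q" for x
  using irr_irreducible 1[OF that] by blast
 show "rep_at (fst x) (snd x)" if "x \<in> verts Q" for x by (rule irreducible_rep_is_rep[OF 2[OF that]])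
qed

lemma vlist_append: "(x, p @ q) \<in> paths Q ==> vlist x (p @ q) = vlist x p @ tl (vlist (pend x p) q)"
 by (induction p arbitrary: x) (cases q; auto)+

lemma path_props:
 assumes "(x, p) \<in> paths Q"
 shows "x \<in> verts Q" "pend x p \<in> verts Q" "hd (vlist x p) = fst x" "set (vlist x p) \<subseteq> orb_reps C"
 using assms by (induction p arbitrary: x) (auto simp: vert)

lemma vlist_ne: "vlist x p \<noteq> []" and last_vlist: "last (vlist x p) = fst (pend x p)"
 by (simp_all add: path_end_def last_map)

lemma vlist_Cons: "(x, p) \<in> paths Q ==> vlist x p = fst x # tl (vlist x p)"
 using path_props(3) vlist_ne by (metis list.collapse)

lemma path_reps: "(x, p) \<in> paths Q ==> reps_at (vlist x p) (snd x) (snd (pend x p))"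
 using path_props[of x p] vert[of x] vert[of "pend x p"] orb_reps_pts vlist_ne[of x p] last_vlist[of x p]
 unfolding reps_at_def by auto

lemma arrow_basis:
 assumes "x \<in> verts Q" "y \<in> verts Q"
 shows "inj_on lab (arrows Q x y)" "is_basis hscale (Hom C N [fst x, fst y] (snd x) (snd y)) (lab ` arrows Q x y)"
 using QG assms unfolding is_QG_def by (force simp: case_prod_beta)+

lemma arrow_reps: "a \<in> arcs Q ==> reps_at [fst (tail Q a), fst (head Q a)] (snd (tail Q a)) (snd (head Q a))"
 using vert[OF Q.tail_in_verts] vert[OF Q.head_in_verts] by (simp add: reps_at_def)

lemma arrow_Hom:
 assumes "a \<in> arcs Q"
 shows "lab a \<in> Hom C N [fst (tail Q a), fst (head Q a)] (snd (tail Q a)) (snd (head Q a))"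
proof -
 interpret K: vector_space "hscale :: 'k => ('g, 'k, 'm, 'v) morph => _" by (rule vs_pw3(3))
 have "Hom C N [fst (tail Q a), fst (head Q a)] (snd (tail Q a)) (snd (head Q a)) = K.span (lab ` arrows Q (tail Q a) (head Q a))"
  using arrow_basis(2)[of "tail Q a" "head Q a"] assms by (simp add: is_basis_def)
 then show ?thesis using assms by (auto intro!: K.span_base)
qed

text \<open>Existence and uniqueness in \<open>dual_basis_arrows\<close> show that the definite
  description behind dual arrows is proper.\<close>

lemma dual_arrow:
 assumes a: "a \<in> arcs Q"
 shows "darr a \<in> Hom C du [fst (head Q a), fst (tail Q a)] (snd (head Q a)) (snd (tail Q a))"
  and "b \<in> arrows Q (tail Q a) (head Q a) ==>
   pairing C N [fst (tail Q a), fst (head Q a)] (snd (tail Q a)) (snd (head Q a)) (lab b) (darr a) = (if b = a then 1 else 0)"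
proof -
 let ?x = "tail Q a" and ?y = "head Q a"
 let ?P = "\<lambda>\<phi>. \<phi> \<in> Hom C du [fst ?y, fst ?x] (snd ?y) (snd ?x) \<and>
   (\<forall>b\<in>arrows Q ?x ?y. pairing C N [fst ?x, fst ?y] (snd ?x) (snd ?y) (lab b) \<phi> = (if b = a then 1 else 0))"
 have v: "?x \<in> verts Q" "?y \<in> verts Q" using a by auto
 have aa: "a \<in> arrows Q ?x ?y" using a by simp
 have r: "rep2 (fst ?x) (fst ?y) (snd ?x) (snd ?y)" using arrow_reps[OF a] by (simp add: rep2_reps_at)
 \<comment> \<open>Basis elements are intertwiners, whereas the dual condition speaks of arrows;
   injectivity of the labels on one arrow set translates between them.\<close>
 have "lab b = lab a \<longleftrightarrow> b = a" if "b \<in> arrows Q ?x ?y" for b using inj_on_eq_iff[OF arrow_basis(1)[OF v] that aa] .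
 then have "\<exists>!\<phi>. ?P \<phi>" using dual_basis_arrows[OF r vert(5)[OF v(1)] arrow_basis(2)[OF v] imageI[OF aa]] by simp
 moreover have "darr a = (THE \<phi>. ?P \<phi>)" by (simp only: dual_arrow_def Let_def case_prod_beta prod.collapse)
 ultimately have "?P (darr a)" using theI'[of ?P] by simp
 then show "darr a \<in> Hom C du [fst ?y, fst ?x] (snd ?y) (snd ?x)"
  "b \<in> arrows Q ?x ?y ==> pairing C N [fst ?x, fst ?y] (snd ?x) (snd ?y) (lab b) (darr a) = (if b = a then 1 else 0)"
  by blast+
qed

text \<open>The definition of \<open>f_path\<close> treats a single arrow separately. Since
  composition with an identity changes nothing, \<open>F_Cons\<close> holds uniformly and serves as
  the recursion from here on.\<close>

lemma
 assumes "(x, p) \<in> paths Q"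
 shows F_Hom: "F x p \<in> Hom C N (vlist x p) (snd x) (snd (pend x p))"
  and F_Cons: "p = a # p' ==> F x p = circ C N [fst x, fst (head Q a)] (snd (head Q a)) (vlist (head Q a) p') (snd (pend x p))
   (F (head Q a) p') (lab a)"
proof -
 have "F x p \<in> Hom C N (vlist x p) (snd x) (snd (pend x p)) \<and> (\<forall>a p'. p = a # p' \<longrightarrow>
   F x p = circ C N [fst x, fst (head Q a)] (snd (head Q a)) (vlist (head Q a) p') (snd (pend x p)) (F (head Q a) p') (lab a))"
  using assms
 proof (induction p arbitrary: x)
  case Nil
  then show ?case using id_hom_Hom[OF vert(2,4)] by simp
 next
  case (Cons a p)
  then have a: "a \<in> arcs Q" "x = tail Q a" "(head Q a, p) \<in> paths Q" by auto
  let ?y = "head Q a"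
  let ?c = "circ C N [fst x, fst ?y] (snd ?y) (vlist ?y p) (snd (pend ?y p)) (F ?y p) (lab a)"
  have F: "F x (a # p) = ?c" using circ_id_left[OF arrow_reps[OF a(1)] arrow_Hom[OF a(1)]] a(2) by (cases p) auto
  have "?c \<in> Hom C N ([fst x, fst ?y] @ tl (vlist ?y p)) (snd x) (snd (pend ?y p))"
   using Cons.IH[OF a(3)] arrow_Hom[OF a(1)] arrow_reps[OF a(1)] path_reps[OF a(3)] path_props(3)[OF a(3)]
   unfolding a(2) by (intro circ_Hom) auto
  moreover have "[fst x, fst ?y] @ tl (vlist ?y p) = vlist x (a # p)" using vlist_Cons[OF a(3)] a(2) by simp
  ultimately show ?case using F by simp
 qed
 then show "F x p \<in> Hom C N (vlist x p) (snd x) (snd (pend x p))"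
  "p = a # p' ==> F x p = circ C N [fst x, fst (head Q a)] (snd (head Q a)) (vlist (head Q a) p') (snd (pend x p)) (F (head Q a) p') (lab a)"
  by blast+
qed

text \<open>Dual intertwiners run backwards: an arrow put in front of the path becomes the last
  operation, composed after the dual intertwiner of the rest.\<close>

lemma
 assumes "(x, p) \<in> paths Q"
 shows \<Phi>_Hom: "\<Phi> x p \<in> Hom C du (rev (vlist x p)) (snd (pend x p)) (snd x)"
  and \<Phi>_Cons: "p = a # p' ==> \<Phi> x p = circ C du (rev (vlist (head Q a) p')) (snd (head Q a)) [fst (head Q a), fst x] (snd x)
   (darr a) (\<Phi> (head Q a) p')"
proof -
 have "\<Phi> x p \<in> Hom C du (rev (vlist x p)) (snd (pend x p)) (snd x) \<and> (\<forall>a p'. p = a # p' \<longrightarrow>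
   \<Phi> x p = circ C du (rev (vlist (head Q a) p')) (snd (head Q a)) [fst (head Q a), fst x] (snd x) (darr a) (\<Phi> (head Q a) p'))"
  using assms
 proof (induction p arbitrary: x)
  case Nil
  then show ?case using D.id_hom_Hom[OF vert(2,4)] by simp
 next
  case (Cons a p)
  then have a: "a \<in> arcs Q" "x = tail Q a" "(head Q a, p) \<in> paths Q" by auto
  let ?y = "head Q a"
  let ?c = "circ C du (rev (vlist ?y p)) (snd ?y) [fst ?y, fst x] (snd x) (darr a) (\<Phi> ?y p)"
  have rd: "D.reps_at [fst ?y, fst x] (snd ?y) (snd x)" using reps_at_rev[OF arrow_reps[OF a(1)]] a(2) by simp
  have F: "\<Phi> x (a # p) = ?c" using D.circ_id_right[OF rd] dual_arrow(1)[OF a(1)] a(2) by (cases p) auto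
  have l: "last (rev (vlist ?y p)) = fst ?y" using path_props(3)[OF a(3)] by (simp add: last_rev)
  have "?c \<in> Hom C du (rev (vlist ?y p) @ tl [fst ?y, fst x]) (snd (pend ?y p)) (snd x)"
   using Cons.IH[OF a(3)] dual_arrow(1)[OF a(1)] reps_at_rev[OF path_reps[OF a(3)]] rd l
   by (intro D.circ_Hom) (auto simp: a(2))
  then show ?case using F a(2) by simp
 qed
 then show "\<Phi> x p \<in> Hom C du (rev (vlist x p)) (snd (pend x p)) (snd x)"
  "p = a # p' ==> \<Phi> x p = circ C du (rev (vlist (head Q a) p')) (snd (head Q a)) [fst (head Q a), fst x] (snd x)
   (darr a) (\<Phi> (head Q a) p')" by blast+
qed

lemma F_append:
 assumes "(x, p @ q) \<in> paths Q"
 shows "F x (p @ q) = circ C N (vlist x p) (snd (pend x p)) (vlist (pend x p) q) (snd (pend x (p @ q))) (F (pend x p) q) (F x p)"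
 using assms
proof (induction p arbitrary: x)
 case Nil
 then show ?case using circ_id_right[OF path_reps F_Hom path_props(3)] by simp
next
 case (Cons a p)
 let ?y = "head Q a" and ?z = "pend (head Q a) p"
 have a: "a \<in> arcs Q" "x = tail Q a" "(?y, p @ q) \<in> paths Q" "(x, a # p) \<in> paths Q"
  "(?y, p) \<in> paths Q" "(?z, q) \<in> paths Q" using Cons.prems by (auto simp: Q.paths_append)
 have h: "hd (vlist ?y p) = fst ?y" "hd (vlist ?z q) = fst ?z" by (rule path_props(3)[OF a(5)], rule path_props(3)[OF a(6)])
 have l: "[fst x, fst ?y] @ tl (vlist ?y p) = vlist x (a # p)" using vlist_Cons[OF a(5)] a(2) by simp
 have "F x (a # p @ q) = circ C N [fst x, fst ?y] (snd ?y) (vlist ?y p @ tl (vlist ?z q)) (snd (pend ?y (p @ q)))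
   (circ C N (vlist ?y p) (snd ?z) (vlist ?z q) (snd (pend ?z q)) (F ?z q) (F ?y p)) (lab a)"
  using F_Cons[OF Cons.prems, of a "p @ q"] Cons.IH[OF a(3)] vlist_append[OF a(3)] by (simp add: Q.path_end_append)
 also have "\<dots> = circ C N ([fst x, fst ?y] @ tl (vlist ?y p)) (snd ?z) (vlist ?z q) (snd (pend ?z q)) (F ?z q)
   (circ C N [fst x, fst ?y] (snd ?y) (vlist ?y p) (snd ?z) (F ?y p) (lab a))" unfolding Q.path_end_append a(2)
  by (rule circ_assoc[OF arrow_reps[OF a(1)] path_reps[OF a(5)] path_reps[OF a(6)] _ _ arrow_Hom[OF a(1)] F_Hom[OF a(5)] F_Hom[OF a(6)]])
    (simp_all only: h last_vlist last.simps list.simps simp_thms if_True if_False)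
 also have "circ C N [fst x, fst ?y] (snd ?y) (vlist ?y p) (snd ?z) (F ?y p) (lab a) = F x (a # p)"
  using F_Cons[OF a(4), of a p] by simp
 finally show ?case unfolding l by (simp add: Q.path_end_append)
qed

lemma T_pair_sum: "T [i, j] V U f \<phi> u = (\<Sum>y\<in>cos_reps C j. \<Sum>b\<in>Bas i (pact C y j).
  D.opr [j, i] U \<phi> (dwd [(y, b)]) (opr [i, j] V f (star [i, j] [(y, b)]) u))" if "j \<in> pts C"
proof -
 have "yseqs C [j] = {[]}" by auto
 then show ?thesis unfolding T_def sum_yseqs_Cons sum_bw_Cons by simp
qed

text \<open>\<open>T_Cons\<close> peels off the first arrows. By induction the operator of the tails
  is zero or the identity, and in the latter case one pair of arrows is left, to which Schur's lemma
  and the dual basis apply. Only the points and the final representation are assumed equal, because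
  the tails may start at different representations.\<close>

lemma T_paths:
 assumes "(x, p) \<in> paths Q" "(x', p') \<in> paths Q" "vlist x p = vlist x' p'" "snd (pend x p) = W" "snd (pend x' p') = W"
  and "u \<in> space (snd x)"
 shows "T (vlist x p) W (snd x') (F x p) (\<Phi> x' p') u = (if x = x' \<and> p = p' then u else 0)" using assms
proof (induction p arbitrary: x x' p' u)
 case Nil
 then have "length (vlist x' p') = Suc 0" by (metis Q.length_awalk_verts length_map list.size(3))
 then have p': "p' = []" by (simp add: Q.length_awalk_verts)
 then have x: "x' = x" using Nil by (simp add: prod_eq_iff)
 have v: "x \<in> verts Q" using Nil by simp
 note i = vert(2)[OF v] vert(4)[OF v]
 show ?case using Nil opr_id_hom[OF i] D.opr_id_hom[OF i] unfolding p' x by (simp add: T_Nil[OF i(1)])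
next
 case (Cons a p)
 then have "length (vlist x' p') = Suc (Suc (length p))" by (metis Q.length_awalk_verts length_map length_Cons)
 then obtain a' q where p': "p' = a' # q" by (auto simp: Q.length_awalk_verts length_Suc_conv)
 let ?y = "head Q a" and ?y' = "head Q a'"
 have a: "a \<in> arcs Q" "x = tail Q a" "(?y, p) \<in> paths Q" and a': "a' \<in> arcs Q" "x' = tail Q a'" "(?y', q) \<in> paths Q"
  using Cons.prems by (auto simp: p')
 have fx: "fst x' = fst x" and vl: "vlist ?y p = vlist ?y' q" using Cons.prems(3) a(2) a'(2) by (auto simp: p')
 have fy: "fst ?y' = fst ?y" using path_props(3)[OF a(3)] path_props(3)[OF a'(3)] vl by simp
 have W: "snd (pend ?y p) = W" "snd (pend ?y' q) = W" using Cons.prems by (auto simp: p')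
 obtain js where js: "vlist ?y p = fst ?y # js" "vlist ?y' q = fst ?y # js" using vlist_Cons[OF a(3)] vl by metis
 have r1: "reps_at [fst x, fst ?y] (snd x) (snd ?y)" "reps_at [fst x, fst ?y] (snd x') (snd ?y')"
  using arrow_reps[OF a(1)] arrow_reps[OF a'(1)] a(2) a'(2) fx fy by simp_all
 have r2: "reps_at (fst ?y # js) (snd ?y) W" "reps_at (fst ?y # js) (snd ?y') W"
  using path_reps[OF a(3)] path_reps[OF a'(3)] js W by simp_all
 have f: "lab a \<in> Hom C N [fst x, fst ?y] (snd x) (snd ?y)" "F ?y p \<in> Hom C N (fst ?y # js) (snd ?y) W"
  using arrow_Hom[OF a(1)] F_Hom[OF a(3)] a(2) js W by simp_all
 have \<phi>: "darr a' \<in> Hom C du [fst ?y, fst x] (snd ?y') (snd x')" "\<Phi> ?y' q \<in> Hom C du (rev (fst ?y # js)) W (snd ?y')"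
  using dual_arrow(1)[OF a'(1)] \<Phi>_Hom[OF a'(3)] a'(2) fx fy js W by simp_all
 note u = \<open>u \<in> space (snd x)\<close>
 have vx: "x \<in> verts Q" "x' \<in> verts Q" "?y \<in> verts Q" using a a' by auto
 note ij = vert(2)[OF vx(1)] vert(2)[OF vx(3)]
 have "T (vlist x (a # p)) W (snd x') (F x (a # p)) (\<Phi> x' p') u =
  (\<Sum>y\<in>cos_reps C (fst ?y). \<Sum>b\<in>Bas (fst x) (pact C y (fst ?y)). D.opr [fst ?y, fst x] (snd x') (darr a') (dwd [(y, b)])
    (T (fst ?y # js) W (snd ?y') (F ?y p) (\<Phi> ?y' q) (opr [fst x, fst ?y] (snd ?y) (lab a) (star [fst x, fst ?y] [(y, b)]) u)))"
  using T_Cons[OF r1(1) r2(1) r1(2) r2(2) f \<phi> u] F_Cons[OF Cons.prems(1), of a p] \<Phi>_Cons[OF Cons.prems(2), of a' q]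
  by (simp add: p' js W fx fy a(2)[symmetric])
 also have "\<dots> = (\<Sum>y\<in>cos_reps C (fst ?y). \<Sum>b\<in>Bas (fst x) (pact C y (fst ?y)). D.opr [fst ?y, fst x] (snd x') (darr a') (dwd [(y, b)])
    (if ?y = ?y' \<and> p = q then opr [fst x, fst ?y] (snd ?y) (lab a) (star [fst x, fst ?y] [(y, b)]) u else 0))"
 proof (intro sum.cong refl arg_cong[where f = "D.opr _ _ _ _"])
  fix y b assume y: "y \<in> cos_reps C (fst ?y)"
  have "vw [fst x, fst ?y] (star [fst x, fst ?y] [(y, b)])" using ij cos_reps_Gr[OF ij(2) y] cof_dual by simp
  from Cons.IH[OF a(3) a'(3) vl W opr_in[OF r1(1) f(1) this u]]
  show "T (fst ?y # js) W (snd ?y') (F ?y p) (\<Phi> ?y' q) (opr [fst x, fst ?y] (snd ?y) (lab a) (star [fst x, fst ?y] [(y, b)]) u) =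
    (if ?y = ?y' \<and> p = q then opr [fst x, fst ?y] (snd ?y) (lab a) (star [fst x, fst ?y] [(y, b)]) u else 0)"
   unfolding js .
 qed
 also have "\<dots> = (if x = x' \<and> a # p = p' then u else 0)"
 \<comment> \<open>If the tails differ, every term is a linear operator at 0; if they agree, the sum
   is the \<open>T\<close> of the two first arrows.\<close>
 proof (cases "?y = ?y' \<and> p = q")
  case False
  have Dr: "D.reps_at [fst ?y, fst x] (snd ?y') (snd x')" using reps_at_rev[OF r1(2)] by simp
  have "D.opr [fst ?y, fst x] (snd x') (darr a') (dwd [(y, b)]) 0 = 0"
   if "y \<in> cos_reps C (fst ?y)" "b \<in> Bas (fst x) (pact C y (fst ?y))" for y b
   using dwd_vw[of "[fst x, fst ?y]" "[(y, b)]"] ij cos_reps_Gr[OF ij(2) that(1)] Bas_bcar[OF that(2)]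
   by (intro linear_on_0[OF D.opr_linear[OF Dr \<phi>(1)] vsp_0[OF rep_vsp[OF D.reps_atD(3)[OF Dr]]]]) simp
  then show ?thesis using False by (auto simp: p')
 next
  case True
  have R: "rep2 (fst x) (fst ?y) (snd x) (snd ?y)" "rep2 (fst x) (fst ?y) (snd x') (snd ?y)"
   using r1 True by (simp_all add: rep2_reps_at)
  have \<phi>1: "darr a' \<in> Hom C du [fst ?y, fst x] (snd ?y) (snd x')" using \<phi>(1) True by simp
  have "T [fst x, fst ?y] (snd ?y) (snd x') (lab a) (darr a') u = (if x = x' \<and> a = a' then u else 0)"
  proof (cases "x = x'")
   case x: True
   have "a \<in> arrows Q (tail Q a') (head Q a')" using a a' True x by simp
   from dual_arrow(2)[OF a'(1) this]
   have "pairing C N [fst x, fst ?y] (snd x) (snd ?y) (lab a) (darr a') = (if a = a' then 1 else 0)"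
    using x True a'(2) by simp
   then show ?thesis using T_pairing[OF R(1) f(1) _ vert(5)[OF vx(1)] u] \<phi>1 x
     vsp_simps(4,5)[OF rep_vsp[OF vert(4)[OF vx(1)]]] by auto
  next
   case False
   then have "snd x \<noteq> snd x'" using fx by (simp add: prod_eq_iff)
   then show ?thesis using T_zero[OF R f(1) \<phi>1 irr_pts[OF ij(1)] _ _ _ u] vert(3)[OF vx(1)] vert(3)[OF vx(2)] fx False by simp
  qed
  then show ?thesis using True unfolding T_pair_sum[OF ij(2)] by (auto simp: p')
 qed
 finally show ?case .
qed

end

section \<open>Spanning by paths and the expansion formula\<close>

lemma linear_on_span:
 assumes L: "linear_on s1 s2 A L" and A: "vsp s1 A" and s2: "vector_space s2" and B: "B \<subseteq> A"
  and LB: "\<And>b. b \<in> B ==> L b \<in> Modules.module.span s2 S" and x: "x \<in> Modules.module.span s1 B"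
 shows "L x \<in> Modules.module.span s2 S"
proof -
 interpret s1: vector_space s1 by (rule vsp_vs[OF A])
 interpret s2: vector_space s2 by fact
 have "vsp s1 {x \<in> A. L x \<in> s2.span S}" using linear_on_0[OF L vsp_0[OF A]] linear_on_add[OF L] linear_on_scale[OF L]
  by (intro vspI[OF s1.vector_space_axioms])
    (auto intro: vsp_0[OF A] vsp_add[OF A] vsp_scale[OF A] s2.span_zero s2.span_add s2.span_scale)
 then have "s1.span B \<subseteq> {x \<in> A. L x \<in> s2.span S}" using B LB by (intro s1.span_minimal) (auto simp: vsp_def)
 then show ?thesis using x by blast
qed

text \<open>Coefficients are indexed by I and not by the image, since distinct paths are not assumed
  to give distinct intertwiners at this stage.\<close>

lemma span_image_sum:
 assumes s: "vector_space s" and I: "finite I" and x: "x \<in> Modules.module.span s (f ` I)"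
 shows "\<exists>c. x = (\<Sum>i\<in>I. s (c i) (f i))"
proof -
 interpret vector_space s by fact
 show ?thesis using x
 proof (induction rule: span_induct_alt)
  case base
  show ?case by (intro exI[of _ "\<lambda>_. 0"]) simp
 next
  case (step c x y)
  then obtain i d where i: "i \<in> I" "x = f i" "y = (\<Sum>i\<in>I. s (d i) (f i))" by blast
  have "(\<Sum>k\<in>I. s (if k = i then c else 0) (f k)) = (\<Sum>k\<in>I. if k = i then s c (f k) else 0)" by (intro sum.cong) auto
  also have "\<dots> = s c x" using i I by simp
  finally show ?case using i
   by (intro exI[of _ "\<lambda>k. (if k = i then c else 0) + d k"]) (simp add: scale_left_distrib sum.distrib)
 qed
qed

context intertwiner_quiver begin

definition paths_of :: "('g, 'i, 'k, 'v) idx => (('g, 'i, 'k, 'v) vertex \<times> 'a list) set" where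
 "paths_of \<alpha> = {\<gamma>. \<gamma> \<in> paths Q \<and> path_idx Q \<gamma> = \<alpha>}"

lemma path_idx: "path_idx Q (x, p) = (vlist x p, snd x, snd (pend x p))" by (simp add: path_idx_def)

text \<open>Finiteness of the vertex set, which rests on the finite number of irreducibles, is what
  gives the path algebra a unit.\<close>

lemma finite_verts: "finite (verts Q)"
proof -
 have "finite (irr i)" if "i \<in> orb_reps C" for i
 proof -
  have i: "i \<in> pts C" using that orb_reps_pts by blast
  interpret Si: finite_subgroup "grp C" "stab C i"
   by (intro finite_subgroup.intro finite_subgroup_axioms.intro is_group stab_subgroup i finite_stab)
  show ?thesis by (rule Si.finite_irr_reps[OF irr_pts[OF i] card_stab[OF i]])
 qed
 then show ?thesis unfolding verts_Q using finite_subset[OF orb_reps_pts finite_pts] by blast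
qed

lemma finite_arcs: "finite (arcs Q)"
proof -
 have "finite (arrows Q x y)" if "x \<in> verts Q" "y \<in> verts Q" for x y
 proof -
  have "reps_at [fst x, fst y] (snd x) (snd y)" using vert that by (simp add: reps_at_def)
  then have "finite (lab ` arrows Q x y)"
   using basis_finite[OF vs_pw3(3) Hom_fin_dim arrow_basis(2)[OF that]] by blast
  then show ?thesis by (rule finite_imageD[OF _ arrow_basis(1)[OF that]])
 qed
 then have "finite (\<Union>x\<in>verts Q. \<Union>y\<in>verts Q. arrows Q x y)" using finite_verts by blast
 moreover have "arcs Q \<subseteq> (\<Union>x\<in>verts Q. \<Union>y\<in>verts Q. arrows Q x y)" by auto
 ultimately show ?thesis by (rule finite_subset[rotated])
qed

text \<open>The index fixes the length of a path, and the quiver is finite.\<close>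

lemma finite_paths_of: "finite (paths_of \<alpha>)"
proof -
 obtain "is" U V where \<alpha>: "\<alpha> = (is, U, V)" by (cases \<alpha>)
 have arcs: "a \<in> arcs Q" if "(x, p) \<in> paths Q" "a \<in> set p" for x p a
  using that unfolding paths_def by (auto elim: Q.awalkE)
 have "paths_of \<alpha> \<subseteq> verts Q \<times> {p. set p \<subseteq> arcs Q \<and> length p = length is - 1}"
  using path_props(1) arcs by (auto simp: paths_of_def \<alpha> path_idx Q.length_awalk_verts)
 then show ?thesis using finite_verts finite_lists_length_eq[OF finite_arcs] by (meson finite_SigmaI finite_subset)
qed

lemma paths_of_Hom: "\<delta> \<in> paths_of (is, U, W) ==> (\<lambda>(x, p). F x p) \<delta> \<in> Hom C N is U W"
 using F_Hom[of "fst \<delta>" "snd \<delta>"] by (cases \<delta>) (simp add: paths_of_def path_idx)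

text \<open>For n = 0 the module is W itself, so Schur's lemma leaves only the multiples of the
  identity. This starts the induction in \<open>F_span\<close>.\<close>

lemma Hom_single:
 assumes i: "i \<in> pts C" and U: "U \<in> irr i" and W: "W \<in> irr i" and f: "f \<in> Hom C N [i] U W" "f \<noteq> 0"
 shows "W = U \<and> (\<exists>c. f = hscale c (id_hom N U))"
proof -
 note irrU = irr_irreducible[OF i U] and irrW = irr_irreducible[OF i W]
 have rU: "rep_at i U" and rW: "rep_at i W" using irrU irrW by (auto dest: irreducible_rep_is_rep)
 have r: "reps_at [i] U W" and rr: "reps_at [i] U U" using i rU rW by (auto simp: reps_at_def)
 have w: "vw [i] []" using i by simp
 have eq: "eqvar (stab C i) U W (opr [i] W f [])"
  using opr_in[OF r f(1) w] opr_linear[OF r f(1) w] opr_gact[OF r f(1) w] by (auto simp: eqvar_def)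
 have "\<exists>u\<in>space U. opr [i] W f [] u \<noteq> 0"
 proof (rule ccontr)
  assume z: "\<not> (\<exists>u\<in>space U. opr [i] W f [] u \<noteq> 0)"
  have 0: "opr [i] W 0 [] u = 0" if "u \<in> space U" for u
   using linear_on_0[OF opr_linear_morph[OF r w that] vsp_0[OF Hom_vsp[OF r]]] .
  have "f = 0" by (rule opr_eqI[OF r f(1) vsp_0[OF Hom_vsp[OF r]]]) (use z 0 in auto)
  then show False using f(2) by blast
 qed
 then obtain u where u: "u \<in> space U" "opr [i] W f [] u \<noteq> 0" by blast
 have "rep_isomorphic (stab C i) U W" by (rule bij_eqvar_rep_isomorphic[OF eq schur_bij[OF irrU irrW eq u]])
 then have WU: "W = U" using irr_pts[OF i] U W by (auto simp: irr_reps_def)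
 obtain c where c: "\<forall>u\<in>space U. opr [i] W f [] u = scal U c u" using schur_scalar[OF irrU] eq WU by blast
 note I = id_hom_Hom[OF i rU]
 have "f = hscale c (id_hom N U)"
 proof (rule opr_eqI[OF rr f(1)[unfolded WU] vsp_scale[OF Hom_vsp[OF rr] I]])
  fix w' u assume w': "vw [i] w'" and u: "u \<in> space U"
  then have "w' = []" by simp
  then show "opr [i] U f w' u = opr [i] U (hscale c (id_hom N U)) w' u"
   using c u opr_scale[OF rr I w u] opr_id_hom[OF i rU u] WU by simp
 qed
 then show ?thesis using WU by blast
qed

text \<open>Each summand of \<open>Hom_split\<close> is bilinear in an element of an arrow space and
  a shorter intertwiner. Expanding the latter by induction and the former in arrows yields the
  intertwiners of paths with one more arrow.\<close>

lemma F_span: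
 assumes "set is \<subseteq> orb_reps C" "is \<noteq> []" "U \<in> irr (hd is)" "W \<in> irr (last is)" "f \<in> Hom C N is U W"
 shows "f \<in> Modules.module.span hscale ((\<lambda>(x, p). F x p) ` paths_of (is, U, W))" using assms
proof (induction "is" arbitrary: U f rule: induct_list012)
 case 1
 then show ?case by simp
next
 interpret K: vector_space "hscale :: 'k => ('g, 'k, 'm, 'v) morph => _" by (rule vs_pw3(3))
 case (2 i)
 then have i: "i \<in> pts C" using orb_reps_pts by auto
 show ?case
 proof (cases "f = 0")
  case True
  then show ?thesis by (simp only: K.span_zero)
 next
  case False
  then obtain c where c: "W = U" "f = hscale c (id_hom N U)" using Hom_single[OF i _ _ _ False, of U W] 2 by auto
  have "((i, U), []) \<in> paths_of ([i], U, W)" using 2 c(1) by (simp add: paths_of_def path_idx verts_Q)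
  then have "id_hom N U \<in> (\<lambda>(x, p). F x p) ` paths_of ([i], U, W)" by (rule rev_image_eqI) simp
  then show ?thesis unfolding c(2) by (intro K.span_scale K.span_base)
 qed
next
 interpret K: vector_space "hscale :: 'k => ('g, 'k, 'm, 'v) morph => _" by (rule vs_pw3(3))
 case (3 i j js)
 let ?S = "(\<lambda>(x, p). F x p) ` paths_of (i # j # js, U, W)"
 have ij: "i \<in> orb_reps C" "j \<in> orb_reps C" "i \<in> pts C" "j \<in> pts C" "set js \<subseteq> pts C" using 3 orb_reps_pts by auto
 have "last (j # js) \<in> set (j # js)" by (rule last_in_set) simp
 then have last: "last (j # js) \<in> pts C" using ij(4,5) by (auto simp del: last.simps)
 have rU: "rep_at i U" and rW: "rep_at (last (j # js)) W"
  using irr_irreducible[OF ij(3), of U, THEN irreducible_rep_is_rep] irr_irreducible[OF last, of W, THEN irreducible_rep_is_rep] 3(5,6)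
  by simp_all
 have r: "reps_at (i # j # js) U W" using rU rW ij by (simp add: reps_at_def)
 obtain n :: nat and V f1 f2 where s:
  "\<forall>a<n. V a \<in> irr j \<and> f1 a \<in> Hom C N [i, j] U (V a) \<and> f2 a \<in> Hom C N (j # js) (V a) W"
  "f = (\<Sum>a<n. circ C N [i, j] (V a) (j # js) W (f2 a) (f1 a))" using Hom_split[OF r 3(7) irr_pts[OF ij(4)]] by blast
 have "circ C N [i, j] (V a) (j # js) W (f2 a) (f1 a) \<in> K.span ?S" if "a < n" for a
 proof -
  have V: "V a \<in> irr j" and f1: "f1 a \<in> Hom C N [i, j] U (V a)" and f2: "f2 a \<in> Hom C N (j # js) (V a) W"
   using s(1) that by auto
  have x: "(i, U) \<in> verts Q" and y: "(j, V a) \<in> verts Q" using 3 V by (auto simp: verts_Q)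
  have rV: "rep_at j (V a)" using vert(4)[OF y] by simp
  have r1: "reps_at [i, j] U (V a)" and r2: "reps_at (j # js) (V a) W" using ij rU rV rW by (auto simp: reps_at_def)
  have IH: "f2 a \<in> K.span ((\<lambda>(x, p). F x p) ` paths_of (j # js, V a, W))" by (rule "3.IH"(2)) (use 3 V f2 in auto)
  have b: "Hom C N [i, j] U (V a) = K.span (lab ` arrows Q (i, U) (j, V a))"
   using arrow_basis(2)[OF x y] by (simp add: is_basis_def)
  have lj: "last [i, j] = hd (j # js)" by simp
  show ?thesis
  proof (rule linear_on_span[OF circ_linear_left[OF r1 r2 lj f1] Hom_vsp[OF r2] K.vector_space_axioms _ _ IH])
   show "(\<lambda>(x, p). F x p) ` paths_of (j # js, V a, W) \<subseteq> Hom C N (j # js) (V a) W"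
    by (intro image_subsetI paths_of_Hom)
   fix g assume "g \<in> (\<lambda>(x, p). F x p) ` paths_of (j # js, V a, W)"
   then obtain x p where g: "g = F x p" "(x, p) \<in> paths Q" "vlist x p = j # js" "snd x = V a" "snd (pend x p) = W"
    by (auto simp: paths_of_def path_idx)
   have "fst x = j" using path_props(3)[OF g(2)] g(3) by simp
   then have gx: "x = (j, V a)" using g(4) by (simp add: prod_eq_iff)
   have gH: "g \<in> Hom C N (j # js) (V a) W" using F_Hom[OF g(2)] g by simp
   show "circ C N [i, j] (V a) (j # js) W g (f1 a) \<in> K.span ?S"
   proof (rule linear_on_span[OF circ_linear_right[OF r1 r2 lj gH] Hom_vsp[OF r1] K.vector_space_axioms _ _ f1[unfolded b]])
    show "lab ` arrows Q (i, U) (j, V a) \<subseteq> Hom C N [i, j] U (V a)" unfolding b by (rule K.span_superset)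
    fix l assume "l \<in> lab ` arrows Q (i, U) (j, V a)"
    then obtain c where c: "l = lab c" "c \<in> arcs Q" "tail Q c = (i, U)" "head Q c = (j, V a)" by auto
    have P: "((i, U), c # p) \<in> paths Q" using c g(2) gx by simp
    have "((i, U), c # p) \<in> paths_of (i # j # js, U, W)" using P c g gx by (simp add: paths_of_def path_idx)
    moreover have "circ C N [i, j] (V a) (j # js) W g l = F (i, U) (c # p)" using F_Cons[OF P refl] c g gx by simp
    ultimately show "circ C N [i, j] (V a) (j # js) W g l \<in> K.span ?S"
     by (intro K.span_base) (auto intro!: rev_image_eqI)
   qed
  qed
 qed
 then show ?case unfolding s(2) by (intro K.span_sum) simp
qed

text \<open>Orthogonality of paths read linearly. It yields at once the independence of the path
  intertwiners and the values of the coefficients.\<close>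

lemma pairing_coefficient:
 assumes \<gamma>: "(x, p) \<in> paths_of (is, U, W)"
 shows "pairing C N is U W (\<Sum>(x, p)\<in>paths_of (is, U, W). hscale (c (x, p)) (F x p)) (\<Phi> x p) = c (x, p)"
proof -
 let ?P = "paths_of (is, U, W)" and ?f = "\<Sum>(x, p)\<in>paths_of (is, U, W). hscale (c (x, p)) (F x p)"
 have x: "(x, p) \<in> paths Q" "is = vlist x p" "U = snd x" "W = snd (pend x p)" using \<gamma> by (auto simp: paths_of_def path_idx)
 have r: "reps_at is U W" using path_reps[OF x(1)] x by simp
 note vU = rep_vsp[OF reps_atD(3)[OF r]]
 note vs = vsp_simps[OF vU]
 note FH = paths_of_Hom[of _ "is" U W]
 have f: "?f = (\<Sum>\<delta>\<in>?P. hscale (c \<delta>) ((\<lambda>(x, p). F x p) \<delta>))" by (simp add: case_prod_beta)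
 have \<Phi>: "\<Phi> x p \<in> Hom C du (rev is) W U" using \<Phi>_Hom[OF x(1)] x by simp
 show ?thesis
 proof (rule pairing_eqI[OF r _ \<Phi>])
  show "?f \<in> Hom C N is U W" unfolding f by (intro vsp_sum[OF Hom_vsp[OF r]] vsp_scale[OF Hom_vsp[OF r]] FH)
  show "space U \<noteq> {0}" using vert(5)[OF path_props(1)[OF x(1)]] x(3) by (simp add: irreducible_rep_def)
  fix u assume u: "u \<in> space U"
  have "T is W U ?f (\<Phi> x p) u = (\<Sum>\<delta>\<in>?P. scal U (c \<delta>) (T is W U ((\<lambda>(x, p). F x p) \<delta>) (\<Phi> x p) u))"
   unfolding f by (rule linear_on_combination[OF T_linear_f[OF r r \<Phi> u] Hom_vsp[OF r] FH])
  also have "\<dots> = (\<Sum>\<delta>\<in>?P. if \<delta> = (x, p) then scal U (c \<delta>) u else 0)"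
  proof (intro sum.cong refl)
   fix \<delta> assume "\<delta> \<in> ?P"
   then obtain y q where y: "\<delta> = (y, q)" "(y, q) \<in> paths Q" "vlist y q = vlist x p" "snd y = U" "snd (pend y q) = W" using x
    by (cases \<delta>) (auto simp: paths_of_def path_idx)
   show "scal U (c \<delta>) (T is W U ((\<lambda>(x, p). F x p) \<delta>) (\<Phi> x p) u) = (if \<delta> = (x, p) then scal U (c \<delta>) u else 0)"
    using T_paths[OF y(2) x(1) y(3,5) x(4)[symmetric], of u] u x y by (simp add: vs vs[unfolded x(3)])
  qed
  also have "\<dots> = scal U (c (x, p)) u" using \<gamma> finite_paths_of by simp
  finally show "T is W U ?f (\<Phi> x p) u = scal U (c (x, p)) u" .
 qed
qed

text \<open>Spanning provides some coefficients; pairing with the dual intertwiners shows what they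
  are.\<close>

lemma intertwiner_expansion:
 assumes "is \<noteq> []" "set is \<subseteq> orb_reps C" "U \<in> irr (hd is)" "W \<in> irr (last is)" and f: "f \<in> Hom C N is U W"
 shows "f = (\<Sum>(x, p)\<in>paths_of (is, U, W). hscale (pairing C N is U W f (\<Phi> x p)) (F x p))"
proof -
 obtain c where c: "f = (\<Sum>\<delta>\<in>paths_of (is, U, W). hscale (c \<delta>) ((\<lambda>(x, p). F x p) \<delta>))"
  using span_image_sum[OF vs_pw3(3) finite_paths_of F_span[OF assms(2,1,3,4) f]] by blast
 then have f: "f = (\<Sum>(x, p)\<in>paths_of (is, U, W). hscale (c (x, p)) (F x p))" by (simp add: case_prod_beta)
 have pc: "pairing C N is U W f (\<Phi> x p) = c (x, p)" if "(x, p) \<in> paths_of (is, U, W)" for x p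
  by (subst f) (rule pairing_coefficient[OF that])
 note f
 also have "(\<Sum>(x, p)\<in>paths_of (is, U, W). hscale (c (x, p)) (F x p)) =
   (\<Sum>(x, p)\<in>paths_of (is, U, W). hscale (pairing C N is U W f (\<Phi> x p)) (F x p))"
  by (rule sum.cong[OF refl]) (clarify, simp only: pc split)
 finally show ?thesis .
qed

end

section \<open>Finitely supported families\<close>

abbreviation supp :: "('x => 'b::zero) => 'x set" where "supp a \<equiv> {x. a x \<noteq> 0}"

lemma finsupp_induct [consumes 1, case_names zero add]:
 fixes a :: "'x => 'b::ab_group_add"
 assumes fin: "finite (supp a)" and zero: "P 0"
  and add: "\<And>x b. a x \<noteq> 0 ==> supp b \<subseteq> supp a ==> P b ==> P (single x (a x) + b)"
 shows "P a"
proof -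
 have "P (\<Sum>x\<in>S. single x (a x))" if "finite S" "S \<subseteq> supp a" for S using that
 proof (induction S)
  case (insert x S)
  have "{y. (\<Sum>x\<in>S. single x (a x)) y \<noteq> 0} \<subseteq> S"
   using insert(1) by (auto simp: sum_apply single_apply split: if_splits intro: ccontr)
  then have "P (single x (a x) + (\<Sum>x\<in>S. single x (a x)))" using insert by (intro add) auto
  then show ?case unfolding sum.insert[OF insert(1,2)] .
 qed (simp add: zero)
 moreover have "(\<Sum>x\<in>supp a. single x (a x)) = a" using fin by (auto simp: fun_eq_iff sum_apply single_apply)
 ultimately show ?thesis using fin by (metis subset_refl)
qed

lemma vsp_finsupp:
 assumes s: "vector_space s" and A: "\<And>x. x \<in> I ==> vsp s (A x)"
 shows "vsp (pw s) {a. finite (supp a) \<and> supp a \<subseteq> I \<and> (\<forall>x\<in>I. a x \<in> A x)}"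
proof (rule vspI[OF vector_space_pw[OF s]])
 fix a b assume a: "a \<in> {a. finite (supp a) \<and> supp a \<subseteq> I \<and> (\<forall>x\<in>I. a x \<in> A x)}"
  and b: "b \<in> {a. finite (supp a) \<and> supp a \<subseteq> I \<and> (\<forall>x\<in>I. a x \<in> A x)}"
 have "supp (a + b) \<subseteq> supp a \<union> supp b" by auto
 then show "a + b \<in> {a. finite (supp a) \<and> supp a \<subseteq> I \<and> (\<forall>x\<in>I. a x \<in> A x)}"
  using a b finite_subset[of "supp (a + b)" "supp a \<union> supp b"] vsp_add[OF A] by auto
next
 fix c a assume a: "a \<in> {a. finite (supp a) \<and> supp a \<subseteq> I \<and> (\<forall>x\<in>I. a x \<in> A x)}"
 have "{x. pw s c a x \<noteq> 0} \<subseteq> supp a" by (auto simp: pw_def vs_simps[OF s])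
 then show "pw s c a \<in> {a. finite (supp a) \<and> supp a \<subseteq> I \<and> (\<forall>x\<in>I. a x \<in> A x)}"
  using a finite_subset[of "{x. pw s c a x \<noteq> 0}" "supp a"] vsp_scale[OF A] by (auto simp: pw_def)
qed (auto intro: vsp_0[OF A])

text \<open>Products are sums over the supports of the factors, which change under addition and
  scaling. Enlarging the index sets brings all products in a distributive law to the same range of
  summation.\<close>

lemma sum_supports:
 assumes S: "finite S" "finite S'" and ab: "supp a \<subseteq> S" "supp b \<subseteq> S'"
  and t: "\<And>x y. P x y ==> x \<in> S ==> y \<in> S' ==> a x = 0 \<or> b y = 0 ==> t x y = 0"
 shows "(\<Sum>(x, y)\<in>{(x, y). a x \<noteq> 0 \<and> b y \<noteq> 0 \<and> P x y}. t x y) = (\<Sum>x\<in>S. \<Sum>y\<in>S'. if P x y then t x y else 0)"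
proof -
 have "(\<Sum>(x, y)\<in>{(x, y). a x \<noteq> 0 \<and> b y \<noteq> 0 \<and> P x y}. t x y) = (\<Sum>(x, y)\<in>S \<times> S'. if P x y then t x y else 0)"
  using S ab t by (intro sum.mono_neutral_cong_left) (auto split: if_splits)
 then show ?thesis by (simp add: sum.cartesian_product)
qed

lemma abelian_group_vsp:
 assumes A: "vsp s (carrier R)" and R: "zero R = 0" "add R = (+)"
 shows "abelian_group R"
proof (rule abelian_groupI)
 show "\<exists>y\<in>carrier R. y \<oplus>\<^bsub>R\<^esub> x = \<zero>\<^bsub>R\<^esub>" if "x \<in> carrier R" for x
  using vsp_diff[OF A vsp_0[OF A] that] by (intro bexI[of _ "0 - x"]) (auto simp: R)
qed (auto simp: R add_ac intro: vsp_add[OF A] vsp_0[OF A])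

lemma module_vsp:
 fixes s :: "'k::field => 'a::ab_group_add => 'a"
 assumes A: "vsp s (carrier R)" and R: "zero R = 0" "add R = (+)" "module.smult R = s"
 shows "Module.module (ring_of_type_algebra :: 'k ring) R" using vsp_simps[OF A]
 by (intro moduleI cring_from_type_algebra abelian_group_vsp[OF A R(1,2)])
   (auto simp: R ring_of_type_algebra_def intro: vsp_scale[OF A])

section \<open>The path algebra as an algebra over the field\<close>

context wf_digraph begin

abbreviation pmult (infixl "\<star>" 70) where "a \<star> b \<equiv> a \<otimes>\<^bsub>path_algebra G\<^esub> b"
abbreviation pone where "pone \<equiv> \<one>\<^bsub>path_algebra G\<^esub>"
abbreviation pcar where "pcar \<equiv> carrier (path_algebra G)"

lemma path_algebra_vsp: "vsp (pw (*)) (pcar :: (_ => 'k::field) set)"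
 using vsp_finsupp[OF vector_space_mult, of "paths G" "\<lambda>_. UNIV"] vspI[OF vector_space_mult, of UNIV]
 by (simp add: path_algebra_def)

lemma path_mult_eq:
 assumes "finite S" "finite S'" "supp a \<subseteq> S" "supp b \<subseteq> S'"
 shows "a \<star> b = (\<Sum>g\<in>S. \<Sum>h\<in>S'. if path_end G (fst g) (snd g) = fst h
  then single (fst g, snd g @ snd h) (a g * b h) else 0)"
proof -
 have "a \<star> b = (\<Sum>(g, h)\<in>{(g, h). a g \<noteq> 0 \<and> b h \<noteq> 0 \<and> path_end G (fst g) (snd g) = fst h}.
   single (fst g, snd g @ snd h) (a g * b h))"
  unfolding path_algebra_def by (auto simp: case_prod_beta intro: sum.cong)
 also have "\<dots> = (\<Sum>g\<in>S. \<Sum>h\<in>S'. if path_end G (fst g) (snd g) = fst h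
  then single (fst g, snd g @ snd h) (a g * b h) else 0)"
  by (rule sum_supports[OF assms]) (auto simp: single_def fun_eq_iff)
 finally show ?thesis .
qed

lemma path_mult_single:
 "single g c \<star> single h d = (if path_end G (fst g) (snd g) = fst h
  then single (fst g, snd g @ snd h) (c * d) else 0)" by (subst path_mult_eq[of "{g}" "{h}"]) (auto simp: single_def)

lemma path_mult_closed:
 assumes a: "a \<in> pcar" and b: "b \<in> pcar"
 shows "a \<star> b \<in> pcar"
proof -
 have s: "single g c \<in> pcar" if "g \<in> paths G" for g c using that by (auto simp: path_algebra_def single_def)
 have z: "0 \<in> pcar" by (rule vsp_0[OF path_algebra_vsp])
 have comp: "(fst g, snd g @ snd h) \<in> paths G"
  if "a g \<noteq> 0" "b h \<noteq> 0" "path_end G (fst g) (snd g) = fst h" for g h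
 proof -
  have "(fst g, snd g) \<in> paths G" "(fst h, snd h) \<in> paths G" using a b that by (auto simp: path_algebra_def)
  then show ?thesis using that(3) by (simp add: paths_append)
 qed
 have t: "(if path_end G (fst g) (snd g) = fst h then single (fst g, snd g @ snd h) (a g * b h) else 0) \<in> pcar"
  if "g \<in> supp a" "h \<in> supp b" for g h using that by (simp add: s comp z)
 have "finite (supp a)" "finite (supp b)" using a b by (simp_all add: path_algebra_def)
 from path_mult_eq[OF this subset_refl subset_refl] show ?thesis by (simp only:) (intro vsp_sum[OF path_algebra_vsp] t)
qed

lemma path_mult_add:
 assumes a: "a \<in> pcar" "a' \<in> pcar" and b: "b \<in> pcar" "b' \<in> pcar"
 shows "(a + a') \<star> b = a \<star> b + a' \<star> b"
  and "a \<star> (b + b') = a \<star> b + a \<star> b'"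
proof -
 let ?S = "supp a \<union> supp a'" and ?T = "supp b \<union> supp b'"
 have fin: "finite ?S" "finite ?T" using a b by (auto simp: path_algebra_def)
 have e: "supp (a + a') \<subseteq> ?S" "supp a \<subseteq> ?S" "supp a' \<subseteq> ?S"
  and e': "supp (b + b') \<subseteq> ?T" "supp b \<subseteq> ?T" "supp b' \<subseteq> ?T" by auto
 show "(a + a') \<star> b = a \<star> b + a' \<star> b"
  unfolding path_mult_eq[OF fin e(1) e'(2)] path_mult_eq[OF fin e(2) e'(2)] path_mult_eq[OF fin e(3) e'(2)] sum.distrib[symmetric]
  by (intro sum.cong refl) (simp add: distrib_right single_def fun_eq_iff)
 show "a \<star> (b + b') = a \<star> b + a \<star> b'"
  unfolding path_mult_eq[OF fin e(2) e'(1)] path_mult_eq[OF fin e(2) e'(2)] path_mult_eq[OF fin e(2) e'(3)] sum.distrib[symmetric]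
  by (intro sum.cong refl) (simp add: distrib_left single_def fun_eq_iff)
qed

lemma path_mult_scale:
 assumes a: "a \<in> pcar" and b: "b \<in> pcar"
 shows "pw (*) c a \<star> b = pw (*) c (a \<star> b)"
  and "a \<star> pw (*) c b = pw (*) c (a \<star> b)"
proof -
 let ?S = "supp a" and ?T = "supp b"
 have fin: "finite ?S" "finite ?T" using a b by (auto simp: path_algebra_def)
 have ex: "x \<star> y = (\<Sum>g\<in>?S. \<Sum>h\<in>?T. if path_end G (fst g) (snd g) = fst h
  then single (fst g, snd g @ snd h) (x g * y h) else 0)" if "x \<in> {a, pw (*) c a}" "y \<in> {b, pw (*) c b}" for x y
  by (rule path_mult_eq[OF fin]) (use that in \<open>auto simp: pw_def\<close>)
 show "pw (*) c a \<star> b = pw (*) c (a \<star> b)"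
  "a \<star> pw (*) c b = pw (*) c (a \<star> b)" by (simp_all add: ex vs_simps(9)[OF vector_space_pw_mult])
    (intro sum.cong refl; simp add: pw_def single_def fun_eq_iff)+
qed

lemma path_algebra_induct [consumes 1, case_names zero add]:
 assumes "a \<in> pcar" "P 0"
  and "\<And>x p c b. (x, p) \<in> paths G ==> single (x, p) c \<in> pcar ==> b \<in> pcar ==> P b ==>
   P (single (x, p) c + b)"
 shows "P a"
proof -
 have "finite (supp a)" using assms(1) by (simp add: path_algebra_def)
 then show ?thesis
 proof (rule finsupp_induct)
  fix g b assume add: "a g \<noteq> 0" "supp b \<subseteq> supp a" "P b"
  obtain x p where g: "g = (x, p)" by force
  have "(x, p) \<in> paths G" using add(1) assms(1) by (auto simp: path_algebra_def g)
  then show "P (single g (a g) + b)" using add assms(1) unfolding g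
   by (intro assms(3)) (auto simp: path_algebra_def single_def intro: finite_subset)
 qed (rule assms(2))
qed

lemma path_mult_zero:
 "0 \<star> a = 0" "a \<star> 0 = 0" unfolding path_algebra_def by (auto simp: case_prod_beta intro!: sum.neutral)

text \<open>Three nested inductions over finitely supported families reduce to single paths, where
  associativity is that of concatenation and of the field.\<close>

lemma path_mult_assoc:
 assumes a: "a \<in> pcar" and b: "b \<in> pcar" and c: "c \<in> pcar"
 shows "(a \<star> b) \<star> c = a \<star> (b \<star> c)" using a
proof (induction rule: path_algebra_induct)
 case zero
 show ?case by (simp only: path_mult_zero)
next
 case (add x p r a)
 have "(single (x, p) r \<star> b) \<star> c = single (x, p) r \<star> (b \<star> c)" using b
 proof (induction rule: path_algebra_induct)
  case zero
  show ?case by (simp only: path_mult_zero)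
 next
  case (add y q s b)
  have "(single (x, p) r \<star> single (y, q) s) \<star> c = single (x, p) r \<star> (single (y, q) s \<star> c)" using c
  proof (induction rule: path_algebra_induct)
   case zero
   show ?case by (simp only: path_mult_zero)
  next
   case (add z t u c)
   have "(single (x, p) r \<star> single (y, q) s) \<star> single (z, t) u =
     single (x, p) r \<star> (single (y, q) s \<star> single (z, t) u)"
    by (auto simp: path_mult_single path_mult_zero path_end_append mult.assoc)
   then show ?case using add \<open>single (x, p) r \<in> _\<close> \<open>single (y, q) s \<in> _\<close>
    by (simp only: path_mult_add path_mult_closed)
  qed
  then show ?case using add \<open>single (x, p) r \<in> _\<close> c by (simp only: path_mult_add path_mult_closed)
 qed
 then show ?case using add b c by (simp only: path_mult_add path_mult_closed)
qed

lemma path_mult_one: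
 assumes V: "finite (verts G)" and a: "a \<in> pcar"
 shows "pone \<in> pcar" "pone \<star> a = a" "a \<star> pone = a"
proof -
 let ?E = "(\<lambda>x. (x, [] :: 'b list)) ` verts G"
 \<comment> \<open>The unit is the indicator of the trivial paths; as an element with finite support
   it exists because there are finitely many vertices.\<close>
 have one: "pone = (\<lambda>g. if g \<in> ?E then 1 else 0)"
  using V by (auto simp: path_algebra_def fun_eq_iff sum_apply single_apply intro!: sum.neutral)
 have fin: "finite ?E" "finite (supp a)" and supp: "supp a \<subseteq> paths G" using V a by (auto simp: path_algebra_def)
 show "pone \<in> pcar" unfolding one using fin(1) by (auto simp: path_algebra_def)
 have a_eq: "(\<Sum>g\<in>supp a. single g (a g)) = a" using fin by (auto simp: fun_eq_iff sum_apply single_apply)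
 have inj: "inj_on (\<lambda>x. (x, [] :: 'b list)) (verts G)" by (auto simp: inj_on_def)
 have "pone \<star> a = (\<Sum>h\<in>supp a. \<Sum>x\<in>verts G. if x = fst h then single (x, snd h) (a h) else 0)"
  by (subst path_mult_eq[OF fin]) (auto simp: one sum.reindex[OF inj] sum.swap[of _ _ "verts G"] intro!: sum.cong)
 also have "\<dots> = (\<Sum>h\<in>supp a. single h (a h))"
  using supp V by (intro sum.cong refl) (auto dest!: subsetD path_in_verts)
 finally show "pone \<star> a = a" unfolding a_eq .
 have "a \<star> pone = (\<Sum>g\<in>supp a. \<Sum>x\<in>verts G. if path_end G (fst g) (snd g) = x then single g (a g) else 0)"
  by (subst path_mult_eq[OF fin(2,1)]) (auto simp: one sum.reindex[OF inj] intro!: sum.cong)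
 also have "\<dots> = (\<Sum>h\<in>supp a. single h (a h))"
  using supp V by (intro sum.cong refl) (auto dest!: subsetD path_in_verts)
 finally show "a \<star> pone = a" unfolding a_eq .
qed

lemma path_algebra_k_algebra:
 assumes "finite (verts G)"
 shows "k_algebra (path_algebra G :: ('k::field, _) module)"
proof -
 have sel: "zero (path_algebra G :: ('k, _) module) = 0" "add (path_algebra G :: ('k, _) module) = (+)" "module.smult (path_algebra G :: ('k, _) module) = pw (*)"
  by (simp_all add: path_algebra_def)
 have "ring (path_algebra G :: ('k, _) module)"
  by (intro ringI abelian_group_vsp[OF path_algebra_vsp sel(1,2)] monoidI)
    (auto simp: sel path_mult_add path_mult_closed path_mult_assoc path_mult_one[OF assms]
     intro: path_mult_one(1)[OF assms vsp_0[OF path_algebra_vsp]])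
 then show ?thesis using module_vsp[OF path_algebra_vsp sel] path_mult_scale unfolding k_algebra_def sel by blast
qed

end

text \<open>Associativity, unit and distributivity are inherited along a multiplicative bijection,
  so only the module structure of the target has to be known beforehand.\<close>

lemma k_algebra_ring_iso:
 assumes A: "k_algebra A" and h: "h \<in> ring_iso A B" "h \<zero>\<^bsub>A\<^esub> = \<zero>\<^bsub>B\<^esub>"
  and scale: "\<And>c x. x \<in> carrier A ==> h (c \<odot>\<^bsub>A\<^esub> x) = c \<odot>\<^bsub>B\<^esub> h x"
  and B: "Module.module (ring_of_type_algebra :: 'k::field ring) B"
 shows "k_algebra (B :: ('k, 'b) module)"
proof -
 have rA: "ring A" and mA: "Module.module ring_of_type_algebra A"
  and sA: "\<And>c x y. x \<in> carrier A ==> y \<in> carrier A ==> (c \<odot>\<^bsub>A\<^esub> x) \<otimes>\<^bsub>A\<^esub> y = c \<odot>\<^bsub>A\<^esub> (x \<otimes>\<^bsub>A\<^esub> y) \<and> x \<otimes>\<^bsub>A\<^esub> (c \<odot>\<^bsub>A\<^esub> y) = c \<odot>\<^bsub>A\<^esub> (x \<otimes>\<^bsub>A\<^esub> y)"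
  using A unfolding k_algebra_def by blast+
 interpret A: ring A by fact
 have cA: "c \<odot>\<^bsub>A\<^esub> x \<in> carrier A" if "x \<in> carrier A" for c x
  using module.smult_closed[OF mA _ that] by (simp add: ring_of_type_algebra_def)
 have hom: "h (x \<otimes>\<^bsub>A\<^esub> y) = h x \<otimes>\<^bsub>B\<^esub> h y" if "x \<in> carrier A" "y \<in> carrier A" for x y
  using h(1) that by (auto simp: ring_iso_def ring_hom_def)
 have onto: "\<exists>a\<in>carrier A. y = h a" if "y \<in> carrier B" for y using h(1) that by (auto simp: ring_iso_def bij_betw_def)
 have "ring (B\<lparr>zero := h \<zero>\<^bsub>A\<^esub>\<rparr>)" by (rule A.ring_iso_imp_img_ring[OF h(1)])
 then have "ring B" unfolding h(2) by simp
 moreover have "(c \<odot>\<^bsub>B\<^esub> x) \<otimes>\<^bsub>B\<^esub> y = c \<odot>\<^bsub>B\<^esub> (x \<otimes>\<^bsub>B\<^esub> y) \<and> x \<otimes>\<^bsub>B\<^esub> (c \<odot>\<^bsub>B\<^esub> y) = c \<odot>\<^bsub>B\<^esub> (x \<otimes>\<^bsub>B\<^esub> y)"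
  if xy: "x \<in> carrier B" "y \<in> carrier B" for c x y
 proof -
  obtain a b where ab: "a \<in> carrier A" "x = h a" "b \<in> carrier A" "y = h b" using onto xy by metis
  then show ?thesis using sA[OF ab(1,3), of c] cA[of _ c] A.m_closed by (metis hom scale)
 qed
 ultimately show ?thesis using B by (simp add: k_algebra_def)
qed

section \<open>The algebra of intertwiners and the isomorphism\<close>

context intertwiner_quiver begin

lemma Intw_index_reps: "\<alpha> \<in> Intw_index C irr ==> reps_at (fst \<alpha>) (fst (snd \<alpha>)) (snd (snd \<alpha>))"
proof -
 assume "\<alpha> \<in> Intw_index C irr"
 then obtain "is" U V where \<alpha>: "\<alpha> = (is, U, V)" "is \<noteq> []" "set is \<subseteq> orb_reps C" "U \<in> irr (hd is)" "V \<in> irr (last is)"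
  by (auto simp: Intw_index_def)
 then have "set is \<subseteq> pts C" "hd is \<in> pts C" "last is \<in> pts C"
  using orb_reps_pts hd_in_set[OF \<alpha>(2)] last_in_set[OF \<alpha>(2)] by blast+
 then show ?thesis using \<alpha> by (simp add: reps_at_def irr_irreducible[THEN irreducible_rep_is_rep])
qed

lemma Intw_vsp: "vsp (pw hscale) (Icar)"
proof -
 have "vsp hscale ((\<lambda>(is, U, V). Hom C N is U V) \<alpha>)" if "\<alpha> \<in> Intw_index C irr" for \<alpha>
  using Hom_vsp[OF Intw_index_reps[OF that]] by (simp add: case_prod_beta)
 from vsp_finsupp[OF vs_pw3(3) this] show ?thesis by (simp add: Intw_def case_prod_beta)
qed

lemma Intw_Hom: "A \<in> Icar ==> \<alpha> \<in> Intw_index C irr ==> A \<alpha> \<in> Hom C N (fst \<alpha>) (fst (snd \<alpha>)) (snd (snd \<alpha>))"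
 by (auto simp: Intw_def)

lemma Intw_finite: "A \<in> Icar ==> finite (supp A)"
 and Intw_support: "A \<in> Icar ==> supp A \<subseteq> Intw_index C irr" by (auto simp: Intw_def)

definition composable :: "('g, 'i, 'k, 'v) idx => ('g, 'i, 'k, 'v) idx => bool" where
 "composable \<beta> \<alpha> \<longleftrightarrow> last (fst \<alpha>) = hd (fst \<beta>) \<and> snd (snd \<alpha>) = fst (snd \<beta>)"

abbreviation circ_at where
 "circ_at \<beta> \<alpha> f' f \<equiv> circ C N (fst \<alpha>) (snd (snd \<alpha>)) (fst \<beta>) (snd (snd \<beta>)) f' f"

abbreviation idx_comp where
 "idx_comp \<beta> \<alpha> \<equiv> (fst \<alpha> @ tl (fst \<beta>), fst (snd \<alpha>), snd (snd \<beta>))"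

lemma
 assumes "\<alpha> \<in> Intw_index C irr" "\<beta> \<in> Intw_index C irr" "composable \<beta> \<alpha>"
 shows circ_at_linear_right: "f' \<in> Hom C N (fst \<beta>) (fst (snd \<beta>)) (snd (snd \<beta>)) ==>
   linear_on hscale hscale (Hom C N (fst \<alpha>) (fst (snd \<alpha>)) (snd (snd \<alpha>))) (circ_at \<beta> \<alpha> f')"
  and circ_at_linear_left: "f \<in> Hom C N (fst \<alpha>) (fst (snd \<alpha>)) (snd (snd \<alpha>)) ==>
   linear_on hscale hscale (Hom C N (fst \<beta>) (fst (snd \<beta>)) (snd (snd \<beta>))) (\<lambda>f'. circ_at \<beta> \<alpha> f' f)"
 using circ_linear_right[OF Intw_index_reps[OF assms(1)], of "fst \<beta>" "snd (snd \<beta>)"]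
  circ_linear_left[OF Intw_index_reps[OF assms(1)], of "fst \<beta>" "snd (snd \<beta>)"] Intw_index_reps[OF assms(2)] assms(3)
 by (simp_all add: composable_def)

text \<open>Index pairs outside the supports contribute nothing because composition with a zero
  intertwiner is zero by bilinearity.\<close>

lemma Intw_mult_eq:
 assumes A: "A \<in> Icar" and B: "B \<in> Icar" and S: "finite S" "finite S'"
  and supp: "supp B \<subseteq> S'" "supp A \<subseteq> S" and I: "S \<subseteq> Intw_index C irr" "S' \<subseteq> Intw_index C irr"
 shows "Intw_mult C N B A = (\<Sum>\<beta>\<in>S'. \<Sum>\<alpha>\<in>S. if composable \<beta> \<alpha> then single (idx_comp \<beta> \<alpha>) (circ_at \<beta> \<alpha> (B \<beta>) (A \<alpha>)) else 0)"
proof -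
 have "Intw_mult C N B A = (\<Sum>(\<beta>, \<alpha>)\<in>{(\<beta>, \<alpha>). B \<beta> \<noteq> 0 \<and> A \<alpha> \<noteq> 0 \<and> composable \<beta> \<alpha>}.
   single (idx_comp \<beta> \<alpha>) (circ_at \<beta> \<alpha> (B \<beta>) (A \<alpha>)))"
  unfolding Intw_mult_def composable_def by (auto simp: case_prod_beta intro!: sum.cong)
 also have "\<dots> = (\<Sum>\<beta>\<in>S'. \<Sum>\<alpha>\<in>S. if composable \<beta> \<alpha> then single (idx_comp \<beta> \<alpha>) (circ_at \<beta> \<alpha> (B \<beta>) (A \<alpha>)) else 0)"
 proof (rule sum_supports[OF S(2,1) supp])
  fix \<beta> \<alpha> assume c: "composable \<beta> \<alpha>" and m: "\<beta> \<in> S'" "\<alpha> \<in> S" and z: "B \<beta> = 0 \<or> A \<alpha> = 0"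
  have i: "\<alpha> \<in> Intw_index C irr" "\<beta> \<in> Intw_index C irr" using I m by auto
  have "circ_at \<beta> \<alpha> (B \<beta>) (A \<alpha>) = 0"
   using linear_on_0[OF circ_at_linear_right[OF i c Intw_Hom[OF B i(2)]] vsp_0[OF Hom_vsp[OF Intw_index_reps[OF i(1)]]]]
    linear_on_0[OF circ_at_linear_left[OF i c Intw_Hom[OF A i(1)]] vsp_0[OF Hom_vsp[OF Intw_index_reps[OF i(2)]]]] z
   by metis
  then show "single (idx_comp \<beta> \<alpha>) (circ_at \<beta> \<alpha> (B \<beta>) (A \<alpha>)) = 0" by (simp add: single_def fun_eq_iff)
 qed
 finally show ?thesis .
qed

lemma single_add: "single x (a + b) = single x a + single x b" for b :: "'b::ab_group_add"
 by (simp add: single_def fun_eq_iff)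

lemma Intw_mult_add:
 assumes A: "A \<in> Icar" "A' \<in> Icar"
  and B: "B \<in> Icar" "B' \<in> Icar"
 shows "Intw_mult C N B (A + A') = Intw_mult C N B A + Intw_mult C N B A'"
  and "Intw_mult C N (B + B') A = Intw_mult C N B A + Intw_mult C N B' A"
proof -
 let ?S = "supp A \<union> supp A'" and ?T = "supp B \<union> supp B'"
 have fin: "finite ?S" "finite ?T" and I: "?S \<subseteq> Intw_index C irr" "?T \<subseteq> Intw_index C irr"
  using A B Intw_finite Intw_support by blast+
 have e: "supp (A + A') \<subseteq> ?S" "supp A \<subseteq> ?S" "supp A' \<subseteq> ?S"
  and e': "supp (B + B') \<subseteq> ?T" "supp B \<subseteq> ?T" "supp B' \<subseteq> ?T" by auto
 have mem: "\<alpha> \<in> Intw_index C irr" "\<beta> \<in> Intw_index C irr" if "\<alpha> \<in> ?S" "\<beta> \<in> ?T" for \<alpha> \<beta> using I that by blast+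
 note sA = vsp_add[OF Intw_vsp A] and sB = vsp_add[OF Intw_vsp B]
 show "Intw_mult C N B (A + A') = Intw_mult C N B A + Intw_mult C N B A'"
  unfolding Intw_mult_eq[OF sA B(1) fin e'(2) e(1) I] Intw_mult_eq[OF A(1) B(1) fin e'(2) e(2) I]
   Intw_mult_eq[OF A(2) B(1) fin e'(2) e(3) I] sum.distrib[symmetric]
 proof (intro sum.cong refl)
  fix \<beta> \<alpha> assume m: "\<beta> \<in> ?T" "\<alpha> \<in> ?S"
  note i = mem[OF m(2,1)]
  show "(if composable \<beta> \<alpha> then single (idx_comp \<beta> \<alpha>) (circ_at \<beta> \<alpha> (B \<beta>) ((A + A') \<alpha>)) else 0) =
    (if composable \<beta> \<alpha> then single (idx_comp \<beta> \<alpha>) (circ_at \<beta> \<alpha> (B \<beta>) (A \<alpha>)) else 0) +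
    (if composable \<beta> \<alpha> then single (idx_comp \<beta> \<alpha>) (circ_at \<beta> \<alpha> (B \<beta>) (A' \<alpha>)) else 0)"
   using linear_on_add[OF circ_at_linear_right[OF i _ Intw_Hom[OF B(1) i(2)]] Intw_Hom[OF A(1) i(1)] Intw_Hom[OF A(2) i(1)]]
   by (cases "composable \<beta> \<alpha>") (simp_all only: if_True if_False plus_fun_apply single_add add_0)
 qed
 show "Intw_mult C N (B + B') A = Intw_mult C N B A + Intw_mult C N B' A"
  unfolding Intw_mult_eq[OF A(1) sB fin e'(1) e(2) I] Intw_mult_eq[OF A(1) B(1) fin e'(2) e(2) I]
   Intw_mult_eq[OF A(1) B(2) fin e'(3) e(2) I] sum.distrib[symmetric]
 proof (intro sum.cong refl)
  fix \<beta> \<alpha> assume m: "\<beta> \<in> ?T" "\<alpha> \<in> ?S"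
  note i = mem[OF m(2,1)]
  show "(if composable \<beta> \<alpha> then single (idx_comp \<beta> \<alpha>) (circ_at \<beta> \<alpha> ((B + B') \<beta>) (A \<alpha>)) else 0) =
    (if composable \<beta> \<alpha> then single (idx_comp \<beta> \<alpha>) (circ_at \<beta> \<alpha> (B \<beta>) (A \<alpha>)) else 0) +
    (if composable \<beta> \<alpha> then single (idx_comp \<beta> \<alpha>) (circ_at \<beta> \<alpha> (B' \<beta>) (A \<alpha>)) else 0)"
   using linear_on_add[OF circ_at_linear_left[OF i _ Intw_Hom[OF A(1) i(1)]] Intw_Hom[OF B(1) i(2)] Intw_Hom[OF B(2) i(2)]]
   by (cases "composable \<beta> \<alpha>") (simp_all only: if_True if_False plus_fun_apply single_add add_0)
 qed
qed

definition Intw_path :: "(('g, 'i, 'k, 'v) vertex \<times> 'a list) => 'k => ('g, 'i, 'k, 'v) idx => ('g, 'k, 'm, 'v) morph" where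
 "Intw_path \<gamma> c = single (path_idx Q \<gamma>) (hscale c (F (fst \<gamma>) (snd \<gamma>)))"

lemma pw_single: "vector_space s ==> pw s c (single x a) = single x (s c a)"
 by (auto simp: pw_def single_def fun_eq_iff vs_simps)

lemma Intw_path_0: "Intw_path \<gamma> 0 = 0" by (simp add: Intw_path_def single_def fun_eq_iff vs_simps(5)[OF vs_pw3(3)])

lemma Intw_path_add: "Intw_path \<gamma> (c + d) = Intw_path \<gamma> c + Intw_path \<gamma> d"
 unfolding Intw_path_def vs_simps(2)[OF vs_pw3(3)] by (rule single_add)

lemma Intw_path_scale: "Intw_path \<gamma> (c * d) = pw hscale c (Intw_path \<gamma> d)"
 unfolding Intw_path_def pw_single[OF vs_pw3(3)] vs_simps(3)[OF vs_pw3(3)] ..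

lemma path_idx_index: "(x, p) \<in> paths Q ==> path_idx Q (x, p) \<in> Intw_index C irr"
 using path_props[of x p] vert(3)[of x] vert(3)[of "pend x p"] vlist_ne[of x p] last_vlist[of x p]
 by (auto simp: path_idx Intw_index_def)

lemma Intw_path_carrier: "\<gamma> \<in> paths Q ==> Intw_path \<gamma> c \<in> Icar"
proof -
 assume \<gamma>: "\<gamma> \<in> paths Q"
 obtain x p where xp: "\<gamma> = (x, p)" by (cases \<gamma>)
 have "{\<alpha>. Intw_path \<gamma> c \<alpha> \<noteq> 0} \<subseteq> {path_idx Q \<gamma>}" by (auto simp: Intw_path_def single_def)
 moreover have "path_idx Q \<gamma> \<in> Intw_index C irr" using \<gamma> xp path_idx_index by blast
 moreover have "Intw_path \<gamma> c (is, U, V) \<in> Hom C N is U V" if "(is, U, V) \<in> Intw_index C irr" for "is" U V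
 proof -
  have v: "vsp hscale (Hom C N is U V)" using Hom_vsp[OF Intw_index_reps[OF that]] by simp
  show ?thesis using vsp_scale[OF v, of "F x p" c] vsp_0[OF v] F_Hom[of x p] \<gamma>
   by (cases "(is, U, V) = path_idx Q \<gamma>") (simp_all only: Intw_path_def single_apply xp fst_conv snd_conv if_True if_False, simp add: path_idx)
 qed
 ultimately show ?thesis unfolding Intw_def using finite_subset[OF _ finite.insertI[OF finite.emptyI]] by auto
qed

lemma path_map_eq:
 assumes "finite S" "supp a \<subseteq> S"
 shows "pmap a = (\<Sum>\<gamma>\<in>S. Intw_path \<gamma> (a \<gamma>))"
proof -
 have "pmap a = (\<Sum>\<gamma>\<in>supp a. Intw_path \<gamma> (a \<gamma>))"
  unfolding path_map_def Intw_path_def pw_single[OF vs_pw3(3)] by (auto simp: case_prod_beta intro!: sum.cong)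
 also have "\<dots> = (\<Sum>\<gamma>\<in>S. Intw_path \<gamma> (a \<gamma>))" using assms Intw_path_0 by (intro sum.mono_neutral_left) auto
 finally show ?thesis .
qed

lemma path_algebraD:
 assumes "a \<in> carrier (path_algebra Q)"
 shows "finite (supp a)" "supp a \<subseteq> paths Q" using assms by (auto simp: path_algebra_def)

lemma path_map_carrier:
 assumes a: "a \<in> carrier (path_algebra Q)"
 shows "pmap a \<in> Icar" unfolding path_map_eq[OF path_algebraD(1)[OF a] subset_refl]
 using path_algebraD(2)[OF a] by (intro vsp_sum[OF Intw_vsp] Intw_path_carrier) blast

lemma path_map_single: "pmap (single \<gamma> c) = Intw_path \<gamma> c"
proof -
 have "{\<delta>. single \<gamma> c \<delta> \<noteq> 0} \<subseteq> {\<gamma>}" by (auto simp: single_def)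
 then have "pmap (single \<gamma> c) = Intw_path \<gamma> (single \<gamma> c \<gamma>)"
  using path_map_eq[of "{\<gamma>}" "single \<gamma> c"] by simp
 then show ?thesis unfolding single_apply by simp
qed

lemma path_map_add:
 assumes a: "a \<in> carrier (path_algebra Q)" and b: "b \<in> carrier (path_algebra Q)"
 shows "pmap (a + b) = pmap a + pmap b"
proof -
 let ?S = "supp a \<union> supp b"
 have fin: "finite ?S" using path_algebraD(1) a b by blast
 have e: "supp (a + b) \<subseteq> ?S" "supp a \<subseteq> ?S" "supp b \<subseteq> ?S" by auto
 show ?thesis unfolding e(1)[THEN path_map_eq[OF fin]] e(2)[THEN path_map_eq[OF fin]] e(3)[THEN path_map_eq[OF fin]]
  by (simp only: sum.distrib[symmetric] plus_fun_apply Intw_path_add)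
qed

lemma path_map_scale:
 assumes a: "a \<in> carrier (path_algebra Q)"
 shows "pmap (pw (*) c a) = pw hscale c (pmap a)"
proof -
 have e: "{\<gamma>. pw (*) c a \<gamma> \<noteq> 0} \<subseteq> supp a" by (auto simp: pw_def)
 have "pmap (pw (*) c a) = (\<Sum>\<gamma>\<in>supp a. pw hscale c (Intw_path \<gamma> (a \<gamma>)))"
  unfolding path_map_eq[OF path_algebraD(1)[OF a] e] by (intro sum.cong refl) (simp only: pw_def[of "(*)"] Intw_path_scale)
 also have "\<dots> = pw hscale c (pmap a)" unfolding path_map_eq[OF path_algebraD(1)[OF a] subset_refl]
   vs_simps(9)[OF vector_space_pw[OF vs_pw3(3)]] ..
 finally show ?thesis .
qed

lemma path_map_0: "pmap 0 = 0" using path_map_eq[of "{}" 0] by simp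

lemma Intw_mult_0: "Intw_mult C N B 0 = 0" "Intw_mult C N 0 A = 0"
 unfolding Intw_mult_def by (auto simp: case_prod_beta intro!: sum.neutral)

text \<open>Two path indices are composable exactly when the paths are. The path traversed first is
  the right factor here, which is where the opposite algebra comes from.\<close>

lemma Intw_mult_path:
 assumes \<gamma>: "(x, p) \<in> paths Q" and \<delta>: "(y, q) \<in> paths Q"
 shows "Intw_mult C N (Intw_path (y, q) d) (Intw_path (x, p) c) = (if pend x p = y then Intw_path (x, p @ q) (c * d) else 0)"
proof -
 let ?\<alpha> = "path_idx Q (x, p)" and ?\<beta> = "path_idx Q (y, q)"
 note i = path_idx_index[OF \<gamma>] path_idx_index[OF \<delta>]
 have s: "{\<alpha>. Intw_path \<gamma> c \<alpha> \<noteq> 0} \<subseteq> {path_idx Q \<gamma>}" for \<gamma> c by (auto simp: Intw_path_def single_def)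
 have c: "composable ?\<beta> ?\<alpha> \<longleftrightarrow> pend x p = y"
  using path_props(3)[OF \<delta>] by (simp only: composable_def path_idx fst_conv snd_conv last_vlist prod_eq_iff)
 have m: "Intw_mult C N (Intw_path (y, q) d) (Intw_path (x, p) c) =
   (if composable ?\<beta> ?\<alpha> then single (idx_comp ?\<beta> ?\<alpha>) (circ_at ?\<beta> ?\<alpha> (hscale d (F y q)) (hscale c (F x p))) else 0)"
  by (subst Intw_mult_eq[OF Intw_path_carrier[OF \<gamma>] Intw_path_carrier[OF \<delta>] _ _ s s])
    (use i in \<open>simp_all add: Intw_path_def single_apply\<close>)
 show ?thesis
 proof (cases "pend x p = y")
  case True
  have pq: "(x, p @ q) \<in> paths Q" using \<gamma> \<delta> True by (simp add: Q.paths_append)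
  have H: "F x p \<in> Hom C N (fst ?\<alpha>) (fst (snd ?\<alpha>)) (snd (snd ?\<alpha>))" "F y q \<in> Hom C N (fst ?\<beta>) (fst (snd ?\<beta>)) (snd (snd ?\<beta>))"
   using F_Hom[OF \<gamma>] F_Hom[OF \<delta>] by (simp_all add: path_idx)
  note cc = c[THEN iffD2, OF True]
  have "circ_at ?\<beta> ?\<alpha> (hscale d (F y q)) (hscale c (F x p)) = hscale d (hscale c (circ_at ?\<beta> ?\<alpha> (F y q) (F x p)))"
   using linear_on_scale[OF circ_at_linear_left[OF i cc vsp_scale[OF Hom_vsp[OF Intw_index_reps[OF i(1)]] H(1)]] H(2)]
    linear_on_scale[OF circ_at_linear_right[OF i cc H(2)] H(1)] by simp
  also have "\<dots> = hscale (c * d) (circ_at ?\<beta> ?\<alpha> (F y q) (F x p))"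
   by (simp only: vs_simps(3)[OF vs_pw3(3)] mult.commute)
  also have "circ_at ?\<beta> ?\<alpha> (F y q) (F x p) = F x (p @ q)"
   using F_append[OF pq] True by (simp add: path_idx Q.path_end_append)
  finally have "circ_at ?\<beta> ?\<alpha> (hscale d (F y q)) (hscale c (F x p)) = hscale (c * d) (F x (p @ q))" .
  moreover have "idx_comp ?\<beta> ?\<alpha> = path_idx Q (x, p @ q)"
   using vlist_append[OF pq] True by (simp add: path_idx Q.path_end_append)
  ultimately show ?thesis using m c True by (simp only: if_True Intw_path_def fst_conv snd_conv simp_thms)
 next
  case False
  then show ?thesis using m c by simp
 qed
qed

lemma path_map_mult:
 assumes a: "a \<in> carrier (path_algebra Q)" and b: "b \<in> carrier (path_algebra Q)"
 shows "pmap (a \<otimes>\<^bsub>path_algebra Q\<^esub> b) = Intw_mult C N (pmap b) (pmap a)"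
 using a
proof (induction rule: Q.path_algebra_induct)
 case zero
 show ?case by (simp only: Q.path_mult_zero path_map_0 Intw_mult_0)
next
 case (add x p c a)
 have "pmap (single (x, p) c \<otimes>\<^bsub>path_algebra Q\<^esub> b) = Intw_mult C N (pmap b) (pmap (single (x, p) c))"
  using b
 proof (induction rule: Q.path_algebra_induct)
  case zero
  show ?case by (simp only: Q.path_mult_zero path_map_0 Intw_mult_0)
 next
  case b: (add y q d b)
  have "pmap (single (x, p) c \<otimes>\<^bsub>path_algebra Q\<^esub> single (y, q) d) =
    Intw_mult C N (pmap (single (y, q) d)) (pmap (single (x, p) c))"
   unfolding path_map_single Intw_mult_path[OF add(1) b(1)] Q.path_mult_single fst_conv snd_conv
   by (cases "pend x p = y") (simp_all only: if_True if_False simp_thms path_map_single path_map_0)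
  then show ?case using b add(2) by (simp only: Q.path_mult_add path_map_add Q.path_mult_closed
    Intw_mult_add(2)[OF path_map_carrier[OF add(2)] path_map_carrier[OF add(2)] path_map_carrier[OF b(2)] path_map_carrier[OF b(3)]])
 qed
 then show ?case using b add by (simp only: Q.path_mult_add path_map_add Q.path_mult_closed
   Intw_mult_add(1)[OF path_map_carrier[OF add(2)] path_map_carrier[OF add(3)] path_map_carrier[OF b] path_map_carrier[OF b]])
qed

lemma path_map_one: "pmap \<one>\<^bsub>path_algebra Q\<^esub> = \<one>\<^bsub>Intw C N irr\<^esub>"
proof -
 have c: "single (x, []) 1 \<in> carrier (path_algebra Q)" if "x \<in> verts Q" for x
  using that by (auto simp: path_algebra_def single_def)
 have "pmap (\<Sum>x\<in>V. single (x, []) 1) = (\<Sum>x\<in>V. Intw_path (x, []) 1)" if "V \<subseteq> verts Q" for V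
  using finite_subset[OF that finite_verts] that
 proof (induction V)
  case (insert x V)
  have "pmap (single (x, []) 1 + (\<Sum>x\<in>V. single (x, []) 1)) =
    pmap (single (x, []) 1) + pmap (\<Sum>x\<in>V. single (x, []) 1)"
   using insert(4) by (intro path_map_add vsp_sum[OF Q.path_algebra_vsp] c) blast+
  also have "\<dots> = Intw_path (x, []) 1 + (\<Sum>x\<in>V. Intw_path (x, []) 1)"
   using insert(3,4) by (simp only: path_map_single insert_subset)
  finally show ?case unfolding sum.insert[OF insert(1,2)] .
 qed (simp only: sum.empty path_map_0)
 from this[OF subset_refl] show ?thesis
  by (simp add: verts_Q path_algebra_def Intw_def Intw_path_def path_idx vs_simps(4)[OF vs_pw3(3)] case_prod_beta)
qed

text \<open>Each component of the image collects the paths with that index. This reduces bijectivity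
  to the expansion in a single space of intertwiners.\<close>

lemma path_map_apply:
 assumes a: "a \<in> carrier (path_algebra Q)"
 shows "pmap a \<alpha> = (\<Sum>(x, p)\<in>paths_of \<alpha>. hscale (a (x, p)) (F x p))"
proof -
 let ?S = "supp a \<union> paths_of \<alpha>"
 have fin: "finite ?S" using path_algebraD(1)[OF a] finite_paths_of by blast
 have "pmap a \<alpha> = (\<Sum>\<gamma>\<in>?S. Intw_path \<gamma> (a \<gamma>) \<alpha>)" by (subst path_map_eq[OF fin]) (auto simp: sum_apply)
 also have "\<dots> = (\<Sum>\<gamma>\<in>paths_of \<alpha>. Intw_path \<gamma> (a \<gamma>) \<alpha>)"
 proof (rule sum.mono_neutral_right[OF fin])
  show "\<forall>\<gamma>\<in>?S - paths_of \<alpha>. Intw_path \<gamma> (a \<gamma>) \<alpha> = 0"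
   using path_algebraD(2)[OF a] by (auto simp: paths_of_def Intw_path_def single_apply)
 qed blast
 also have "\<dots> = (\<Sum>(x, p)\<in>paths_of \<alpha>. hscale (a (x, p)) (F x p))"
  by (intro sum.cong refl) (auto simp: paths_of_def Intw_path_def single_apply)
 finally show ?thesis .
qed

text \<open>The coefficient at a path is recovered from the image by pairing with the dual
  intertwiner of that path.\<close>

lemma path_map_inj: "inj_on (pmap) (carrier (path_algebra Q))"
proof (rule inj_onI, rule ext)
 fix a b :: "('g, 'i, 'k, 'v) vertex \<times> 'a list => 'k" and \<gamma> :: "('g, 'i, 'k, 'v) vertex \<times> 'a list" assume a: "a \<in> carrier (path_algebra Q)" and b: "b \<in> carrier (path_algebra Q)"
  and eq: "pmap a = pmap b"
 obtain x p where xp: "\<gamma> = (x, p)" by (cases \<gamma>)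
 show "a \<gamma> = b \<gamma>"
 proof (cases "\<gamma> \<in> paths Q")
  case True
  obtain "is" U W where i: "path_idx Q \<gamma> = (is, U, W)" by (cases "path_idx Q \<gamma>") auto
  have "(x, p) \<in> paths_of (is, U, W)" using True i xp by (simp add: paths_of_def)
  note pc = pairing_coefficient[OF this]
  show ?thesis using pc[of a] pc[of b] path_map_apply[OF a, of "(is, U, W)"] path_map_apply[OF b, of "(is, U, W)"] eq xp by simp
 next
  case False
  then have "a \<gamma> = 0" "b \<gamma> = 0" using path_algebraD(2)[OF a] path_algebraD(2)[OF b] by auto
  then show ?thesis by simp
 qed
qed

text \<open>The pairings prescribe the coefficients, and the expansion formula applies to every
  component. What needs care is finite support.\<close>

lemma path_map_surj:
 assumes A: "A \<in> Icar"
 shows "\<exists>a\<in>carrier (path_algebra Q). pmap a = A"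
proof -
 define c where "c x p = pairing C N (vlist x p) (snd x) (snd (pend x p)) (A (path_idx Q (x, p))) (\<Phi> x p)" for x p
 define a where "a = (\<lambda>(x, p). if (x, p) \<in> paths Q then c x p else 0)"
 \<comment> \<open>The pairing is a definite description, so its vanishing at the zero intertwiner
   has to be derived: zero is the combination of paths with all coefficients 0.\<close>
 have z: "a \<gamma> = 0" if "A (path_idx Q \<gamma>) = 0" for \<gamma>
 proof -
  obtain x p where xp: "\<gamma> = (x, p)" by (cases \<gamma>)
  have "c x p = 0" if p: "(x, p) \<in> paths Q"
   using pairing_coefficient[of x p "vlist x p" "snd x" "snd (pend x p)" "\<lambda>_. 0"] p that \<open>A (path_idx Q \<gamma>) = 0\<close>
   by (simp add: c_def xp paths_of_def path_idx vs_simps(5)[OF vs_pw3(3)] case_prod_beta)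
  then show ?thesis by (simp add: a_def xp)
 qed
 have sub: "supp a \<subseteq> paths Q" by (auto simp: a_def split: if_splits)
 \<comment> \<open>Only finitely many components of A are nonzero, and each has finitely many
   paths.\<close>
 have "supp a \<subseteq> (\<Union>\<alpha>\<in>supp A. paths_of \<alpha>)" using sub z by (auto simp: paths_of_def)
 then have "finite (supp a)" by (rule finite_subset) (use Intw_finite[OF A] finite_paths_of in blast)
 then have ac: "a \<in> carrier (path_algebra Q)" using sub by (simp add: path_algebra_def)
 have "pmap a \<alpha> = A \<alpha>" for \<alpha>
 proof (cases "\<alpha> \<in> Intw_index C irr")
  case True
  obtain "is" U W where \<alpha>: "\<alpha> = (is, U, W)" by (cases \<alpha>) auto
  have f: "A \<alpha> \<in> Hom C N is U W" using Intw_Hom[OF A True] \<alpha> by simp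
  have "A \<alpha> = (\<Sum>(x, p)\<in>paths_of \<alpha>. hscale (pairing C N is U W (A \<alpha>) (\<Phi> x p)) (F x p))"
   unfolding \<alpha> by (rule intertwiner_expansion) (use True f \<alpha> in \<open>auto simp: Intw_index_def\<close>)
  also have "\<dots> = (\<Sum>(x, p)\<in>paths_of \<alpha>. hscale (a (x, p)) (F x p))"
   by (intro sum.cong refl) (auto simp: paths_of_def a_def c_def \<alpha> path_idx)
  finally show ?thesis using path_map_apply[OF ac] by simp
 next
  case False
  then have "paths_of \<alpha> = {}" using path_idx_index by (auto simp: paths_of_def)
  then show ?thesis using path_map_apply[OF ac] False Intw_support[OF A] by auto
 qed
 then show ?thesis using ac by blast
qed

lemma path_algebra_iso: "algebra_iso (path_algebra Q) (opposite (Intw C N irr)) (pmap)"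
proof -
 let ?P = "path_algebra Q" and ?I = "opposite (Intw C N irr)" and ?h = "pmap"
 have P: "k_algebra (?P :: ('k, _) module)" by (rule Q.path_algebra_k_algebra[OF finite_verts])
 have I: "carrier ?I = Icar" "zero ?I = 0" "add ?I = (+)" "module.smult ?I = pw hscale"
  "one ?I = \<one>\<^bsub>Intw C N irr\<^esub>" "mult ?I = (\<lambda>x y. Intw_mult C N y x)" by (simp_all add: opposite_def Intw_def)
 have Psel: "add ?P = (+)" "zero ?P = 0" "module.smult ?P = pw (*)" by (simp_all add: path_algebra_def)
 have "bij_betw ?h (carrier ?P) (carrier ?I)"
  unfolding bij_betw_def I(1) using path_map_inj path_map_carrier path_map_surj by blast
 moreover have "?h \<in> ring_hom ?P ?I"
  by (rule ring_hom_memI) (simp_all only: I Psel path_map_carrier path_map_add path_map_mult path_map_one)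
 ultimately have iso: "?h \<in> ring_iso ?P ?I" by (simp add: ring_iso_def)
 have scale: "?h (c \<odot>\<^bsub>?P\<^esub> x) = c \<odot>\<^bsub>?I\<^esub> ?h x" if "x \<in> carrier ?P" for c x
  unfolding I Psel by (rule path_map_scale[OF that])
 have "k_algebra ?I"
 proof (rule k_algebra_ring_iso[OF P iso])
  show "?h (c \<odot>\<^bsub>?P\<^esub> x) = c \<odot>\<^bsub>?I\<^esub> ?h x" if "x \<in> carrier ?P" for c x by (rule scale[OF that])
  show "?h \<zero>\<^bsub>?P\<^esub> = \<zero>\<^bsub>?I\<^esub>" unfolding I Psel by (rule path_map_0)
  show "Module.module ring_of_type_algebra ?I" by (rule module_vsp[OF _ I(2-4)]) (simp only: I(1) Intw_vsp)
 qed
 then show ?thesis using P iso scale by (simp add: algebra_iso_def)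
qed

end

theorem theorem1p25:
  fixes C :: "('g, 'i) gset"
    and M :: "('g, 'i, 'k::alg_closed_field, 'm::ab_group_add) bimod"
    and irr :: "'i \<Rightarrow> ('g, 'k, 'v::ab_group_add) rep set"
    and Q :: "(('g, 'i, 'k, 'v) vertex, 'a) pre_digraph"
    and lab :: "'a \<Rightarrow> ('g, 'k, 'm, 'v) morph"
  assumes "is_gset C"
    and "\<not> CHAR('k) dvd Coset.order (grp C)"
    and "is_gbimod C M"
    and "\<forall>i\<in>pts C. irr_reps (grp C) (stab C i) (irr i)"
    and "is_QG C M irr Q lab"
  shows "algebra_iso (path_algebra Q) (opposite (Intw C M irr)) (path_map C M Q lab) \<and>
    (\<forall>is U\<^sub>0 U\<^sub>n. \<forall>f\<in>Hom C M is U\<^sub>0 U\<^sub>n.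
      is \<noteq> [] \<and> set is \<subseteq> orb_reps C \<and> U\<^sub>0 \<in> irr (hd is) \<and> U\<^sub>n \<in> irr (last is) \<longrightarrow>
      f = (\<Sum>(x, p) | (x, p) \<in> paths Q \<and> path_idx Q (x, p) = (is, U\<^sub>0, U\<^sub>n).
             hscale (pairing C M is U\<^sub>0 U\<^sub>n f (phi_path C M Q lab x p)) (f_path C M Q lab x p)))"
proof -
  interpret G: gset_action C by unfold_locales (rule assms(1))
  interpret M: gbimod C M by unfold_locales (rule assms(3))
  interpret M: gbimod_dual C M by (rule M.gbimod_dual)
  \<comment> \<open>By Lagrange, the order of a stabiliser divides that of G, so the characteristic
    does not divide it either.\<close>
  interpret M: gbimod_coprime C M
  proof unfold_locales
    fix i assume "i \<in> pts C"
    then have "card (stab C i) dvd Coset.order (grp C)"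
      using G.lagrange[OF G.stab_subgroup] by (metis dvd_triv_right)
    then show "of_nat (card (stab C i)) \<noteq> (0 :: 'k)"
      using assms(2) by (auto simp: of_nat_eq_0_iff_char_dvd dest: dvd_trans)
  qed
  interpret intertwiner_quiver C M irr Q lab
    by unfold_locales (use assms in auto)
  have "{(x, p). (x, p) \<in> paths Q \<and> path_idx Q (x, p) = \<alpha>} = paths_of \<alpha>" for \<alpha>
    by (auto simp: paths_of_def)
  then show ?thesis using path_algebra_iso intertwiner_expansion by simp
qed

end
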